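(* Let $n\in\{1,2\}$ and let $\mu:[0,\infty)\to[0,\infty)$ be a modulus of continuity satisfying, for some sufficiently large constants $C, C_0>0$ and a sufficiently small $s_0>0$, \[ s^k|\mu^{(k)}(s)|\leq C\mu(s)\quad\text{for } 1\leq k\leq n,\ s\in(0,s_0], \qquad\text{and}\qquad \int_{C_0}^\infty \frac{\mu(s^{-1})}{s}\,ds<\infty. \] Set $h(s)=|s|^{1+\frac2n}\mu(|s|)$ and consider the Cauchy problem \[ u_{tt}-\Delta u+u_t=h(u),\quad (t,x)\in[0,\infty)\times\mathbb{R}^n,\qquad u(0,x)=\phi(x),\quad u_t(0,x)=\psi(x). \] Let $\mathcal{A}:=(H^{1+\lfloor n/2\rfloor}(\mathbb{R}^n)\cap L^1(\mathbb{R}^n))\times(H^{\lfloor n/2\rfloor}(\mathbb{R}^n)\cap L^1(\mathbb{R}^n))$ with its natural norm. Then there exists $\varepsilon_0>0$ such that for all $(\phi,\psi)\in\mathcal{A}$ with $\|(\phi,\psi)\|_{\mathcal{A}}\leq\varepsilon\le\varepsilon_0$ there exists a unique global (in time) Sobolev solution \[ u\in C\big([0,\infty),H^1(\mathbb{R}^n)\cap L^\infty(\mathbb{R}^n)\big) \] satisfying, for all $t\ge0$, \[ \|u(t,\cdot)\|_{L^\infty}\leq C(1+t)^{-\frac n2}\|(\phi,\psi)\|_{\mathcal{A}},\qquad \|\nabla_x^k u(t,\cdot)\|_{L^2}\leq C(1+t)^{-\frac{n+2k}{4}}\|(\phi,\psi)\|_{\mathcal{A}},\ k=0,1, \] with $C$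 independent of $t$ and of the data.
   Context: A modulus of continuity is a function $\mu:[0,\infty)\to[0,\infty)$ that is continuous, concave, increasing, and satisfies $\mu(0)=0$ (the derivative condition above is required only on the small interval $(0,s_0]$, where $\mu$ is assumed $n$ times differentiable). $\lfloor\cdot\rfloor$ denotes the floor function. A Sobolev solution means a mild solution: $u(t)=u^{lin}(t)+\int_0^t \Phi(t,s,\cdot)\ast_{(x)} h(u(s,\cdot))\,ds$, where $u^{lin}$ solves the linear problem $u_{tt}-\Delta u+u_t=0$ with data $(\phi,\psi)$ at $t=0$, and $\Phi(t,s,\cdot)\ast_{(x)} f$ denotes the solution at time $t$ of the linear problem $u_{tt}-\Delta u+u_t=0$ with data $u(s)=0$, $u_t(s)=f$ at time $s$. *)

theory Defs
  imports "HOL-Analysis.Analysis"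
begin

definition modulus_of_continuity :: "(real \<Rightarrow> real) \<Rightarrow> bool" where
  "modulus_of_continuity \<mu> \<longleftrightarrow>
     continuous_on {0..} \<mu> \<and> concave_on {0..} \<mu> \<and> mono_on {0..} \<mu> \<and>
     \<mu> 0 = 0 \<and> (\<forall>s\<ge>0. \<mu> s \<ge> 0)"

definition Lp :: "real \<Rightarrow> (real^'n \<Rightarrow> real) \<Rightarrow> bool" where
  "Lp p f \<longleftrightarrow> f \<in> borel_measurable lebesgue \<and> integrable lebesgue (\<lambda>x. \<bar>f x\<bar> powr p)"

definition Lp_norm :: "real \<Rightarrow> (real^'n \<Rightarrow> real) \<Rightarrow> real" where
  "Lp_norm p f = (\<integral>x. \<bar>f x\<bar> powr p \<partial>lebesgue) powr (1 / p)"

definition Linf :: "(real^'n \<Rightarrow> real) \<Rightarrow> bool" where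
  "Linf f \<longleftrightarrow> f \<in> borel_measurable lebesgue \<and> (\<exists>M. AE x in lebesgue. \<bar>f x\<bar> \<le> M)"

definition Linf_norm :: "(real^'n \<Rightarrow> real) \<Rightarrow> real" where
  "Linf_norm f = Inf {M. AE x in lebesgue. \<bar>f x\<bar> \<le> M}"

definition pd :: "'n \<Rightarrow> (real^'n \<Rightarrow> real) \<Rightarrow> real^'n \<Rightarrow> real" where
  "pd i f x = deriv (\<lambda>t. f (x + t *\<^sub>R axis i 1)) 0"

fun iter_pd :: "'n list \<Rightarrow> (real^'n \<Rightarrow> real) \<Rightarrow> real^'n \<Rightarrow> real" where
  "iter_pd [] f = f"
| "iter_pd (i # is) f = pd i (iter_pd is f)"

definition smooth_fun :: "(real^'n \<Rightarrow> real) \<Rightarrow> bool" where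
  "smooth_fun f \<longleftrightarrow> (\<forall>is. continuous_on UNIV (iter_pd is f) \<and>
      (\<forall>i x. (\<lambda>t. iter_pd is f (x + t *\<^sub>R axis i 1)) differentiable (at 0)))"

definition test_fun :: "(real^'n \<Rightarrow> real) \<Rightarrow> bool" where
  "test_fun \<theta> \<longleftrightarrow> smooth_fun \<theta> \<and> (\<exists>R. \<forall>x. norm x > R \<longrightarrow> \<theta> x = 0)"

definition weak_deriv :: "'n list \<Rightarrow> (real^'n \<Rightarrow> real) \<Rightarrow> (real^'n \<Rightarrow> real) \<Rightarrow> bool" where
  "weak_deriv is f g \<longleftrightarrow> (\<forall>\<theta>. test_fun \<theta> \<longrightarrow>
      integrable lebesgue (\<lambda>x. f x * iter_pd is \<theta> x) \<and> integrable lebesgue (\<lambda>x. g x * \<theta> x) \<and>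
      (\<integral>x. f x * iter_pd is \<theta> x \<partial>lebesgue) = (-1) ^ length is * (\<integral>x. g x * \<theta> x \<partial>lebesgue))"

definition wd :: "'n list \<Rightarrow> (real^'n \<Rightarrow> real) \<Rightarrow> real^'n \<Rightarrow> real" where
  "wd is f = (SOME g. Lp 2 g \<and> weak_deriv is f g)"

definition sobolev :: "nat \<Rightarrow> (real^'n \<Rightarrow> real) \<Rightarrow> bool" where
  "sobolev k f \<longleftrightarrow> Lp 2 f \<and> (\<forall>is::'n list. length is \<le> k \<longrightarrow> (\<exists>g. Lp 2 g \<and> weak_deriv is f g))"

definition sobolev_norm :: "nat \<Rightarrow> (real^'n \<Rightarrow> real) \<Rightarrow> real" where
  "sobolev_norm k f = sqrt (\<Sum>is\<in>{is::'n list. length is \<le> k}. (Lp_norm 2 (wd is f))\<^sup>2)"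

definition grad_L2 :: "(real^'n \<Rightarrow> real) \<Rightarrow> real" where
  "grad_L2 f = sqrt (\<Sum>i\<in>UNIV. (Lp_norm 2 (wd [i] f))\<^sup>2)"

definition data_space :: "(real^'n \<Rightarrow> real) \<Rightarrow> (real^'n \<Rightarrow> real) \<Rightarrow> bool" where
  "data_space \<phi> \<psi> \<longleftrightarrow>
     sobolev (1 + CARD('n) div 2) \<phi> \<and> Lp 1 \<phi> \<and> sobolev (CARD('n) div 2) \<psi> \<and> Lp 1 \<psi>"

definition data_norm :: "(real^'n \<Rightarrow> real) \<Rightarrow> (real^'n \<Rightarrow> real) \<Rightarrow> real" where
  "data_norm \<phi> \<psi> = sobolev_norm (1 + CARD('n) div 2) \<phi> + Lp_norm 1 \<phi>
                    + sobolev_norm (CARD('n) div 2) \<psi> + Lp_norm 1 \<psi>"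

definition fourier :: "(real^'n \<Rightarrow> real) \<Rightarrow> real^'n \<Rightarrow> complex" where
  "fourier f \<xi> = (\<integral>x. exp (- \<i> * complex_of_real (x \<bullet> \<xi>)) * complex_of_real (f x) \<partial>lebesgue)"

text \<open>Fourier multiplier of the solution of u_tt + |xi|^2 u + u_t = 0, u(0)=0, u_t(0)=1.\<close>
definition K1 :: "real \<Rightarrow> real^'n \<Rightarrow> real" where
  "K1 t \<xi> = (let d = 1/4 - (norm \<xi>)\<^sup>2 in
     if d > 0 then exp (- t/2) * sinh (t * sqrt d) / sqrt d
     else if d = 0 then t * exp (- t/2)
     else exp (- t/2) * sin (t * sqrt (- d)) / sqrt (- d))"

text \<open>Fourier multiplier of the solution with u(0)=1, u_t(0)=0 (equals d/dt K1 + K1).\<close>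
definition K0 :: "real \<Rightarrow> real^'n \<Rightarrow> real" where
  "K0 t \<xi> = (let d = 1/4 - (norm \<xi>)\<^sup>2 in
     if d > 0 then exp (- t/2) * (cosh (t * sqrt d) + sinh (t * sqrt d) / (2 * sqrt d))
     else if d = 0 then exp (- t/2) * (1 + t/2)
     else exp (- t/2) * (cos (t * sqrt (- d)) + sin (t * sqrt (- d)) / (2 * sqrt (- d))))"

definition hnl :: "nat \<Rightarrow> (real \<Rightarrow> real) \<Rightarrow> real \<Rightarrow> real" where
  "hnl n \<mu> s = \<bar>s\<bar> powr (1 + 2 / real n) * \<mu> \<bar>s\<bar>"

text \<open>Mild (Duhamel) solution: u(t) = u_lin(t) + int_0^t Phi(t,s) * h(u(s)) ds, where the
  linear propagators are given by their Fourier multipliers and the identity is understood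
  in the sense of (tempered) distributions: paired with the Fourier transform of every test
  function theta (Parseval: int w(x) hat theta(x) dx = int hat w(xi) chi(xi) dxi).\<close>
definition mild_solution ::
  "(real \<Rightarrow> real) \<Rightarrow> (real^'n \<Rightarrow> real) \<Rightarrow> (real^'n \<Rightarrow> real) \<Rightarrow> (real \<Rightarrow> real^'n \<Rightarrow> real) \<Rightarrow> bool" where
  "mild_solution \<mu> \<phi> \<psi> u \<longleftrightarrow> (\<forall>t\<ge>0. \<forall>\<theta>. test_fun \<theta> \<longrightarrow>
     (\<integral>x. complex_of_real (u t x) * fourier \<theta> x \<partial>lebesgue) =
     (\<integral>\<xi>. complex_of_real (\<theta> \<xi>) *
          (complex_of_real (K0 t \<xi>) * fourier \<phi> \<xi> + complex_of_real (K1 t \<xi>) * fourier \<psi> \<xi>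
           + (LINT s:{0..t}|lborel. complex_of_real (K1 (t - s) \<xi>) *
                fourier (\<lambda>y. hnl CARD('n) \<mu> (u s y)) \<xi>)) \<partial>lebesgue))"

definition solution_class :: "(real \<Rightarrow> real^'n \<Rightarrow> real) \<Rightarrow> bool" where
  "solution_class u \<longleftrightarrow> (\<forall>t\<ge>0. sobolev 1 (u t) \<and> Linf (u t)) \<and>
     (\<forall>t\<ge>0. ((\<lambda>s. sobolev_norm 1 (\<lambda>x. u s x - u t x) + Linf_norm (\<lambda>x. u s x - u t x))
               \<longlongrightarrow> 0) (at t within {0..}))"

end

theory Submission
  imports Defs "HOL-Probability.Probability"
begin

text \<open>
  Everything happens on the Fourier side, where the linear propagators are multiplication by
  \<open>K0\<close> and \<open>K1\<close>; both are dominated by \<open>exp (- t * min 1 |\<xi>|\<^sup>2 / 8)\<close>, with a gain of one power of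
  \<open>|\<xi>|\<close> at high frequencies for \<open>K1\<close>. This gives the decay rates of \<open>u\<close> in \<open>L\<^sup>2\<close>, of its gradient in \<open>L\<^sup>2\<close>,
  and of its Fourier transform in \<open>L\<^sup>1\<close>; the latter controls the sup norm.

  If \<open>u\<close> has these rates with a constant \<open>R \<le> 1\<close>, then \<open>h(u(s))\<close> is, in \<open>L\<^sup>1\<close>, at most of size
  \<open>R\<^sup>2 \<mu>((1+s)\<^bsup>-n/2\<^esup>) / (1+s)\<close>. The substitution \<open>r = (1+s)\<^bsup>n/2\<^esup>\<close> turns the Dini condition on \<open>\<mu>\<close>
  into integrability of this bound in time, so the Duhamel term is \<open>O(R\<^sup>2)\<close> with the same rates. The bounds are
  thus propagated by Picard iteration for small data, and convergence of the iteration needs only the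
  local Lipschitz property of \<open>h\<close> in \<open>L\<^sup>2\<close>, in a norm weighted by \<open>exp (- \<lambda> t)\<close>. The same
  Lipschitz estimate yields uniqueness, after a duality argument has turned the distributional mild
  identity into an \<open>L\<^sup>2\<close> bound.

  The one derivative of \<open>h(u)\<close> required in dimension two is estimated by translation differences
  and the consequence
  \<open>|h(a) - h(b)| \<le> C max(|a|,|b|)\<^bsup>2/n\<^esup> \<mu>(max(|a|,|b|)) |a - b|\<close>
  of the concavity of \<open>\<mu>\<close>.
\<close>

subsection \<open>Norm bounds\<close>

text \<open>The power 1 + 2/n is critical: for a solution with the linear rates the source decays in
  L1 like 1/(1+s) times a factor coming from \<open>\<mu>\<close>, so no power of time is left to
  waste. In dimension two, estimating all of the Duhamel integral from L1 would need the kernel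
  (1+t-s)^(-1) near s = t, which costs a logarithm. Hence the integral is cut at t/2: old sources
  are measured in L1 together with L2, recent ones in a weighted L2 norm alone, whose kernel
  exponent never exceeds 1/2. The L1 norm of the transform is recovered from L2 by dividing by the
  n-th power of (1+|\<xi>|^2)^(1/2); one power is gained by \<open>K1\<close>, and the remaining n -
  1 are derivatives of the source. The iterates are functions defined at every frequency. One
  Duhamel step turns L2 closeness into closeness at each \<xi>, so the limit is pointwise and norm
  bounds survive by Fatou. Joint measurability, required by Fubini and Minkowski, comes from joint
  continuity of the transformed source. In the uniqueness part a competing solution is known only to
  be bounded on each [0,T], by a possibly large constant; the exponential weight absorbs it.\<close>

definition L2le :: "'a measure \<Rightarrow> ('a \<Rightarrow> 'b::{banach,second_countable_topology}) \<Rightarrow> real \<Rightarrow> bool" where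
  "L2le M f A \<longleftrightarrow> f \<in> borel_measurable M \<and> 0 \<le> A \<and> (\<integral>\<^sup>+x. ennreal ((norm (f x))\<^sup>2) \<partial>M) \<le> ennreal (A\<^sup>2)"

text \<open>Both predicates bundle measurability, a nonnegative constant and a bound on the extended
  nonnegative integral. Membership in the space and the quantitative estimate then travel together,
  for real and complex values alike, and the default value of a Bochner integral cannot make a bound
  hold by accident.\<close>

definition L1le :: "'a measure \<Rightarrow> ('a \<Rightarrow> 'b::{banach,second_countable_topology}) \<Rightarrow> real \<Rightarrow> bool" where
  "L1le M f A \<longleftrightarrow> f \<in> borel_measurable M \<and> 0 \<le> A \<and> (\<integral>\<^sup>+x. ennreal (norm (f x)) \<partial>M) \<le> ennreal A"

lemma L2le_measurable[measurable_dest]: "L2le M f A \<Longrightarrow> f \<in> borel_measurable M"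
  by (simp add: L2le_def)

lemma L1le_measurable[measurable_dest]: "L1le M f A \<Longrightarrow> f \<in> borel_measurable M"
  by (simp add: L1le_def)

lemma L2le_nonneg: "L2le M f A \<Longrightarrow> 0 \<le> A"
  by (simp add: L2le_def)

lemma L1le_nonneg: "L1le M f A \<Longrightarrow> 0 \<le> A"
  by (simp add: L1le_def)

lemma L2le_mono: "L2le M f A \<Longrightarrow> A \<le> B \<Longrightarrow> L2le M f B"
  unfolding L2le_def by (meson ennreal_leI order_trans power_mono)

lemma L1le_mono: "L1le M f A \<Longrightarrow> A \<le> B \<Longrightarrow> L1le M f B"
  unfolding L1le_def by (meson ennreal_leI order_trans)

lemma L2le_dom:
  assumes f: "L2le M f A" and g: "g \<in> borel_measurable M" and c: "0 \<le> c"
    and le: "AE x in M. norm (g x) \<le> c * norm (f x)"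
  shows "L2le M g (c * A)"
proof -
  have "(\<integral>\<^sup>+x. ennreal ((norm (g x))\<^sup>2) \<partial>M) \<le> (\<integral>\<^sup>+x. ennreal (c\<^sup>2) * ennreal ((norm (f x))\<^sup>2) \<partial>M)"
    using le by (intro nn_integral_mono_AE)
      (auto simp: ennreal_mult[symmetric] power_mult_distrib[symmetric] intro!: ennreal_leI power_mono)
  also have "\<dots> = ennreal (c\<^sup>2) * (\<integral>\<^sup>+x. ennreal ((norm (f x))\<^sup>2) \<partial>M)"
    using f by (intro nn_integral_cmult) (auto simp: L2le_def)
  also have "\<dots> \<le> ennreal (c\<^sup>2) * ennreal (A\<^sup>2)"
    using f by (intro mult_left_mono) (auto simp: L2le_def)
  finally show ?thesis
    using f g c by (auto simp: L2le_def ennreal_mult[symmetric] power_mult_distrib)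
qed

lemma L1le_dom:
  assumes f: "L1le M f A" and g: "g \<in> borel_measurable M" and c: "0 \<le> c"
    and le: "AE x in M. norm (g x) \<le> c * norm (f x)"
  shows "L1le M g (c * A)"
proof -
  have "(\<integral>\<^sup>+x. ennreal (norm (g x)) \<partial>M) \<le> (\<integral>\<^sup>+x. ennreal c * ennreal (norm (f x)) \<partial>M)"
    using le by (intro nn_integral_mono_AE) (auto simp: ennreal_mult[symmetric] c intro!: ennreal_leI)
  also have "\<dots> = ennreal c * (\<integral>\<^sup>+x. ennreal (norm (f x)) \<partial>M)"
    using f by (intro nn_integral_cmult) (auto simp: L1le_def)
  also have "\<dots> \<le> ennreal c * ennreal A"
    using f by (intro mult_left_mono) (auto simp: L1le_def)
  finally show ?thesis
    using f g c by (auto simp: L1le_def ennreal_mult[symmetric])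
qed

lemma L2le_dom1:
  assumes "L2le M f A" "g \<in> borel_measurable M" "\<And>x. norm (g x) \<le> norm (f x)"
  shows "L2le M g A"
  using L2le_dom[OF assms(1,2), of 1] assms(3) by simp

lemma L1le_dom1:
  assumes "L1le M f A" "g \<in> borel_measurable M" "\<And>x. norm (g x) \<le> norm (f x)"
  shows "L1le M g A"
  using L1le_dom[OF assms(1,2), of 1] assms(3) by simp

lemma L2le_cong_AE:
  assumes "L2le M f A" "g \<in> borel_measurable M" "AE x in M. f x = g x"
  shows "L2le M g A"
proof -
  have "AE x in M. norm (g x) \<le> 1 * norm (f x)" using assms(3) by eventually_elim simp
  from L2le_dom[OF assms(1,2) _ this] show ?thesis by simp
qed

lemma L1le_integrable: "L1le M f A \<Longrightarrow> integrable M f"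
  unfolding L1le_def by (rule integrableI_bounded) (auto intro: le_less_trans[OF _ ennreal_less_top])

lemma L2le_integrable: "L2le M f A \<Longrightarrow> integrable M (\<lambda>x. (norm (f x))\<^sup>2)"
  unfolding L2le_def by (rule integrableI_bounded) (auto intro: le_less_trans[OF _ ennreal_less_top])

lemma L1le_integral: "L1le M f A \<Longrightarrow> norm (integral\<^sup>L M f) \<le> A"
proof -
  assume f: "L1le M f A"
  have "ennreal (norm (integral\<^sup>L M f)) \<le> (\<integral>\<^sup>+x. ennreal (norm (f x)) \<partial>M)"
    using L1le_integrable[OF f] by (rule integral_norm_bound_ennreal)
  also have "\<dots> \<le> ennreal A" using f by (simp add: L1le_def)
  finally show ?thesis using L1le_nonneg[OF f] by simp
qed

lemma L2le_integral: "L2le M f A \<Longrightarrow> (\<integral>x. (norm (f x))\<^sup>2 \<partial>M) \<le> A\<^sup>2"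
proof -
  assume f: "L2le M f A"
  have "ennreal (\<integral>x. (norm (f x))\<^sup>2 \<partial>M) = (\<integral>\<^sup>+x. ennreal ((norm (f x))\<^sup>2) \<partial>M)"
    by (rule nn_integral_eq_integral[symmetric, OF L2le_integrable[OF f]]) auto
  also have "\<dots> \<le> ennreal (A\<^sup>2)" using f by (simp add: L2le_def)
  finally show ?thesis by (simp add: ennreal_le_iff)
qed

lemma L1leI_integrable: "integrable M f \<Longrightarrow> (\<integral>x. norm (f x) \<partial>M) \<le> A \<Longrightarrow> L1le M f A"
  using order_trans[OF integral_nonneg_AE[of "\<lambda>x. norm (f x)" M], of A]
  by (auto simp: L1le_def nn_integral_eq_integral ennreal_leI)

lemma L2leI_integrable:
  "f \<in> borel_measurable M \<Longrightarrow> integrable M (\<lambda>x. (norm (f x))\<^sup>2) \<Longrightarrow> 0 \<le> A \<Longrightarrow>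
    (\<integral>x. (norm (f x))\<^sup>2 \<partial>M) \<le> A\<^sup>2 \<Longrightarrow> L2le M f A"
  by (auto simp: L2le_def nn_integral_eq_integral ennreal_leI)

text \<open>Strips the square from the extended-real Cauchy-Schwarz inequality. For negative
  \<open>a\<close> the right-hand side of the hypothesis is 0, which forces x = 0.\<close>

lemma ennreal_power2_le: "x\<^sup>2 \<le> (ennreal a)\<^sup>2 \<Longrightarrow> x \<le> ennreal a"
proof (cases x)
  case (real r)
  assume le: "x\<^sup>2 \<le> (ennreal a)\<^sup>2"
  show ?thesis
  proof (cases "0 \<le> a")
    case True
    then show ?thesis using real le by (auto simp: ennreal_power intro!: ennreal_leI elim: power2_le_imp_le)
  next
    case False
    then have "x\<^sup>2 \<le> 0" using le by (simp add: ennreal_neg)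
    then show ?thesis by simp
  qed
next
  case top
  assume le: "x\<^sup>2 \<le> (ennreal a)\<^sup>2"
  have "(ennreal a)\<^sup>2 < top" by (simp add: power2_eq_square ennreal_mult_less_top)
  then show ?thesis using le top by (simp add: power2_eq_square top_unique)
qed

lemma L2le_mult:
  fixes f g :: "'a \<Rightarrow> 'b::{real_normed_algebra,banach,second_countable_topology}"
  assumes f: "L2le M f A" and g: "L2le M g B"
  shows "L1le M (\<lambda>x. f x * g x) (A * B)"
proof -
  have [measurable]: "f \<in> borel_measurable M" "g \<in> borel_measurable M" using f g by (auto simp: L2le_def)
  let ?I = "\<integral>\<^sup>+x. ennreal (norm (f x)) * ennreal (norm (g x)) \<partial>M"
  have "?I\<^sup>2 \<le> (\<integral>\<^sup>+x. (ennreal (norm (f x)))\<^sup>2 \<partial>M) * (\<integral>\<^sup>+x. (ennreal (norm (g x)))\<^sup>2 \<partial>M)"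
    by (rule Cauchy_Schwarz_nn_integral) auto
  also have "\<dots> \<le> ennreal (A\<^sup>2) * ennreal (B\<^sup>2)"
    using f g by (intro mult_mono) (auto simp: L2le_def ennreal_power)
  also have "\<dots> = (ennreal (A * B))\<^sup>2"
    using L2le_nonneg[OF f] L2le_nonneg[OF g] by (simp add: ennreal_power ennreal_mult[symmetric] power_mult_distrib)
  finally have "?I\<^sup>2 \<le> (ennreal (A * B))\<^sup>2" .
  then have "?I \<le> ennreal (A * B)"
    by (rule ennreal_power2_le)
  moreover have "(\<integral>\<^sup>+x. ennreal (norm (f x * g x)) \<partial>M) \<le> ?I"
    by (intro nn_integral_mono) (auto simp: ennreal_mult[symmetric] norm_mult_ineq intro!: ennreal_leI)
  ultimately show ?thesis
    using L2le_nonneg[OF f] L2le_nonneg[OF g] by (auto simp: L1le_def)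
qed

lemma L2le_norm: "L2le M f A \<Longrightarrow> L2le M (\<lambda>x. norm (f x)) A"
  by (auto simp: L2le_def)

lemma L2le_add:
  assumes f: "L2le M f A" and g: "L2le M g B"
  shows "L2le M (\<lambda>x. f x + g x) (A + B)"
proof -
  have [measurable]: "f \<in> borel_measurable M" "g \<in> borel_measurable M" using f g by (auto simp: L2le_def)
  have m: "L1le M (\<lambda>x. norm (f x) * norm (g x)) (A * B)"
    by (rule L2le_mult[OF L2le_norm[OF f] L2le_norm[OF g]])
  have nn: "0 \<le> A" "0 \<le> B" using f g by (auto simp: L2le_def)
  have "(\<integral>\<^sup>+x. ennreal ((norm (f x + g x))\<^sup>2) \<partial>M)
      \<le> (\<integral>\<^sup>+x. ennreal ((norm (f x))\<^sup>2) + (ennreal ((norm (g x))\<^sup>2) + 2 * ennreal (norm (norm (f x) * norm (g x)))) \<partial>M)"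
  proof (rule nn_integral_mono)
    fix x
    have "(norm (f x + g x))\<^sup>2 \<le> (norm (f x) + norm (g x))\<^sup>2"
      by (intro power_mono norm_triangle_ineq) auto
    also have "\<dots> = (norm (f x))\<^sup>2 + ((norm (g x))\<^sup>2 + 2 * (norm (f x) * norm (g x)))"
      by (simp add: power2_sum)
    finally have "ennreal ((norm (f x + g x))\<^sup>2) \<le> ennreal \<dots>" by (rule ennreal_leI)
    then show "ennreal ((norm (f x + g x))\<^sup>2) \<le> ennreal ((norm (f x))\<^sup>2) + (ennreal ((norm (g x))\<^sup>2) + 2 * ennreal (norm (norm (f x) * norm (g x))))"
      by (subst (asm) ennreal_plus, simp, simp, subst (asm) ennreal_plus, simp, simp) (simp add: ennreal_mult)
  qed
  also have "\<dots> = (\<integral>\<^sup>+x. ennreal ((norm (f x))\<^sup>2) \<partial>M) + ((\<integral>\<^sup>+x. ennreal ((norm (g x))\<^sup>2) \<partial>M)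
      + 2 * (\<integral>\<^sup>+x. ennreal (norm (norm (f x) * norm (g x))) \<partial>M))"
    by (simp add: nn_integral_add nn_integral_cmult)
  also have "\<dots> \<le> ennreal (A\<^sup>2) + (ennreal (B\<^sup>2) + 2 * ennreal (A * B))"
    using f g m by (intro add_mono mult_left_mono) (auto simp: L2le_def L1le_def)
  also have "\<dots> = ennreal ((A + B)\<^sup>2)"
  proof -
    have "2 * ennreal (A * B) = ennreal (2 * (A * B))" using nn by (simp add: ennreal_mult)
    then show ?thesis using nn by (simp add: ennreal_plus[symmetric] power2_sum add.assoc del: ennreal_plus)
  qed
  finally show ?thesis using nn by (auto simp: L2le_def)
qed

lemma L1le_add:
  assumes f: "L1le M f A" and g: "L1le M g B"
  shows "L1le M (\<lambda>x. f x + g x) (A + B)"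
proof -
  have [measurable]: "f \<in> borel_measurable M" "g \<in> borel_measurable M" using f g by (auto simp: L1le_def)
  have nn: "0 \<le> A" "0 \<le> B" using f g by (auto simp: L1le_def)
  have "(\<integral>\<^sup>+x. ennreal (norm (f x + g x)) \<partial>M) \<le> (\<integral>\<^sup>+x. ennreal (norm (f x)) + ennreal (norm (g x)) \<partial>M)"
    by (intro nn_integral_mono) (simp add: ennreal_plus[symmetric] norm_triangle_ineq ennreal_leI del: ennreal_plus)
  also have "\<dots> = (\<integral>\<^sup>+x. ennreal (norm (f x)) \<partial>M) + (\<integral>\<^sup>+x. ennreal (norm (g x)) \<partial>M)"
    by (rule nn_integral_add) auto
  also have "\<dots> \<le> ennreal A + ennreal B" using f g by (intro add_mono) (auto simp: L1le_def)
  finally show ?thesis using nn by (auto simp: L1le_def ennreal_plus[symmetric] simp del: ennreal_plus)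
qed

lemma L2le_uminus: "L2le M f A \<Longrightarrow> L2le M (\<lambda>x. - f x) A"
  by (auto simp: L2le_def)

lemma L2le_diff: "L2le M f A \<Longrightarrow> L2le M g B \<Longrightarrow> L2le M (\<lambda>x. f x - g x) (A + B)"
  using L2le_add[of M f A "\<lambda>x. - g x" B] L2le_uminus[of M g B] by simp

lemma L2le_diff_commute: "L2le M (\<lambda>x. f x - g x) A \<Longrightarrow> L2le M (\<lambda>x. g x - f x) A"
  using L2le_uminus[of M "\<lambda>x. f x - g x" A] by simp

lemma L2le_zero: "0 \<le> A \<Longrightarrow> L2le M (\<lambda>x. 0) A"
  by (auto simp: L2le_def)

lemma L2le_sum:
  "(\<And>i. i \<in> I \<Longrightarrow> L2le M (f i) (A i)) \<Longrightarrow> L2le M (\<lambda>x. \<Sum>i\<in>I. f i x) (\<Sum>i\<in>I. A i)"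
  by (induction I rule: infinite_finite_induct) (auto intro: L2le_add L2le_zero)

text \<open>The constants may vary with the index, so a bound carrying an error that tends to 0
  passes to the limit with the clean constant. This is the main device for transferring estimates
  from approximations to limits.\<close>

lemma L2le_Fatou:
  assumes f: "\<And>k::nat. L2le M (f k) (A k)" and g: "g \<in> borel_measurable M"
    and lim: "AE x in M. (\<lambda>k. f k x) \<longlonglongrightarrow> g x" and A: "A \<longlonglongrightarrow> B"
  shows "L2le M g B"
proof -
  have [measurable]: "\<And>k. f k \<in> borel_measurable M" using f by (auto simp: L2le_def)
  have "(\<integral>\<^sup>+x. ennreal ((norm (g x))\<^sup>2) \<partial>M) = (\<integral>\<^sup>+x. liminf (\<lambda>k. ennreal ((norm (f k x))\<^sup>2)) \<partial>M)"
  proof (rule nn_integral_cong_AE, use lim in eventually_elim)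
    fix x assume "(\<lambda>k. f k x) \<longlonglongrightarrow> g x"
    then have "(\<lambda>k. ennreal ((norm (f k x))\<^sup>2)) \<longlonglongrightarrow> ennreal ((norm (g x))\<^sup>2)"
      by (intro tendsto_ennrealI tendsto_intros)
    then show "ennreal ((norm (g x))\<^sup>2) = liminf (\<lambda>k. ennreal ((norm (f k x))\<^sup>2))"
      by (intro lim_imp_Liminf[symmetric]) auto
  qed
  also have "\<dots> \<le> liminf (\<lambda>k. \<integral>\<^sup>+x. ennreal ((norm (f k x))\<^sup>2) \<partial>M)"
    by (rule nn_integral_liminf) measurable
  also have "\<dots> \<le> liminf (\<lambda>k. ennreal ((A k)\<^sup>2))"
    using f by (intro Liminf_mono) (auto simp: L2le_def)
  also have "\<dots> = ennreal (B\<^sup>2)"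
    using A by (intro lim_imp_Liminf tendsto_ennrealI tendsto_intros) auto
  finally show ?thesis
    using g LIMSEQ_le_const[OF A] L2le_nonneg[OF f] by (auto simp: L2le_def)
qed

lemma L1le_Fatou:
  assumes f: "\<And>k::nat. L1le M (f k) (A k)" and g: "g \<in> borel_measurable M"
    and lim: "AE x in M. (\<lambda>k. f k x) \<longlonglongrightarrow> g x" and A: "A \<longlonglongrightarrow> B"
  shows "L1le M g B"
proof -
  have [measurable]: "\<And>k. f k \<in> borel_measurable M" using f by (auto simp: L1le_def)
  have "(\<integral>\<^sup>+x. ennreal (norm (g x)) \<partial>M) = (\<integral>\<^sup>+x. liminf (\<lambda>k. ennreal (norm (f k x))) \<partial>M)"
  proof (rule nn_integral_cong_AE, use lim in eventually_elim)
    fix x assume "(\<lambda>k. f k x) \<longlonglongrightarrow> g x"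
    then have "(\<lambda>k. ennreal (norm (f k x))) \<longlonglongrightarrow> ennreal (norm (g x))"
      by (intro tendsto_ennrealI tendsto_intros)
    then show "ennreal (norm (g x)) = liminf (\<lambda>k. ennreal (norm (f k x)))"
      by (intro lim_imp_Liminf[symmetric]) auto
  qed
  also have "\<dots> \<le> liminf (\<lambda>k. \<integral>\<^sup>+x. ennreal (norm (f k x)) \<partial>M)"
    by (rule nn_integral_liminf) measurable
  also have "\<dots> \<le> liminf (\<lambda>k. ennreal (A k))"
    using f by (intro Liminf_mono) (auto simp: L1le_def)
  also have "\<dots> = ennreal B"
    using A by (intro lim_imp_Liminf tendsto_ennrealI tendsto_intros) auto
  finally show ?thesis
    using g LIMSEQ_le_const[OF A] L1le_nonneg[OF f] by (auto simp: L1le_def)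
qed

lemma L2le_zero_AE: "L2le M f 0 \<Longrightarrow> AE x in M. f x = 0"
proof -
  assume f: "L2le M f 0"
  then have [measurable]: "f \<in> borel_measurable M" by (simp add: L2le_def)
  have "(\<integral>\<^sup>+x. ennreal ((norm (f x))\<^sup>2) \<partial>M) = 0" using f by (simp add: L2le_def)
  then show ?thesis by (subst (asm) nn_integral_0_iff_AE) auto
qed

lemma L2le_limit_bound:
  assumes "\<And>k::nat. L2le M f (A k)" "A \<longlonglongrightarrow> B" shows "L2le M f B"
  using L2le_Fatou[of M "\<lambda>_. f" A f B] assms L2le_measurable[OF assms(1)] by auto

text \<open>Cauchy-Schwarz in s for the factorization G = sqrt W * (G / sqrt W), followed by
  Tonelli. The weight \<open>W\<close> only has to dominate the L2 norm of each slice; where it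
  vanishes the factorization would divide by zero, hence the condition that \<open>G\<close>
  vanishes there too.\<close>

lemma nn_integral_Minkowski:
  fixes G :: "'s \<Rightarrow> 'a \<Rightarrow> ennreal" and W :: "'s \<Rightarrow> real"
  assumes sf: "sigma_finite_measure M" "sigma_finite_measure N"
    and [measurable]: "(\<lambda>(s, x). G s x) \<in> borel_measurable (N \<Otimes>\<^sub>M M)" "W \<in> borel_measurable N"
    and W: "\<And>s. 0 \<le> W s" "\<And>s x. W s = 0 \<Longrightarrow> G s x = 0" and I: "integrable N W"
    and G: "\<And>s. s \<in> space N \<Longrightarrow> (\<integral>\<^sup>+x. (G s x)\<^sup>2 \<partial>M) \<le> ennreal ((W s)\<^sup>2)"
  shows "(\<integral>\<^sup>+x. (\<integral>\<^sup>+s. G s x \<partial>N)\<^sup>2 \<partial>M) \<le> ennreal ((integral\<^sup>L N W)\<^sup>2)"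
proof -
  interpret M: sigma_finite_measure M by fact
  interpret N: sigma_finite_measure N by fact
  interpret P: pair_sigma_finite N M ..
  have IW: "(\<integral>\<^sup>+s. ennreal (W s) \<partial>N) = ennreal (integral\<^sup>L N W)"
    using W I by (intro nn_integral_eq_integral) auto
  have Inn: "0 \<le> integral\<^sup>L N W" using W by (intro integral_nonneg_AE AE_I2) auto
  have "(\<integral>\<^sup>+s. G s x \<partial>N)\<^sup>2 \<le> ennreal (integral\<^sup>L N W) * (\<integral>\<^sup>+s. (G s x)\<^sup>2 * ennreal (1 / W s) \<partial>N)"
    if [measurable]: "x \<in> space M" for x
  proof -
    have "(\<integral>\<^sup>+s. G s x \<partial>N) = (\<integral>\<^sup>+s. ennreal (sqrt (W s)) * (G s x * ennreal (1 / sqrt (W s))) \<partial>N)"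
    proof (rule nn_integral_cong)
      fix s assume s: "s \<in> space N"
      have "W s = 0 \<or> ennreal (sqrt (W s)) * ennreal (1 / sqrt (W s)) = 1"
        using W(1)[of s] by (auto simp: ennreal_mult[symmetric])
      then show "G s x = ennreal (sqrt (W s)) * (G s x * ennreal (1 / sqrt (W s)))"
        using W(2)[of s x] by (metis mult.left_commute mult.right_neutral mult_zero_left mult_zero_right)
    qed
    also have "\<dots>\<^sup>2 \<le> (\<integral>\<^sup>+s. (ennreal (sqrt (W s)))\<^sup>2 \<partial>N) * (\<integral>\<^sup>+s. (G s x * ennreal (1 / sqrt (W s)))\<^sup>2 \<partial>N)"
      by (rule Cauchy_Schwarz_nn_integral) measurable
    also have "(\<integral>\<^sup>+s. (ennreal (sqrt (W s)))\<^sup>2 \<partial>N) = ennreal (integral\<^sup>L N W)"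
      using W unfolding IW[symmetric] by (intro nn_integral_cong) (auto simp: ennreal_power)
    also have "(\<integral>\<^sup>+s. (G s x * ennreal (1 / sqrt (W s)))\<^sup>2 \<partial>N) = (\<integral>\<^sup>+s. (G s x)\<^sup>2 * ennreal (1 / W s) \<partial>N)"
      using W by (intro nn_integral_cong) (auto simp: power_mult_distrib ennreal_power power_divide)
    finally show ?thesis .
  qed
  then have "(\<integral>\<^sup>+x. (\<integral>\<^sup>+s. G s x \<partial>N)\<^sup>2 \<partial>M) \<le> (\<integral>\<^sup>+x. ennreal (integral\<^sup>L N W) * (\<integral>\<^sup>+s. (G s x)\<^sup>2 * ennreal (1 / W s) \<partial>N) \<partial>M)"
    by (intro nn_integral_mono)
  also have "\<dots> = ennreal (integral\<^sup>L N W) * (\<integral>\<^sup>+x. (\<integral>\<^sup>+s. (G s x)\<^sup>2 * ennreal (1 / W s) \<partial>N) \<partial>M)"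
    by (intro nn_integral_cmult) measurable
  also have "(\<integral>\<^sup>+x. (\<integral>\<^sup>+s. (G s x)\<^sup>2 * ennreal (1 / W s) \<partial>N) \<partial>M) = (\<integral>\<^sup>+s. (\<integral>\<^sup>+x. (G s x)\<^sup>2 * ennreal (1 / W s) \<partial>M) \<partial>N)"
    by (rule P.Fubini') measurable
  also have "\<dots> \<le> (\<integral>\<^sup>+s. ennreal (W s) \<partial>N)"
  proof (rule nn_integral_mono)
    fix s assume s[measurable]: "s \<in> space N"
    have "(\<integral>\<^sup>+x. (G s x)\<^sup>2 * ennreal (1 / W s) \<partial>M) = (\<integral>\<^sup>+x. (G s x)\<^sup>2 \<partial>M) * ennreal (1 / W s)"
      by (rule nn_integral_multc) measurable
    also have "\<dots> \<le> ennreal ((W s)\<^sup>2) * ennreal (1 / W s)" by (intro mult_right_mono G s) auto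
    also have "\<dots> = ennreal (W s)" using W(1)[of s] by (simp add: ennreal_mult[symmetric] power2_eq_square)
    finally show "(\<integral>\<^sup>+x. (G s x)\<^sup>2 * ennreal (1 / W s) \<partial>M) \<le> ennreal (W s)" .
  qed
  also have "\<dots> = ennreal (integral\<^sup>L N W)" by (rule IW)
  finally show ?thesis using Inn by (simp add: ennreal_mult[symmetric] power2_eq_square mult_left_mono)
qed

text \<open>The weight is made strictly positive on the interval by adding 1/(k+1) to
  \<open>w\<close>, so that it vanishes only outside the interval, where the integrand is cut off
  anyway. The surplus disappears in the limit over k.\<close>

lemma L2le_Minkowski:
  fixes g :: "real \<Rightarrow> 'a \<Rightarrow> 'b::{banach,second_countable_topology}"
  assumes sf: "sigma_finite_measure M"
    and [measurable]: "(\<lambda>(s, x). g s x) \<in> borel_measurable (lborel \<Otimes>\<^sub>M M)"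
    and g: "\<And>s. s \<in> {a..b} \<Longrightarrow> L2le M (g s) (w s)"
    and w: "set_integrable lborel {a..b} w"
  shows "L2le M (\<lambda>x. LINT s:{a..b}|lborel. g s x) (LINT s:{a..b}|lborel. w s)"
proof -
  interpret M: sigma_finite_measure M by fact
  let ?I = "LINT s:{a..b}|lborel. w s"
  have wi: "integrable lborel (\<lambda>s. indicator {a..b} s * w s)"
    using w by (simp add: set_integrable_def)
  have ci: "integrable lborel (\<lambda>s. indicator {a..b} s * (c::real))" for c
    by (auto simp: emeasure_lborel_Icc_eq ennreal_mult_less_top)
  have "L2le M (\<lambda>x. LINT s:{a..b}|lborel. g s x) (?I + (1 / Suc k) * (LINT s|lborel. indicator {a..b} s))" for k
  proof -
    define d where "d = 1 / real (Suc k)"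
    have d: "d > 0" by (simp add: d_def)
    define W where "W s = indicator {a..b} s * w s + indicator {a..b} s * d" for s
    define G where "G s x = ennreal (norm (indicator {a..b} s *\<^sub>R g s x))" for s x
    have wnn: "s \<in> {a..b} \<Longrightarrow> 0 \<le> w s" for s using L2le_nonneg[OF g] .
    have Wi: "integrable lborel W"
      unfolding W_def[abs_def] by (intro Bochner_Integration.integrable_add wi ci)
    have IW: "integral\<^sup>L lborel W = ?I + d * (LINT s|lborel. indicator {a..b} s)"
      unfolding W_def using wi ci[of d] by (simp add: set_lebesgue_integral_def mult.commute)
    have "(\<integral>\<^sup>+x. ennreal ((norm (LINT s:{a..b}|lborel. g s x))\<^sup>2) \<partial>M) \<le> (\<integral>\<^sup>+x. (\<integral>\<^sup>+s. G s x \<partial>lborel)\<^sup>2 \<partial>M)"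
    proof (rule nn_integral_mono)
      fix x
      have "ennreal (norm (LINT s:{a..b}|lborel. g s x)) \<le> (\<integral>\<^sup>+s. G s x \<partial>lborel)"
      proof (cases "integrable lborel (\<lambda>s. indicator {a..b} s *\<^sub>R g s x)")
        case True
        then show ?thesis unfolding set_lebesgue_integral_def G_def by (rule integral_norm_bound_ennreal)
      next
        \<comment> \<open>A slice that is not integrable in s has Bochner integral 0 by convention,
          so the bound is trivial there.\<close>
        case False
        then show ?thesis by (simp add: set_lebesgue_integral_def not_integrable_integral_eq)
      qed
      then show "ennreal ((norm (LINT s:{a..b}|lborel. g s x))\<^sup>2) \<le> (\<integral>\<^sup>+s. G s x \<partial>lborel)\<^sup>2"
        by (simp add: ennreal_power[symmetric] power_mono)
    qed
    also have "\<dots> \<le> ennreal ((integral\<^sup>L lborel W)\<^sup>2)"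
    proof (rule nn_integral_Minkowski[OF sf lborel.sigma_finite_measure_axioms])
      show "(\<lambda>(s, x). G s x) \<in> borel_measurable (lborel \<Otimes>\<^sub>M M)"
        unfolding G_def by measurable
      show "W \<in> borel_measurable lborel" using Wi by auto
      show "0 \<le> W s" for s using wnn[of s] d by (auto simp: W_def indicator_def)
      show "W s = 0 \<Longrightarrow> G s x = 0" for s x using wnn[of s] d by (auto simp: W_def G_def indicator_def)
      show "integrable lborel W" by (rule Wi)
      fix s :: real
      show "(\<integral>\<^sup>+x. (G s x)\<^sup>2 \<partial>M) \<le> ennreal ((W s)\<^sup>2)"
      proof (cases "s \<in> {a..b}")
        case True
        have "L2le M (g s) (w s + d)" by (rule L2le_mono[OF g[OF True]]) (use d in simp)
        then show ?thesis using True by (simp add: G_def W_def L2le_def ennreal_power)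
      qed (simp add: G_def)
    qed
    finally have "(\<integral>\<^sup>+x. ennreal ((norm (LINT s:{a..b}|lborel. g s x))\<^sup>2) \<partial>M) \<le> ennreal ((integral\<^sup>L lborel W)\<^sup>2)" .
    moreover have "0 \<le> integral\<^sup>L lborel W" using wnn d by (intro integral_nonneg_AE AE_I2) (auto simp: W_def indicator_def)
    moreover have "(\<lambda>x. LINT s:{a..b}|lborel. g s x) \<in> borel_measurable M"
      unfolding set_lebesgue_integral_def by measurable
    ultimately show ?thesis unfolding IW by (simp add: L2le_def d_def)
  qed
  moreover have "(\<lambda>k. ?I + (1 / Suc k) * (LINT s|lborel. indicator {a..b} s)) \<longlonglongrightarrow> ?I + 0 * (LINT s|lborel. indicator {a..b} s)"
    by (intro tendsto_intros LIMSEQ_Suc lim_1_over_n)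
  ultimately show ?thesis using L2le_limit_bound by fastforce
qed

lemma L1le_Minkowski:
  fixes g :: "real \<Rightarrow> 'a \<Rightarrow> 'b::{banach,second_countable_topology}"
  assumes sf: "sigma_finite_measure M"
    and [measurable]: "(\<lambda>(s, x). g s x) \<in> borel_measurable (lborel \<Otimes>\<^sub>M M)"
    and g: "\<And>s. s \<in> {a..b} \<Longrightarrow> L1le M (g s) (w s)"
    and w: "set_integrable lborel {a..b} w"
  shows "L1le M (\<lambda>x. LINT s:{a..b}|lborel. g s x) (LINT s:{a..b}|lborel. w s)"
proof -
  interpret M: sigma_finite_measure M by fact
  interpret P: pair_sigma_finite lborel M ..
  have wnn: "s \<in> {a..b} \<Longrightarrow> 0 \<le> w s" for s using L1le_nonneg[OF g] .
  have "(\<integral>\<^sup>+x. ennreal (norm (LINT s:{a..b}|lborel. g s x)) \<partial>M)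
      \<le> (\<integral>\<^sup>+x. (\<integral>\<^sup>+s. ennreal (norm (indicator {a..b} s *\<^sub>R g s x)) \<partial>lborel) \<partial>M)"
  proof (rule nn_integral_mono)
    fix x
    show "ennreal (norm (LINT s:{a..b}|lborel. g s x)) \<le> (\<integral>\<^sup>+s. ennreal (norm (indicator {a..b} s *\<^sub>R g s x)) \<partial>lborel)"
    proof (cases "integrable lborel (\<lambda>s. indicator {a..b} s *\<^sub>R g s x)")
      case True
      then show ?thesis unfolding set_lebesgue_integral_def by (rule integral_norm_bound_ennreal)
    qed (simp add: set_lebesgue_integral_def not_integrable_integral_eq)
  qed
  also have "\<dots> = (\<integral>\<^sup>+s. (\<integral>\<^sup>+x. ennreal (norm (indicator {a..b} s *\<^sub>R g s x)) \<partial>M) \<partial>lborel)"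
    by (rule P.Fubini') measurable
  also have "\<dots> \<le> (\<integral>\<^sup>+s. ennreal (indicator {a..b} s * w s) \<partial>lborel)"
  proof (rule nn_integral_mono)
    fix s
    show "(\<integral>\<^sup>+x. ennreal (norm (indicator {a..b} s *\<^sub>R g s x)) \<partial>M) \<le> ennreal (indicator {a..b} s * w s)"
      using g[of s] by (cases "s \<in> {a..b}") (auto simp: L1le_def)
  qed
  also have "\<dots> = ennreal (LINT s:{a..b}|lborel. w s)"
    using w wnn unfolding set_lebesgue_integral_def set_integrable_def
    by (subst nn_integral_eq_integral) (auto simp: indicator_def)
  finally have "(\<integral>\<^sup>+x. ennreal (norm (LINT s:{a..b}|lborel. g s x)) \<partial>M) \<le> ennreal (LINT s:{a..b}|lborel. w s)" .
  moreover have "0 \<le> (LINT s:{a..b}|lborel. w s)"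
    unfolding set_lebesgue_integral_def using wnn by (intro integral_nonneg_AE AE_I2) (auto simp: indicator_def)
  moreover have "(\<lambda>x. LINT s:{a..b}|lborel. g s x) \<in> borel_measurable M"
    unfolding set_lebesgue_integral_def by measurable
  ultimately show ?thesis by (simp add: L1le_def)
qed

text \<open>The partial sums \<open>S\<close> of the pointwise increments increase and stay below 2
  in L2. By monotone convergence their supremum is finite almost everywhere, so the telescoping
  series converges absolutely there. The factor 2 in the conclusion is the tail of the geometric
  series.\<close>

lemma L2_Riesz_Fischer:
  fixes f :: "nat \<Rightarrow> 'a \<Rightarrow> 'b::{banach,second_countable_topology}"
  assumes [measurable]: "\<And>k. f k \<in> borel_measurable M"
    and d: "\<And>k. L2le M (\<lambda>x. f (Suc k) x - f k x) ((1/2) ^ k)"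
  shows "\<exists>g. g \<in> borel_measurable M \<and> (AE x in M. (\<lambda>k. f k x) \<longlonglongrightarrow> g x)
            \<and> (\<forall>k. L2le M (\<lambda>x. g x - f k x) (2 * (1/2) ^ k))"
proof -
  have geo: "(\<Sum>j<K. (1/2::real) ^ (k + j)) \<le> 2 * (1/2) ^ k" for k K
  proof -
    have "(\<Sum>j<K. (1/2::real) ^ (k + j)) = (1/2) ^ k * (\<Sum>j<K. (1/2::real) ^ j)"
      by (simp add: power_add sum_distrib_left)
    also have "(\<Sum>j<K. (1/2::real) ^ j) = 2 - 2 * (1/2) ^ K" by (induction K) auto
    also have "(1/2) ^ k * (2 - 2 * (1/2) ^ K) \<le> (1/2::real) ^ k * 2" by (intro mult_left_mono) simp_all
    finally show ?thesis by simp
  qed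
  define S where "S K x = (\<Sum>j<K. norm (f (Suc j) x - f j x))" for K x
  have [measurable]: "S K \<in> borel_measurable M" for K unfolding S_def by measurable
  have "L2le M (S K) (\<Sum>j<K. (1/2) ^ j)" for K
    unfolding S_def by (intro L2le_sum L2le_norm d)
  then have SK: "L2le M (S K) 2" for K by (rule L2le_mono) (use geo[of 0 K] in simp)
  have "(\<integral>\<^sup>+x. (SUP K. ennreal ((norm (S K x))\<^sup>2)) \<partial>M) = (SUP K. \<integral>\<^sup>+x. ennreal ((norm (S K x))\<^sup>2) \<partial>M)"
  proof (rule nn_integral_monotone_convergence_SUP)
    show "incseq (\<lambda>K x. ennreal ((norm (S K x))\<^sup>2))"
      unfolding incseq_def le_fun_def S_def
      by (auto intro!: ennreal_leI power_mono sum_mono2 simp: sum_nonneg)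
  qed measurable
  also have "\<dots> \<le> ennreal (2\<^sup>2)" using SK by (intro SUP_least) (auto simp: L2le_def)
  finally have "(\<integral>\<^sup>+x. (SUP K. ennreal ((norm (S K x))\<^sup>2)) \<partial>M) \<noteq> \<infinity>"
    using ennreal_less_top[of "2\<^sup>2"] by (metis infinity_ennreal_def leD)
  then have "AE x in M. (SUP K. ennreal ((norm (S K x))\<^sup>2)) \<noteq> \<infinity>"
    by (rule nn_integral_PInf_AE[rotated]) measurable
  then have conv: "AE x in M. convergent (\<lambda>k. f k x)"
  proof eventually_elim
    fix x assume "(SUP K. ennreal ((norm (S K x))\<^sup>2)) \<noteq> \<infinity>"
    then obtain r where r: "(SUP K. ennreal ((norm (S K x))\<^sup>2)) = ennreal r" "r \<ge> 0"
      by (cases "SUP K. ennreal ((norm (S K x))\<^sup>2)") auto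
    have "S K x \<le> sqrt r" for K
    proof -
      have "ennreal ((norm (S K x))\<^sup>2) \<le> ennreal r" unfolding r(1)[symmetric] by (rule SUP_upper) simp
      then have "(S K x)\<^sup>2 \<le> r" using r by simp
      then show ?thesis by (rule real_le_rsqrt)
    qed
    then have "summable (\<lambda>j. norm (f (Suc j) x - f j x))"
      unfolding S_def by (intro summableI_nonneg_bounded) auto
    then have "summable (\<lambda>j. f (Suc j) x - f j x)" by (rule summable_norm_cancel)
    then have "convergent (\<lambda>n. \<Sum>j<n. f (Suc j) x - f j x)" by (simp add: summable_iff_convergent)
    then have "convergent (\<lambda>n. f n x - f 0 x)" unfolding sum_lessThan_telescope[of "\<lambda>j. f j x"] .
    then show "convergent (\<lambda>k. f k x)" by (simp add: convergent_diff_const_right_iff)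
  qed
  define g where "g x = lim (\<lambda>k. f k x)" for x
  have [measurable]: "g \<in> borel_measurable M" unfolding g_def[abs_def] by (rule borel_measurable_lim_metric) simp
  have lim: "AE x in M. (\<lambda>k. f k x) \<longlonglongrightarrow> g x"
    using conv by eventually_elim (simp add: g_def convergent_LIMSEQ_iff)
  have "L2le M (\<lambda>x. g x - f k x) (2 * (1/2) ^ k)" for k
  proof (rule L2le_Fatou[where f="\<lambda>j x. f (j + k) x - f k x" and A="\<lambda>j. 2 * (1/2) ^ k"])
    fix j
    have eq: "f (j + k) x - f k x = (\<Sum>i<j. f (Suc (k + i)) x - f (k + i) x)" for x
      by (induction j) (auto simp: algebra_simps)
    have "L2le M (\<lambda>x. \<Sum>i<j. f (Suc (k + i)) x - f (k + i) x) (\<Sum>i<j. (1/2) ^ (k + i))"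
      by (intro L2le_sum d)
    then have "L2le M (\<lambda>x. \<Sum>i<j. f (Suc (k + i)) x - f (k + i) x) (2 * (1/2) ^ k)"
      by (rule L2le_mono) (rule geo)
    then show "L2le M (\<lambda>x. f (j + k) x - f k x) (2 * (1/2) ^ k)" by (simp only: eq)
  next
    show "AE x in M. (\<lambda>j. f (j + k) x - f k x) \<longlonglongrightarrow> g x - f k x"
      using lim by eventually_elim (intro tendsto_diff tendsto_const LIMSEQ_ignore_initial_segment)
  qed auto
  then show ?thesis using lim by (intro exI[of _ g]) auto
qed

section \<open>Affine changes of variable for Lebesgue measure\<close>

lemma nn_integral_lborel_affine:
  fixes t :: "'a::euclidean_space"
  assumes [measurable]: "f \<in> borel_measurable borel" and c: "c \<noteq> 0"
  shows "(\<integral>\<^sup>+x. f x \<partial>lborel) = ennreal (\<bar>c\<bar> ^ DIM('a)) * (\<integral>\<^sup>+x. f (t + c *\<^sub>R x) \<partial>lborel)"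
  by (subst lborel_affine[OF c, of t]) (simp add: nn_integral_density nn_integral_distr nn_integral_cmult)

text \<open>The sign \<open>e\<close> lets one statement serve translations and point reflections;
  the Jacobian is 1 in both cases.\<close>

lemma lborel_shift_reflect:
  fixes y :: "'a::euclidean_space" and f :: "'a \<Rightarrow> 'b::{banach,second_countable_topology}"
  assumes [measurable]: "f \<in> borel_measurable borel" and e: "e = 1 \<or> e = -1"
  shows "L2le lborel (\<lambda>x. f (y + e *\<^sub>R x)) A \<longleftrightarrow> L2le lborel f A"
    and "L1le lborel (\<lambda>x. f (y + e *\<^sub>R x)) A \<longleftrightarrow> L1le lborel f A"
    and "integrable lborel (\<lambda>x. f (y + e *\<^sub>R x)) \<longleftrightarrow> integrable lborel f"
    and "(\<integral>x. f (y + e *\<^sub>R x) \<partial>lborel) = (\<integral>x. f x \<partial>lborel)"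
proof -
  have e0: "e \<noteq> 0" "\<bar>e\<bar> = 1" using e by auto
  show "L2le lborel (\<lambda>x. f (y + e *\<^sub>R x)) A \<longleftrightarrow> L2le lborel f A"
    using nn_integral_lborel_affine[of "\<lambda>x. ennreal ((norm (f x))\<^sup>2)" e y] e0 by (simp add: L2le_def)
  show "L1le lborel (\<lambda>x. f (y + e *\<^sub>R x)) A \<longleftrightarrow> L1le lborel f A"
    using nn_integral_lborel_affine[of "\<lambda>x. ennreal (norm (f x))" e y] e0 by (simp add: L1le_def)
  have D: "distr lborel borel (\<lambda>x. y + e *\<^sub>R x) = lborel"
    using lborel_affine[OF e0(1), of y] e0(2) by (simp add: density_1)
  show "integrable lborel (\<lambda>x. f (y + e *\<^sub>R x)) \<longleftrightarrow> integrable lborel f"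
    by (subst (2) D[symmetric], subst integrable_distr_eq) auto
  show "(\<integral>x. f (y + e *\<^sub>R x) \<partial>lborel) = (\<integral>x. f x \<partial>lborel)"
    by (subst (2) D[symmetric], subst integral_distr) auto
qed

lemma L2le_dominated_convergence:
  fixes f :: "nat \<Rightarrow> 'a \<Rightarrow> 'b::{banach,second_countable_topology}" and h :: "'a \<Rightarrow> 'c::{banach,second_countable_topology}"
  assumes [measurable]: "\<And>k. f k \<in> borel_measurable M" and h: "L2le M h A"
    and dom: "\<And>k. AE x in M. norm (f k x) \<le> norm (h x)"
    and lim: "AE x in M. (\<lambda>k. f k x) \<longlonglongrightarrow> 0" and e: "\<epsilon> > 0"
  shows "eventually (\<lambda>k. L2le M (f k) \<epsilon>) sequentially"
proof -
  have [measurable]: "h \<in> borel_measurable M" using h by (simp add: L2le_def)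
  have "(\<lambda>k. \<integral>\<^sup>+x. ennreal ((norm (f k x))\<^sup>2) \<partial>M) \<longlonglongrightarrow> (\<integral>\<^sup>+x. 0 \<partial>M)"
  proof (rule nn_integral_dominated_convergence[where w="\<lambda>x. ennreal ((norm (h x))\<^sup>2)"])
    fix k
    show "AE x in M. ennreal ((norm (f k x))\<^sup>2) \<le> ennreal ((norm (h x))\<^sup>2)"
      using dom[of k] by eventually_elim (auto intro!: ennreal_leI power_mono)
  next
    show "(\<integral>\<^sup>+x. ennreal ((norm (h x))\<^sup>2) \<partial>M) < \<infinity>"
      using h by (auto simp: L2le_def intro: le_less_trans[OF _ ennreal_less_top])
    show "AE x in M. (\<lambda>k. ennreal ((norm (f k x))\<^sup>2)) \<longlonglongrightarrow> 0"
      using lim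
    proof eventually_elim
      fix x assume "(\<lambda>k. f k x) \<longlonglongrightarrow> 0"
      then have "(\<lambda>k. (norm (f k x))\<^sup>2) \<longlonglongrightarrow> (norm (0::'b))\<^sup>2" by (intro tendsto_intros)
      then show "(\<lambda>k. ennreal ((norm (f k x))\<^sup>2)) \<longlonglongrightarrow> 0"
        using tendsto_ennrealI[of "\<lambda>k. (norm (f k x))\<^sup>2" 0] by simp
    qed
  qed measurable
  then have "(\<lambda>k. \<integral>\<^sup>+x. ennreal ((norm (f k x))\<^sup>2) \<partial>M) \<longlonglongrightarrow> 0" by simp
  then have "eventually (\<lambda>k. (\<integral>\<^sup>+x. ennreal ((norm (f k x))\<^sup>2) \<partial>M) < ennreal (\<epsilon>\<^sup>2)) sequentially"
    using e by (intro order_tendstoD) auto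
  then show ?thesis by eventually_elim (use e in \<open>auto simp: L2le_def\<close>)
qed

subsection \<open>Test functions\<close>

text \<open>The flat function exp(-1/x), extended by 0, times a polynomial in 1/x. The polynomial is
  carried along because differentiation changes nothing else.\<close>

definition exp_inv :: "real poly \<Rightarrow> real \<Rightarrow> real" where
  "exp_inv P x = (if x > 0 then poly P (1 / x) * exp (- (1 / x)) else 0)"

lemma poly_times_exp_tendsto_0: "((\<lambda>y::real. poly P y * exp (- y)) \<longlongrightarrow> 0) at_top"
proof -
  have "((\<lambda>y. \<Sum>i\<le>degree P. coeff P i * (y ^ i / exp y)) \<longlongrightarrow> (\<Sum>i\<le>degree P. coeff P i * 0)) at_top"
    by (intro tendsto_intros tendsto_power_div_exp_0)
  moreover have "(\<lambda>y. \<Sum>i\<le>degree P. coeff P i * (y ^ i / exp y)) = (\<lambda>y. poly P y * exp (- y))"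
    unfolding poly_altdef sum_distrib_right by (intro ext sum.cong) (simp_all add: exp_minus divide_inverse)
  ultimately show ?thesis by simp
qed

text \<open>In the variable y = 1/x the derivative of P(y) exp(-y) with respect to x is y^2 (P -
  P')(y) exp(-y), which explains the new polynomial.\<close>

lemma exp_inv_has_derivative:
  "(exp_inv P has_real_derivative exp_inv (monom 1 2 * (P - pderiv P)) x) (at x)"
proof -
  consider "x > 0" | "x < 0" | "x = 0" by linarith
  then show ?thesis
  proof cases
    case 1
    have "((\<lambda>x. poly P (1 / x) * exp (- (1 / x))) has_real_derivative exp_inv (monom 1 2 * (P - pderiv P)) x) (at x)"
      using 1 by (auto intro!: derivative_eq_intros DERIV_chain2[OF poly_DERIV] simp: exp_inv_def poly_monom power2_eq_square field_simps)
    then show ?thesis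
      by (rule has_field_derivative_transform_within_open[where S="{0<..}"]) (use 1 in \<open>auto simp: exp_inv_def\<close>)
  next
    case 2
    have "((\<lambda>x. 0) has_real_derivative exp_inv (monom 1 2 * (P - pderiv P)) x) (at x)"
      using 2 by (simp add: exp_inv_def)
    then show ?thesis
      by (rule has_field_derivative_transform_within_open[where S="{..<0}"]) (use 2 in \<open>auto simp: exp_inv_def\<close>)
  next
    case 3
    \<comment> \<open>At 0 the quotient vanishes from the left, and from the right it is z P(z)
      exp(-z) with z the inverse of y tending to infinity.\<close>
    have "((\<lambda>y. exp_inv P y / y) \<longlongrightarrow> 0) (at 0)"
    proof (subst filterlim_at_split, safe)
      show "((\<lambda>y. exp_inv P y / y) \<longlongrightarrow> 0) (at_left 0)"
        by (rule Lim_transform_eventually[OF tendsto_const])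
           (auto simp: exp_inv_def eventually_at_filter)
      have "((\<lambda>y. poly (monom 1 1 * P) (inverse y) * exp (- inverse y)) \<longlongrightarrow> 0) (at_right 0)"
        by (rule filterlim_compose[OF poly_times_exp_tendsto_0 filterlim_inverse_at_top_right])
      moreover have "eventually (\<lambda>y. poly (monom 1 1 * P) (inverse y) * exp (- inverse y) = exp_inv P y / y) (at_right 0)"
        by (auto simp: exp_inv_def eventually_at_filter poly_monom field_simps)
      ultimately show "((\<lambda>y. exp_inv P y / y) \<longlongrightarrow> 0) (at_right 0)" by (rule Lim_transform_eventually)
    qed
    then show ?thesis using 3 by (simp add: has_field_derivative_iff exp_inv_def)
  qed
qed

text \<open>A class of one-dimensional functions closed under differentiation and rich enough to
  contain smooth cut-offs of every interval.\<close>

inductive cutoff1 :: "(real \<Rightarrow> real) \<Rightarrow> bool" where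
  base: "cutoff1 (\<lambda>x. exp_inv P (a * x + b))"
| add: "cutoff1 f \<Longrightarrow> cutoff1 g \<Longrightarrow> cutoff1 (\<lambda>x. f x + g x)"
| mult: "cutoff1 f \<Longrightarrow> cutoff1 g \<Longrightarrow> cutoff1 (\<lambda>x. f x * g x)"

lemma cutoff1_derivative:
  "cutoff1 f \<Longrightarrow> \<exists>f'. cutoff1 f' \<and> (\<forall>x. (f has_real_derivative f' x) (at x))"
proof (induction rule: cutoff1.induct)
  case (base P a b)
  let ?Q = "smult a (monom 1 2 * (P - pderiv P))"
  have "((\<lambda>x. exp_inv P (a * x + b)) has_real_derivative exp_inv ?Q (a * x + b)) (at x)" for x
  proof -
    have "((\<lambda>x. exp_inv P (a * x + b)) has_real_derivative exp_inv (monom 1 2 * (P - pderiv P)) (a * x + b) * a) (at x)"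
      by (rule DERIV_chain2[OF exp_inv_has_derivative]) (auto intro!: derivative_eq_intros)
    moreover have "exp_inv (monom 1 2 * (P - pderiv P)) (a * x + b) * a = exp_inv ?Q (a * x + b)"
      by (simp add: exp_inv_def)
    ultimately show ?thesis by (simp only:)
  qed
  then show ?case using cutoff1.base[of ?Q a b] by blast
next
  case (add f g)
  then obtain f' g' where "cutoff1 f'" "cutoff1 g'" "\<forall>x. (f has_real_derivative f' x) (at x)" "\<forall>x. (g has_real_derivative g' x) (at x)"
    by blast
  then show ?case by (intro exI[of _ "\<lambda>x. f' x + g' x"]) (auto intro!: cutoff1.add derivative_intros)
next
  case (mult f g)
  then obtain f' g' where *: "cutoff1 f'" "cutoff1 g'" "\<forall>x. (f has_real_derivative f' x) (at x)" "\<forall>x. (g has_real_derivative g' x) (at x)"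
    by blast
  have "cutoff1 (\<lambda>x. f' x * g x + g' x * f x)" using * mult.hyps by (intro cutoff1.add cutoff1.mult) auto
  then show ?case using * by (intro exI[of _ "\<lambda>x. f' x * g x + g' x * f x"]) (auto intro!: DERIV_mult)
qed

text \<open>A partial derivative of such a product changes a single factor. Smoothness in the sense
  of iterated \<open>pd\<close>, which quantifies over all lists of directions, is thereby reduced
  to the one-dimensional class.\<close>

definition tensor :: "('n::finite \<Rightarrow> real \<Rightarrow> real) \<Rightarrow> real^'n \<Rightarrow> real" where
  "tensor f x = (\<Prod>i\<in>UNIV. f i (x $ i))"

lemma tensor_derivative:
  fixes f :: "'n::finite \<Rightarrow> real \<Rightarrow> real"
  assumes "(f i has_real_derivative f' (x $ i)) (at (x $ i))"
  shows "((\<lambda>t. tensor f (x + t *\<^sub>R axis i 1)) has_real_derivative tensor (f(i := f')) x) (at 0)"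
proof -
  have eq: "tensor f (x + t *\<^sub>R axis i 1) = f i (x $ i + t) * (\<Prod>j\<in>UNIV - {i}. f j (x $ j))" for t
    unfolding tensor_def by (subst prod.remove[of _ i]) (auto simp: axis_def intro!: prod.cong)
  have "((\<lambda>t. f i (x $ i + t)) has_real_derivative f' (x $ i)) (at 0)"
    using assms DERIV_shift[of "f i" "f' (x $ i)" 0 "x $ i"] by (simp add: add.commute)
  then have "((\<lambda>t. f i (x $ i + t) * (\<Prod>j\<in>UNIV - {i}. f j (x $ j))) has_real_derivative f' (x $ i) * (\<Prod>j\<in>UNIV - {i}. f j (x $ j))) (at 0)"
    by (rule DERIV_cmult_right)
  moreover have "tensor (f(i := f')) x = f' (x $ i) * (\<Prod>j\<in>UNIV - {i}. f j (x $ j))"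
    unfolding tensor_def by (subst prod.remove[of _ i]) (auto intro!: prod.cong)
  ultimately show ?thesis unfolding eq by simp
qed

lemma iter_pd_tensor:
  fixes f :: "'n::finite \<Rightarrow> real \<Rightarrow> real"
  assumes "\<And>i. cutoff1 (f i)"
  shows "\<exists>g. (\<forall>i. cutoff1 (g i)) \<and> iter_pd is (tensor f) = tensor g"
proof (induction "is")
  case Nil
  then show ?case using assms by auto
next
  case (Cons i js)
  then obtain g where g: "\<forall>i. cutoff1 (g i)" "iter_pd js (tensor f) = tensor g" by blast
  obtain g' where g': "cutoff1 g'" "\<forall>x. (g i has_real_derivative g' x) (at x)" using cutoff1_derivative g(1) by blast
  have "pd i (tensor g) = tensor (g(i := g'))"
    using tensor_derivative[of g i g'] g'(2) by (auto simp: fun_eq_iff pd_def intro!: DERIV_imp_deriv)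
  then have "iter_pd (i # js) (tensor f) = tensor (g(i := g'))" by (simp only: iter_pd.simps g(2))
  moreover have "\<forall>j. cutoff1 ((g(i := g')) j)" using g g' by simp
  ultimately show ?case by blast
qed

lemma smooth_fun_tensor:
  fixes f :: "'n::finite \<Rightarrow> real \<Rightarrow> real"
  assumes "\<And>i. cutoff1 (f i)"
  shows "smooth_fun (tensor f)"
  unfolding smooth_fun_def
proof (intro allI conjI)
  fix js :: "'n list"
  obtain g where g: "\<forall>i. cutoff1 (g i)" "iter_pd js (tensor f) = tensor g" using iter_pd_tensor[of f js, OF assms] by blast
  have c: "continuous_on UNIV (g i)" for i
  proof -
    obtain g' where "\<forall>x. (g i has_real_derivative g' x) (at x)" using cutoff1_derivative g(1) by blast
    then show ?thesis by (intro continuous_at_imp_continuous_on ballI) (blast intro: DERIV_isCont)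
  qed
  show "continuous_on UNIV (iter_pd js (tensor f))"
    unfolding g(2) tensor_def
    by (intro continuous_on_prod continuous_on_compose2[OF c] continuous_intros) auto
  fix i x
  obtain g' where g': "\<forall>x. (g i has_real_derivative g' x) (at x)" using cutoff1_derivative g(1) by blast
  show "(\<lambda>t. iter_pd js (tensor f) (x + t *\<^sub>R axis i 1)) differentiable (at 0)"
    unfolding g(2) using tensor_derivative[of g i g' x] g' real_differentiable_def by blast
qed

text \<open>A product of two flat functions, one for each endpoint, with steepness \<open>k\<close>.
  As k grows it tends to the indicator of the open interval while staying between 0 and 1, because
  exp(-1/(k c)) tends to 1 for every c > 0.\<close>

definition cutoff :: "real \<Rightarrow> real \<Rightarrow> real \<Rightarrow> real \<Rightarrow> real" where
  "cutoff k a b x = exp_inv 1 (k * x + (- k * a)) * exp_inv 1 ((- k) * x + k * b)"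

lemma cutoff1_cutoff: "cutoff1 (cutoff k a b)"
  unfolding cutoff_def[abs_def] by (intro cutoff1.intros)

lemma exp_inv_1_bounds: "0 \<le> exp_inv 1 x" "exp_inv 1 x \<le> 1"
  by (auto simp: exp_inv_def)

lemma cutoff_bounds: "0 \<le> cutoff k a b x" "cutoff k a b x \<le> 1"
  using exp_inv_1_bounds by (auto simp: cutoff_def intro!: mult_le_one)

lemma cutoff_support: "k > 0 \<Longrightarrow> x \<notin> {a<..<b} \<Longrightarrow> cutoff k a b x = 0"
proof -
  assume k: "k > 0" and x: "x \<notin> {a<..<b}"
  consider "x \<le> a" | "b \<le> x" using x by force
  then show ?thesis
  proof cases
    case 1
    then have "k * x + (- k * a) \<le> 0" using k by (simp add: mult_left_mono)
    then show ?thesis by (simp add: cutoff_def exp_inv_def)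
  next
    case 2
    then have "(- k) * x + k * b \<le> 0" using k by (simp add: mult_left_mono)
    then show ?thesis by (simp add: cutoff_def exp_inv_def)
  qed
qed

lemma exp_inv_scaled_tendsto:
  assumes c: "c > 0" shows "(\<lambda>k. exp_inv 1 (real (Suc k) * c)) \<longlonglongrightarrow> 1"
proof -
  have "(\<lambda>k. exp (- (inverse (real (Suc k)) / c))) \<longlonglongrightarrow> exp (- (0 / c))"
    by (intro tendsto_intros LIMSEQ_inverse_real_of_nat) (use c in auto)
  moreover have "exp_inv 1 (real (Suc k) * c) = exp (- (inverse (real (Suc k)) / c))" for k
    using mult_pos_pos[OF _ c, of "real (Suc k)"] by (simp add: exp_inv_def divide_inverse)
  ultimately show ?thesis by simp
qed

lemma cutoff_tendsto: "(\<lambda>k. cutoff (real (Suc k)) a b x) \<longlonglongrightarrow> indicator {a<..<b} x"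
proof (cases "x \<in> {a<..<b}")
  case True
  have "(\<lambda>k. exp_inv 1 (real (Suc k) * (x - a)) * exp_inv 1 (real (Suc k) * (b - x))) \<longlonglongrightarrow> 1 * 1"
    using True by (intro tendsto_mult exp_inv_scaled_tendsto) auto
  then show ?thesis using True by (simp add: cutoff_def algebra_simps)
next
  case False
  then show ?thesis by (simp add: cutoff_support)
qed

definition box_cutoff :: "real \<Rightarrow> real^'n \<Rightarrow> real^'n \<Rightarrow> real^'n::finite \<Rightarrow> real" where
  "box_cutoff k a b = tensor (\<lambda>i. cutoff k (a $ i) (b $ i))"

lemma box_cutoff_bounds: "0 \<le> box_cutoff k a b x" "box_cutoff k a b x \<le> 1"
  using cutoff_bounds by (auto simp: box_cutoff_def tensor_def intro!: prod_nonneg prod_le_1)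

lemma box_cutoff_support: "k > 0 \<Longrightarrow> x \<notin> box a b \<Longrightarrow> box_cutoff k a b x = 0"
  using cutoff_support[of k] by (fastforce simp: box_cutoff_def tensor_def mem_box_cart)

lemma box_cutoff_tendsto: "(\<lambda>k. box_cutoff (real (Suc k)) a b x) \<longlonglongrightarrow> indicator (box a b) x"
proof -
  have "(\<lambda>k. box_cutoff (real (Suc k)) a b x) \<longlonglongrightarrow> (\<Prod>i\<in>UNIV. indicator {a $ i<..<b $ i} (x $ i))"
    unfolding box_cutoff_def tensor_def by (intro tendsto_prod cutoff_tendsto)
  also have "(\<Prod>i\<in>UNIV. indicator {a $ i<..<b $ i} (x $ i)) = (indicator (box a b) x :: real)"
    by (auto simp: indicator_def mem_box_cart prod_zero_iff)
  finally show ?thesis .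
qed

lemma test_fun_box_cutoff: "k > 0 \<Longrightarrow> test_fun (box_cutoff k a b)"
proof -
  assume k: "k > 0"
  obtain R where R: "box a b \<subseteq> cball 0 R" using bounded_box[of a b] by (auto simp: bounded_iff subset_iff)
  have "box_cutoff k a b x = 0" if "norm x > R" for x
    using box_cutoff_support[OF k, of x a b] R that by force
  then show ?thesis
    unfolding test_fun_def using smooth_fun_tensor[of "\<lambda>i. cutoff k (a $ i) (b $ i)"] cutoff1_cutoff
    by (auto simp: box_cutoff_def)
qed

section \<open>Differential calculus of test functions\<close>

lemma iter_pd_append: "iter_pd (is @ js) f = iter_pd is (iter_pd js f)"
  by (induction "is") auto

lemma smooth_fun_iter_pd: "smooth_fun f \<Longrightarrow> smooth_fun (iter_pd is f)"
  unfolding smooth_fun_def by (simp add: iter_pd_append[symmetric])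

text \<open>The exterior of the ball is open, so \<open>f\<close> vanishes on a whole segment around
  the point in direction i. Supports therefore do not grow under differentiation.\<close>

lemma pd_zero_outside:
  assumes "\<And>x. norm x > R \<Longrightarrow> f x = 0" "norm x > R"
  shows "pd i f x = 0"
proof -
  have "((\<lambda>t. norm (x + t *\<^sub>R axis i (1::real))) \<longlongrightarrow> norm (x + 0 *\<^sub>R axis i 1)) (nhds (0::real))"
    by (intro tendsto_intros filterlim_ident)
  then have "eventually (\<lambda>t. norm (x + t *\<^sub>R axis i 1) > R) (nhds (0::real))"
    using assms(2) by (intro order_tendstoD(1)) auto
  then have "eventually (\<lambda>t. f (x + t *\<^sub>R axis i 1) = 0) (nhds (0::real))"
    by eventually_elim (rule assms(1))
  then have "deriv (\<lambda>t. f (x + t *\<^sub>R axis i 1)) 0 = deriv (\<lambda>t. 0) 0"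
    by (intro deriv_cong_ev) auto
  then show ?thesis by (simp add: pd_def)
qed

lemma test_fun_iter_pd:
  assumes "test_fun f" shows "test_fun (iter_pd is f)"
proof -
  obtain R where R: "\<And>x. norm x > R \<Longrightarrow> f x = 0" using assms by (auto simp: test_fun_def)
  have "norm x > R \<Longrightarrow> iter_pd is f x = 0" for x
    by (induction "is" arbitrary: x) (auto intro: R pd_zero_outside)
  then show ?thesis using assms smooth_fun_iter_pd unfolding test_fun_def by blast
qed

lemma test_fun_pd: "test_fun f \<Longrightarrow> test_fun (pd i f)"
  using test_fun_iter_pd[of f "[i]"] by simp

lemma smooth_fun_continuous: "smooth_fun f \<Longrightarrow> continuous_on UNIV f"
  unfolding smooth_fun_def by (metis iter_pd.simps(1))

lemma smooth_fun_has_pd: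
  assumes "smooth_fun f"
  shows "((\<lambda>t. f (x + t *\<^sub>R axis i 1)) has_real_derivative pd i f x) (at 0)"
proof -
  have "(\<lambda>t. f (x + t *\<^sub>R axis i 1)) differentiable (at 0)"
    using assms unfolding smooth_fun_def by (metis iter_pd.simps(1))
  then show ?thesis unfolding pd_def real_differentiable_def using DERIV_imp_deriv by fastforce
qed

lemma test_fun_has_pd:
  assumes "test_fun f"
  shows "((\<lambda>t. f (x + t *\<^sub>R axis i 1)) has_real_derivative pd i f (x + t *\<^sub>R axis i 1)) (at t)"
proof -
  have "((\<lambda>s. f ((x + t *\<^sub>R axis i 1) + s *\<^sub>R axis i 1)) has_real_derivative pd i f (x + t *\<^sub>R axis i 1)) (at 0)"
    using assms by (intro smooth_fun_has_pd) (simp add: test_fun_def)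
  then have "((\<lambda>s. f (x + (s + t) *\<^sub>R axis i 1)) has_real_derivative pd i f (x + t *\<^sub>R axis i 1)) (at 0)"
    by (simp add: scaleR_add_left add_ac)
  then show ?thesis using DERIV_shift[of "\<lambda>s. f (x + s *\<^sub>R axis i 1)" _ 0 t] by simp
qed

text \<open>\<open>pd\<close> is built on \<open>deriv\<close>, which is linear only where
  derivatives exist; smoothness of both functions supplies existence at every order.\<close>

lemma iter_pd_lincomb:
  assumes f: "smooth_fun f" and g: "smooth_fun g"
  shows "iter_pd is (\<lambda>x. a * f x + b * g x) = (\<lambda>x. a * iter_pd is f x + b * iter_pd is g x)"
proof (induction "is")
  case (Cons i js)
  have "((\<lambda>t. a * iter_pd js f (x + t *\<^sub>R axis i 1) + b * iter_pd js g (x + t *\<^sub>R axis i 1)) has_real_derivative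
      a * pd i (iter_pd js f) x + b * pd i (iter_pd js g) x) (at 0)" for x
    using smooth_fun_has_pd[OF smooth_fun_iter_pd[OF f]] smooth_fun_has_pd[OF smooth_fun_iter_pd[OF g]]
    by (intro DERIV_add DERIV_cmult)
  then have "pd i (\<lambda>x. a * iter_pd js f x + b * iter_pd js g x) x = a * pd i (iter_pd js f) x + b * pd i (iter_pd js g) x" for x
    unfolding pd_def[of i "\<lambda>x. a * iter_pd js f x + b * iter_pd js g x"] by (rule DERIV_imp_deriv)
  then show ?case by (simp add: Cons fun_eq_iff)
qed simp

lemma test_fun_lincomb:
  assumes "test_fun f" "test_fun g" shows "test_fun (\<lambda>x. a * f x + b * g x)"
proof -
  have s: "smooth_fun f" "smooth_fun g" using assms by (auto simp: test_fun_def)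
  obtain R1 R2 where R: "\<And>x. norm x > R1 \<Longrightarrow> f x = 0" "\<And>x. norm x > R2 \<Longrightarrow> g x = 0"
    using assms by (auto simp: test_fun_def)
  have "smooth_fun (\<lambda>x. a * f x + b * g x)"
    unfolding smooth_fun_def iter_pd_lincomb[OF s]
  proof (intro allI conjI)
    fix js :: "'a list" and i :: 'a and x
    show "continuous_on UNIV (\<lambda>x. a * iter_pd js f x + b * iter_pd js g x)"
      using s by (intro continuous_intros) (auto simp: smooth_fun_def)
    have "((\<lambda>t. a * iter_pd js f (x + t *\<^sub>R axis i 1) + b * iter_pd js g (x + t *\<^sub>R axis i 1)) has_real_derivative
      a * pd i (iter_pd js f) x + b * pd i (iter_pd js g) x) (at 0)"
      using smooth_fun_has_pd[OF smooth_fun_iter_pd[OF s(1)]] smooth_fun_has_pd[OF smooth_fun_iter_pd[OF s(2)]]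
      by (intro DERIV_add DERIV_cmult)
    then show "(\<lambda>t. a * iter_pd js f (x + t *\<^sub>R axis i 1) + b * iter_pd js g (x + t *\<^sub>R axis i 1)) differentiable (at 0)"
      using real_differentiable_def by blast
  qed
  moreover have "norm x > max R1 R2 \<Longrightarrow> a * f x + b * g x = 0" for x using R by simp
  ultimately show ?thesis unfolding test_fun_def by blast
qed

lemma test_fun_zero: "test_fun (\<lambda>x. 0)"
  using test_fun_lincomb[OF test_fun_box_cutoff[of 1 0 0] test_fun_box_cutoff[of 1 0 0], of 0 0] by simp

lemma test_fun_measurable[measurable_dest]: "test_fun f \<Longrightarrow> f \<in> borel_measurable borel"
  using smooth_fun_continuous[of f] by (simp add: test_fun_def borel_measurable_continuous_onI)

lemma test_fun_bound:
  assumes "test_fun f" shows "\<exists>B R. B \<ge> 0 \<and> (\<forall>x. norm (f x) \<le> B * indicator (cball 0 R) x)"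
proof -
  obtain R where R: "\<And>x. norm x > R \<Longrightarrow> f x = 0" using assms by (auto simp: test_fun_def)
  have "continuous_on (cball 0 R) f"
    using assms continuous_on_subset[OF smooth_fun_continuous] unfolding test_fun_def by blast
  then have "bounded (f ` cball 0 R)" by (intro compact_imp_bounded compact_continuous_image) auto
  then obtain B where B: "B > 0" "\<And>x. x \<in> cball 0 R \<Longrightarrow> norm (f x) \<le> B" by (auto simp: bounded_pos)
  have "norm (f x) \<le> B * indicator (cball 0 R) x" for x
    using B R[of x] by (cases "x \<in> cball 0 R") auto
  then show ?thesis using B(1) by (intro exI[of _ B] exI[of _ R]) auto
qed

lemma L2le_indicator:
  fixes A :: "'a::euclidean_space set"
  assumes "A \<in> sets lborel" "emeasure lborel A < \<infinity>"
  shows "\<exists>c. L2le lborel (indicator A :: 'a \<Rightarrow> real) c"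
proof -
  have "(\<integral>\<^sup>+x. ennreal ((norm (indicator A x :: real))\<^sup>2) \<partial>lborel) = (\<integral>\<^sup>+x. indicator A x \<partial>lborel)"
    by (intro nn_integral_cong) (auto simp: indicator_def)
  also have "\<dots> = ennreal (measure lborel A)" using assms by (simp add: emeasure_eq_ennreal_measure)
  finally show ?thesis using assms by (intro exI[of _ "sqrt (measure lborel A)"]) (auto simp: L2le_def)
qed

lemma test_fun_L2: assumes "test_fun f" shows "\<exists>c. L2le lborel f c"
proof -
  obtain B R where B: "B \<ge> 0" "\<And>x. norm (f x) \<le> B * indicator (cball 0 R) x" using test_fun_bound[OF assms] by auto
  obtain c where c: "L2le lborel (indicator (cball 0 R) :: real^'a \<Rightarrow> real) c"
    using L2le_indicator[OF _ emeasure_bounded_finite[OF bounded_cball]] by auto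
  have "L2le lborel f (B * c)" using B test_fun_measurable[OF assms] by (intro L2le_dom[OF c]) auto
  then show ?thesis ..
qed

lemma test_fun_integrable: assumes "test_fun f" shows "integrable lborel f"
proof -
  obtain B R where B: "B \<ge> 0" "\<And>x. norm (f x) \<le> B * indicator (cball 0 R) x" using test_fun_bound[OF assms] by auto
  have "integrable lborel (\<lambda>x::real^'a. B * indicator (cball 0 R) x)"
    by (intro integrable_mult_right integrable_real_indicator emeasure_bounded_finite[OF bounded_cball]) auto
  then show ?thesis
  proof (rule Bochner_Integration.integrable_bound)
    show "AE x in lborel. norm (f x) \<le> norm (B * indicator (cball 0 R) x)"
      using B(2) by (intro AE_I2) (metis abs_ge_self order_trans real_norm_def)
  qed (use test_fun_measurable[OF assms] in simp)
qed

subsection \<open>Density of test functions in \<open>L\<^sup>2\<close>\<close>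

text \<open>Density is stated as a property of the target function, so that the class of
  approximable functions can be shown closed under linear combinations and dominated limits.\<close>

definition test_approx :: "(real^'n::finite \<Rightarrow> real) \<Rightarrow> bool" where
  "test_approx f \<longleftrightarrow> (\<forall>\<epsilon>>0. \<exists>\<theta>. test_fun \<theta> \<and> L2le lborel (\<lambda>x. f x - \<theta> x) \<epsilon>)"

lemma test_approx_closed:
  assumes "\<And>\<epsilon>. \<epsilon> > 0 \<Longrightarrow> \<exists>g. test_approx g \<and> L2le lborel (\<lambda>x. f x - g x) \<epsilon>"
  shows "test_approx f"
  unfolding test_approx_def
proof (intro allI impI)
  fix \<epsilon> :: real assume e: "\<epsilon> > 0"
  obtain g where g: "test_approx g" "L2le lborel (\<lambda>x. f x - g x) (\<epsilon>/2)" using assms[of "\<epsilon>/2"] e by auto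
  obtain \<theta> where t: "test_fun \<theta>" "L2le lborel (\<lambda>x. g x - \<theta> x) (\<epsilon>/2)" using g(1) e half_gt_zero unfolding test_approx_def by blast
  have "L2le lborel (\<lambda>x. f x - \<theta> x) \<epsilon>" using L2le_add[OF g(2) t(2)] by simp
  then show "\<exists>\<theta>. test_fun \<theta> \<and> L2le lborel (\<lambda>x. f x - \<theta> x) \<epsilon>" using t(1) by blast
qed

lemma test_approx_lincomb:
  assumes f: "test_approx f" and g: "test_approx g"
  shows "test_approx (\<lambda>x. a * f x + b * g x)"
  unfolding test_approx_def
proof (intro allI impI)
  fix \<epsilon> :: real assume e: "\<epsilon> > 0"
  define d where "d = \<epsilon> / (\<bar>a\<bar> + \<bar>b\<bar> + 1)"
  have d: "d > 0" using e by (simp add: d_def add_nonneg_pos)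
  obtain u where u: "test_fun u" "L2le lborel (\<lambda>x. f x - u x) d" using f d unfolding test_approx_def by blast
  obtain v where v: "test_fun v" "L2le lborel (\<lambda>x. g x - v x) d" using g d unfolding test_approx_def by blast
  have u': "L2le lborel (\<lambda>x. a * (f x - u x)) (\<bar>a\<bar> * d)"
    using L2le_measurable[OF u(2)] by (intro L2le_dom[OF u(2)] AE_I2) (auto simp: abs_mult)
  have v': "L2le lborel (\<lambda>x. b * (g x - v x)) (\<bar>b\<bar> * d)"
    using L2le_measurable[OF v(2)] by (intro L2le_dom[OF v(2)] AE_I2) (auto simp: abs_mult)
  have "L2le lborel (\<lambda>x. a * (f x - u x) + b * (g x - v x)) (\<bar>a\<bar> * d + \<bar>b\<bar> * d)" by (rule L2le_add[OF u' v'])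
  then have "L2le lborel (\<lambda>x. a * (f x - u x) + b * (g x - v x)) \<epsilon>"
  proof (rule L2le_mono)
    have "\<bar>a\<bar> * d + \<bar>b\<bar> * d \<le> (\<bar>a\<bar> + \<bar>b\<bar> + 1) * d" using d by (simp add: algebra_simps)
    also have "\<dots> = \<epsilon>" by (simp add: d_def add_nonneg_pos less_imp_neq[symmetric])
    finally show "\<bar>a\<bar> * d + \<bar>b\<bar> * d \<le> \<epsilon>" .
  qed
  then have "L2le lborel (\<lambda>x. (a * f x + b * g x) - (a * u x + b * v x)) \<epsilon>" by (simp add: algebra_simps)
  then show "\<exists>\<theta>. test_fun \<theta> \<and> L2le lborel (\<lambda>x. (a * f x + b * g x) - \<theta> x) \<epsilon>"
    using test_fun_lincomb[OF u(1) v(1)] by blast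
qed

lemma test_approx_test_fun: "test_fun f \<Longrightarrow> test_approx f"
  unfolding test_approx_def by (intro allI impI exI[of _ f]) (simp add: L2le_zero)

lemma test_approx_zero: "test_approx (\<lambda>x. 0)"
  by (rule test_approx_test_fun[OF test_fun_zero])

lemma test_approx_sum: "finite I \<Longrightarrow> (\<And>i. i \<in> I \<Longrightarrow> test_approx (f i)) \<Longrightarrow> test_approx (\<lambda>x. \<Sum>i\<in>I. c i * f i x)"
proof (induction I rule: finite_induct)
  case (insert i I)
  then show ?case using test_approx_lincomb[of "f i" "\<lambda>x. \<Sum>i\<in>I. c i * f i x" "c i" 1] by simp
qed (simp add: test_approx_zero)

lemma test_approx_LIMSEQ:
  fixes f :: "nat \<Rightarrow> real^'n::finite \<Rightarrow> real"
  assumes f: "\<And>k. test_approx (f k)" and m: "\<And>k. f k \<in> borel_measurable lborel" "g \<in> borel_measurable lborel"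
    and h: "L2le lborel (h :: _ \<Rightarrow> real) A" "\<And>k x. norm (f k x - g x) \<le> norm (h x)" and lim: "\<And>x. (\<lambda>k. f k x) \<longlonglongrightarrow> g x"
  shows "test_approx g"
proof (rule test_approx_closed)
  fix \<epsilon> :: real assume e: "\<epsilon> > 0"
  have "eventually (\<lambda>k. L2le lborel (\<lambda>x. f k x - g x) \<epsilon>) sequentially"
    using m h lim e by (intro L2le_dominated_convergence[where h=h and A=A]) (auto simp: LIM_zero)
  then obtain k where "L2le lborel (\<lambda>x. f k x - g x) \<epsilon>" by (auto simp: eventually_sequentially)
  then show "\<exists>h. test_approx h \<and> L2le lborel (\<lambda>x. g x - h x) \<epsilon>" using f L2le_diff_commute by blast
qed

lemma test_approx_box: "test_approx (indicator (box a b) :: real^'n::finite \<Rightarrow> real)"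
proof -
  obtain c where c: "L2le lborel (indicator (box a b) :: real^'n \<Rightarrow> real) c"
    using L2le_indicator[OF _ emeasure_bounded_finite[OF bounded_box], of a b] by auto
  show ?thesis
  proof (rule test_approx_LIMSEQ[where f="\<lambda>k. box_cutoff (real (Suc k)) a b" and h="indicator (box a b)" and A=c])
    show "box_cutoff (real (Suc k)) a b \<in> borel_measurable lborel" for k
      using test_fun_measurable[OF test_fun_box_cutoff[of "real (Suc k)" a b]] by simp
    show "norm (box_cutoff (real (Suc k)) a b x - indicator (box a b) x) \<le> norm (indicator (box a b) x :: real)" for k x
      using box_cutoff_bounds[of "real (Suc k)" a b x] box_cutoff_support[of "real (Suc k)" x a b] by (auto simp: indicator_def)
  qed (simp_all only: test_approx_test_fun test_fun_box_cutoff box_cutoff_tendsto c, simp_all add: test_approx_test_fun test_fun_box_cutoff)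
qed

text \<open>Dynkin's argument with the boxes as generating family stable under intersection.
  Everything is intersected with one fixed box: its indicator is then a common L2 majorant, and
  complements stay within finite measure.\<close>

lemma test_approx_indicator:
  assumes "A \<in> sets borel"
  shows "test_approx (indicator (A \<inter> box a b) :: real^'n::finite \<Rightarrow> real)"
proof -
  let ?E = "range (\<lambda>(a, b). box a b :: (real^'n) set)"
  obtain c where c: "L2le lborel (indicator (box a b) :: real^'n \<Rightarrow> real) c"
    using L2le_indicator[OF _ emeasure_bounded_finite[OF bounded_box], of a b] by auto
  have "Int_stable ?E" by (auto simp: Int_stable_def box_Int_box)
  moreover have "?E \<subseteq> Pow UNIV" by auto
  moreover have "A \<in> sigma_sets UNIV ?E" using assms by (simp add: borel_eq_box)
  ultimately show ?thesis
  proof (induction rule: sigma_sets_induct_disjoint)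
    case (basic A)
    then show ?case by (auto simp: box_Int_box intro!: test_approx_box)
  next
    case empty
    then show ?case using test_approx_zero by (simp add: indicator_def[abs_def])
  next
    case (compl A)
    have "(indicator ((UNIV - A) \<inter> box a b) :: real^'n \<Rightarrow> real) = (\<lambda>x. 1 * indicator (box a b) x + (-1) * indicator (A \<inter> box a b) x)"
      by (auto simp: fun_eq_iff indicator_def)
    then show ?case using test_approx_lincomb[where a=1 and b="-1", OF test_approx_box compl.IH] by simp
  next
    case (union A)
    have A: "A k \<in> sets borel" for k using union.hyps(2) by (auto simp: borel_eq_box)
    show ?case
    proof (rule test_approx_LIMSEQ[where f="\<lambda>k x. \<Sum>i<k. 1 * indicator (A i \<inter> box a b) x" and h="indicator (box a b)" and A=c])
      show "test_approx (\<lambda>x. \<Sum>i<k. 1 * (indicator (A i \<inter> box a b) x::real))" for k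
        by (intro test_approx_sum) (auto intro: union)
      have *: "(\<Sum>i<k. 1 * (indicator (A i \<inter> box a b) x::real)) = indicator ((\<Union>i<k. A i) \<inter> box a b) x" for k x
      proof -
        have "(\<Sum>i<k. 1 * (indicator (A i \<inter> box a b) x::real)) = (\<Sum>i<k. indicator (A i \<inter> box a b) x)" by simp
        also have "\<dots> = indicator (\<Union>i<k. A i \<inter> box a b) x"
          using union.hyps(1) by (intro indicator_UN_disjoint[symmetric]) (auto simp: disjoint_family_on_def)
        finally show ?thesis by (simp add: Int_UN_distrib2)
      qed
      show "norm ((\<Sum>i<k. (1::real) * indicator (A i \<inter> box a b) x) - indicator (\<Union> (range A) \<inter> box a b) x) \<le> norm (indicator (box a b) x :: real)" for k x
        unfolding * by (auto simp: indicator_def)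
      show "(\<lambda>k. \<Sum>i<k. 1 * (indicator (A i \<inter> box a b) x::real)) \<longlonglongrightarrow> indicator (\<Union> (range A) \<inter> box a b) x" for x
      proof -
        have "(\<lambda>k. indicator (\<Union>i<k. A i \<inter> box a b) x :: real) \<longlonglongrightarrow> indicator (\<Union>i. A i \<inter> box a b) x"
          by (rule LIMSEQ_indicator_UN)
        then show ?thesis unfolding * by (simp add: Int_UN_distrib2)
      qed
    qed (use A c in auto)
  qed
qed

text \<open>Simple functions converging to \<open>f\<close>, each restricted to a cube that grows
  with the index, are approximable. Since |F k| is at most 2|f|, the error is dominated by 3|f|,
  which is in L2.\<close>

theorem test_fun_dense_L2:
  fixes f :: "real^'n::finite \<Rightarrow> real"
  assumes f: "L2le lborel f A" shows "test_approx f"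
proof -
  have [measurable]: "f \<in> borel_measurable lborel" using f by (simp add: L2le_def)
  obtain F where F: "\<And>i. simple_function lborel (F i)" "\<And>x. (\<lambda>i. F i x) \<longlonglongrightarrow> f x"
      "\<And>i x. norm (F i x) \<le> 2 * norm (f x)"
    using borel_measurable_implies_sequence_metric[of f lborel 0] by auto
  define B :: "nat \<Rightarrow> (real^'n) set" where "B k = box (vec (- real k)) (vec (real k))" for k
  show ?thesis
  proof (rule test_approx_LIMSEQ[where f="\<lambda>k x. \<Sum>y\<in>range (F k). y * indicator ((F k -` {y}) \<inter> B k) x" and h="\<lambda>x. 3 * f x" and A="3 * A"])
    have fin: "finite (range (F k))" for k using F(1)[of k] by (simp add: simple_function_def)
    have *: "(\<Sum>y\<in>range (F k). y * indicator ((F k -` {y}) \<inter> B k) x) = F k x * indicator (B k) x" for k x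
      using fin[of k] by (subst sum.remove[of _ "F k x"]) (auto simp: indicator_def intro!: sum.neutral)
    have meas: "F k -` {y} \<in> sets borel" for k y using simple_functionD(2)[OF F(1)[of k], of "{y}"] by simp
    show "test_approx (\<lambda>x. \<Sum>y\<in>range (F k). y * indicator ((F k -` {y}) \<inter> B k) x)" for k
      unfolding B_def by (intro test_approx_sum fin test_approx_indicator meas)
    show "(\<lambda>x. \<Sum>y\<in>range (F k). y * indicator ((F k -` {y}) \<inter> B k) x) \<in> borel_measurable lborel" for k
      using meas by (auto simp: B_def)
    show "L2le lborel (\<lambda>x. 3 * f x) (3 * A)" by (intro L2le_dom[OF f]) (auto simp: abs_mult)
    show "norm ((\<Sum>y\<in>range (F k). y * indicator ((F k -` {y}) \<inter> B k) x) - f x) \<le> norm (3 * f x)" for k x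
      unfolding * using F(3)[of k x] by (auto simp: indicator_def)
    show "(\<lambda>k. \<Sum>y\<in>range (F k). y * indicator ((F k -` {y}) \<inter> B k) x) \<longlonglongrightarrow> f x" for x
    proof -
      obtain N :: nat where N: "norm x < real N" using reals_Archimedean2 by blast
      have "x \<in> B k" if "k \<ge> N" for k
      proof -
        have "\<bar>x $ i\<bar> < real k" for i using component_le_norm_cart[of x i] N that by simp
        then show ?thesis by (auto simp: B_def mem_box_cart abs_less_iff minus_less_iff)
      qed
      then have "eventually (\<lambda>k. F k x = F k x * indicator (B k) x) sequentially"
        by (intro eventually_sequentiallyI[of N]) simp
      then show ?thesis unfolding * using F(2) by (rule Lim_transform_eventually[rotated])
    qed
  qed simp
qed

text \<open>By hypothesis the integral of g^2 equals that of g (g - \<theta>) for every test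
  function, and density makes the latter at most A times any \<epsilon>.\<close>

lemma fundamental_lemma_lborel:
  fixes g :: "real^'n::finite \<Rightarrow> real"
  assumes g: "L2le lborel g A" and z: "\<And>\<theta>. test_fun \<theta> \<Longrightarrow> (\<integral>x. g x * \<theta> x \<partial>lborel) = 0"
  shows "AE x in lborel. g x = 0"
proof -
  have nn: "0 \<le> A" using L2le_nonneg[OF g] .
  have le: "(\<integral>x. g x * g x \<partial>lborel) \<le> A * \<epsilon>" if e: "\<epsilon> > 0" for \<epsilon>
  proof -
    obtain \<theta> where t: "test_fun \<theta>" "L2le lborel (\<lambda>x. g x - \<theta> x) \<epsilon>"
      using test_fun_dense_L2[OF g] e unfolding test_approx_def by blast
    obtain c where c: "L2le lborel \<theta> c" using test_fun_L2[OF t(1)] by blast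
    have "(\<integral>x. g x * g x \<partial>lborel) = (\<integral>x. g x * (g x - \<theta> x) + g x * \<theta> x \<partial>lborel)" by (simp add: algebra_simps)
    also have "\<dots> = (\<integral>x. g x * (g x - \<theta> x) \<partial>lborel) + (\<integral>x. g x * \<theta> x \<partial>lborel)"
      by (intro Bochner_Integration.integral_add L1le_integrable[OF L2le_mult[OF g t(2)]] L1le_integrable[OF L2le_mult[OF g c]])
    also have "\<dots> \<le> A * \<epsilon>" using L1le_integral[OF L2le_mult[OF g t(2)]] z[OF t(1)] by simp
    finally show ?thesis .
  qed
  have "(\<integral>x. g x * g x \<partial>lborel) \<le> 0"
  proof (rule field_le_epsilon)
    fix e :: real assume "e > 0"
    \<comment> \<open>Dividing by A + 1 rather than by A covers the case A = 0.\<close>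
    moreover from this have "A * (e / (A + 1)) \<le> e" using nn by (simp add: field_simps)
    ultimately show "(\<integral>x. g x * g x \<partial>lborel) \<le> 0 + e"
      using le[of "e / (A + 1)"] nn by simp
  qed
  then have "L2le lborel g 0"
    using L2le_measurable[OF g] L2le_integrable[OF g] by (intro L2leI_integrable) (auto simp: power2_eq_square)
  then show ?thesis by (rule L2le_zero_AE)
qed

text \<open>Dominated convergence settles the case of a test function, whose translates by a bounded
  sequence share one ball as support. The general case follows with three errors of \<epsilon>/3,
  since translation preserves the L2 norm.\<close>

lemma L2_translation_continuous_real:
  fixes f :: "real^'n::finite \<Rightarrow> real"
  assumes f: "L2le lborel f A" and z: "z \<longlonglongrightarrow> 0" and e: "\<epsilon> > 0"
  shows "eventually (\<lambda>k. L2le lborel (\<lambda>x. f (z k + x) - f x) \<epsilon>) sequentially"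
proof -
  have fm: "f \<in> borel_measurable borel" using f by (simp add: L2le_def)
  obtain \<theta> where t: "test_fun \<theta>" "L2le lborel (\<lambda>x. f x - \<theta> x) (\<epsilon>/3)"
    using test_fun_dense_L2[OF f] e unfolding test_approx_def by (metis zero_less_divide_iff zero_less_numeral)
  note [measurable] = test_fun_measurable[OF t(1)] fm
  obtain B R where B: "B \<ge> 0" "\<And>x. norm (\<theta> x) \<le> B * indicator (cball 0 R) x" using test_fun_bound[OF t(1)] by auto
  obtain M where M: "\<And>k. norm (z k) \<le> M" using z convergent_imp_Bseq[of z] by (auto simp: convergent_def Bseq_def)
  obtain c where c: "L2le lborel (indicator (cball 0 (R + M)) :: real^'n \<Rightarrow> real) c"
    using L2le_indicator[OF _ emeasure_bounded_finite[OF bounded_cball]] by auto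
  have M0: "M \<ge> 0" using M[of 0] norm_ge_zero order_trans by blast
  have h: "L2le lborel (\<lambda>x::real^'n. 2 * B * indicator (cball 0 (R + M)) x) (2 * B * c)"
    by (rule L2le_dom[OF c]) (use B L2le_measurable[OF c] in auto)
  have "eventually (\<lambda>k. L2le lborel (\<lambda>x. \<theta> (z k + x) - \<theta> x) (\<epsilon>/3)) sequentially"
  proof (rule L2le_dominated_convergence[OF _ h])
    fix k
    have "norm (\<theta> (z k + x) - \<theta> x) \<le> norm (2 * B * indicator (cball 0 (R + M)) x)" for x
    proof (cases "x \<in> cball 0 (R + M)")
      case True
      have le: "norm (\<theta> y) \<le> B" for y using B(1) B(2)[of y] by (cases "y \<in> cball 0 R") auto
      have "norm (\<theta> (z k + x) - \<theta> x) \<le> B + B"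
        using norm_triangle_ineq4[of "\<theta> (z k + x)" "\<theta> x"] le[of "z k + x"] le[of x] by linarith
      then show ?thesis using True B by simp
    next
      case False
      then have "norm x > R + M" by simp
      moreover have "norm (z k + x) \<ge> norm x - norm (z k)" by (metis add.commute norm_diff_ineq)
      ultimately have "z k + x \<notin> cball 0 R" "x \<notin> cball 0 R" using M[of k] M0 by auto
      then have "\<theta> (z k + x) = 0" "\<theta> x = 0" using B(2)[of "z k + x"] B(2)[of x] by auto
      then show ?thesis by simp
    qed
    then show "AE x in lborel. norm (\<theta> (z k + x) - \<theta> x) \<le> norm (2 * B * indicator (cball 0 (R + M)) x)" by simp
  next
    have "(\<lambda>k. \<theta> (z k + x) - \<theta> x) \<longlonglongrightarrow> 0" for x
    proof -
      have "isCont \<theta> x" using t(1) smooth_fun_continuous continuous_on_eq_continuous_at[of UNIV \<theta>] by (auto simp: test_fun_def)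
      moreover have "(\<lambda>k. z k + x) \<longlonglongrightarrow> 0 + x" using z by (intro tendsto_intros)
      ultimately have "(\<lambda>k. \<theta> (z k + x)) \<longlonglongrightarrow> \<theta> x" using isCont_tendsto_compose[of x \<theta> "\<lambda>k. z k + x"] by simp
      then show ?thesis by (rule LIM_zero)
    qed
    then show "AE x in lborel. (\<lambda>k. \<theta> (z k + x) - \<theta> x) \<longlonglongrightarrow> 0" by simp
  qed (use e in auto)
  then show ?thesis
  proof eventually_elim
    fix k assume k: "L2le lborel (\<lambda>x. \<theta> (z k + x) - \<theta> x) (\<epsilon>/3)"
    have "L2le lborel (\<lambda>x. f (z k + x) - \<theta> (z k + x)) (\<epsilon>/3)"
      using lborel_shift_reflect(1)[of "\<lambda>x. f x - \<theta> x" 1 "z k"] t(2) by simp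
    from L2le_add[OF L2le_add[OF this k] L2le_diff_commute[OF t(2)]]
    show "L2le lborel (\<lambda>x. f (z k + x) - f x) \<epsilon>" by simp
  qed
qed

subsection \<open>The Fourier transform\<close>

text \<open>The transform of the statement, but for complex functions and over the Borel measure
  \<open>lborel\<close>, where products of measures and Fubini are available. No normalizing factor
  is included.\<close>

definition ft :: "(real^'n::finite \<Rightarrow> complex) \<Rightarrow> real^'n \<Rightarrow> complex" where
  "ft f \<xi> = (\<integral>x. exp (- \<i> * complex_of_real (x \<bullet> \<xi>)) * f x \<partial>lborel)"

definition gauss :: "'a::real_inner \<Rightarrow> real" where
  "gauss x = exp (- (x \<bullet> x) / 2)"

lemma gauss_measurable[measurable]: "gauss \<in> borel_measurable (borel :: 'a::euclidean_space measure)"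
  unfolding gauss_def by measurable

lemma gauss_bounds: "0 < gauss x" "gauss x \<le> 1"
  by (auto simp: gauss_def)

lemma norm_exp_phase[simp]: "norm (exp (- (\<i> * complex_of_real r))) = 1" "norm (exp (\<i> * complex_of_real r)) = 1"
  "norm (exp (- \<i> * complex_of_real r)) = 1"
  using norm_exp_i_times[of "-r"] norm_exp_i_times[of r] by auto

text \<open>Up to the factor sqrt(2 pi) this is the characteristic function of the standard normal
  distribution.\<close>

lemma gauss_fourier_1d:
  "integrable lborel (\<lambda>x::real. exp (\<i> * complex_of_real (t * x)) * complex_of_real (gauss x))"
  "(\<integral>x. exp (\<i> * complex_of_real (t * x)) * complex_of_real (gauss x) \<partial>lborel) = complex_of_real (sqrt (2 * pi) * gauss t)"
proof -
  let ?f = "\<lambda>x::real. exp (\<i> * complex_of_real (t * x)) * complex_of_real (gauss x)"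
  have eq: "?f x = complex_of_real (sqrt (2 * pi)) * (std_normal_density x *\<^sub>R exp (\<i> * complex_of_real (t * x)))" for x
    by (simp add: gauss_def std_normal_density_def power2_eq_square scaleR_conv_of_real)
  have "integrable std_normal_distribution (\<lambda>x. exp (\<i> * complex_of_real (t * x)))"
  proof -
    interpret prob_space std_normal_distribution by (rule prob_space_normal_density) simp
    show ?thesis by (rule integrable_const_bound[where B=1]) (auto intro!: AE_I2)
  qed
  then have i: "integrable lborel (\<lambda>x. std_normal_density x *\<^sub>R exp (\<i> * complex_of_real (t * x)))"
    by (subst (asm) integrable_density) (auto simp: normal_density_nonneg)
  then show "integrable lborel ?f" unfolding eq by (intro integrable_mult_right)
  have "(\<integral>x. std_normal_density x *\<^sub>R exp (\<i> * complex_of_real (t * x)) \<partial>lborel) = char std_normal_distribution t"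
    unfolding char_def by (subst integral_density) (auto simp: normal_density_nonneg)
  also have "\<dots> = complex_of_real (gauss t)"
    by (simp add: char_std_normal_distribution gauss_def power2_eq_square)
  finally show "(\<integral>x. ?f x \<partial>lborel) = complex_of_real (sqrt (2 * pi) * gauss t)"
    unfolding eq by (subst integral_mult_right_zero) simp
qed

text \<open>Both the phase and the Gaussian factor over an orthonormal basis, so the integral over
  the product measure is a product of one-dimensional ones.\<close>

lemma gauss_fourier:
  fixes z :: "'a::euclidean_space"
  shows "integrable lborel (\<lambda>x. exp (\<i> * complex_of_real (x \<bullet> z)) * complex_of_real (gauss x))"
    and "(\<integral>x. exp (\<i> * complex_of_real (x \<bullet> z)) * complex_of_real (gauss x) \<partial>lborel)
       = complex_of_real (sqrt ((2 * pi) ^ DIM('a)) * gauss z)"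
proof -
  let ?T = "\<lambda>f. \<Sum>b\<in>Basis. f b *\<^sub>R b :: 'a"
  let ?h = "\<lambda>b x. exp (\<i> * complex_of_real ((z \<bullet> b) * x)) * complex_of_real (gauss x)"
  interpret product_sigma_finite "\<lambda>_::'a. lborel :: real measure" ..
  have [measurable]: "?T \<in> measurable (\<Pi>\<^sub>M b\<in>Basis. lborel) borel" by measurable
  have eq: "exp (\<i> * complex_of_real (?T f \<bullet> z)) * complex_of_real (gauss (?T f)) = (\<Prod>b\<in>Basis. ?h b (f b))" for f
  proof -
    have 1: "?T f \<bullet> z = (\<Sum>b\<in>Basis. (z \<bullet> b) * f b)"
      unfolding inner_sum_left inner_scaleR_left by (intro sum.cong) (simp_all add: inner_commute)
    have 2: "?T f \<bullet> ?T f = (\<Sum>b\<in>Basis. f b * f b)"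
      by (subst euclidean_inner) (simp add: inner_sum_left_Basis)
    have 3: "gauss (?T f) = (\<Prod>b\<in>Basis. gauss (f b))"
      unfolding gauss_def 2 by (simp add: exp_sum[symmetric] sum_negf sum_divide_distrib)
    show ?thesis unfolding 1 3
      by (simp add: exp_sum sum_distrib_left prod.distrib)
  qed
  have I: "integrable (\<Pi>\<^sub>M b\<in>Basis. lborel) (\<lambda>f. \<Prod>b\<in>Basis. ?h b (f b))"
    by (rule product_integrable_prod) (auto intro: gauss_fourier_1d simp del: of_real_mult)
  show "integrable lborel (\<lambda>x. exp (\<i> * complex_of_real (x \<bullet> z)) * complex_of_real (gauss x))"
    by (subst lborel_eq, subst integrable_distr_eq) (use I in \<open>auto simp: eq\<close>)
  have "(\<integral>x. exp (\<i> * complex_of_real (x \<bullet> z)) * complex_of_real (gauss x) \<partial>lborel) =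
      (\<integral>f. (\<Prod>b\<in>Basis. ?h b (f b)) \<partial>(\<Pi>\<^sub>M b\<in>Basis. lborel))"
    by (subst lborel_eq, subst integral_distr) (auto simp: eq)
  also have "\<dots> = (\<Prod>b\<in>Basis. \<integral>x. ?h b x \<partial>lborel)"
    by (rule product_integral_prod) (auto intro: gauss_fourier_1d simp del: of_real_mult)
  also have "\<dots> = (\<Prod>b\<in>Basis. complex_of_real (sqrt (2 * pi)) * complex_of_real (gauss (z \<bullet> b)))"
    unfolding gauss_fourier_1d(2) by (simp only: of_real_mult)
  also have "\<dots> = complex_of_real (sqrt ((2 * pi) ^ DIM('a)) * gauss z)"
  proof -
    have "gauss z = (\<Prod>b\<in>Basis. gauss (z \<bullet> b))"
      unfolding gauss_def euclidean_inner[of z z] by (simp add: exp_sum[symmetric] sum_negf sum_divide_distrib)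
    moreover have "sqrt ((2 * pi) ^ DIM('a)) = sqrt (2 * pi) ^ DIM('a)" by (rule real_sqrt_power)
    ultimately show ?thesis by (simp only: prod.distrib prod_constant of_real_mult of_real_power of_real_prod)
  qed
  finally show "(\<integral>x. exp (\<i> * complex_of_real (x \<bullet> z)) * complex_of_real (gauss x) \<partial>lborel)
       = complex_of_real (sqrt ((2 * pi) ^ DIM('a)) * gauss z)" .
qed

lemma gauss_integrable: "integrable lborel (gauss :: 'a::euclidean_space \<Rightarrow> real)"
  and gauss_integral: "(\<integral>x. gauss (x::'a) \<partial>lborel) = sqrt ((2 * pi) ^ DIM('a))"
proof -
  have i: "integrable lborel (\<lambda>x::'a. complex_of_real (gauss x))" using gauss_fourier(1)[of "0::'a"] by simp
  show "integrable lborel (gauss :: 'a \<Rightarrow> real)" using integrable_Re[OF i] by simp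
  have "complex_of_real (\<integral>x. gauss (x::'a) \<partial>lborel) = complex_of_real (sqrt ((2 * pi) ^ DIM('a)))"
    using gauss_fourier(2)[of "0::'a"] by (simp add: gauss_def)
  then show "(\<integral>x. gauss (x::'a) \<partial>lborel) = sqrt ((2 * pi) ^ DIM('a))" using of_real_eq_iff by blast
qed

lemma integral_lborel_affine:
  fixes t :: "'a::euclidean_space" and f :: "'a \<Rightarrow> 'b::{banach,second_countable_topology}"
  assumes [measurable]: "f \<in> borel_measurable borel" and c: "c \<noteq> 0"
  shows "(\<integral>x. f x \<partial>lborel) = (\<bar>c\<bar> ^ DIM('a)) *\<^sub>R (\<integral>x. f (t + c *\<^sub>R x) \<partial>lborel)"
    and "integrable lborel (\<lambda>x. f (t + c *\<^sub>R x)) \<longleftrightarrow> integrable lborel f"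
proof -
  show "(\<integral>x. f x \<partial>lborel) = (\<bar>c\<bar> ^ DIM('a)) *\<^sub>R (\<integral>x. f (t + c *\<^sub>R x) \<partial>lborel)"
    by (subst lborel_affine[OF c, of t]) (simp add: integral_density integral_distr)
  show "integrable lborel (\<lambda>x. f (t + c *\<^sub>R x)) \<longleftrightarrow> integrable lborel f"
    (is "?L \<longleftrightarrow> ?R")
  proof -
    have "?R \<longleftrightarrow> integrable lborel (\<lambda>x. (\<bar>c\<bar> ^ DIM('a)) *\<^sub>R f (t + c *\<^sub>R x))"
      by (subst lborel_affine[OF c, of t]) (simp add: integrable_density integrable_distr_eq)
    also have "\<dots> \<longleftrightarrow> ?L"
    proof
      assume "integrable lborel (\<lambda>x. (\<bar>c\<bar> ^ DIM('a)) *\<^sub>R f (t + c *\<^sub>R x))"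
      from integrable_scaleR_right[of "1 / \<bar>c\<bar> ^ DIM('a)", OF this] show ?L using c by simp
    qed auto
    finally show ?thesis ..
  qed
qed

lemma ft_gauss_scaled:
  fixes w :: "real^'n::finite"
  assumes e: "\<epsilon> > 0"
  shows "integrable lborel (\<lambda>\<xi>::real^'n. complex_of_real (gauss (\<epsilon> *\<^sub>R \<xi>)))"
    and "ft (\<lambda>\<xi>. complex_of_real (gauss (\<epsilon> *\<^sub>R \<xi>))) w
       = complex_of_real ((1 / \<epsilon>) ^ CARD('n) * sqrt ((2 * pi) ^ CARD('n)) * gauss ((1 / \<epsilon>) *\<^sub>R w))"
proof -
  show "integrable lborel (\<lambda>\<xi>::real^'n. complex_of_real (gauss (\<epsilon> *\<^sub>R \<xi>)))"
    using integral_lborel_affine(2)[of "\<lambda>x::real^'n. complex_of_real (gauss x)" \<epsilon> 0] gauss_fourier(1)[of "0::real^'n"] e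
    by simp
  have "ft (\<lambda>\<xi>. complex_of_real (gauss (\<epsilon> *\<^sub>R \<xi>))) w = \<bar>1 / \<epsilon>\<bar> ^ CARD('n) *\<^sub>R
     (\<integral>x. exp (- \<i> * complex_of_real ((0 + (1 / \<epsilon>) *\<^sub>R x) \<bullet> w)) * complex_of_real (gauss (\<epsilon> *\<^sub>R (0 + (1 / \<epsilon>) *\<^sub>R x))) \<partial>lborel)"
    unfolding ft_def using e by (subst integral_lborel_affine(1)[where c="1 / \<epsilon>" and t=0]) auto
  also have "(\<integral>x. exp (- \<i> * complex_of_real ((0 + (1 / \<epsilon>) *\<^sub>R x) \<bullet> w)) * complex_of_real (gauss (\<epsilon> *\<^sub>R (0 + (1 / \<epsilon>) *\<^sub>R x))) \<partial>lborel)
      = (\<integral>x. exp (\<i> * complex_of_real (x \<bullet> (- (1 / \<epsilon>) *\<^sub>R w))) * complex_of_real (gauss x) \<partial>lborel)"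
    using e by (intro Bochner_Integration.integral_cong) simp_all
  also have "\<dots> = complex_of_real (sqrt ((2 * pi) ^ CARD('n)) * gauss (- (1 / \<epsilon>) *\<^sub>R w))"
    by (subst gauss_fourier(2)) simp
  also have "gauss (- (1 / \<epsilon>) *\<^sub>R w) = gauss ((1 / \<epsilon>) *\<^sub>R w)" by (simp add: gauss_def)
  finally show "ft (\<lambda>\<xi>. complex_of_real (gauss (\<epsilon> *\<^sub>R \<xi>))) w
       = complex_of_real ((1 / \<epsilon>) ^ CARD('n) * sqrt ((2 * pi) ^ CARD('n)) * gauss ((1 / \<epsilon>) *\<^sub>R w))"
    using e by (simp add: scaleR_conv_of_real)
qed

lemma integrable_phase:
  fixes f :: "real^'n::finite \<Rightarrow> complex"
  assumes "integrable lborel f"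
  shows "integrable lborel (\<lambda>x. exp (- \<i> * complex_of_real (x \<bullet> \<xi>)) * f x)"
proof -
  have [measurable]: "f \<in> borel_measurable borel" using assms by auto
  show ?thesis using assms by (rule Bochner_Integration.integrable_bound) (auto simp: norm_mult)
qed

lemma ft_bound: assumes f: "L1le lborel f A" shows "norm (ft f \<xi>) \<le> A"
proof -
  have [measurable]: "f \<in> borel_measurable borel" using f by (auto simp: L1le_def)
  show ?thesis unfolding ft_def by (rule L1le_integral, rule L1le_dom1[OF f]) (auto simp: norm_mult)
qed

lemma ft_continuous:
  assumes f: "integrable lborel f" shows "continuous_on UNIV (ft f)"
proof -
  have [measurable]: "f \<in> borel_measurable lborel" using f by auto
  have "isCont (ft f) \<xi>" for \<xi>
  proof (rule continuous_at_sequentiallyI)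
    fix X assume X: "X \<longlonglongrightarrow> \<xi>"
    show "(\<lambda>k. ft f (X k)) \<longlonglongrightarrow> ft f \<xi>"
      unfolding ft_def
      by (rule integral_dominated_convergence[where w="\<lambda>x. norm (f x)"])
         (use f X in \<open>auto simp: norm_mult intro!: tendsto_intros\<close>)
  qed
  then show ?thesis by (simp add: continuous_at_imp_continuous_on)
qed

lemma ft_measurable[measurable]: "integrable lborel f \<Longrightarrow> ft f \<in> borel_measurable borel"
  by (intro borel_measurable_continuous_onI ft_continuous)

lemma ft_diff: "integrable lborel f \<Longrightarrow> integrable lborel g \<Longrightarrow> ft (\<lambda>x. f x - g x) \<xi> = ft f \<xi> - ft g \<xi>"
  unfolding ft_def by (subst Bochner_Integration.integral_diff[symmetric]) (auto simp only: right_diff_distrib intro: integrable_phase)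

lemma ft_cmult: "ft (\<lambda>x. c * f x) \<xi> = c * ft f \<xi>"
  unfolding ft_def by (subst integral_mult_right_zero[symmetric]) (simp add: mult_ac)

lemma ft_shift:
  assumes [measurable]: "f \<in> borel_measurable borel"
  shows "ft (\<lambda>x. f (y + x)) \<xi> = exp (\<i> * complex_of_real (y \<bullet> \<xi>)) * ft f \<xi>"
proof -
  have "ft (\<lambda>x. f (y + x)) \<xi> = (\<integral>x. exp (\<i> * complex_of_real (y \<bullet> \<xi>)) * (exp (- \<i> * complex_of_real ((y + 1 *\<^sub>R x) \<bullet> \<xi>)) * f (y + 1 *\<^sub>R x)) \<partial>lborel)"
    unfolding ft_def by (intro Bochner_Integration.integral_cong) (auto simp: inner_add_left exp_add[symmetric] algebra_simps mult_exp_exp)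
  also have "\<dots> = exp (\<i> * complex_of_real (y \<bullet> \<xi>)) * (\<integral>x. (exp (- \<i> * complex_of_real ((y + 1 *\<^sub>R x) \<bullet> \<xi>)) * f (y + 1 *\<^sub>R x)) \<partial>lborel)"
    by (rule integral_mult_right_zero)
  also have "(\<integral>x. (exp (- \<i> * complex_of_real ((y + 1 *\<^sub>R x) \<bullet> \<xi>)) * f (y + 1 *\<^sub>R x)) \<partial>lborel) = ft f \<xi>"
    unfolding ft_def by (rule lborel_shift_reflect(4)[of "\<lambda>x. exp (- \<i> * complex_of_real (x \<bullet> \<xi>)) * f x"]) auto
  finally show ?thesis .
qed

lemma ft_reflect:
  assumes [measurable]: "f \<in> borel_measurable borel"
  shows "ft (\<lambda>x. f (- x)) \<xi> = ft f (- \<xi>)"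
proof -
  have "ft (\<lambda>x. f (- x)) \<xi> = (\<integral>x. exp (- \<i> * complex_of_real ((0 + (-1) *\<^sub>R x) \<bullet> - \<xi>)) * f (0 + (-1) *\<^sub>R x) \<partial>lborel)"
    unfolding ft_def by simp
  also have "\<dots> = ft f (- \<xi>)" unfolding ft_def
    by (rule lborel_shift_reflect(4)[of "\<lambda>x. exp (- \<i> * complex_of_real (x \<bullet> - \<xi>)) * f x"]) auto
  finally show ?thesis .
qed

lemma ft_cnj: "ft (\<lambda>x. cnj (f x)) \<xi> = cnj (ft f (- \<xi>))"
  unfolding ft_def Bochner_Integration.integral_cnj[symmetric] by (intro Bochner_Integration.integral_cong) (auto simp: exp_cnj)

lemma integrable_product_kernel:
  fixes f g :: "real^'n::finite \<Rightarrow> complex"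
  assumes f: "integrable lborel f" and g: "integrable lborel g"
    and K[measurable]: "(\<lambda>(x, y). K x y) \<in> borel_measurable (lborel \<Otimes>\<^sub>M lborel)" and K1: "\<And>x y. norm (K x y :: complex) \<le> 1"
  shows "integrable (lborel \<Otimes>\<^sub>M lborel) (\<lambda>(x, y). K x y * f x * g y)"
proof -
  have [measurable]: "f \<in> borel_measurable lborel" "g \<in> borel_measurable lborel" using f g by auto
  have "integrable (lborel \<Otimes>\<^sub>M lborel) (\<lambda>(x, y). f x * g y)"
  proof (rule lborel_pair.Fubini_integrable)
    show "integrable lborel (\<lambda>x. LINT y|lborel. norm (case (x, y) of (x, y) \<Rightarrow> f x * g y))"
      using f by (simp add: norm_mult)
    show "AE x in lborel. integrable lborel (\<lambda>y. case (x, y) of (x, y) \<Rightarrow> f x * g y)" using g by simp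
  qed measurable
  then show ?thesis
  proof (rule Bochner_Integration.integrable_bound)
    show "AE x in lborel \<Otimes>\<^sub>M lborel. norm (case x of (x, y) \<Rightarrow> K x y * f x * g y) \<le> norm (case x of (x, y) \<Rightarrow> f x * g y)"
      using K1 by (intro AE_I2) (auto simp: norm_mult mult.assoc intro!: mult_left_le_one_le split: prod.split)
  qed measurable
qed

lemma ft_mult_formula:
  assumes f: "integrable lborel f" and g: "integrable lborel g"
  shows "(\<integral>\<xi>. ft f \<xi> * g \<xi> \<partial>lborel) = (\<integral>x. f x * ft g x \<partial>lborel)"
proof -
  have [measurable]: "f \<in> borel_measurable lborel" "g \<in> borel_measurable lborel" using f g by auto
  let ?K = "\<lambda>x y. exp (- \<i> * complex_of_real (x \<bullet> y))"
  have I: "integrable (lborel \<Otimes>\<^sub>M lborel) (\<lambda>(x, y). ?K x y * f x * g y)"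
    by (rule integrable_product_kernel[OF f g]) (simp_all only: norm_exp_phase, measurable)
  have "(\<integral>\<xi>. ft f \<xi> * g \<xi> \<partial>lborel) = (\<integral>\<xi>. (\<integral>x. ?K x \<xi> * f x * g \<xi> \<partial>lborel) \<partial>lborel)"
    unfolding ft_def by (simp add: integral_mult_left_zero[symmetric] mult.assoc)
  also have "\<dots> = (\<integral>x. (\<integral>\<xi>. ?K x \<xi> * f x * g \<xi> \<partial>lborel) \<partial>lborel)"
    by (rule lborel_pair.Fubini_integral[OF I])
  also have "\<dots> = (\<integral>x. f x * ft g x \<partial>lborel)"
  proof (rule Bochner_Integration.integral_cong[OF refl])
    fix x
    have "(\<integral>\<xi>. ?K x \<xi> * f x * g \<xi> \<partial>lborel) = (\<integral>\<xi>. f x * (exp (- \<i> * complex_of_real (\<xi> \<bullet> x)) * g \<xi>) \<partial>lborel)"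
      by (intro Bochner_Integration.integral_cong) (auto simp: inner_commute)
    also have "\<dots> = f x * ft g x" unfolding ft_def by (rule integral_mult_right_zero)
    finally show "(\<integral>\<xi>. ?K x \<xi> * f x * g \<xi> \<partial>lborel) = f x * ft g x" .
  qed
  finally show ?thesis .
qed

section \<open>Parseval and Plancherel on the intersection of L1 and L2\<close>

lemma L2le_complexI:
  assumes "L2le M (\<lambda>x. Re (f x)) A" "L2le M (\<lambda>x. Im (f x)) B" shows "L2le M f (A + B)"
proof -
  have [measurable]: "f \<in> borel_measurable M"
    using assms by (subst borel_measurable_complex_iff) (auto simp: L2le_def)
  from L2le_add[OF L2le_norm[OF assms(1)] L2le_norm[OF assms(2)]] show ?thesis
    by (rule L2le_dom1) (auto simp: cmod_le)
qed

lemma L2le_Re: "L2le M f A \<Longrightarrow> L2le M (\<lambda>x. Re (f x)) A"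
  by (rule L2le_dom1, assumption) (auto simp: abs_Re_le_cmod dest: L2le_measurable intro: measurable_compose)

lemma L2le_Im: "L2le M f A \<Longrightarrow> L2le M (\<lambda>x. Im (f x)) A"
  by (rule L2le_dom1, assumption) (auto simp: abs_Im_le_cmod dest: L2le_measurable intro: measurable_compose)

lemma borel_measurable_cnj[measurable]: "cnj \<in> borel_measurable borel"
  by (intro borel_measurable_continuous_onI continuous_intros)

lemma L2_translation_continuous:
  fixes f :: "real^'n::finite \<Rightarrow> complex"
  assumes f: "L2le lborel f A" and z: "z \<longlonglongrightarrow> 0" and e: "\<epsilon> > 0"
  shows "eventually (\<lambda>k. L2le lborel (\<lambda>x. f (z k + x) - f x) \<epsilon>) sequentially"
  using L2_translation_continuous_real[OF L2le_Re[OF f] z half_gt_zero[OF e]]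
    L2_translation_continuous_real[OF L2le_Im[OF f] z half_gt_zero[OF e]]
proof eventually_elim
  case (elim k)
  then show ?case using L2le_complexI[of lborel "\<lambda>x. f (z k + x) - f x" "\<epsilon>/2" "\<epsilon>/2"] by simp
qed

lemma L2le_cnj: "L2le M f A \<Longrightarrow> L2le M (\<lambda>x. cnj (f x)) A"
  by (rule L2le_dom1, assumption) (auto dest: L2le_measurable)

text \<open>The product of two transforms is not yet known to be integrable; a Gaussian factor makes
  it so. Two uses of the multiplication formula then rewrite the regularized integral as a Gaussian
  average, at scale \<epsilon>, of the correlation of f with g.\<close>

lemma Parseval_gauss:
  fixes f g :: "real^'n::finite \<Rightarrow> complex"
  assumes f: "integrable lborel f" "L2le lborel f A" and g: "integrable lborel g" "L2le lborel g B" and e: "\<epsilon> > 0"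
  shows "(\<integral>\<xi>. complex_of_real (gauss (\<epsilon> *\<^sub>R \<xi>)) * (ft f \<xi> * cnj (ft g \<xi>)) \<partial>lborel)
     = complex_of_real (sqrt ((2 * pi) ^ CARD('n))) * (\<integral>z. complex_of_real (gauss z) * (\<integral>x. f x * cnj (g ((- \<epsilon>) *\<^sub>R z + x)) \<partial>lborel) \<partial>lborel)"
proof -
  have [measurable]: "f \<in> borel_measurable borel" "g \<in> borel_measurable borel" using f g by auto
  let ?s = "sqrt ((2 * pi) ^ CARD('n))"
  \<comment> \<open>Conjugating and reflecting g produces a function whose transform is the
    conjugate of the transform of g, so that \<open>h\<close> is again a Gaussian times a
    transform.\<close>
  define g' where "g' y = cnj (g (- y))" for y
  have g'i: "integrable lborel g'"
    unfolding g'_def using lborel_shift_reflect(3)[of "\<lambda>x. cnj (g x)" "-1" 0] g(1) by (simp add: integrable_cnj)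
  have [measurable]: "g' \<in> borel_measurable borel" using g'i by auto
  have ftg': "ft g' \<xi> = cnj (ft g \<xi>)" for \<xi>
    unfolding g'_def using ft_reflect[of "\<lambda>x. cnj (g x)" \<xi>] ft_cnj[of g "- \<xi>"] by simp
  have gi: "integrable lborel (\<lambda>\<xi>::real^'n. complex_of_real (gauss (\<epsilon> *\<^sub>R \<xi>)))" by (rule ft_gauss_scaled(1)[OF e])
  define h where "h \<xi> = complex_of_real (gauss (\<epsilon> *\<^sub>R \<xi>)) * cnj (ft g \<xi>)" for \<xi>
  have hi: "integrable lborel h"
  proof -
    have "integrable lborel (\<lambda>\<xi>::real^'n. complex_of_real (\<integral>x. norm (g x) \<partial>lborel) * complex_of_real (gauss (\<epsilon> *\<^sub>R \<xi>)))"
      by (intro integrable_mult_right gi)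
    then show ?thesis
    proof (rule Bochner_Integration.integrable_bound)
      show "h \<in> borel_measurable lborel" unfolding h_def using g(1) by measurable
      have "norm (ft g \<xi>) \<le> (\<integral>x. norm (g x) \<partial>lborel)" for \<xi> by (rule ft_bound[OF L1leI_integrable[OF g(1)]]) simp
      then show "AE \<xi> in lborel. norm (h \<xi>) \<le> norm (complex_of_real (\<integral>x. norm (g x) \<partial>lborel) * complex_of_real (gauss (\<epsilon> *\<^sub>R \<xi>)))"
        by (intro AE_I2) (auto simp: h_def norm_mult mult.commute[of "\<bar>gauss _\<bar>"] intro!: mult_right_mono)
    qed
  qed
  have fth: "ft h x = complex_of_real ?s * (\<integral>z. complex_of_real (gauss z) * cnj (g ((- \<epsilon>) *\<^sub>R z + x)) \<partial>lborel)" for x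
  proof -
    let ?k = "\<lambda>\<xi>. exp (- \<i> * complex_of_real (\<xi> \<bullet> x)) * complex_of_real (gauss (\<epsilon> *\<^sub>R \<xi>))"
    have "ft h x = (\<integral>\<xi>. ft g' \<xi> * ?k \<xi> \<partial>lborel)"
      unfolding ft_def[of h] by (simp add: h_def ftg' mult_ac)
    also have "\<dots> = (\<integral>y. g' y * ft ?k y \<partial>lborel)"
      by (rule ft_mult_formula[OF g'i integrable_phase[OF gi]])
    also have "\<dots> = (\<integral>y. g' y * complex_of_real ((1 / \<epsilon>) ^ CARD('n) * ?s * gauss ((1 / \<epsilon>) *\<^sub>R (x + y))) \<partial>lborel)"
    proof -
      have "ft ?k y = ft (\<lambda>\<xi>. complex_of_real (gauss (\<epsilon> *\<^sub>R \<xi>))) (x + y)" for y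
        unfolding ft_def by (intro Bochner_Integration.integral_cong) (auto simp: inner_add_right mult_exp_exp algebra_simps)
      then show ?thesis by (simp only: ft_gauss_scaled(2)[OF e])
    qed
    \<comment> \<open>The Gaussian is concentrated at y = -x on scale \<epsilon>; the substitution y
      = -x + \<epsilon> z rescales it to the standard one and its Jacobian cancels the factor
      (1/\<epsilon>)^n.\<close>
    also have "\<dots> = \<bar>\<epsilon>\<bar> ^ CARD('n) *\<^sub>R (\<integral>z. g' ((- x) + \<epsilon> *\<^sub>R z) * complex_of_real ((1 / \<epsilon>) ^ CARD('n) * ?s * gauss ((1 / \<epsilon>) *\<^sub>R (x + ((- x) + \<epsilon> *\<^sub>R z)))) \<partial>lborel)"
      using e by (subst integral_lborel_affine(1)[where c=\<epsilon> and t="-x"]) auto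
    also have "\<dots> = \<bar>\<epsilon>\<bar> ^ CARD('n) *\<^sub>R (\<integral>z. complex_of_real ((1 / \<epsilon>) ^ CARD('n) * ?s) * (complex_of_real (gauss z) * cnj (g ((- \<epsilon>) *\<^sub>R z + x))) \<partial>lborel)"
      using e by (simp add: g'_def algebra_simps)
    also have "\<dots> = \<bar>\<epsilon>\<bar> ^ CARD('n) *\<^sub>R (complex_of_real ((1 / \<epsilon>) ^ CARD('n) * ?s) * (\<integral>z. (complex_of_real (gauss z) * cnj (g ((- \<epsilon>) *\<^sub>R z + x))) \<partial>lborel))"
      by (simp only: integral_mult_right_zero)
    also have "\<dots> = complex_of_real (\<bar>\<epsilon>\<bar> ^ CARD('n) * (1 / \<epsilon>) ^ CARD('n)) * (complex_of_real ?s * (\<integral>z. (complex_of_real (gauss z) * cnj (g ((- \<epsilon>) *\<^sub>R z + x))) \<partial>lborel))"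
      by (simp add: scaleR_conv_of_real mult_ac)
    also have "\<bar>\<epsilon>\<bar> ^ CARD('n) * (1 / \<epsilon>) ^ CARD('n) = 1" using e by (simp add: power_mult_distrib[symmetric])
    finally show ?thesis by simp
  qed
  have shift: "L2le lborel (\<lambda>x. g ((- \<epsilon>) *\<^sub>R z + x)) B" for z
    using lborel_shift_reflect(1)[of g 1 "(- \<epsilon>) *\<^sub>R z"] g(2) by simp
  have "integrable (lborel \<Otimes>\<^sub>M lborel) (\<lambda>(z, x). complex_of_real (gauss z) * (f x * cnj (g ((- \<epsilon>) *\<^sub>R z + x))))"
  proof (rule lborel_pair.Fubini_integrable)
    have L: "L1le lborel (\<lambda>x. f x * cnj (g ((- \<epsilon>) *\<^sub>R z + x))) (A * B)" for z
      by (rule L2le_mult[OF f(2) L2le_cnj[OF shift]])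
    have "(LINT x|lborel. norm (f x * cnj (g ((- \<epsilon>) *\<^sub>R z + x)))) \<le> A * B" for z
    proof -
      have "L1le lborel (\<lambda>x. norm (f x * cnj (g ((- \<epsilon>) *\<^sub>R z + x)))) (A * B)" by (rule L1le_dom1[OF L]) auto
      from L1le_integral[OF this] show ?thesis by simp
    qed
    then have b: "norm (LINT x|lborel. norm (complex_of_real (gauss z) * (f x * cnj (g ((- \<epsilon>) *\<^sub>R z + x))))) \<le> norm (gauss z * (A * B))" for z
      using gauss_bounds[of z] L2le_nonneg[OF f(2)] L2le_nonneg[OF g(2)] by (simp add: norm_mult mult_left_mono)
    have "integrable lborel (\<lambda>z::real^'n. gauss z * (A * B))" by (intro integrable_mult_left gauss_integrable)
    then show "integrable lborel (\<lambda>z. LINT x|lborel. norm (case (z, x) of (z, x) \<Rightarrow> complex_of_real (gauss z) * (f x * cnj (g ((- \<epsilon>) *\<^sub>R z + x)))))"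
    proof (rule Bochner_Integration.integrable_bound)
      show "AE z in lborel. norm (LINT x|lborel. norm (case (z, x) of (z, x) \<Rightarrow> complex_of_real (gauss z) * (f x * cnj (g ((- \<epsilon>) *\<^sub>R z + x))))) \<le> norm (gauss z * (A * B))"
        using b by (intro AE_I2) (simp only: split_conv)
    qed measurable
    show "AE z in lborel. integrable lborel (\<lambda>x. case (z, x) of (z, x) \<Rightarrow> complex_of_real (gauss z) * (f x * cnj (g ((- \<epsilon>) *\<^sub>R z + x))))"
      by (simp only: split_conv) (intro AE_I2 integrable_mult_right L1le_integrable[OF L])
  qed measurable
  note F = lborel_pair.Fubini_integral[OF this]
  have "(\<integral>\<xi>. complex_of_real (gauss (\<epsilon> *\<^sub>R \<xi>)) * (ft f \<xi> * cnj (ft g \<xi>)) \<partial>lborel) = (\<integral>\<xi>. ft f \<xi> * h \<xi> \<partial>lborel)"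
    by (simp add: h_def mult_ac)
  also have "\<dots> = (\<integral>x. f x * ft h x \<partial>lborel)" by (rule ft_mult_formula[OF f(1) hi])
  also have "\<dots> = (\<integral>x. complex_of_real ?s * (\<integral>z. complex_of_real (gauss z) * (f x * cnj (g ((- \<epsilon>) *\<^sub>R z + x))) \<partial>lborel) \<partial>lborel)"
  proof (rule Bochner_Integration.integral_cong[OF refl])
    fix x
    have "(\<integral>z. complex_of_real (gauss z) * (f x * cnj (g ((- \<epsilon>) *\<^sub>R z + x))) \<partial>lborel) = (\<integral>z. f x * (complex_of_real (gauss z) * cnj (g ((- \<epsilon>) *\<^sub>R z + x))) \<partial>lborel)"
      by (intro Bochner_Integration.integral_cong) auto
    also have "\<dots> = f x * (\<integral>z. complex_of_real (gauss z) * cnj (g ((- \<epsilon>) *\<^sub>R z + x)) \<partial>lborel)" by (rule integral_mult_right_zero)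
    finally show "f x * ft h x = complex_of_real ?s * (\<integral>z. complex_of_real (gauss z) * (f x * cnj (g ((- \<epsilon>) *\<^sub>R z + x))) \<partial>lborel)"
      unfolding fth by (simp only: mult.left_commute)
  qed
  also have "\<dots> = complex_of_real ?s * (\<integral>x. (\<integral>z. complex_of_real (gauss z) * (f x * cnj (g ((- \<epsilon>) *\<^sub>R z + x))) \<partial>lborel) \<partial>lborel)"
    by (rule integral_mult_right_zero)
  also have "\<dots> = complex_of_real ?s * (\<integral>z. (\<integral>x. complex_of_real (gauss z) * (f x * cnj (g ((- \<epsilon>) *\<^sub>R z + x))) \<partial>lborel) \<partial>lborel)"
    unfolding F ..
  finally show ?thesis by (simp add: integral_mult_right_zero)
qed

text \<open>By Cauchy-Schwarz the correlation at shift w differs from its value at 0 by at most A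
  times the L2 distance between g and its translate. It is therefore continuous at 0, and the
  Gaussian average converges to the value there times the total mass.\<close>

lemma Parseval_gauss_limit:
  fixes f g :: "real^'n::finite \<Rightarrow> complex"
  assumes f: "integrable lborel f" "L2le lborel f A" and g: "integrable lborel g" "L2le lborel g B"
  shows "(\<lambda>k. \<integral>\<xi>. complex_of_real (gauss ((1 / real (Suc k)) *\<^sub>R \<xi>)) * (ft f \<xi> * cnj (ft g \<xi>)) \<partial>lborel)
     \<longlonglongrightarrow> complex_of_real ((2 * pi) ^ CARD('n)) * (\<integral>x. f x * cnj (g x) \<partial>lborel)"
proof -
  have [measurable]: "f \<in> borel_measurable borel" "g \<in> borel_measurable borel" using f g by auto
  have nn: "0 \<le> A" "0 \<le> B" using L2le_nonneg f g by auto
  let ?s = "sqrt ((2 * pi) ^ CARD('n))"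
  let ?r = "\<lambda>w. \<integral>x. f x * cnj (g (w + x)) \<partial>lborel"
  let ?e = "\<lambda>k. 1 / real (Suc k)"
  have shift: "L2le lborel (\<lambda>x. g (w + x)) B" for w
    using lborel_shift_reflect(1)[of g 1 w] g(2) by simp
  have rb: "norm (?r w) \<le> A * B" for w by (rule L1le_integral[OF L2le_mult[OF f(2) L2le_cnj[OF shift]]])
  have rlim: "(\<lambda>k. ?r ((- ?e k) *\<^sub>R z)) \<longlonglongrightarrow> ?r 0" for z
  proof (rule LIMSEQ_I)
    fix d :: real assume d: "d > 0"
    have z: "(\<lambda>k. (- ?e k) *\<^sub>R z) \<longlonglongrightarrow> 0"
      using tendsto_scaleR[OF tendsto_minus[OF LIMSEQ_Suc[OF lim_1_over_n]] tendsto_const[of z]] by simp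
    have "eventually (\<lambda>k. L2le lborel (\<lambda>x. g ((- ?e k) *\<^sub>R z + x) - g x) (d / (A + 1))) sequentially"
      using nn d by (intro L2_translation_continuous[OF g(2) z]) auto
    then have "eventually (\<lambda>k. norm (?r ((- ?e k) *\<^sub>R z) - ?r 0) < d) sequentially"
    proof eventually_elim
      fix k assume L: "L2le lborel (\<lambda>x. g ((- ?e k) *\<^sub>R z + x) - g x) (d / (A + 1))"
      have "?r ((- ?e k) *\<^sub>R z) - ?r 0 = (\<integral>x. f x * cnj (g ((- ?e k) *\<^sub>R z + x)) - f x * cnj (g (0 + x)) \<partial>lborel)"
        by (intro Bochner_Integration.integral_diff[symmetric] L1le_integrable[OF L2le_mult[OF f(2) L2le_cnj[OF shift]]])
      also have "\<dots> = (\<integral>x. f x * cnj (g ((- ?e k) *\<^sub>R z + x) - g x) \<partial>lborel)"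
        by (simp add: right_diff_distrib)
      finally have "norm (?r ((- ?e k) *\<^sub>R z) - ?r 0) \<le> A * (d / (A + 1))"
        using L1le_integral[OF L2le_mult[OF f(2) L2le_cnj[OF L]]] by simp
      also have "\<dots> < d" using nn d by (simp add: field_simps)
      finally show "norm (?r ((- ?e k) *\<^sub>R z) - ?r 0) < d" .
    qed
    then show "\<exists>N. \<forall>k\<ge>N. norm (?r ((- ?e k) *\<^sub>R z) - ?r 0) < d" by (simp add: eventually_sequentially)
  qed
  have "(\<lambda>k. \<integral>z. complex_of_real (gauss z) * ?r ((- ?e k) *\<^sub>R z) \<partial>lborel) \<longlonglongrightarrow> (\<integral>z. complex_of_real (gauss (z::real^'n)) * ?r 0 \<partial>lborel)"
  proof (rule integral_dominated_convergence[where w="\<lambda>z. gauss z * (A * B)"])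
    show "integrable lborel (\<lambda>z::real^'n. gauss z * (A * B))" by (intro integrable_mult_left gauss_integrable)
    show "AE z in lborel. norm (complex_of_real (gauss z) * ?r ((- ?e k) *\<^sub>R z)) \<le> gauss z * (A * B)" for k
      by (simp only: norm_mult norm_of_real abs_of_pos[OF gauss_bounds(1)]) (intro AE_I2 mult_left_mono rb less_imp_le gauss_bounds(1))
    show "AE z in lborel. (\<lambda>k. complex_of_real (gauss z) * ?r ((- ?e k) *\<^sub>R z)) \<longlonglongrightarrow> complex_of_real (gauss z) * ?r 0"
      by (intro AE_I2 tendsto_mult_left rlim)
  qed measurable
  also have "(\<integral>z. complex_of_real (gauss (z::real^'n)) * ?r 0 \<partial>lborel) = complex_of_real ?s * ?r 0"
    by (simp add: gauss_integral)
  finally have "(\<lambda>k. complex_of_real ?s * (\<integral>z. complex_of_real (gauss z) * ?r ((- ?e k) *\<^sub>R z) \<partial>lborel)) \<longlonglongrightarrow> complex_of_real ?s * (complex_of_real ?s * ?r 0)"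
    by (rule tendsto_mult_left)
  moreover have "complex_of_real ?s * (complex_of_real ?s * ?r 0) = complex_of_real ((2 * pi) ^ CARD('n)) * (\<integral>x. f x * cnj (g x) \<partial>lborel)"
    by (simp add: mult.assoc[symmetric] of_real_mult[symmetric] del: of_real_mult of_real_power)
  moreover have "(\<integral>\<xi>. complex_of_real (gauss (?e k *\<^sub>R \<xi>)) * (ft f \<xi> * cnj (ft g \<xi>)) \<partial>lborel) = complex_of_real ?s * (\<integral>z. complex_of_real (gauss z) * ?r ((- ?e k) *\<^sub>R z) \<partial>lborel)" for k
    by (rule Parseval_gauss[OF f g]) simp
  ultimately show ?thesis by (simp only:)
qed

text \<open>The Plancherel factor (2 pi)^n of the unnormalized transform, indexed by the coordinate
  type.\<close>

definition ftc :: "'n::finite itself \<Rightarrow> real" where "ftc _ = (2 * pi) ^ CARD('n)"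

lemma ftc_ge_1: "ftc TYPE('n::finite) \<ge> 1"
  unfolding ftc_def using pi_ge_two by (intro one_le_power) simp

lemma sqrt_ftc_ge_1: "sqrt (ftc TYPE('n::finite)) \<ge> 1"
  using ftc_ge_1[where 'n='n] by simp

text \<open>The transform is damped by the square root of a Gaussian, so that its squared modulus
  carries exactly the Gaussian of the regularized Parseval identity. Those integrals converge, and
  Fatou gives the bound for the undamped transform.\<close>

lemma ft_L2:
  fixes f :: "real^'n::finite \<Rightarrow> complex"
  assumes f: "integrable lborel f" "L2le lborel f A"
  shows "L2le lborel (ft f) (sqrt (ftc TYPE('n)) * A)"
proof -
  have [measurable]: "f \<in> borel_measurable borel" using f by auto
  have nn: "0 \<le> A" using L2le_nonneg f by auto
  define F where "F k \<xi> = complex_of_real (sqrt (gauss ((1 / real (Suc k)) *\<^sub>R \<xi>))) * ft f \<xi>" for k \<xi>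
  define B where "B k = sqrt (\<integral>\<xi>. gauss ((1 / real (Suc k)) *\<^sub>R \<xi>) * (norm (ft f \<xi>))\<^sup>2 \<partial>lborel)" for k
  have Fm[measurable]: "F k \<in> borel_measurable borel" for k unfolding F_def using f(1) by measurable
  have nF: "(norm (F k \<xi>))\<^sup>2 = gauss ((1 / real (Suc k)) *\<^sub>R \<xi>) * (norm (ft f \<xi>))\<^sup>2" for k \<xi>
    by (simp add: F_def norm_mult power_mult_distrib gauss_bounds less_imp_le)
  obtain C where C: "\<And>\<xi>. norm (ft f \<xi>) \<le> C" using ft_bound[OF L1leI_integrable[OF f(1) order_refl]] by blast
  have int: "integrable lborel (\<lambda>\<xi>. gauss ((1 / real (Suc k)) *\<^sub>R \<xi>) * (norm (ft f \<xi>))\<^sup>2)" for k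
  proof -
    have "integrable lborel (\<lambda>\<xi>::real^'n. complex_of_real (gauss ((1 / real (Suc k)) *\<^sub>R \<xi>)))" by (rule ft_gauss_scaled(1)) simp
    then have "integrable lborel (\<lambda>\<xi>::real^'n. gauss ((1 / real (Suc k)) *\<^sub>R \<xi>))" using integrable_Re by force
    then have "integrable lborel (\<lambda>\<xi>::real^'n. gauss ((1 / real (Suc k)) *\<^sub>R \<xi>) * C\<^sup>2)" by (rule integrable_mult_left)
    then show ?thesis
    proof (rule Bochner_Integration.integrable_bound)
      show "(\<lambda>\<xi>. gauss ((1 / real (Suc k)) *\<^sub>R \<xi>) * (norm (ft f \<xi>))\<^sup>2) \<in> borel_measurable lborel" using f(1) by measurable
      show "AE \<xi> in lborel. norm (gauss ((1 / real (Suc k)) *\<^sub>R \<xi>) * (norm (ft f \<xi>))\<^sup>2) \<le> norm (gauss ((1 / real (Suc k)) *\<^sub>R \<xi>) * C\<^sup>2)"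
        using C by (intro AE_I2) (auto simp: abs_mult gauss_bounds less_imp_le intro!: mult_left_mono power_mono)
    qed
  qed
  have 1: "L2le lborel (F k) (B k)" for k
  proof (rule L2leI_integrable)
    show "integrable lborel (\<lambda>x. (norm (F k x))\<^sup>2)" unfolding nF by (rule int)
    have p: "0 \<le> (\<integral>\<xi>. gauss ((1 / real (Suc k)) *\<^sub>R \<xi>) * (norm (ft f \<xi>))\<^sup>2 \<partial>lborel)"
      by (intro integral_nonneg_AE AE_I2) (simp add: gauss_bounds less_imp_le)
    then show "0 \<le> B k" by (simp add: B_def)
    show "(\<integral>x. (norm (F k x))\<^sup>2 \<partial>lborel) \<le> (B k)\<^sup>2" unfolding nF using p by (simp add: B_def)
  qed simp
  have 2: "B \<longlonglongrightarrow> sqrt (ftc TYPE('n) * (\<integral>x. (norm (f x))\<^sup>2 \<partial>lborel))"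
  proof -
    have c1: "complex_of_real (gauss ((1 / real (Suc k)) *\<^sub>R \<xi>)) * (ft f \<xi> * cnj (ft f \<xi>)) = complex_of_real (gauss ((1 / real (Suc k)) *\<^sub>R \<xi>) * (norm (ft f \<xi>))\<^sup>2)" for k \<xi>
      by (simp only: of_real_mult complex_norm_square)
    have c2: "f x * cnj (f x) = complex_of_real ((norm (f x))\<^sup>2)" for x by (simp only: complex_norm_square)
    have "(\<lambda>k. complex_of_real (\<integral>\<xi>. gauss ((1 / real (Suc k)) *\<^sub>R \<xi>) * (norm (ft f \<xi>))\<^sup>2 \<partial>lborel)) \<longlonglongrightarrow>
      complex_of_real (ftc TYPE('n) * (\<integral>x. (norm (f x))\<^sup>2 \<partial>lborel))"
      using Parseval_gauss_limit[OF f f] unfolding c1 c2 integral_complex_of_real by (simp add: ftc_def)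
    then have "(\<lambda>k. (\<integral>\<xi>. gauss ((1 / real (Suc k)) *\<^sub>R \<xi>) * (norm (ft f \<xi>))\<^sup>2 \<partial>lborel)) \<longlonglongrightarrow> ftc TYPE('n) * (\<integral>x. (norm (f x))\<^sup>2 \<partial>lborel)"
      by (rule tendsto_of_real_iff[THEN iffD1])
    then show ?thesis unfolding B_def by (rule tendsto_real_sqrt)
  qed
  have 3: "(\<lambda>k. F k \<xi>) \<longlonglongrightarrow> ft f \<xi>" for \<xi>
  proof -
    have "(\<lambda>k. complex_of_real (sqrt (exp (- (((1 / real (Suc k)) *\<^sub>R \<xi>) \<bullet> ((1 / real (Suc k)) *\<^sub>R \<xi>)) / 2))) * ft f \<xi>) \<longlonglongrightarrow> complex_of_real (sqrt (exp (- ((0 *\<^sub>R \<xi>) \<bullet> (0 *\<^sub>R \<xi>)) / 2))) * ft f \<xi>"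
      by (intro tendsto_intros LIMSEQ_Suc[OF lim_1_over_n]) auto
    then show ?thesis by (simp add: F_def gauss_def)
  qed
  have "L2le lborel (ft f) (sqrt (ftc TYPE('n) * (\<integral>x. (norm (f x))\<^sup>2 \<partial>lborel)))"
    using f(1) 3 by (intro L2le_Fatou[OF 1 _ _ 2]) auto
  then show ?thesis
  proof (rule L2le_mono)
    have "sqrt (\<integral>x. (norm (f x))\<^sup>2 \<partial>lborel) \<le> A" using L2le_integral[OF f(2)] nn by (simp add: real_le_lsqrt)
    then show "sqrt (ftc TYPE('n) * (\<integral>x. (norm (f x))\<^sup>2 \<partial>lborel)) \<le> sqrt (ftc TYPE('n)) * A"
      using sqrt_ftc_ge_1[where 'n='n] by (simp add: real_sqrt_mult mult_left_mono)
  qed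
qed

text \<open>With both transforms in L2 their product is integrable, and dominated convergence
  removes the Gaussian.\<close>

theorem Parseval:
  fixes f g :: "real^'n::finite \<Rightarrow> complex"
  assumes f: "integrable lborel f" "L2le lborel f A" and g: "integrable lborel g" "L2le lborel g B"
  shows "(\<integral>\<xi>. ft f \<xi> * cnj (ft g \<xi>) \<partial>lborel) = complex_of_real (ftc TYPE('n)) * (\<integral>x. f x * cnj (g x) \<partial>lborel)"
proof -
  have I: "integrable lborel (\<lambda>\<xi>. ft f \<xi> * cnj (ft g \<xi>))"
    by (rule L1le_integrable[OF L2le_mult[OF ft_L2[OF f] L2le_cnj[OF ft_L2[OF g]]]])
  have "(\<lambda>k. \<integral>\<xi>. complex_of_real (gauss ((1 / real (Suc k)) *\<^sub>R \<xi>)) * (ft f \<xi> * cnj (ft g \<xi>)) \<partial>lborel) \<longlonglongrightarrow> (\<integral>\<xi>. ft f \<xi> * cnj (ft g \<xi>) \<partial>lborel)"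
  proof (rule integral_dominated_convergence[where w="\<lambda>\<xi>. norm (ft f \<xi> * cnj (ft g \<xi>))"])
    show "integrable lborel (\<lambda>\<xi>. norm (ft f \<xi> * cnj (ft g \<xi>)))" using I by (rule integrable_norm)
    show "AE \<xi> in lborel. norm (complex_of_real (gauss ((1 / real (Suc k)) *\<^sub>R \<xi>)) * (ft f \<xi> * cnj (ft g \<xi>))) \<le> norm (ft f \<xi> * cnj (ft g \<xi>))" for k
      using gauss_bounds by (intro AE_I2) (auto simp: norm_mult abs_of_pos[OF gauss_bounds(1)] less_imp_le[OF gauss_bounds(1)] intro!: mult_left_le_one_le)
    have "(\<lambda>k. complex_of_real (gauss ((1 / real (Suc k)) *\<^sub>R \<xi>)) * (ft f \<xi> * cnj (ft g \<xi>))) \<longlonglongrightarrow> complex_of_real (gauss (0 *\<^sub>R \<xi>)) * (ft f \<xi> * cnj (ft g \<xi>))" for \<xi>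
      unfolding gauss_def by (intro tendsto_intros LIMSEQ_Suc[OF lim_1_over_n]) auto
    then show "AE \<xi> in lborel. (\<lambda>k. complex_of_real (gauss ((1 / real (Suc k)) *\<^sub>R \<xi>)) * (ft f \<xi> * cnj (ft g \<xi>))) \<longlonglongrightarrow> ft f \<xi> * cnj (ft g \<xi>)"
      by (simp add: gauss_def)
  qed (use f g in measurable)
  with Parseval_gauss_limit[OF f g] show ?thesis unfolding ftc_def by (rule LIMSEQ_unique[rotated])
qed

lemma ft_L2_converse:
  fixes f :: "real^'n::finite \<Rightarrow> complex"
  assumes f: "integrable lborel f" "L2le lborel f A" and F: "L2le lborel (ft f) (sqrt (ftc TYPE('n)) * B)"
  shows "L2le lborel f B"
proof (rule L2leI_integrable)
  have s: "ftc TYPE('n) > 0" "sqrt (ftc TYPE('n)) > 0" using ftc_ge_1[where 'n='n] sqrt_ftc_ge_1[where 'n='n] by auto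
  show "0 \<le> B" using L2le_nonneg[OF F] s by (simp add: zero_le_mult_iff)
  have c2: "f x * cnj (f x) = complex_of_real ((norm (f x))\<^sup>2)" for f :: "real^'n \<Rightarrow> complex" and x by (simp only: complex_norm_square)
  have "complex_of_real (\<integral>x. (norm (ft f x))\<^sup>2 \<partial>lborel) = complex_of_real (ftc TYPE('n) * (\<integral>x. (norm (f x))\<^sup>2 \<partial>lborel))"
    using Parseval[OF f f] unfolding c2 integral_complex_of_real by simp
  then have "(\<integral>x. (norm (ft f x))\<^sup>2 \<partial>lborel) = ftc TYPE('n) * (\<integral>x. (norm (f x))\<^sup>2 \<partial>lborel)" using of_real_eq_iff by blast
  moreover have "(\<integral>x. (norm (ft f x))\<^sup>2 \<partial>lborel) \<le> ftc TYPE('n) * B\<^sup>2"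
    using L2le_integral[OF F] s by (simp add: power_mult_distrib)
  ultimately show "(\<integral>x. (norm (f x))\<^sup>2 \<partial>lborel) \<le> B\<^sup>2" using s by simp
qed (use f L2le_integrable in auto)

section \<open>The inverse transform\<close>

definition ift :: "(real^'n::finite \<Rightarrow> complex) \<Rightarrow> real^'n \<Rightarrow> complex" where
  "ift F x = ft F (- x) / complex_of_real (ftc TYPE('n))"

lemma ift_bound: assumes "L1le lborel F A" shows "norm (ift F x) \<le> A"
proof -
  have "norm (ift F x) \<le> A / ftc TYPE('a)"
    unfolding ift_def using ft_bound[OF assms, of "-x"] ftc_ge_1[where 'n='a] by (simp add: norm_divide divide_right_mono)
  also have "\<dots> \<le> A / 1" using ftc_ge_1[where 'n='a] L1le_nonneg[OF assms] by (intro divide_left_mono) auto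
  finally show ?thesis by simp
qed

lemma ift_continuous: "integrable lborel F \<Longrightarrow> continuous_on UNIV (ift F)"
  unfolding ift_def[abs_def] using ftc_ge_1[where 'n='a]
  by (intro continuous_intros continuous_on_compose2[OF ft_continuous]) auto

lemma ift_measurable[measurable]: "integrable lborel F \<Longrightarrow> ift F \<in> borel_measurable borel"
  by (intro borel_measurable_continuous_onI ift_continuous)

lemma ift_diff: "integrable lborel f \<Longrightarrow> integrable lborel g \<Longrightarrow> ift (\<lambda>x. f x - g x) x = ift f x - ift g x"
  unfolding ift_def by (simp add: ft_diff diff_divide_distrib)

lemma ift_shift:
  "ift F (y + x) = ift (\<lambda>\<xi>. exp (\<i> * complex_of_real (y \<bullet> \<xi>)) * F \<xi>) x"
proof -
  have "ft F (- (y + x)) = ft (\<lambda>\<xi>. exp (\<i> * complex_of_real (y \<bullet> \<xi>)) * F \<xi>) (- x)"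
    unfolding ft_def
  proof (rule Bochner_Integration.integral_cong[OF refl])
    fix \<xi>
    have "- \<i> * complex_of_real (\<xi> \<bullet> - (y + x)) = - \<i> * complex_of_real (\<xi> \<bullet> - x) + \<i> * complex_of_real (y \<bullet> \<xi>)"
      by (simp add: inner_add_right inner_diff_right inner_commute[of \<xi> y] ring_distribs)
    then show "exp (- \<i> * complex_of_real (\<xi> \<bullet> - (y + x))) * F \<xi> = exp (- \<i> * complex_of_real (\<xi> \<bullet> - x)) * (exp (\<i> * complex_of_real (y \<bullet> \<xi>)) * F \<xi>)"
      by (simp only: exp_add mult.assoc)
  qed
  then show ?thesis by (simp add: ift_def)
qed

text \<open>As in \<open>ift_bound\<close>, the sharp constant is a negative power of 2 pi and is
  relaxed to 1, so that bounds pass from the Fourier side to the physical side unchanged.\<close>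

lemma ift_L2:
  fixes F :: "real^'n::finite \<Rightarrow> complex"
  assumes F: "integrable lborel F" "L2le lborel F A"
  shows "L2le lborel (ift F) A"
proof -
  have s: "ftc TYPE('n) \<ge> 1" "sqrt (ftc TYPE('n)) \<ge> 1" using ftc_ge_1 sqrt_ftc_ge_1 by auto
  have "L2le lborel (\<lambda>x. ft F (- x)) (sqrt (ftc TYPE('n)) * A)"
    using lborel_shift_reflect(1)[of "ft F" "-1" 0] ft_L2[OF F] ft_measurable[OF F(1)] by simp
  then have "L2le lborel (ift F) ((1 / ftc TYPE('n)) * (sqrt (ftc TYPE('n)) * A))"
    by (rule L2le_dom) (use ift_measurable[OF F(1)] s in \<open>auto simp: ift_def norm_divide\<close>)
  then show ?thesis
  proof (rule L2le_mono)
    have "sqrt (ftc TYPE('n)) * sqrt (ftc TYPE('n)) = ftc TYPE('n)" using s by simp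
    then have "sqrt (ftc TYPE('n)) * 1 \<le> ftc TYPE('n)" using mult_left_mono[OF s(2), of "sqrt (ftc TYPE('n))"] s by simp
    then have "sqrt (ftc TYPE('n)) * A \<le> ftc TYPE('n) * A" using L2le_nonneg[OF F(2)] by (simp add: mult_right_mono)
    then show "1 / ftc TYPE('n) * (sqrt (ftc TYPE('n)) * A) \<le> A" using s by (simp add: field_simps)
  qed
qed

lemma ift_real:
  assumes F[measurable]: "F \<in> borel_measurable borel" and h: "\<And>\<xi>. F (- \<xi>) = cnj (F \<xi>)"
  shows "ift F x = complex_of_real (Re (ift F x))"
proof -
  have "cnj (ft F (- x)) = ft (\<lambda>\<xi>. cnj (F \<xi>)) x" by (simp add: ft_cnj)
  also have "\<dots> = ft (\<lambda>\<xi>. F (- \<xi>)) x" by (simp add: h)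
  also have "\<dots> = ft F (- x)" by (rule ft_reflect) measurable
  finally have "cnj (ift F x) = ift F x" by (simp add: ift_def)
  then show ?thesis by (metis complex_cnj_cancel_iff complex_is_Real_iff Reals_cnj_iff of_real_Re)
qed

lemma ift_mult_formula:
  fixes F :: "real^'n::finite \<Rightarrow> complex"
  assumes F: "integrable lborel F" and g: "integrable lborel g"
  shows "(\<integral>x. ift F x * g x \<partial>lborel) = (\<integral>\<xi>. F \<xi> * ft g (- \<xi>) \<partial>lborel) / complex_of_real (ftc TYPE('n))"
proof -
  have [measurable]: "F \<in> borel_measurable borel" using F by auto
  have [measurable]: "g \<in> borel_measurable borel" using g by auto
  have F': "integrable lborel (\<lambda>\<xi>. F (- \<xi>))" using lborel_shift_reflect(3)[of F "-1" 0] F by simp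
  have "(\<integral>x. ft F (- x) * g x \<partial>lborel) = (\<integral>x. ft (\<lambda>\<xi>. F (- \<xi>)) x * g x \<partial>lborel)" by (simp add: ft_reflect)
  also have "\<dots> = (\<integral>\<xi>. F (0 + (-1) *\<^sub>R \<xi>) * ft g (- (0 + (-1) *\<^sub>R \<xi>)) \<partial>lborel)" using ft_mult_formula[OF F' g] by simp
  also have "\<dots> = (\<integral>\<xi>. F \<xi> * ft g (- \<xi>) \<partial>lborel)"
    by (rule lborel_shift_reflect(4)[of "\<lambda>\<xi>. F \<xi> * ft g (- \<xi>)"]) (use ft_measurable[OF g] in auto)
  finally show ?thesis by (simp add: ift_def)
qed

text \<open>This is the pairing in which the mild identity is phrased. It is Parseval for the
  reflections of F and of the conjugate of g.\<close>

lemma ift_ft_pairing: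
  fixes F :: "real^'n::finite \<Rightarrow> complex"
  assumes F: "integrable lborel F" "L2le lborel F A" and g: "integrable lborel g" "L2le lborel g B"
  shows "(\<integral>x. ift F x * ft g x \<partial>lborel) = (\<integral>\<xi>. F \<xi> * g \<xi> \<partial>lborel)"
proof -
  have [measurable]: "F \<in> borel_measurable borel" using F by auto
  have [measurable]: "g \<in> borel_measurable borel" using g by auto
  define F' where "F' \<xi> = F (- \<xi>)" for \<xi>
  define g' where "g' \<xi> = cnj (g (- \<xi>))" for \<xi>
  have F': "integrable lborel F'" "L2le lborel F' A"
    unfolding F'_def using lborel_shift_reflect(1,3)[of F "-1" 0] F by auto
  have g': "integrable lborel g'" "L2le lborel g' B"
    unfolding g'_def using lborel_shift_reflect(1,3)[of "\<lambda>x. cnj (g x)" "-1" 0] g L2le_cnj[OF g(2)] by auto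
  have 1: "ft F' x = ft F (- x)" for x unfolding F'_def by (rule ft_reflect) measurable
  have 2: "cnj (ft g' x) = ft g x" for x
  proof -
    have "ft g' x = ft (\<lambda>x. cnj (g x)) (- x)" unfolding g'_def by (rule ft_reflect[of "\<lambda>x. cnj (g x)"]) measurable
    then show ?thesis by (simp add: ft_cnj)
  qed
  have "(\<integral>x. ft F (- x) * ft g x \<partial>lborel) = complex_of_real (ftc TYPE('n)) * (\<integral>x. F' x * cnj (g' x) \<partial>lborel)"
    using Parseval[OF F' g'] unfolding 1 2 .
  also have "(\<integral>x. F' x * cnj (g' x) \<partial>lborel) = (\<integral>x. F (0 + (-1) *\<^sub>R x) * g (0 + (-1) *\<^sub>R x) \<partial>lborel)"
    by (simp add: F'_def g'_def)
  also have "\<dots> = (\<integral>x. F x * g x \<partial>lborel)" by (rule lborel_shift_reflect(4)[of "\<lambda>x. F x * g x"]) auto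
  finally show ?thesis using ftc_ge_1[where 'n='n] by (simp add: ift_def field_simps)
qed

subsection \<open>Weak derivatives on the Fourier side\<close>

definition cx :: "('a \<Rightarrow> real) \<Rightarrow> 'a \<Rightarrow> complex" where "cx f x = complex_of_real (f x)"

lemma cx_measurable[measurable]: "f \<in> borel_measurable M \<Longrightarrow> cx f \<in> borel_measurable M"
  unfolding cx_def[abs_def] by measurable

lemma norm_cx[simp]: "norm (cx f x) = \<bar>f x\<bar>"
  by (simp add: cx_def)

lemma cx_integrable: "integrable M f \<Longrightarrow> integrable M (cx f)"
  unfolding cx_def[abs_def] by (rule integrable_of_real)

lemma cx_L2le: "L2le M f A \<Longrightarrow> L2le M (cx f) A"
  unfolding L2le_def by (auto simp: cx_def)

lemma iexp_minus_one_bound: "norm (exp (\<i> * complex_of_real r) - 1) \<le> \<bar>r\<bar>"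
  using iexp_approx1[of r 0] by simp

lemma L2_truncation:
  fixes F :: "real^'n::finite \<Rightarrow> complex"
  assumes F: "L2le lborel F A" and e: "\<epsilon> > 0"
  shows "\<exists>k::nat. L2le lborel (\<lambda>\<xi>. indicator (cball 0 (real k)) \<xi> *\<^sub>R F \<xi> - F \<xi>) \<epsilon>"
proof -
  have [measurable]: "F \<in> borel_measurable borel" using F by (auto simp: L2le_def)
  have "eventually (\<lambda>k. L2le lborel (\<lambda>\<xi>. indicator (cball 0 (real k)) \<xi> *\<^sub>R F \<xi> - F \<xi>) \<epsilon>) sequentially"
  proof (rule L2le_dominated_convergence[OF _ F])
    show "AE x in lborel. norm (indicator (cball 0 (real k)) x *\<^sub>R F x - F x) \<le> norm (F x)" for k
      by (intro AE_I2) (auto simp: indicator_def)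
    have "(\<lambda>k. indicator (cball 0 (real k)) x *\<^sub>R F x - F x) \<longlonglongrightarrow> 0" for x
    proof (rule tendsto_eventually)
      obtain N :: nat where "norm x < real N" using reals_Archimedean2 by blast
      then show "eventually (\<lambda>k. indicator (cball 0 (real k)) x *\<^sub>R F x - F x = 0) sequentially"
        by (intro eventually_sequentiallyI[of N]) auto
    qed
    then show "AE x in lborel. (\<lambda>k. indicator (cball 0 (real k)) x *\<^sub>R F x - F x) \<longlonglongrightarrow> 0" by simp
    show "(\<lambda>\<xi>. indicator (cball 0 (real k)) \<xi> *\<^sub>R F \<xi> - F \<xi>) \<in> borel_measurable lborel" for k
      by (intro borel_measurable_diff borel_measurable_scaleR borel_measurable_indicator) auto
  qed fact
  then show ?thesis by (rule eventually_happens'[OF sequentially_bot])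
qed

lemma L2_truncation_integrable:
  fixes F :: "real^'n::finite \<Rightarrow> complex"
  assumes F: "L2le lborel F A"
  shows "integrable lborel (\<lambda>\<xi>. indicator (cball 0 R) \<xi> *\<^sub>R F \<xi>)" "L2le lborel (\<lambda>\<xi>. indicator (cball 0 R) \<xi> *\<^sub>R F \<xi>) A"
proof -
  have [measurable]: "F \<in> borel_measurable borel" using F by (auto simp: L2le_def)
  obtain c where c: "L2le lborel (indicator (cball 0 R) :: real^'n \<Rightarrow> real) c"
    using L2le_indicator[OF _ emeasure_bounded_finite[OF bounded_cball]] by auto
  from L1le_integrable[OF L2le_mult[OF cx_L2le[OF c] F]]
  show "integrable lborel (\<lambda>\<xi>. indicator (cball 0 R) \<xi> *\<^sub>R F \<xi>)" by (simp add: cx_def scaleR_conv_of_real)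
  show "L2le lborel (\<lambda>\<xi>. indicator (cball 0 R) \<xi> *\<^sub>R F \<xi>) A"
    by (rule L2le_dom1[OF F]) (auto simp: indicator_def)
qed

lemma test_fun_cx: assumes "test_fun \<theta>" shows "integrable lborel (cx \<theta>)" "\<exists>c. L2le lborel (cx \<theta>) c"
  using cx_integrable[OF test_fun_integrable[OF assms]] test_fun_L2[OF assms] by (auto intro: cx_L2le)

text \<open>For F merely in L2 the integral defining \<open>ift F\<close> may fail to exist. F is
  truncated to balls with L2 errors (1/2)^k / 2; the inverse transforms of the truncations then
  satisfy the increment hypothesis of \<open>L2_Riesz_Fischer\<close>, and their limit is identified
  by its pairings with test functions.\<close>

lemma L2_inverse_ft:
  fixes F :: "real^'n::finite \<Rightarrow> complex"
  assumes F: "L2le lborel F A"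
  shows "\<exists>g. L2le lborel g A \<and> (\<forall>\<theta>. test_fun \<theta> \<longrightarrow>
     (\<integral>x. g x * cx \<theta> x \<partial>lborel) = (\<integral>\<xi>. F \<xi> * ft (cx \<theta>) (- \<xi>) \<partial>lborel) / complex_of_real (ftc TYPE('n)))"
proof -
  have [measurable]: "F \<in> borel_measurable borel" using F by (auto simp: L2le_def)
  have "\<exists>r. \<forall>k. L2le lborel (\<lambda>\<xi>. indicator (cball 0 (real (r k))) \<xi> *\<^sub>R F \<xi> - F \<xi>) ((1/2) ^ k / 2)"
    using L2_truncation[OF F] by (intro choice allI) auto
  then obtain r :: "nat \<Rightarrow> nat" where r: "\<And>k. L2le lborel (\<lambda>\<xi>. indicator (cball 0 (real (r k))) \<xi> *\<^sub>R F \<xi> - F \<xi>) ((1/2) ^ k / 2)"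
    by blast
  define G where "G k \<xi> = indicator (cball 0 (real (r k))) \<xi> *\<^sub>R F \<xi>" for k \<xi>
  have G: "integrable lborel (G k)" "L2le lborel (G k) A" "L2le lborel (\<lambda>\<xi>. G k \<xi> - F \<xi>) ((1/2) ^ k / 2)" for k
    unfolding G_def using L2_truncation_integrable[OF F] r by auto
  have "L2le lborel (\<lambda>x. ift (G (Suc k)) x - ift (G k) x) ((1/2) ^ k)" for k
  proof -
    have "L2le lborel (\<lambda>\<xi>. G (Suc k) \<xi> - G k \<xi>) ((1/2) ^ Suc k / 2 + (1/2) ^ k / 2)"
      using L2le_diff[OF G(3)[of "Suc k"] G(3)[of k]] by simp
    then have "L2le lborel (\<lambda>\<xi>. G (Suc k) \<xi> - G k \<xi>) ((1/2) ^ k)" by (rule L2le_mono) simp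
    from ift_L2[OF _ this] have "L2le lborel (ift (\<lambda>\<xi>. G (Suc k) \<xi> - G k \<xi>)) ((1/2) ^ k)" using G(1) by auto
    then show ?thesis by (simp add: ift_diff[OF G(1) G(1), abs_def])
  qed
  from L2_Riesz_Fischer[of "\<lambda>k. ift (G k)", OF _ this] ift_measurable[OF G(1)]
  obtain g where g: "g \<in> borel_measurable lborel" "AE x in lborel. (\<lambda>k. ift (G k) x) \<longlonglongrightarrow> g x"
     "\<And>k. L2le lborel (\<lambda>x. g x - ift (G k) x) (2 * (1/2) ^ k)" by auto
  have gA: "L2le lborel g A"
    by (rule L2le_Fatou[OF _ g(1,2) tendsto_const]) (rule ift_L2[OF G(1,2)])
  have half: "(\<lambda>k. (1/2::real) ^ k) \<longlonglongrightarrow> 0" by (rule LIMSEQ_realpow_zero) auto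
  have "(\<integral>x. g x * cx \<theta> x \<partial>lborel) = (\<integral>\<xi>. F \<xi> * ft (cx \<theta>) (- \<xi>) \<partial>lborel) / complex_of_real (ftc TYPE('n))"
    if t: "test_fun \<theta>" for \<theta>
  proof -
    note ti = test_fun_cx(1)[OF t]
    obtain c where c: "L2le lborel (cx \<theta>) c" using test_fun_cx(2)[OF t] by blast
    let ?c = "sqrt (ftc TYPE('n)) * c"
    have c': "L2le lborel (\<lambda>\<xi>. ft (cx \<theta>) (- \<xi>)) ?c"
      using lborel_shift_reflect(1)[of "ft (cx \<theta>)" "-1" 0] ft_L2[OF ti c] ft_measurable[OF ti] by simp
    have 1: "(\<lambda>k. \<integral>x. ift (G k) x * cx \<theta> x \<partial>lborel) \<longlonglongrightarrow> (\<integral>x. g x * cx \<theta> x \<partial>lborel)"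
    proof (rule metric_tendsto_imp_tendsto[where f="\<lambda>k. (2 * (1/2) ^ k) * c" and a=0])
      show "(\<lambda>k. (2 * (1/2::real) ^ k) * c) \<longlonglongrightarrow> 0" using tendsto_mult_right[OF tendsto_mult_left[OF half, of 2], of c] by simp
      have "dist (\<integral>x. ift (G k) x * cx \<theta> x \<partial>lborel) (\<integral>x. g x * cx \<theta> x \<partial>lborel) \<le> dist ((2 * (1/2) ^ k) * c) 0" for k
      proof -
        have "(\<integral>x. g x * cx \<theta> x \<partial>lborel) - (\<integral>x. ift (G k) x * cx \<theta> x \<partial>lborel) = (\<integral>x. g x * cx \<theta> x - ift (G k) x * cx \<theta> x \<partial>lborel)"
          by (intro Bochner_Integration.integral_diff[symmetric] L1le_integrable[OF L2le_mult[OF gA c]] L1le_integrable[OF L2le_mult[OF ift_L2[OF G(1,2)] c]])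
        also have "\<dots> = (\<integral>x. (g x - ift (G k) x) * cx \<theta> x \<partial>lborel)" by (simp only: left_diff_distrib)
        finally have "norm ((\<integral>x. g x * cx \<theta> x \<partial>lborel) - (\<integral>x. ift (G k) x * cx \<theta> x \<partial>lborel)) \<le> (2 * (1/2) ^ k) * c"
          using L1le_integral[OF L2le_mult[OF g(3) c]] by simp
        then show ?thesis by (simp add: dist_norm norm_minus_commute)
      qed
      then show "eventually (\<lambda>k. dist (\<integral>x. ift (G k) x * cx \<theta> x \<partial>lborel) (\<integral>x. g x * cx \<theta> x \<partial>lborel) \<le> dist ((2 * (1/2) ^ k) * c) 0) sequentially"
        by simp
    qed
    have 2: "(\<lambda>k. \<integral>\<xi>. G k \<xi> * ft (cx \<theta>) (- \<xi>) \<partial>lborel) \<longlonglongrightarrow> (\<integral>\<xi>. F \<xi> * ft (cx \<theta>) (- \<xi>) \<partial>lborel)"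
    proof (rule metric_tendsto_imp_tendsto[where f="\<lambda>k. ((1/2) ^ k / 2) * ?c" and a=0])
      show "(\<lambda>k. ((1/2::real) ^ k / 2) * ?c) \<longlonglongrightarrow> 0" using tendsto_mult_right[OF tendsto_mult_right[OF half, of "1/2"], of ?c] by simp
      have "dist (\<integral>\<xi>. G k \<xi> * ft (cx \<theta>) (- \<xi>) \<partial>lborel) (\<integral>\<xi>. F \<xi> * ft (cx \<theta>) (- \<xi>) \<partial>lborel) \<le> dist (((1/2) ^ k / 2) * ?c) 0" for k
      proof -
        have "(\<integral>\<xi>. G k \<xi> * ft (cx \<theta>) (- \<xi>) \<partial>lborel) - (\<integral>\<xi>. F \<xi> * ft (cx \<theta>) (- \<xi>) \<partial>lborel) = (\<integral>\<xi>. G k \<xi> * ft (cx \<theta>) (- \<xi>) - F \<xi> * ft (cx \<theta>) (- \<xi>) \<partial>lborel)"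
          by (intro Bochner_Integration.integral_diff[symmetric] L1le_integrable[OF L2le_mult[OF G(2) c']] L1le_integrable[OF L2le_mult[OF F c']])
        also have "\<dots> = (\<integral>\<xi>. (G k \<xi> - F \<xi>) * ft (cx \<theta>) (- \<xi>) \<partial>lborel)" by (simp only: left_diff_distrib)
        finally have "norm ((\<integral>\<xi>. G k \<xi> * ft (cx \<theta>) (- \<xi>) \<partial>lborel) - (\<integral>\<xi>. F \<xi> * ft (cx \<theta>) (- \<xi>) \<partial>lborel)) \<le> ((1/2) ^ k / 2) * ?c"
          using L1le_integral[OF L2le_mult[OF G(3) c']] by simp
        then show ?thesis unfolding dist_norm by (rule order_trans) simp
      qed
      then show "eventually (\<lambda>k. dist (\<integral>\<xi>. G k \<xi> * ft (cx \<theta>) (- \<xi>) \<partial>lborel) (\<integral>\<xi>. F \<xi> * ft (cx \<theta>) (- \<xi>) \<partial>lborel) \<le> dist (((1/2) ^ k / 2) * ?c) 0) sequentially"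
        by simp
    qed
    have 3: "(\<integral>x. ift (G k) x * cx \<theta> x \<partial>lborel) = (\<integral>\<xi>. G k \<xi> * ft (cx \<theta>) (- \<xi>) \<partial>lborel) / complex_of_real (ftc TYPE('n))" for k
      by (rule ift_mult_formula[OF G(1) ti])
    have "(\<lambda>k. \<integral>x. ift (G k) x * cx \<theta> x \<partial>lborel) \<longlonglongrightarrow> (\<integral>\<xi>. F \<xi> * ft (cx \<theta>) (- \<xi>) \<partial>lborel) / complex_of_real (ftc TYPE('n))"
      unfolding 3 by (intro tendsto_divide 2 tendsto_const) (use ftc_ge_1[where 'n='n] in simp)
    with 1 show ?thesis by (rule LIMSEQ_unique)
  qed
  then show ?thesis using gA by blast
qed

text \<open>The mean value theorem along a coordinate line. Keeping a compactly supported factor on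
  the right provides an integrable majorant for all difference quotients with step at most
  1.\<close>

lemma test_fun_lipschitz:
  assumes t: "test_fun \<theta>"
  shows "\<exists>B R. B \<ge> 0 \<and> (\<forall>x t. \<bar>t\<bar> \<le> 1 \<longrightarrow> \<bar>\<theta> (t *\<^sub>R axis i 1 + x) - \<theta> x\<bar> \<le> \<bar>t\<bar> * (B * indicator (cball 0 R) x))"
proof -
  obtain B R where B: "B \<ge> 0" "\<And>x. norm (pd i \<theta> x) \<le> B * indicator (cball 0 R) x"
    using test_fun_bound[OF test_fun_pd[OF t, of i]] by blast
  have "\<bar>\<theta> (t *\<^sub>R axis i 1 + x) - \<theta> x\<bar> \<le> \<bar>t\<bar> * (B * indicator (cball 0 (R + 1)) x)" if "\<bar>t\<bar> \<le> 1" for x t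
  proof -
    let ?f = "\<lambda>s. \<theta> (x + s *\<^sub>R axis i 1)"
    have bd: "norm (pd i \<theta> (x + s *\<^sub>R axis i 1)) \<le> B * indicator (cball 0 (R + 1)) x" if "\<bar>s\<bar> \<le> 1" for s
    proof (cases "x + s *\<^sub>R axis i 1 \<in> cball 0 R")
      case True
      have "norm x \<le> norm (x + s *\<^sub>R axis i (1::real)) + norm (s *\<^sub>R axis i (1::real))"
        by (metis add_diff_cancel norm_triangle_ineq4)
      also have "\<dots> \<le> R + 1" using True that by (simp add: norm_axis_1)
      finally show ?thesis using B(2)[of "x + s *\<^sub>R axis i 1"] True by simp
    next
      case False
      then show ?thesis using B(2)[of "x + s *\<^sub>R axis i 1"] B(1) by (simp add: indicator_def)
    qed
    have "norm (?f t - ?f 0) \<le> (B * indicator (cball 0 (R + 1)) x) * norm (t - 0)"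
    proof (rule field_differentiable_bound[where S="{-1..1}"])
      show "(?f has_field_derivative pd i \<theta> (x + s *\<^sub>R axis i 1)) (at s within {-1..1})" for s
        using test_fun_has_pd[OF t, of x i s] by (rule has_field_derivative_at_within)
      show "norm (pd i \<theta> (x + s *\<^sub>R axis i 1)) \<le> B * indicator (cball 0 (R + 1)) x" if "s \<in> {-1..1}" for s
        using that by (intro bd) auto
    qed (use that in auto)
    then show ?thesis by (simp add: add.commute mult.commute)
  qed
  then show ?thesis using B(1) by blast
qed

text \<open>The difference quotients with step 1/(k+1) converge in the integral by domination. On
  the Fourier side they are multiplication by a quotient that tends to the derivative at 0 of an
  exponential. Comparing both limits avoids integrating by parts.\<close>

lemma ft_pd:
  assumes t: "test_fun \<theta>"
  shows "ft (cx (pd i \<theta>)) \<xi> = \<i> * complex_of_real (\<xi> $ i) * ft (cx \<theta>) \<xi>"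
proof -
  note [measurable] = test_fun_measurable[OF t] test_fun_measurable[OF test_fun_pd[OF t, of i]]
  obtain B R where B: "B \<ge> 0" "\<And>x t. \<bar>t\<bar> \<le> 1 \<Longrightarrow> \<bar>\<theta> (t *\<^sub>R axis i 1 + x) - \<theta> x\<bar> \<le> \<bar>t\<bar> * (B * indicator (cball 0 R) x)"
    using test_fun_lipschitz[OF t, of i] by blast
  let ?e = "\<lambda>k. 1 / real (Suc k)"
  define D where "D k x = complex_of_real (real (Suc k)) * (cx \<theta> (?e k *\<^sub>R axis i 1 + x) - cx \<theta> x)" for k x
  have [measurable]: "D k \<in> borel_measurable borel" for k unfolding D_def by measurable
  have e0: "?e \<longlonglongrightarrow> 0" by (rule LIMSEQ_Suc[OF lim_1_over_n])
  have e1: "filterlim ?e (at 0) sequentially" using e0 by (simp add: filterlim_at)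
  have Dlim: "(\<lambda>k. D k x) \<longlonglongrightarrow> cx (pd i \<theta>) x" for x
  proof -
    have "((\<lambda>t. (\<theta> (x + t *\<^sub>R axis i 1) - \<theta> (x + 0 *\<^sub>R axis i 1)) / (t - 0)) \<longlongrightarrow> pd i \<theta> x) (at 0)"
      using test_fun_has_pd[OF t, of x i 0] by (simp add: has_field_derivative_iff)
    from filterlim_compose[OF this e1]
    have "(\<lambda>k. complex_of_real ((\<theta> (x + ?e k *\<^sub>R axis i 1) - \<theta> (x + 0 *\<^sub>R axis i 1)) / (?e k - 0))) \<longlonglongrightarrow> complex_of_real (pd i \<theta> x)"
      by (rule tendsto_of_real)
    moreover have "complex_of_real ((\<theta> (x + ?e k *\<^sub>R axis i 1) - \<theta> (x + 0 *\<^sub>R axis i 1)) / (?e k - 0)) = D k x" for k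
      by (simp add: D_def cx_def add.commute mult.commute)
    ultimately show ?thesis by (simp add: cx_def)
  qed
  have Db: "norm (D k x) \<le> B * indicator (cball 0 R) x" for k x
  proof -
    have "norm (D k x) = real (Suc k) * \<bar>\<theta> (?e k *\<^sub>R axis i 1 + x) - \<theta> x\<bar>"
      by (simp only: D_def cx_def norm_mult norm_of_real of_real_diff[symmetric] abs_of_nat)
    also have "\<dots> \<le> real (Suc k) * (\<bar>?e k\<bar> * (B * indicator (cball 0 R) x))"
      by (intro mult_left_mono B) auto
    also have "\<dots> = B * indicator (cball 0 R) x" by simp
    finally show ?thesis .
  qed
  have "(\<lambda>k. ft (D k) \<xi>) \<longlonglongrightarrow> ft (cx (pd i \<theta>)) \<xi>"
    unfolding ft_def
  proof (rule integral_dominated_convergence[where w="\<lambda>x. B * indicator (cball 0 R) x"])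
    show "integrable lborel (\<lambda>x::real^'a. B * indicator (cball 0 R) x)"
      by (intro integrable_mult_right integrable_real_indicator emeasure_bounded_finite[OF bounded_cball]) auto
    show "AE x in lborel. (\<lambda>k. exp (- \<i> * complex_of_real (x \<bullet> \<xi>)) * D k x) \<longlonglongrightarrow> exp (- \<i> * complex_of_real (x \<bullet> \<xi>)) * cx (pd i \<theta>) x"
      by (intro AE_I2 tendsto_mult_left Dlim)
    show "AE x in lborel. norm (exp (- \<i> * complex_of_real (x \<bullet> \<xi>)) * D k x) \<le> B * indicator (cball 0 R) x" for k
      using Db by (intro AE_I2) (simp add: norm_mult)
  qed measurable
  moreover have "(\<lambda>k. ft (D k) \<xi>) \<longlonglongrightarrow> \<i> * complex_of_real (\<xi> $ i) * ft (cx \<theta>) \<xi>"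
  proof -
    have ti: "integrable lborel (cx \<theta>)" by (rule test_fun_cx(1)[OF t])
    have ts: "integrable lborel (\<lambda>x. cx \<theta> (?e k *\<^sub>R axis i 1 + x))" for k
      using lborel_shift_reflect(3)[of "cx \<theta>" 1 "?e k *\<^sub>R axis i 1"] ti by simp
    have "ft (D k) \<xi> = ((exp (\<i> * complex_of_real (?e k * \<xi> $ i)) - 1) / complex_of_real (?e k)) * ft (cx \<theta>) \<xi>" for k
    proof -
      have "ft (D k) \<xi> = complex_of_real (real (Suc k)) * (ft (\<lambda>x. cx \<theta> (?e k *\<^sub>R axis i 1 + x)) \<xi> - ft (cx \<theta>) \<xi>)"
        unfolding D_def by (simp only: ft_cmult ft_diff[OF ts ti])
      also have "ft (\<lambda>x. cx \<theta> (?e k *\<^sub>R axis i 1 + x)) \<xi> = exp (\<i> * complex_of_real ((?e k *\<^sub>R axis i 1) \<bullet> \<xi>)) * ft (cx \<theta>) \<xi>"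
        by (rule ft_shift) measurable
      also have "(?e k *\<^sub>R axis i 1) \<bullet> \<xi> = ?e k * \<xi> $ i" by (simp add: inner_axis')
      finally show ?thesis by (simp add: field_simps)
    qed
    moreover have "(\<lambda>k. (exp (\<i> * complex_of_real (?e k * \<xi> $ i)) - 1) / complex_of_real (?e k)) \<longlonglongrightarrow> \<i> * complex_of_real (\<xi> $ i)"
    proof -
      have "((\<lambda>z. exp (\<i> * complex_of_real (\<xi> $ i) * z)) has_field_derivative \<i> * complex_of_real (\<xi> $ i)) (at 0)"
        by (auto intro!: derivative_eq_intros)
      then have "((\<lambda>z. (exp (\<i> * complex_of_real (\<xi> $ i) * z) - 1) / z) \<longlongrightarrow> \<i> * complex_of_real (\<xi> $ i)) (at 0)"
        by (simp add: has_field_derivative_iff)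
      moreover have "filterlim (\<lambda>k. complex_of_real (?e k)) (at 0) sequentially"
        by (rule filterlim_atI[OF tendsto_of_real[OF e0, where 'a=complex, simplified of_real_0]]) (simp only: of_real_eq_0_iff, simp)
      ultimately have "(\<lambda>k. (exp (\<i> * complex_of_real (\<xi> $ i) * complex_of_real (?e k)) - 1) / complex_of_real (?e k)) \<longlonglongrightarrow> \<i> * complex_of_real (\<xi> $ i)"
        by (rule filterlim_compose)
      then show ?thesis by (simp only: of_real_mult mult.assoc mult.commute[of "complex_of_real (\<xi> $ i)"])
    qed
    ultimately show ?thesis by (simp only: tendsto_mult_right)
  qed
  ultimately show ?thesis by (rule LIMSEQ_unique)
qed

text \<open>The symbol of the iterated partial derivative along the list: the product of the factors
  i times the corresponding coordinate of \<xi>.\<close>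

definition xi_pow :: "'n list \<Rightarrow> real^'n \<Rightarrow> complex" where
  "xi_pow is \<xi> = (\<Prod>i\<leftarrow>is. \<i> * complex_of_real (\<xi> $ i))"

lemma ft_iter_pd: "test_fun \<theta> \<Longrightarrow> ft (cx (iter_pd is \<theta>)) \<xi> = xi_pow is \<xi> * ft (cx \<theta>) \<xi>"
  by (induction "is") (simp_all add: xi_pow_def ft_pd[OF test_fun_iter_pd])

lemma weak_deriv_lborel:
  fixes u g :: "real^'n::finite \<Rightarrow> real"
  assumes u: "L2le lborel u A" and g: "L2le lborel g B"
    and eq: "\<And>\<theta>. test_fun \<theta> \<Longrightarrow> (\<integral>x. u x * iter_pd is \<theta> x \<partial>lborel) = (-1) ^ length is * (\<integral>x. g x * \<theta> x \<partial>lborel)"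
  shows "weak_deriv is u g"
  unfolding weak_deriv_def
proof (intro allI impI)
  fix \<theta> :: "real^'n \<Rightarrow> real" assume t: "test_fun \<theta>"
  note m[measurable] = test_fun_measurable[OF t] test_fun_measurable[OF test_fun_iter_pd[OF t, of "is"]]
  have [measurable]: "u \<in> borel_measurable borel" "g \<in> borel_measurable borel" using u g by (auto simp: L2le_def)
  obtain c1 c2 where c: "L2le lborel \<theta> c1" "L2le lborel (iter_pd is \<theta>) c2" using test_fun_L2 test_fun_iter_pd t by metis
  have "integrable lborel (\<lambda>x. u x * iter_pd is \<theta> x)" "integrable lborel (\<lambda>x. g x * \<theta> x)"
    by (rule L1le_integrable[OF L2le_mult[OF u c(2)]], rule L1le_integrable[OF L2le_mult[OF g c(1)]])
  then show "integrable lebesgue (\<lambda>x. u x * iter_pd is \<theta> x) \<and> integrable lebesgue (\<lambda>x. g x * \<theta> x) \<and>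
      (\<integral>x. u x * iter_pd is \<theta> x \<partial>lebesgue) = (-1) ^ length is * (\<integral>x. g x * \<theta> x \<partial>lebesgue)"
    using eq[OF t] by (simp add: integrable_completion integral_completion)
qed

text \<open>F is integrable, so its inverse transform is an honest function; the multiple of F by a
  coordinate is only in L2, so the derivative has to come from \<open>L2_inverse_ft\<close>. The
  sign produced by evaluating the transform at -\<xi> is the sign in the definition of a weak
  derivative.\<close>

lemma ift_weak_deriv:
  fixes F :: "real^'n::finite \<Rightarrow> complex"
  assumes F: "integrable lborel F" "L2le lborel F A" and FB: "L2le lborel (\<lambda>\<xi>. complex_of_real (\<xi> $ i) * F \<xi>) B"
  shows "\<exists>g. L2le lborel g B \<and> weak_deriv [i] (\<lambda>x. Re (ift F x)) g"
proof -
  have [measurable]: "F \<in> borel_measurable borel" using F by auto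
  have FB': "L2le lborel (\<lambda>\<xi>. \<i> * complex_of_real (\<xi> $ i) * F \<xi>) B"
    by (rule L2le_dom1[OF FB]) (auto simp: norm_mult)
  obtain g where g: "L2le lborel g B" "\<And>\<theta>. test_fun \<theta> \<Longrightarrow>
     (\<integral>x. g x * cx \<theta> x \<partial>lborel) = (\<integral>\<xi>. (\<i> * complex_of_real (\<xi> $ i) * F \<xi>) * ft (cx \<theta>) (- \<xi>) \<partial>lborel) / complex_of_real (ftc TYPE('n))"
    using L2_inverse_ft[OF FB'] by blast
  have "weak_deriv [i] (\<lambda>x. Re (ift F x)) (\<lambda>x. Re (g x))"
  proof (rule weak_deriv_lborel[OF L2le_Re[OF ift_L2[OF F]] L2le_Re[OF g(1)]])
    fix \<theta> :: "real^'n \<Rightarrow> real" assume t: "test_fun \<theta>"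
    note t' = test_fun_pd[OF t, of i]
    obtain c1 c2 where c: "L2le lborel (cx \<theta>) c1" "L2le lborel (cx (pd i \<theta>)) c2" using test_fun_cx(2) t t' by metis
    have "(\<integral>x. ift F x * cx (pd i \<theta>) x \<partial>lborel) = (\<integral>\<xi>. F \<xi> * ft (cx (pd i \<theta>)) (- \<xi>) \<partial>lborel) / complex_of_real (ftc TYPE('n))"
      by (rule ift_mult_formula[OF F(1) test_fun_cx(1)[OF t']])
    also have "(\<integral>\<xi>. F \<xi> * ft (cx (pd i \<theta>)) (- \<xi>) \<partial>lborel) = (\<integral>\<xi>. - ((\<i> * complex_of_real (\<xi> $ i) * F \<xi>) * ft (cx \<theta>) (- \<xi>)) \<partial>lborel)"
      by (intro Bochner_Integration.integral_cong) (auto simp: ft_pd[OF t])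
    also have "\<dots> / complex_of_real (ftc TYPE('n)) = - (\<integral>x. g x * cx \<theta> x \<partial>lborel)"
      by (subst g(2)[OF t]) simp
    finally have eq: "(\<integral>x. ift F x * cx (pd i \<theta>) x \<partial>lborel) = - (\<integral>x. g x * cx \<theta> x \<partial>lborel)" .
    have "(\<integral>x. Re (ift F x) * pd i \<theta> x \<partial>lborel) = (\<integral>x. Re (ift F x * cx (pd i \<theta>) x) \<partial>lborel)" by (simp add: cx_def)
    also have "\<dots> = Re (\<integral>x. ift F x * cx (pd i \<theta>) x \<partial>lborel)"
      by (rule integral_Re[OF L1le_integrable[OF L2le_mult[OF ift_L2[OF F] c(2)]]])
    also have "\<dots> = - Re (\<integral>x. g x * cx \<theta> x \<partial>lborel)" by (simp add: eq)
    also have "Re (\<integral>x. g x * cx \<theta> x \<partial>lborel) = (\<integral>x. Re (g x * cx \<theta> x) \<partial>lborel)"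
      by (rule integral_Re[symmetric, OF L1le_integrable[OF L2le_mult[OF g(1) c(1)]]])
    also have "\<dots> = (\<integral>x. Re (g x) * \<theta> x \<partial>lborel)" by (simp add: cx_def)
    finally show "(\<integral>x. Re (ift F x) * iter_pd [i] \<theta> x \<partial>lborel) = (-1) ^ length [i] * (\<integral>x. Re (g x) * \<theta> x \<partial>lborel)" by simp
  qed
  then show ?thesis using L2le_Re[OF g(1)] by blast
qed

section \<open>Mollification and the transform of weak derivatives\<close>

lemma iter_pd_reflect:
  assumes "smooth_fun \<eta>"
  shows "iter_pd is (\<lambda>y. \<eta> (x - y)) = (\<lambda>y. (-1) ^ length is * iter_pd is \<eta> (x - y))"
proof (induction "is")
  case (Cons i js)
  have "((\<lambda>t. (-1) ^ length js * iter_pd js \<eta> (x - (y + t *\<^sub>R axis i 1))) has_real_derivative (-1) ^ length js * (- pd i (iter_pd js \<eta>) (x - y))) (at 0)" for y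
  proof -
    have "((\<lambda>t. iter_pd js \<eta> ((x - y) + t *\<^sub>R axis i 1)) has_real_derivative pd i (iter_pd js \<eta>) (x - y)) (at (- 0))"
      using smooth_fun_has_pd[OF smooth_fun_iter_pd[OF assms], of js "x - y" i] by simp
    then have "((\<lambda>t. iter_pd js \<eta> ((x - y) + (- t) *\<^sub>R axis i 1)) has_real_derivative - pd i (iter_pd js \<eta>) (x - y)) (at 0)"
      by (subst (asm) DERIV_mirror)
    then have "((\<lambda>t. iter_pd js \<eta> (x - (y + t *\<^sub>R axis i 1))) has_real_derivative - pd i (iter_pd js \<eta>) (x - y)) (at 0)"
      by (simp add: algebra_simps)
    then show ?thesis by (rule DERIV_cmult)
  qed
  then have "pd i (\<lambda>y. (-1) ^ length js * iter_pd js \<eta> (x - y)) y = (-1) ^ length js * (- pd i (iter_pd js \<eta>) (x - y))" for y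
    unfolding pd_def[of i "\<lambda>y. (-1) ^ length js * iter_pd js \<eta> (x - y)"] by (rule DERIV_imp_deriv)
  then show ?case by (simp add: Cons fun_eq_iff)
qed simp

lemma test_fun_reflect:
  assumes "test_fun \<eta>" shows "test_fun (\<lambda>y. \<eta> (x - y))"
proof -
  have s: "smooth_fun \<eta>" using assms by (simp add: test_fun_def)
  obtain R where R: "\<And>x. norm x > R \<Longrightarrow> \<eta> x = 0" using assms by (auto simp: test_fun_def)
  have "smooth_fun (\<lambda>y. \<eta> (x - y))"
    unfolding smooth_fun_def iter_pd_reflect[OF s]
  proof (intro allI conjI)
    fix js :: "'a list" and i :: 'a and y
    have "continuous_on UNIV (iter_pd js \<eta>)" using s by (simp add: smooth_fun_def)
    from continuous_on_compose2[OF this continuous_on_diff[OF continuous_on_const continuous_on_id]]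
    show "continuous_on UNIV (\<lambda>y. (-1) ^ length js * iter_pd js \<eta> (x - y))"
      by (intro continuous_on_mult_left) auto
    have "((\<lambda>t. iter_pd js \<eta> ((x - y) + t *\<^sub>R axis i 1)) has_real_derivative pd i (iter_pd js \<eta>) (x - y)) (at (- 0))"
      using smooth_fun_has_pd[OF smooth_fun_iter_pd[OF s], of js "x - y" i] by simp
    then have "((\<lambda>t. iter_pd js \<eta> ((x - y) + (- t) *\<^sub>R axis i 1)) has_real_derivative - pd i (iter_pd js \<eta>) (x - y)) (at 0)"
      by (subst (asm) DERIV_mirror)
    then have "((\<lambda>t. iter_pd js \<eta> (x - (y + t *\<^sub>R axis i 1))) has_real_derivative - pd i (iter_pd js \<eta>) (x - y)) (at 0)"
      by (simp add: algebra_simps)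
    from DERIV_cmult[OF this, of "(-1) ^ length js"]
    show "(\<lambda>t. (-1) ^ length js * iter_pd js \<eta> (x - (y + t *\<^sub>R axis i 1))) differentiable at 0"
      using real_differentiable_def by blast
  qed
  moreover have "\<eta> (x - y) = 0" if "norm y > R + norm x" for y
  proof (rule R)
    show "R < norm (x - y)" using that norm_triangle_sub[of y x] by (simp add: norm_minus_commute)
  qed
  ultimately show ?thesis unfolding test_fun_def by blast
qed

lemma cutoff_pos: "k > 0 \<Longrightarrow> x \<in> {a<..<b} \<Longrightarrow> cutoff k a b x > 0"
proof -
  assume k: "k > 0" and x: "x \<in> {a<..<b}"
  have "0 < k * (x - a)" "0 < k * (b - x)" using k x by auto
  then have "0 < k * x + (- k * a)" "0 < (- k) * x + k * b" by (auto simp: algebra_simps)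
  then show ?thesis by (simp add: cutoff_def exp_inv_def)
qed

text \<open>Normalized cut-offs of cubes of half-width 1/(k+1). Their mass is positive because they
  are positive on a nonempty open box. On the support |x . \<xi>| is at most n |\<xi>| / (k+1), so
  the transform tends to the total mass 1 at every \<xi>.\<close>

lemma mollifier_exists:
  "\<exists>\<eta> :: nat \<Rightarrow> real^'n::finite \<Rightarrow> real. (\<forall>k. test_fun (\<eta> k) \<and> (\<forall>x. 0 \<le> \<eta> k x) \<and> (\<integral>x. \<eta> k x \<partial>lborel) = 1)
     \<and> (\<forall>\<xi>. (\<lambda>k. ft (cx (\<eta> k)) \<xi>) \<longlonglongrightarrow> 1)"
proof -
  define h where "h k = 1 / real (Suc k)" for k
  have h: "h k > 0" for k by (simp add: h_def)
  define b :: "nat \<Rightarrow> real^'n \<Rightarrow> real" where "b k = box_cutoff 1 (vec (- h k)) (vec (h k))" for k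
  have tb: "test_fun (b k)" for k unfolding b_def by (rule test_fun_box_cutoff) simp
  have b0: "0 \<le> b k x" for k x unfolding b_def by (rule box_cutoff_bounds)
  have bi: "integrable lborel (b k)" for k by (rule test_fun_integrable[OF tb])
  have pos: "(\<integral>x. b k x \<partial>lborel) > 0" for k
  proof (rule ccontr)
    let ?B = "box (vec (- h k)) (vec (h k)) :: (real^'n) set"
    assume "\<not> (\<integral>x. b k x \<partial>lborel) > 0"
    then have "(\<integral>x. b k x \<partial>lborel) = 0" using integral_nonneg_AE[OF AE_I2[of lborel "\<lambda>x. 0 \<le> b k x", OF b0]] by linarith
    then have "AE x in lborel. b k x = 0" using integral_nonneg_eq_0_iff_AE[OF bi] b0 by simp
    moreover have "x \<notin> ?B" if "b k x = 0" for x
    proof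
      assume "x \<in> ?B"
      then have "b k x > 0" unfolding b_def box_cutoff_def tensor_def
        by (intro prod_pos cutoff_pos) (auto simp: mem_box_cart)
      then show False using that by simp
    qed
    ultimately have "AE x in lborel. x \<notin> ?B" by (elim AE_mp) auto
    then have "?B \<in> null_sets lborel" by (subst (asm) AE_iff_null_sets[symmetric]) auto
    then have "negligible ?B" by (simp add: negligible_iff_null_sets null_sets_completionI)
    moreover have "0 \<in> ?B" using h[of k] by (simp add: mem_box_cart)
    ultimately show False by (metis empty_iff open_box open_not_negligible)
  qed
  \<comment> \<open>The vanishing second summand only brings the scaling into the form covered by
    \<open>test_fun_lincomb\<close>.\<close>
  define \<eta> where "\<eta> k x = (1 / (\<integral>x. b k x \<partial>lborel)) * b k x + 0 * b k x" for k x
  have t: "test_fun (\<eta> k)" for k unfolding \<eta>_def[abs_def] by (rule test_fun_lincomb[OF tb tb])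
  have n0: "0 \<le> \<eta> k x" for k x using pos[of k] b0[of k x] by (simp add: \<eta>_def)
  have i1: "(\<integral>x. \<eta> k x \<partial>lborel) = 1" for k using pos[of k] by (simp add: \<eta>_def)
  have sup: "\<bar>x \<bullet> \<xi>\<bar> \<le> (real CARD('n) * h k) * norm \<xi>" if "\<eta> k x \<noteq> 0" for k x \<xi>
  proof -
    have "x \<in> box (vec (- h k)) (vec (h k))" using that box_cutoff_support[of 1 x] by (force simp: \<eta>_def b_def)
    then have "\<bar>x $ i\<bar> \<le> h k" for i by (auto simp: mem_box_cart abs_le_iff less_imp_le minus_le_iff)
    then have "(\<Sum>i\<in>UNIV. \<bar>x $ i\<bar>) \<le> (\<Sum>i\<in>(UNIV::'n set). h k)" by (intro sum_mono)
    then have "norm x \<le> real CARD('n) * h k" using norm_le_l1_cart[of x] by simp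
    then show ?thesis using Cauchy_Schwarz_ineq2[of x \<xi>] mult_right_mono[of "norm x" _ "norm \<xi>"] by fastforce
  qed
  have lim: "(\<lambda>k. ft (cx (\<eta> k)) \<xi>) \<longlonglongrightarrow> 1" for \<xi>
  proof (rule metric_tendsto_imp_tendsto[where f="\<lambda>k. (real CARD('n) * h k) * norm \<xi>" and a=0])
    have "(\<lambda>k. (real CARD('n) * h k) * norm \<xi>) \<longlonglongrightarrow> (real CARD('n) * 0) * norm \<xi>"
      unfolding h_def by (intro tendsto_intros LIMSEQ_Suc[OF lim_1_over_n])
    then show "(\<lambda>k. (real CARD('n) * h k) * norm \<xi>) \<longlonglongrightarrow> 0" by simp
    have "dist (ft (cx (\<eta> k)) \<xi>) 1 \<le> dist ((real CARD('n) * h k) * norm \<xi>) 0" for k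
    proof -
      let ?c = "(real CARD('n) * h k) * norm \<xi>"
      have ci: "integrable lborel (cx (\<eta> k))" by (rule test_fun_cx(1)[OF t])
      have "ft (cx (\<eta> k)) \<xi> - 1 = ft (cx (\<eta> k)) \<xi> - (\<integral>x. cx (\<eta> k) x \<partial>lborel)"
        using i1[of k] by (simp add: cx_def)
      also have "\<dots> = (\<integral>x. exp (- \<i> * complex_of_real (x \<bullet> \<xi>)) * cx (\<eta> k) x - cx (\<eta> k) x \<partial>lborel)"
        unfolding ft_def by (rule Bochner_Integration.integral_diff[symmetric, OF integrable_phase[OF ci] ci])
      also have "norm \<dots> \<le> (\<integral>x. ?c * \<eta> k x \<partial>lborel)"
      proof (rule Bochner_Integration.integral_norm_bound_integral)
        show "integrable lborel (\<lambda>x. exp (- \<i> * complex_of_real (x \<bullet> \<xi>)) * cx (\<eta> k) x - cx (\<eta> k) x)"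
          by (intro Bochner_Integration.integrable_diff integrable_phase ci)
        show "integrable lborel (\<lambda>x. ?c * \<eta> k x)" by (intro integrable_mult_right test_fun_integrable[OF t])
        show "norm (exp (- \<i> * complex_of_real (x \<bullet> \<xi>)) * cx (\<eta> k) x - cx (\<eta> k) x) \<le> ?c * \<eta> k x" for x
        proof (cases "\<eta> k x = 0")
          case False
          have "norm (exp (- \<i> * complex_of_real (x \<bullet> \<xi>)) * cx (\<eta> k) x - cx (\<eta> k) x) = norm ((exp (\<i> * complex_of_real (- (x \<bullet> \<xi>))) - 1) * cx (\<eta> k) x)"
            by (simp add: left_diff_distrib)
          also have "\<dots> = norm (exp (\<i> * complex_of_real (- (x \<bullet> \<xi>))) - 1) * \<eta> k x" using n0[of k x] by (simp only: norm_mult norm_cx abs_of_nonneg)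
          also have "\<dots> \<le> \<bar>- (x \<bullet> \<xi>)\<bar> * \<eta> k x" by (intro mult_right_mono iexp_minus_one_bound n0)
          also have "\<dots> \<le> ?c * \<eta> k x" using sup[OF False, of \<xi>] n0[of k x] by (intro mult_right_mono) auto
          finally show ?thesis .
        qed (simp add: cx_def)
      qed
      also have "\<dots> = ?c" using i1[of k] by simp
      finally show ?thesis by (simp add: dist_norm)
    qed
    then show "eventually (\<lambda>k. dist (ft (cx (\<eta> k)) \<xi>) 1 \<le> dist ((real CARD('n) * h k) * norm \<xi>) 0) sequentially" by simp
  qed
  show ?thesis using t n0 i1 lim by (intro exI[of _ \<eta>]) blast
qed

text \<open>Minkowski with weight proportional to \<eta>. The proportionality constant is taken
  strictly above A, so that the weight vanishes only where \<eta> does even if A = 0; the excess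
  1/(k+1) is removed at the end.\<close>

lemma convolution_L2:
  fixes g \<eta> :: "real^'n::finite \<Rightarrow> real"
  assumes g: "L2le lborel g A" and e: "integrable lborel \<eta>" "\<And>x. 0 \<le> \<eta> x" "(\<integral>x. \<eta> x \<partial>lborel) = 1"
  shows "L2le lborel (\<lambda>x. \<integral>y. \<eta> y * g (x - y) \<partial>lborel) A"
proof -
  have [measurable]: "g \<in> borel_measurable borel" using g by (auto simp: L2le_def)
  have [measurable]: "\<eta> \<in> borel_measurable borel" using e by auto
  have "L2le lborel (\<lambda>x. \<integral>y. \<eta> y * g (x - y) \<partial>lborel) (A + 1 / real (Suc k))" for k
  proof -
    define B where "B = A + 1 / real (Suc k)"
    have B: "B > 0" "A \<le> B" using L2le_nonneg[OF g] by (auto simp: B_def intro: add_nonneg_pos)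
    have gB: "L2le lborel (\<lambda>x. g (x - y)) B" for y
      using lborel_shift_reflect(1)[of g 1 "-y"] L2le_mono[OF g B(2)] by simp
    have "(\<integral>\<^sup>+x. ennreal ((norm (\<integral>y. \<eta> y * g (x - y) \<partial>lborel))\<^sup>2) \<partial>lborel) \<le> (\<integral>\<^sup>+x. (\<integral>\<^sup>+y. ennreal (norm (\<eta> y * g (x - y))) \<partial>lborel)\<^sup>2 \<partial>lborel)"
    proof (rule nn_integral_mono)
      fix x
      have "ennreal (norm (\<integral>y. \<eta> y * g (x - y) \<partial>lborel)) \<le> (\<integral>\<^sup>+y. ennreal (norm (\<eta> y * g (x - y))) \<partial>lborel)"
      proof (cases "integrable lborel (\<lambda>y. \<eta> y * g (x - y))")
        case True then show ?thesis by (rule integral_norm_bound_ennreal)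
      qed (simp add: not_integrable_integral_eq)
      then show "ennreal ((norm (\<integral>y. \<eta> y * g (x - y) \<partial>lborel))\<^sup>2) \<le> (\<integral>\<^sup>+y. ennreal (norm (\<eta> y * g (x - y))) \<partial>lborel)\<^sup>2"
        by (simp only: ennreal_power[symmetric] norm_ge_zero power_mono zero_le)
    qed
    also have "\<dots> \<le> ennreal ((\<integral>y. B * \<eta> y \<partial>lborel)\<^sup>2)"
    proof (rule nn_integral_Minkowski[OF lborel.sigma_finite_measure_axioms lborel.sigma_finite_measure_axioms])
      show "(\<lambda>(y, x). ennreal (norm (\<eta> y * g (x - y)))) \<in> borel_measurable (lborel \<Otimes>\<^sub>M lborel)" by measurable
      show "(\<lambda>y. B * \<eta> y) \<in> borel_measurable lborel" by measurable
      show "0 \<le> B * \<eta> s" for s using B e(2)[of s] by simp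
      show "B * \<eta> s = 0 \<Longrightarrow> ennreal (norm (\<eta> s * g (x - s))) = 0" for s x using B by simp
      show "integrable lborel (\<lambda>y. B * \<eta> y)" by (intro integrable_mult_right e)
      fix s
      have "L2le lborel (\<lambda>x. \<eta> s * g (x - s)) (\<eta> s * B)"
        by (rule L2le_dom[OF gB[of s]]) (use e(2)[of s] in \<open>auto simp: abs_mult\<close>)
      then show "(\<integral>\<^sup>+x. (ennreal (norm (\<eta> s * g (x - s))))\<^sup>2 \<partial>lborel) \<le> ennreal ((B * \<eta> s)\<^sup>2)"
        unfolding L2le_def by (simp only: ennreal_power norm_ge_zero mult.commute[of B])
    qed
    also have "(\<integral>y. B * \<eta> y \<partial>lborel) = B" using e(3) by simp
    finally show ?thesis using B unfolding L2le_def B_def[symmetric] by simp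
  qed
  moreover have "(\<lambda>k. A + 1 / real (Suc k)) \<longlonglongrightarrow> A + 0" by (intro tendsto_intros LIMSEQ_Suc[OF lim_1_over_n])
  ultimately have "L2le lborel (\<lambda>x. \<integral>y. \<eta> y * g (x - y) \<partial>lborel) (A + 0)" by (rule L2le_limit_bound)
  then show ?thesis by simp
qed

lemma convolution_ft:
  fixes f \<zeta> :: "real^'n::finite \<Rightarrow> real"
  assumes f: "integrable lborel f" and z: "integrable lborel \<zeta>"
  defines "m \<equiv> \<lambda>x. \<integral>y. f y * \<zeta> (x - y) \<partial>lborel"
  shows "integrable lborel m" "ft (cx m) \<xi> = ft (cx f) \<xi> * ft (cx \<zeta>) \<xi>"
proof -
  have [measurable]: "f \<in> borel_measurable borel" using f by auto
  have [measurable]: "\<zeta> \<in> borel_measurable borel" using z by auto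
  have sh: "integrable lborel (\<lambda>x. \<zeta> (x - y))" "(\<integral>x. norm (\<zeta> (x - y)) \<partial>lborel) = (\<integral>x. norm (\<zeta> x) \<partial>lborel)" for y
    using lborel_shift_reflect(3)[of \<zeta> 1 "-y"] lborel_shift_reflect(4)[of "\<lambda>x. norm (\<zeta> x)" 1 "-y"] z by auto
  have I: "integrable (lborel \<Otimes>\<^sub>M lborel) (\<lambda>(y, x). f y * \<zeta> (x - y))"
  proof (rule lborel_pair.Fubini_integrable)
    show "integrable lborel (\<lambda>y. LINT x|lborel. norm (case (y, x) of (y, x) \<Rightarrow> f y * \<zeta> (x - y)))"
      using f sh(2) by (simp add: abs_mult)
    show "AE y in lborel. integrable lborel (\<lambda>x. case (y, x) of (y, x) \<Rightarrow> f y * \<zeta> (x - y))"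
      using sh(1) by simp
  qed measurable
  show "integrable lborel m" unfolding m_def using lborel_pair.integrable_snd[OF I] by simp
  have I2: "integrable (lborel \<Otimes>\<^sub>M lborel) (\<lambda>(y, x). exp (- \<i> * complex_of_real (x \<bullet> \<xi>)) * complex_of_real (f y * \<zeta> (x - y)))"
    by (rule Bochner_Integration.integrable_bound[OF I]) (measurable, auto simp: norm_mult)
  have "ft (cx m) \<xi> = (\<integral>x. (\<integral>y. exp (- \<i> * complex_of_real (x \<bullet> \<xi>)) * complex_of_real (f y * \<zeta> (x - y)) \<partial>lborel) \<partial>lborel)"
    unfolding ft_def cx_def m_def by (simp only: integral_complex_of_real[symmetric] integral_mult_right_zero)
  also have "\<dots> = (\<integral>y. (\<integral>x. exp (- \<i> * complex_of_real (x \<bullet> \<xi>)) * complex_of_real (f y * \<zeta> (x - y)) \<partial>lborel) \<partial>lborel)"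
    by (rule lborel_pair.Fubini_integral[OF I2])
  also have "\<dots> = (\<integral>y. (exp (- \<i> * complex_of_real (y \<bullet> \<xi>)) * cx f y) * ft (cx \<zeta>) \<xi> \<partial>lborel)"
  proof (rule Bochner_Integration.integral_cong[OF refl])
    fix y
    have "(\<integral>x. exp (- \<i> * complex_of_real (x \<bullet> \<xi>)) * complex_of_real (f y * \<zeta> (x - y)) \<partial>lborel)
       = (\<integral>x. cx f y * (exp (- \<i> * complex_of_real (x \<bullet> \<xi>)) * cx \<zeta> (- y + x)) \<partial>lborel)"
      by (intro Bochner_Integration.integral_cong) (auto simp: cx_def)
    also have "\<dots> = cx f y * ft (\<lambda>x. cx \<zeta> (- y + x)) \<xi>" unfolding ft_def by (rule integral_mult_right_zero)
    also have "ft (\<lambda>x. cx \<zeta> (- y + x)) \<xi> = exp (\<i> * complex_of_real ((- y) \<bullet> \<xi>)) * ft (cx \<zeta>) \<xi>" by (rule ft_shift) measurable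
    finally show "(\<integral>x. exp (- \<i> * complex_of_real (x \<bullet> \<xi>)) * complex_of_real (f y * \<zeta> (x - y)) \<partial>lborel) = (exp (- \<i> * complex_of_real (y \<bullet> \<xi>)) * cx f y) * ft (cx \<zeta>) \<xi>"
      by simp
  qed
  also have "\<dots> = ft (cx f) \<xi> * ft (cx \<zeta>) \<xi>" unfolding ft_def by (rule integral_mult_left_zero)
  finally show "ft (cx m) \<xi> = ft (cx f) \<xi> * ft (cx \<zeta>) \<xi>" .
qed

text \<open>Plancherel cannot be applied to g directly, since g need not be integrable. Mollifying
  moves the derivative: the convolution of f with the derivative of \<eta> k equals that of g with
  \<eta> k, which is integrable through f and bounded by A in L2 through g. On the Fourier side the
  mollifier tends to 1, and Fatou concludes.\<close>

lemma weak_deriv_ft_bound: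
  fixes f g :: "real^'n::finite \<Rightarrow> real"
  assumes f: "integrable lborel f" and g: "L2le lborel g A"
    and eq: "\<And>\<theta>. test_fun \<theta> \<Longrightarrow> (\<integral>x. f x * iter_pd is \<theta> x \<partial>lborel) = (-1) ^ length is * (\<integral>x. g x * \<theta> x \<partial>lborel)"
  shows "L2le lborel (\<lambda>\<xi>. xi_pow is \<xi> * ft (cx f) \<xi>) (sqrt (ftc TYPE('n)) * A)"
proof -
  have [measurable]: "g \<in> borel_measurable borel" using g by (auto simp: L2le_def)
  have [measurable]: "f \<in> borel_measurable borel" using f by auto
  obtain \<eta> :: "nat \<Rightarrow> real^'n \<Rightarrow> real" where \<eta>: "\<And>k. test_fun (\<eta> k)" "\<And>k x. 0 \<le> \<eta> k x" "\<And>k. (\<integral>x. \<eta> k x \<partial>lborel) = 1"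
      "\<And>\<xi>. (\<lambda>k. ft (cx (\<eta> k)) \<xi>) \<longlonglongrightarrow> 1"
    using mollifier_exists by blast
  have L: "L2le lborel (\<lambda>\<xi>. ft (cx f) \<xi> * (xi_pow is \<xi> * ft (cx (\<eta> k)) \<xi>)) (sqrt (ftc TYPE('n)) * A)" for k
  proof -
    note [measurable] = test_fun_measurable[OF \<eta>(1)[of k]]
    define \<zeta> where "\<zeta> = iter_pd is (\<eta> k)"
    have z: "test_fun \<zeta>" unfolding \<zeta>_def by (rule test_fun_iter_pd[OF \<eta>(1)])
    define m where "m = (\<lambda>x. \<integral>y. f y * \<zeta> (x - y) \<partial>lborel)"
    have m1: "integrable lborel m" "\<And>\<xi>. ft (cx m) \<xi> = ft (cx f) \<xi> * ft (cx \<zeta>) \<xi>"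
      unfolding m_def using convolution_ft[OF f test_fun_integrable[OF z]] by auto
    have "m x = (\<integral>y. \<eta> k y * g (x - y) \<partial>lborel)" for x
    proof -
      let ?p = "(-1) ^ length is :: real"
      have "?p * m x = (\<integral>y. f y * (?p * \<zeta> (x - y)) \<partial>lborel)"
        unfolding m_def by (subst integral_mult_right_zero[symmetric]) (simp only: mult.left_commute)
      also have "\<dots> = (\<integral>y. f y * iter_pd is (\<lambda>y. \<eta> k (x - y)) y \<partial>lborel)"
        using \<eta>(1)[of k] by (subst iter_pd_reflect) (auto simp: test_fun_def \<zeta>_def)
      also have "\<dots> = ?p * (\<integral>y. g y * \<eta> k (x - y) \<partial>lborel)" by (rule eq[OF test_fun_reflect[OF \<eta>(1)]])
      finally have "m x = (\<integral>y. g y * \<eta> k (x - y) \<partial>lborel)" by simp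
      also have "\<dots> = (\<integral>y. g (x + (-1) *\<^sub>R y) * \<eta> k (x - (x + (-1) *\<^sub>R y)) \<partial>lborel)"
        by (rule lborel_shift_reflect(4)[symmetric, of "\<lambda>y. g y * \<eta> k (x - y)"]) auto
      finally show ?thesis by (simp add: mult.commute)
    qed
    then have "m = (\<lambda>x. \<integral>y. \<eta> k y * g (x - y) \<partial>lborel)" by (rule ext)
    then have m2: "L2le lborel m A" using convolution_L2[OF g test_fun_integrable[OF \<eta>(1)] \<eta>(2,3)] by simp
    have "L2le lborel (ft (cx m)) (sqrt (ftc TYPE('n)) * A)"
      by (rule ft_L2[OF cx_integrable[OF m1(1)] cx_L2le[OF m2]])
    moreover have "ft (cx m) = (\<lambda>\<xi>. ft (cx f) \<xi> * (xi_pow is \<xi> * ft (cx (\<eta> k)) \<xi>))"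
      by (rule ext) (simp only: m1(2) \<zeta>_def ft_iter_pd[OF \<eta>(1)])
    ultimately show ?thesis by simp
  qed
  have xm: "xi_pow is \<in> borel_measurable borel"
    unfolding xi_pow_def[abs_def] by (induction "is") auto
  show ?thesis
  proof (rule L2le_Fatou[OF L _ _ tendsto_const])
    show "(\<lambda>\<xi>. xi_pow is \<xi> * ft (cx f) \<xi>) \<in> borel_measurable lborel"
      using xm ft_measurable[OF cx_integrable[OF f]] by simp
    have "(\<lambda>k. ft (cx f) \<xi> * (xi_pow is \<xi> * ft (cx (\<eta> k)) \<xi>)) \<longlonglongrightarrow> ft (cx f) \<xi> * (xi_pow is \<xi> * 1)" for \<xi>
      by (intro tendsto_mult_left \<eta>(4))
    then show "AE \<xi> in lborel. (\<lambda>k. ft (cx f) \<xi> * (xi_pow is \<xi> * ft (cx (\<eta> k)) \<xi>)) \<longlonglongrightarrow> xi_pow is \<xi> * ft (cx f) \<xi>"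
      by (simp add: mult.commute)
  qed
qed

subsection \<open>Decay of the damped wave multipliers\<close>

definition jb :: "'a::real_normed_vector \<Rightarrow> real" where "jb \<xi> = sqrt (1 + (norm \<xi>)\<^sup>2)"

text \<open>Diffusive like a heat kernel at low frequency, exponential in time at high frequency.
  The small rate 1/8 leaves room for the factor t that appears where the two characteristic roots
  meet, at |\<xi>| = 1/2.\<close>

definition decay :: "real \<Rightarrow> 'a::real_normed_vector \<Rightarrow> real" where
  "decay t \<xi> = exp (- (t * min 1 ((norm \<xi>)\<^sup>2)) / 8)"

lemma jb_ge_1: "jb \<xi> \<ge> 1" and jb_pos: "jb \<xi> > 0" and jb_sq: "(jb \<xi>)\<^sup>2 = 1 + (norm \<xi>)\<^sup>2"
  and norm_le_jb: "norm \<xi> \<le> jb \<xi>"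
proof -
  show "jb \<xi> \<ge> 1" by (simp add: jb_def)
  then show "jb \<xi> > 0" by linarith
  show "(jb \<xi>)\<^sup>2 = 1 + (norm \<xi>)\<^sup>2" by (simp add: jb_def add_nonneg_nonneg)
  show "norm \<xi> \<le> jb \<xi>" unfolding jb_def by (rule real_le_rsqrt) simp
qed

lemma jb_measurable[measurable]: "jb \<in> borel_measurable (borel :: 'a::euclidean_space measure)"
  unfolding jb_def[abs_def] by measurable

lemma decay_measurable[measurable]: "decay t \<in> borel_measurable (borel :: 'a::euclidean_space measure)"
  unfolding decay_def[abs_def] by measurable

lemma decay_bounds: "0 < decay t \<xi>" "t \<ge> 0 \<Longrightarrow> decay t \<xi> \<le> 1"
  by (auto simp: decay_def)

lemma decay_lower: assumes "t \<ge> 0" shows "exp (- t / 8) \<le> decay t \<xi>" "exp (- (t * (norm \<xi>)\<^sup>2)) \<le> decay t \<xi>"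
proof -
  have 1: "min 1 ((norm \<xi>)\<^sup>2) \<le> 1" "min 1 ((norm \<xi>)\<^sup>2) \<le> (norm \<xi>)\<^sup>2" by auto
  have "t * min 1 ((norm \<xi>)\<^sup>2) \<le> t" using mult_left_mono[OF 1(1) assms] by simp
  then show "exp (- t / 8) \<le> decay t \<xi>" by (simp add: decay_def)
  have "t * min 1 ((norm \<xi>)\<^sup>2) \<le> t * (norm \<xi>)\<^sup>2" using mult_left_mono[OF 1(2) assms] .
  moreover have "0 \<le> t * (norm \<xi>)\<^sup>2" using assms by simp
  ultimately have "t * min 1 ((norm \<xi>)\<^sup>2) / 8 \<le> t * (norm \<xi>)\<^sup>2" by linarith
  then show "exp (- (t * (norm \<xi>)\<^sup>2)) \<le> decay t \<xi>" by (simp add: decay_def)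
qed

lemma sinh_le: assumes "x \<ge> 0" shows "sinh x \<le> x * exp (x::real)"
proof -
  have "1 - 2 * x \<le> exp (- 2 * x)" using exp_ge_add_one_self[of "- 2 * x"] by simp
  then have "exp x * (1 - 2 * x) \<le> exp x * exp (- 2 * x)" by (intro mult_left_mono) auto
  also have "\<dots> = exp (- x)" by (simp add: exp_add[symmetric])
  finally show ?thesis by (simp add: sinh_field_def algebra_simps)
qed

lemma t_exp_le: assumes "t \<ge> (0::real)" shows "t * exp (- t / 2) \<le> 8 * exp (- t / 8)" "t * exp (- t / 4) \<le> 8 * exp (- t / 8)"
proof -
  have 1: "t \<le> 8 * exp (t / 8)" using exp_ge_add_one_self[of "t / 8"] by linarith
  have "t * exp (- t / 4) \<le> 8 * exp (t / 8) * exp (- t / 4)" using 1 by (intro mult_right_mono) auto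
  also have "\<dots> = 8 * exp (- t / 8)" by (simp add: exp_add[symmetric])
  finally show 2: "t * exp (- t / 4) \<le> 8 * exp (- t / 8)" .
  have "t * exp (- t / 2) \<le> t * exp (- t / 4)" using assms by (intro mult_left_mono) auto
  with 2 show "t * exp (- t / 2) \<le> 8 * exp (- t / 8)" by linarith
qed

text \<open>The slower root of the characteristic equation is then at most -|\<xi>|^2, which gives
  heat-like decay.\<close>

lemma sqrt_quarter_bound:
  assumes "1/4 - r\<^sup>2 > (0::real)" shows "sqrt (1/4 - r\<^sup>2) \<le> 1/2 - r\<^sup>2"
proof (rule real_le_lsqrt)
  have "(1/2 - r\<^sup>2)\<^sup>2 = 1/4 - r\<^sup>2 + (r\<^sup>2)\<^sup>2" by (simp add: power2_eq_square algebra_simps)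
  then show "1/4 - r\<^sup>2 \<le> (1/2 - r\<^sup>2)\<^sup>2" by simp
qed (use assms in auto)

text \<open>For |\<xi>| at most 1 the factor 1 / \<open>jb\<close> costs at most 2, so the constant
  16 there comes from 8 times \<open>decay\<close>. A true gain of one power is needed only for
  |\<xi>| at least 1.\<close>

lemma K1_bound:
  assumes t: "t \<ge> 0" shows "\<bar>K1 t \<xi>\<bar> \<le> 16 * (decay t \<xi> / jb \<xi>)"
proof -
  define d where "d = 1/4 - (norm \<xi>)\<^sup>2"
  have jb2: "norm \<xi> \<le> 1 \<Longrightarrow> jb \<xi> \<le> 2"
  proof -
    assume "norm \<xi> \<le> 1"
    then have "(norm \<xi>)\<^sup>2 \<le> 1" by (simp add: power_le_one)
    then show ?thesis unfolding jb_def by (intro real_le_lsqrt) auto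
  qed
  have low: "x \<le> 8 * decay t \<xi> \<Longrightarrow> norm \<xi> \<le> 1 \<Longrightarrow> x \<le> 16 * (decay t \<xi> / jb \<xi>)" for x
  proof -
    assume x: "x \<le> 8 * decay t \<xi>" and "norm \<xi> \<le> 1"
    then have "8 * decay t \<xi> * jb \<xi> \<le> 8 * decay t \<xi> * 2" using jb2 decay_bounds(1)[of t \<xi>] by (intro mult_left_mono) auto
    then have "8 * decay t \<xi> \<le> 16 * (decay t \<xi> / jb \<xi>)" using jb_pos[of \<xi>] by (simp add: field_simps)
    then show ?thesis using x by linarith
  qed
  \<comment> \<open>The multiplier is a quotient by sqrt |d|, which degenerates at d = 0. For
    |\<xi>| at least 1, or sqrt d at least 1/4, the denominator is bounded below and division is
    harmless; in the zone between, |sin x| <= |x| and its analogue for sinh cancel the denominator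
    at the price of a factor t.\<close>
  consider "d < 0" "norm \<xi> \<ge> 1" | "d < 0" "norm \<xi> \<le> 1" | "d = 0" | "d > 0" "sqrt d \<ge> 1/4" | "d > 0" "sqrt d < 1/4" by linarith
  then show ?thesis
  proof cases
    case 1
    have "(jb \<xi> / 2)\<^sup>2 \<le> - d"
    proof -
      have "1 \<le> (norm \<xi>)\<^sup>2" using 1(2) by simp
      then show ?thesis by (simp add: power_divide jb_sq d_def)
    qed
    then have w: "jb \<xi> / 2 \<le> sqrt (- d)" by (rule real_le_rsqrt)
    have w0: "sqrt (- d) > 0" using 1 by simp
    have "\<bar>K1 t \<xi>\<bar> = exp (- t / 2) * \<bar>sin (t * sqrt (- d))\<bar> / sqrt (- d)"
      using 1 w0 by (simp add: K1_def Let_def d_def[symmetric] abs_mult)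
    also have "\<dots> \<le> exp (- t / 2) * 1 / (jb \<xi> / 2)"
      using w jb_pos[of \<xi>] by (intro frac_le mult_left_mono) auto
    also have "\<dots> \<le> exp (- t / 8) * 1 / (jb \<xi> / 2)"
      using t jb_pos[of \<xi>] by (intro divide_right_mono) auto
    also have "\<dots> \<le> decay t \<xi> * 1 / (jb \<xi> / 2)"
      using decay_lower(1)[OF t, of \<xi>] jb_pos[of \<xi>] by (intro divide_right_mono) auto
    also have "\<dots> \<le> 16 * (decay t \<xi> / jb \<xi>)" using jb_pos[of \<xi>] decay_bounds(1)[of t \<xi>] by (simp add: field_simps)
    finally show ?thesis .
  next
    case 2
    have w0: "sqrt (- d) > 0" using 2 by simp
    have "\<bar>K1 t \<xi>\<bar> = exp (- t / 2) * (\<bar>sin (t * sqrt (- d))\<bar> / sqrt (- d))"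
      using 2 w0 by (simp add: K1_def Let_def d_def[symmetric] abs_mult)
    also have "\<dots> \<le> exp (- t / 2) * t"
    proof (intro mult_left_mono)
      show "\<bar>sin (t * sqrt (- d))\<bar> / sqrt (- d) \<le> t"
        using abs_sin_x_le_abs_x[of "t * sqrt (- d)"] w0 t by (simp add: abs_mult divide_le_eq)
    qed simp
    also have "\<dots> \<le> 8 * decay t \<xi>" using t_exp_le(1)[OF t] decay_lower(1)[OF t, of \<xi>] by (simp add: mult.commute)
    finally show ?thesis using 2 low by blast
  next
    case 3
    then have "(norm \<xi>)\<^sup>2 \<le> 1\<^sup>2" by (simp add: d_def)
    then have n1: "norm \<xi> \<le> 1" by (rule power2_le_imp_le) simp
    have "\<bar>K1 t \<xi>\<bar> = t * exp (- t / 2)" using 3 t by (simp add: K1_def Let_def d_def[symmetric])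
    also have "\<dots> \<le> 8 * decay t \<xi>" using t_exp_le(1)[OF t] decay_lower(1)[OF t, of \<xi>] by simp
    finally show ?thesis using n1 low by blast
  next
    case 4
    then have "(norm \<xi>)\<^sup>2 \<le> 1\<^sup>2" by (simp add: d_def)
    then have n1: "norm \<xi> \<le> 1" by (rule power2_le_imp_le) simp
    have s: "sqrt d \<le> 1/2 - (norm \<xi>)\<^sup>2" using sqrt_quarter_bound[of "norm \<xi>"] 4 by (simp add: d_def)
    have x0: "0 \<le> t * sqrt d" using t 4 by simp
    have "sinh (t * sqrt d) \<le> exp (t * sqrt d) / 2" by (simp add: sinh_field_def)
    then have "sinh (t * sqrt d) / sqrt d \<le> (exp (t * sqrt d) / 2) / (1/4)"
      using 4 x0 by (intro frac_le) auto
    then have "exp (- t / 2) * (sinh (t * sqrt d) / sqrt d) \<le> exp (- t / 2) * (2 * exp (t * sqrt d))"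
      by (intro mult_left_mono) auto
    also have "\<dots> = 2 * exp (- t / 2 + t * sqrt d)" by (simp only: exp_add mult.left_commute)
    also have "\<dots> \<le> 2 * exp (- (t * (norm \<xi>)\<^sup>2))"
      using mult_left_mono[OF s t] by (simp add: algebra_simps)
    also have "\<dots> \<le> 8 * decay t \<xi>" using decay_lower(2)[OF t, of \<xi>] decay_bounds(1)[of t \<xi>] by linarith
    finally have "exp (- t / 2) * (sinh (t * sqrt d) / sqrt d) \<le> 8 * decay t \<xi>" .
    moreover have "\<bar>K1 t \<xi>\<bar> = exp (- t / 2) * (sinh (t * sqrt d) / sqrt d)"
      using 4 x0 by (simp add: K1_def Let_def d_def[symmetric] abs_mult)
    ultimately show ?thesis using n1 low by simp
  next
    case 5
    then have "(norm \<xi>)\<^sup>2 \<le> 1\<^sup>2" by (simp add: d_def)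
    then have n1: "norm \<xi> \<le> 1" by (rule power2_le_imp_le) simp
    have x0: "0 \<le> t * sqrt d" using t 5 by simp
    have "sinh (t * sqrt d) \<le> (t * sqrt d) * exp (t * sqrt d)" by (rule sinh_le[OF x0])
    also have "\<dots> \<le> (t * sqrt d) * exp (t / 4)"
      using mult_left_mono[of "sqrt d" "1/4" t] 5 t x0 by (intro mult_left_mono) auto
    finally have "sinh (t * sqrt d) / sqrt d \<le> t * exp (t / 4)" using 5 by (simp add: divide_le_eq mult_ac)
    then have "exp (- t / 2) * (sinh (t * sqrt d) / sqrt d) \<le> exp (- t / 2) * (t * exp (t / 4))"
      by (intro mult_left_mono) auto
    also have "\<dots> = t * (exp (- t / 2) * exp (t / 4))" by (simp add: mult_ac)
    also have "exp (- t / 2) * exp (t / 4) = exp (- t / 4)" by (simp add: exp_add[symmetric])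
    also have "t * exp (- t / 4) \<le> 8 * decay t \<xi>" using t_exp_le(2)[OF t] decay_lower(1)[OF t, of \<xi>] by linarith
    finally have "exp (- t / 2) * (sinh (t * sqrt d) / sqrt d) \<le> 8 * decay t \<xi>" .
    moreover have "\<bar>K1 t \<xi>\<bar> = exp (- t / 2) * (sinh (t * sqrt d) / sqrt d)"
      using 5 x0 by (simp add: K1_def Let_def d_def[symmetric] abs_mult)
    ultimately show ?thesis using n1 low by simp
  qed
qed

text \<open>Subtracting half of \<open>K1\<close> leaves only the cosine part, which has no
  denominator and is at most \<open>decay\<close>; the constant is 9 = 1 + 16/2. No negative power
  of \<open>jb\<close> is gained here, which is why one more derivative is asked of the first
  datum.\<close>

lemma K0_bound:
  assumes t: "t \<ge> 0" shows "\<bar>K0 t \<xi>\<bar> \<le> 9 * decay t \<xi>"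
proof -
  define d where "d = 1/4 - (norm \<xi>)\<^sup>2"
  have "\<bar>K0 t \<xi> - K1 t \<xi> / 2\<bar> \<le> decay t \<xi>"
  proof (cases "d > 0")
    case True
    have s: "sqrt d \<le> 1/2 - (norm \<xi>)\<^sup>2" using sqrt_quarter_bound[of "norm \<xi>"] True by (simp add: d_def)
    have x0: "0 \<le> t * sqrt d" using t True by simp
    have "K0 t \<xi> - K1 t \<xi> / 2 = exp (- t / 2) * cosh (t * sqrt d)"
      using True by (simp add: K0_def K1_def Let_def d_def[symmetric] ring_distribs)
    moreover have "cosh (t * sqrt d) \<le> exp (t * sqrt d)" using x0 by (simp add: cosh_field_def)
    then have "exp (- t / 2) * cosh (t * sqrt d) \<le> exp (- t / 2) * exp (t * sqrt d)" by (intro mult_left_mono) auto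
    moreover have "exp (- t / 2) * exp (t * sqrt d) = exp (- t / 2 + t * sqrt d)" by (simp only: exp_add)
    moreover have "exp (- t / 2 + t * sqrt d) \<le> exp (- (t * (norm \<xi>)\<^sup>2))"
      using mult_left_mono[OF s t] by (simp add: algebra_simps)
    moreover have "0 \<le> exp (- t / 2) * cosh (t * sqrt d)" by (simp add: cosh_field_def)
    ultimately show ?thesis using decay_lower(2)[OF t, of \<xi>] by linarith
  next
    case False
    have "\<bar>K0 t \<xi> - K1 t \<xi> / 2\<bar> \<le> exp (- t / 2)"
    proof (cases "d = 0")
      case True
      then show ?thesis by (simp add: K0_def K1_def Let_def d_def[symmetric] ring_distribs)
    next
      case nz: False
      have "K0 t \<xi> - K1 t \<xi> / 2 = exp (- t / 2) * cos (t * sqrt (- d))"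
        using False nz by (simp add: K0_def K1_def Let_def d_def[symmetric] ring_distribs)
      then show ?thesis by (simp add: abs_mult)
    qed
    also have "\<dots> \<le> exp (- t / 8)" using t by simp
    finally show ?thesis using decay_lower(1)[OF t, of \<xi>] by linarith
  qed
  moreover have "\<bar>K1 t \<xi>\<bar> \<le> 16 * decay t \<xi>"
  proof -
    have "decay t \<xi> / jb \<xi> \<le> decay t \<xi>" using jb_ge_1[of \<xi>] jb_pos[of \<xi>] decay_bounds(1)[of t \<xi>] by (simp add: divide_le_eq)
    then show ?thesis using K1_bound[OF t, of \<xi>] by linarith
  qed
  ultimately show ?thesis by linarith
qed

section \<open>Measurability, continuity and symmetry of the multipliers\<close>

lemma K1_measurable[measurable]: "(\<lambda>(t, \<xi>::real^'n::finite). K1 t \<xi>) \<in> borel_measurable (borel \<Otimes>\<^sub>M borel)"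
  unfolding K1_def Let_def sinh_field_def by measurable

lemma K0_measurable[measurable]: "(\<lambda>(t, \<xi>::real^'n::finite). K0 t \<xi>) \<in> borel_measurable (borel \<Otimes>\<^sub>M borel)"
  unfolding K0_def Let_def sinh_field_def cosh_field_def by measurable

lemma K1_continuous: "continuous_on UNIV (\<lambda>t. K1 t \<xi>)"
proof -
  define d where "d = 1/4 - (norm \<xi>)\<^sup>2"
  consider "d > 0" | "d = 0" | "d < 0" by linarith
  then show ?thesis
    by cases (auto simp: K1_def Let_def d_def[symmetric] sinh_field_def intro!: continuous_intros)
qed

lemma K0_continuous: "continuous_on UNIV (\<lambda>t. K0 t \<xi>)"
proof -
  define d where "d = 1/4 - (norm \<xi>)\<^sup>2"
  consider "d > 0" | "d = 0" | "d < 0" by linarith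
  then show ?thesis
    by cases (auto simp: K0_def Let_def d_def[symmetric] sinh_field_def cosh_field_def intro!: continuous_intros)
qed

lemma K1_even: "K1 t (- \<xi>) = K1 t \<xi>" and K0_even: "K0 t (- \<xi>) = K0 t \<xi>"
  by (simp_all add: K1_def K0_def)

section \<open>Model integrals in frequency space\<close>

lemma gaussian_L1:
  fixes a :: real
  assumes a: "a > 0"
  shows "L1le lborel (\<lambda>\<xi>::real^'n::finite. exp (- (a * (norm \<xi>)\<^sup>2))) ((pi / a) powr (real CARD('n) / 2))"
proof -
  define c where "c = sqrt (2 * a)"
  have c: "c > 0" "c\<^sup>2 = 2 * a" using a by (auto simp: c_def)
  have g: "gauss (c *\<^sub>R \<xi>) = exp (- (a * (norm \<xi>)\<^sup>2))" for \<xi> :: "real^'n"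
    using c(2) by (simp add: gauss_def power2_norm_eq_inner[symmetric] power_mult_distrib power2_eq_square[symmetric])
  have "ennreal (sqrt ((2 * pi) ^ CARD('n))) = (\<integral>\<^sup>+\<xi>. ennreal (gauss (\<xi>::real^'n)) \<partial>lborel)"
    by (subst nn_integral_eq_integral[OF gauss_integrable]) (auto simp: gauss_integral less_imp_le[OF gauss_bounds(1)])
  also have "\<dots> = ennreal (c ^ CARD('n)) * (\<integral>\<^sup>+\<xi>. ennreal (exp (- (a * (norm (\<xi>::real^'n))\<^sup>2))) \<partial>lborel)"
    using nn_integral_lborel_affine[of "\<lambda>x::real^'n. ennreal (gauss x)" c 0] c(1) by (simp add: g)
  finally have 1: "ennreal (sqrt ((2 * pi) ^ CARD('n))) = ennreal (c ^ CARD('n)) * (\<integral>\<^sup>+\<xi>. ennreal (exp (- (a * (norm (\<xi>::real^'n))\<^sup>2))) \<partial>lborel)" .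
  have "(\<integral>\<^sup>+\<xi>. ennreal (exp (- (a * (norm (\<xi>::real^'n))\<^sup>2))) \<partial>lborel)
     = ennreal (1 / c ^ CARD('n)) * (ennreal (c ^ CARD('n)) * (\<integral>\<^sup>+\<xi>. ennreal (exp (- (a * (norm (\<xi>::real^'n))\<^sup>2))) \<partial>lborel))"
    using c(1) by (simp add: mult.assoc[symmetric] ennreal_mult[symmetric])
  also have "\<dots> = ennreal (1 / c ^ CARD('n) * sqrt ((2 * pi) ^ CARD('n)))"
    unfolding 1[symmetric] using c(1) by (simp add: ennreal_mult[symmetric])
  also have "1 / c ^ CARD('n) * sqrt ((2 * pi) ^ CARD('n)) = (pi / a) powr (real CARD('n) / 2)"
  proof -
    have "1 / c ^ CARD('n) * sqrt ((2 * pi) ^ CARD('n)) = (sqrt (2 * pi) / c) ^ CARD('n)"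
      unfolding real_sqrt_power power_divide by simp
    also have "sqrt (2 * pi) / c = sqrt (pi / a)" using a by (simp add: c_def real_sqrt_divide[symmetric])
    also have "sqrt (pi / a) ^ CARD('n) = (pi / a) powr (real CARD('n) / 2)"
      using a by (simp add: powr_half_sqrt[symmetric] powr_realpow[symmetric] powr_powr)
    finally show ?thesis .
  qed
  finally show ?thesis by (simp add: L1le_def)
qed

lemma gaussian_L2:
  fixes a :: real
  assumes a: "a > 0"
  shows "L2le lborel (\<lambda>\<xi>::real^'n::finite. exp (- (a * (norm \<xi>)\<^sup>2))) ((pi / (2 * a)) powr (real CARD('n) / 4))"
proof -
  have "(exp (- (a * (norm \<xi>)\<^sup>2)))\<^sup>2 = exp (- ((2 * a) * (norm \<xi>)\<^sup>2))" for \<xi> :: "real^'n"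
    by (simp add: power2_eq_square exp_add[symmetric])
  moreover have "((pi / (2 * a)) powr (real CARD('n) / 4))\<^sup>2 = (pi / (2 * a)) powr (real CARD('n) / 2)"
    by (simp add: power2_eq_square powr_add[symmetric])
  ultimately show ?thesis
    using gaussian_L1[of "2 * a", where 'n='n] a by (simp add: L2le_def L1le_def)
qed

text \<open>Each factor 1/(1+|\<xi>|^2) is at most 1/(1+\<xi>_b^2) for its own coordinate, so the
  square is dominated by a product of one-dimensional integrands, each of integral pi.\<close>

lemma jb_L2: "L2le lborel (\<lambda>\<xi>::real^'n::finite. 1 / jb \<xi> ^ CARD('n)) (sqrt (pi ^ CARD('n)))"
proof -
  have one: "(\<integral>\<^sup>+x. ennreal (1 / (1 + x\<^sup>2)) \<partial>lborel) = ennreal pi"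
  proof -
    have lim: "((\<lambda>x. arctan x) \<longlongrightarrow> pi / 2) at_top" "((\<lambda>x. arctan x) \<longlongrightarrow> - (pi / 2)) at_bot"
      by (rule tendsto_arctan_at_top, rule tendsto_arctan_at_bot)
    have m: "(\<lambda>x::real. 1 / (1 + x\<^sup>2)) \<in> borel_measurable borel" by measurable
    have pos: "(\<integral>\<^sup>+x. ennreal (1 / (1 + x\<^sup>2)) * indicator {0..} x \<partial>lborel) = ennreal (pi / 2 - arctan 0)"
      by (rule nn_integral_FTC_atLeast[OF m])
         (auto intro!: derivative_eq_intros lim simp: add_nonneg_eq_0_iff inverse_eq_divide)
    have "(\<integral>\<^sup>+x. ennreal (1 / (1 + x\<^sup>2)) * indicator {..0} x \<partial>lborel) = (\<integral>\<^sup>+x. ennreal (1 / (1 + x\<^sup>2)) * indicator {0..} x \<partial>lborel)"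
      by (subst nn_integral_lborel_affine[where c="-1" and t=0]) (auto intro!: nn_integral_cong simp: indicator_def)
    moreover have "(\<integral>\<^sup>+x. ennreal (1 / (1 + x\<^sup>2)) \<partial>lborel) = (\<integral>\<^sup>+x. ennreal (1 / (1 + x\<^sup>2)) * indicator {..0} x + ennreal (1 / (1 + x\<^sup>2)) * indicator {0..} x \<partial>lborel)"
      by (rule nn_integral_cong_AE, rule AE_mp[OF AE_lborel_singleton[of 0]]) (auto simp: indicator_def)
    ultimately show ?thesis using pos by (simp add: nn_integral_add ennreal_plus[symmetric] del: ennreal_plus)
  qed
  have "(\<integral>\<^sup>+\<xi>. ennreal ((norm (1 / jb (\<xi>::real^'n) ^ CARD('n)))\<^sup>2) \<partial>lborel) \<le> (\<integral>\<^sup>+\<xi>. (\<Prod>b\<in>Basis. ennreal (1 / (1 + ((\<xi>::real^'n) \<bullet> b)\<^sup>2))) \<partial>lborel)"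
  proof (rule nn_integral_mono)
    fix \<xi> :: "real^'n"
    have "(norm (1 / jb \<xi> ^ CARD('n)))\<^sup>2 = (1 / (jb \<xi>)\<^sup>2) ^ CARD('n)"
      by (simp add: power_divide power_mult[symmetric] mult.commute)
    also have "\<dots> = (\<Prod>b\<in>(Basis :: (real^'n) set). 1 / (1 + (norm \<xi>)\<^sup>2))" by (simp add: jb_sq)
    also have "\<dots> \<le> (\<Prod>b\<in>Basis. 1 / (1 + (\<xi> \<bullet> b)\<^sup>2))"
    proof (intro prod_mono conjI)
      fix b :: "real^'n" assume "b \<in> Basis"
      then have "\<bar>\<xi> \<bullet> b\<bar> \<le> norm \<xi>" by (rule Basis_le_norm)
      then have "(\<xi> \<bullet> b)\<^sup>2 \<le> (norm \<xi>)\<^sup>2" using power_mono[of "\<bar>\<xi> \<bullet> b\<bar>" "norm \<xi>" 2] by simp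
      then show "1 / (1 + (norm \<xi>)\<^sup>2) \<le> 1 / (1 + (\<xi> \<bullet> b)\<^sup>2)" by (intro divide_left_mono mult_pos_pos add_pos_nonneg) auto
    qed simp
    finally show "ennreal ((norm (1 / jb \<xi> ^ CARD('n)))\<^sup>2) \<le> (\<Prod>b\<in>Basis. ennreal (1 / (1 + (\<xi> \<bullet> b)\<^sup>2)))"
      by (subst prod_ennreal) (auto intro: ennreal_leI)
  qed
  also have "\<dots> = (\<Prod>b\<in>(Basis :: (real^'n) set). ennreal pi)"
    by (subst nn_integral_lborel_prod) (auto simp: one)
  also have "\<dots> = ennreal ((sqrt (pi ^ CARD('n)))\<^sup>2)" by (simp add: ennreal_power)
  finally show ?thesis by (simp add: L2le_def)
qed

text \<open>The three norms in which the solution is controlled: \<open>L\<^sup>2\<close> and homogeneous \<open>H\<^sup>1\<close> of the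
  solution, and \<open>L\<^sup>1\<close> of its Fourier transform, which bounds the sup norm.\<close>

definition fnorm_le :: "nat \<Rightarrow> (real^'n::finite \<Rightarrow> complex) \<Rightarrow> real \<Rightarrow> bool" where
  "fnorm_le j F A = (if j = 0 then L2le lborel F A
     else if j = 1 then L2le lborel (\<lambda>\<xi>. complex_of_real (norm \<xi>) * F \<xi>) A else L1le lborel F A)"

text \<open>The decay beyond the common factor (1+t)^(-n/4): none for the solution in L2, a half
  power for its gradient, n/4 for the L1 norm of the transform.\<close>

definition rate :: "real \<Rightarrow> nat \<Rightarrow> real" where
  "rate n j = (if j = 0 then 0 else if j = 1 then 1/2 else n / 4)"

lemma fnorm_le_mono: "fnorm_le j F A \<Longrightarrow> A \<le> B \<Longrightarrow> fnorm_le j F B"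
  by (auto simp: fnorm_le_def intro: L2le_mono L1le_mono split: if_splits)

lemma fnorm_le_add:
  assumes F: "fnorm_le j F A" and G: "fnorm_le j G B" shows "fnorm_le j (\<lambda>\<xi>. F \<xi> + G \<xi>) (A + B)"
proof -
  consider "j = 0" | "j = 1" | "j \<noteq> 0" "j \<noteq> 1" by blast
  then show ?thesis
  proof cases
    case 1 then show ?thesis using L2le_add[of lborel F A G B] F G by (simp add: fnorm_le_def)
  next
    case 2
    then have "L2le lborel (\<lambda>\<xi>. complex_of_real (norm \<xi>) * F \<xi> + complex_of_real (norm \<xi>) * G \<xi>) (A + B)"
      using F G by (intro L2le_add) (auto simp: fnorm_le_def)
    then show ?thesis using 2 by (simp add: fnorm_le_def ring_distribs)
  next
    case 3 then show ?thesis using L1le_add[of lborel F A G B] F G by (simp add: fnorm_le_def)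
  qed
qed

lemma fnorm_le_Fatou:
  assumes F: "\<And>k::nat. fnorm_le j (F k) A" and G: "G \<in> borel_measurable borel"
    and lim: "\<And>\<xi>. (\<lambda>k. F k \<xi>) \<longlonglongrightarrow> G \<xi>"
  shows "fnorm_le j G A"
proof -
  consider "j = 0" | "j = 1" | "j \<noteq> 0" "j \<noteq> 1" by blast
  then show ?thesis
  proof cases
    case 1
    then have *: "L2le lborel (F k) A" for k using F[of k] by (simp add: fnorm_le_def)
    have "L2le lborel G A" by (rule L2le_Fatou[OF * _ AE_I2[OF lim] tendsto_const]) (use G in simp)
    then show ?thesis using 1 by (simp add: fnorm_le_def)
  next
    case 2
    have "L2le lborel (\<lambda>\<xi>. complex_of_real (norm \<xi>) * G \<xi>) A"
    proof (rule L2le_Fatou[OF _ _ _ tendsto_const])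
      show "L2le lborel (\<lambda>\<xi>. complex_of_real (norm \<xi>) * F k \<xi>) A" for k using F[of k] 2 by (simp add: fnorm_le_def)
      show "AE \<xi> in lborel. (\<lambda>k. complex_of_real (norm \<xi>) * F k \<xi>) \<longlonglongrightarrow> complex_of_real (norm \<xi>) * G \<xi>"
        by (intro AE_I2 tendsto_mult_left lim)
    qed (use G in simp)
    then show ?thesis using 2 by (simp add: fnorm_le_def)
  next
    case 3
    then have *: "L1le lborel (F k) A" for k using F[of k] by (simp add: fnorm_le_def)
    have "L1le lborel G A" by (rule L1le_Fatou[OF * _ AE_I2[OF lim] tendsto_const]) (use G in simp)
    then show ?thesis using 3 by (simp add: fnorm_le_def)
  qed
qed

lemma fnorm_le_Minkowski:
  fixes g :: "real \<Rightarrow> real^'n::finite \<Rightarrow> complex"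
  assumes m[measurable]: "(\<lambda>(s, \<xi>). g s \<xi>) \<in> borel_measurable (borel \<Otimes>\<^sub>M borel)"
    and g: "\<And>s. s \<in> {a..b} \<Longrightarrow> fnorm_le j (g s) (w s)" and w: "set_integrable lborel {a..b} w"
  shows "fnorm_le j (\<lambda>\<xi>. LINT s:{a..b}|lborel. g s \<xi>) (LINT s:{a..b}|lborel. w s)"
proof -
  have m': "(\<lambda>(s, \<xi>). g s \<xi>) \<in> borel_measurable (lborel \<Otimes>\<^sub>M lborel)" by measurable
  consider "j = 0" | "j = 1" | "j \<noteq> 0" "j \<noteq> 1" by blast
  then show ?thesis
  proof cases
    case 1
    then show ?thesis using L2le_Minkowski[OF lborel.sigma_finite_measure_axioms m' _ w] g by (simp add: fnorm_le_def)
  next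
    case 2
    have m'': "(\<lambda>(s, \<xi>). complex_of_real (norm \<xi>) * g s \<xi>) \<in> borel_measurable (lborel \<Otimes>\<^sub>M lborel)" by measurable
    have "L2le lborel (\<lambda>\<xi>. LINT s:{a..b}|lborel. complex_of_real (norm \<xi>) * g s \<xi>) (LINT s:{a..b}|lborel. w s)"
      by (rule L2le_Minkowski[OF lborel.sigma_finite_measure_axioms m'' _ w]) (use g 2 in \<open>simp add: fnorm_le_def\<close>)
    then show ?thesis using 2 by (simp add: fnorm_le_def)
  next
    case 3
    then show ?thesis using L1le_Minkowski[OF lborel.sigma_finite_measure_axioms m' _ w] g by (simp add: fnorm_le_def)
  qed
qed

section \<open>Decay of Fourier multipliers\<close>

lemma low_frequency_bound:
  assumes t: "t \<ge> 0" and x: "norm \<xi> \<le> 1"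
  shows "decay t \<xi> \<le> 2 * exp (- ((1 + t) / 8 * (norm \<xi>)\<^sup>2))"
proof -
  have n: "(norm \<xi>)\<^sup>2 \<le> 1" using x by (simp add: power_le_one)
  then have m: "min 1 ((norm \<xi>)\<^sup>2) = (norm \<xi>)\<^sup>2" by simp
  \<comment> \<open>Passing from t to 1 + t costs the bounded factor exp(|\<xi>|^2/8) and keeps the
    Gaussian integrable at t = 0.\<close>
  have "decay t \<xi> = exp ((norm \<xi>)\<^sup>2 / 8) * exp (- ((1 + t) / 8 * (norm \<xi>)\<^sup>2))"
    unfolding decay_def m exp_add[symmetric] by (simp add: field_simps)
  also have "\<dots> \<le> 2 * exp (- ((1 + t) / 8 * (norm \<xi>)\<^sup>2))"
  proof (intro mult_right_mono)
    have "exp ((norm \<xi>)\<^sup>2 / 8) \<le> exp (1 / 2)" using n by simp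
    also have "exp (1 / 2 :: real) \<le> 2"
      using exp_bound_half[of "1/2::real"] by simp
    finally show "exp ((norm \<xi>)\<^sup>2 / 8) \<le> 2" .
  qed simp
  finally show ?thesis .
qed

text \<open>Exponential decay beats (1+t)^(-1), and 1 is the largest rate ever requested: it is
  attained in dimension two by the gradient and by the sup norm.\<close>

lemma high_frequency_bound:
  assumes t: "t \<ge> 0" and x: "norm \<xi> \<ge> 1" and b: "0 \<le> \<beta>" "\<beta> \<le> 1"
  shows "decay t \<xi> \<le> 8 * (1 + t) powr (- \<beta>)"
proof -
  have "1 \<le> (norm \<xi>)\<^sup>2" using x by simp
  then have "min 1 ((norm \<xi>)\<^sup>2) = 1" by simp
  then have "decay t \<xi> = 1 / exp (t / 8)" by (simp add: decay_def exp_minus inverse_eq_divide)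
  also have "\<dots> \<le> 1 / ((1 + t) / 8)"
  proof (rule divide_left_mono)
    have "(1 + t) / 8 \<le> 1 + t / 8" by (simp add: add_divide_distrib)
    then show "(1 + t) / 8 \<le> exp (t / 8)" using exp_ge_add_one_self[of "t / 8"] by (rule order_trans)
  qed (use t in auto)
  also have "\<dots> = 8 * (1 + t) powr (- 1)" using t by (simp add: powr_minus inverse_eq_divide)
  also have "\<dots> \<le> 8 * (1 + t) powr (- \<beta>)" using t b by (intro mult_left_mono powr_mono) auto
  finally show ?thesis .
qed

lemma norm_gaussian_bound:
  assumes T: "T > 0"
  shows "norm \<xi> * exp (- (T / 8 * (norm \<xi>)\<^sup>2)) \<le> 2 * T powr (- 1/2) * exp (- (T / 16 * (norm \<xi>)\<^sup>2))"
proof -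
  define x where "x = sqrt T * norm \<xi>"
  have x2: "x\<^sup>2 = T * (norm \<xi>)\<^sup>2" using T by (simp add: x_def power_mult_distrib)
  \<comment> \<open>Half of the Gaussian exponent is spent on absorbing the factor x = sqrt T *
    |\<xi>|.\<close>
  have "x / 2 \<le> 1 + x\<^sup>2 / 16" using zero_le_power2[of "x / 4 - 1"] by (simp add: power2_eq_square field_simps)
  also have "\<dots> \<le> exp (x\<^sup>2 / 16)" by (rule exp_ge_add_one_self)
  finally have "x \<le> 2 * exp (x\<^sup>2 / 16)" by simp
  then have "x * exp (- (x\<^sup>2 / 8)) \<le> 2 * exp (x\<^sup>2 / 16) * exp (- (x\<^sup>2 / 8))" by (intro mult_right_mono) auto
  also have "\<dots> = 2 * exp (- (x\<^sup>2 / 16))" by (simp add: exp_add[symmetric])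
  finally have "T powr (- 1/2) * (x * exp (- (x\<^sup>2 / 8))) \<le> T powr (- 1/2) * (2 * exp (- (x\<^sup>2 / 16)))" by (intro mult_left_mono) auto
  moreover have "T powr (- 1/2) * x = norm \<xi>"
    using T by (simp add: x_def powr_minus powr_half_sqrt field_simps)
  ultimately have "norm \<xi> * exp (- (x\<^sup>2 / 8)) \<le> 2 * T powr (- 1/2) * exp (- (x\<^sup>2 / 16))"
    by (simp only: mult.assoc[symmetric] mult.commute[of 2])
  then show ?thesis by (simp add: x2)
qed

lemma powr_pi_bound:
  assumes "0 < c" "c \<le> 8" "0 \<le> \<beta>" "\<beta> \<le> 1" "T > 0" shows "(c * pi / T) powr \<beta> \<le> 32 * T powr (- \<beta>)"
proof -
  have "(c * pi / T) powr \<beta> \<le> (8 * pi / T) powr \<beta>"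
    using assms by (intro powr_mono2) (auto intro!: divide_right_mono)
  also have "\<dots> = (8 * pi) powr \<beta> * T powr (- \<beta>)" using assms by (simp add: powr_divide powr_minus inverse_eq_divide)
  also have "\<dots> \<le> (8 * pi) powr 1 * T powr (- \<beta>)" using assms pi_ge_two by (intro mult_right_mono powr_mono) auto
  also have "\<dots> \<le> 32 * T powr (- \<beta>)" using pi_less_4 by (intro mult_right_mono) auto
  finally show ?thesis .
qed

text \<open>Two estimates for one multiplier. The first also uses the size P of the symbol for
  |\<xi>| <= 1, supplied in applications by an L1 bound, and gains the extra factor (1+t)^(-n/4).
  The second uses only the weighted L2 norm and forgoes that factor. For |\<xi>| > 1 both rely on
  exponential decay and on the power of \<open>jb\<close> in the hypothesis.\<close>

lemma multiplier_estimate: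
  fixes F :: "real^'n::finite \<Rightarrow> complex" and G :: "real^'n \<Rightarrow> real"
  assumes dim: "CARD('n) = 1 \<or> CARD('n) = 2" and t: "t \<ge> 0" and c: "c \<ge> 0"
    and Fm[measurable]: "F \<in> borel_measurable borel" and Gm[measurable]: "G \<in> borel_measurable borel"
    and FG: "\<And>\<xi>. norm (F \<xi>) \<le> c * (decay t \<xi> / jb \<xi>) * \<bar>G \<xi>\<bar>"
    and P: "\<And>\<xi>. norm \<xi> \<le> 1 \<Longrightarrow> \<bar>G \<xi>\<bar> \<le> P" and Q: "L2le lborel (\<lambda>\<xi>. jb \<xi> ^ (CARD('n) - 1) * G \<xi>) Q"
  shows "fnorm_le j F (400 * c * (1 + t) powr (- (rate CARD('n) j + CARD('n) / 4)) * (P + Q))" (is ?g1)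
    and "fnorm_le j F (400 * c * (1 + t) powr (- rate CARD('n) j) * Q)" (is ?g2)
proof -
  define T where "T = 1 + t"
  have T: "T \<ge> 1" "T > 0" using t by (auto simp: T_def)
  define n where "n = real CARD('n)"
  have n: "n \<le> 2" "n \<ge> 1" "n > 0" using dim by (auto simp: n_def)
  have P0: "0 \<le> P" using P[of 0] by (rule order_trans[OF abs_ge_zero]) simp
  have Q0: "0 \<le> Q" by (rule L2le_nonneg[OF Q])
  have GQ: "L2le lborel G Q"
  proof (rule L2le_dom1[OF Q])
    show "norm (G \<xi>) \<le> norm (jb \<xi> ^ (CARD('n) - 1) * G \<xi>)" for \<xi>
      using mult_right_mono[OF one_le_power[OF jb_ge_1[of \<xi>], of "CARD('n) - 1"], of "\<bar>G \<xi>\<bar>"] jb_pos[of \<xi>] by (simp add: abs_mult)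
  qed simp
  \<comment> \<open>This factorization into two L2 functions fixes the weight: \<open>jb\<close> to
    the power n is the model function in L2, one of these powers comes from the multiplier, and n -
    1 are left for G.\<close>
  have GJ: "L1le lborel (\<lambda>\<xi>. G \<xi> / jb \<xi>) (4 * Q)"
  proof -
    have "L1le lborel (\<lambda>\<xi>. (jb \<xi> ^ (CARD('n) - 1) * G \<xi>) * (1 / jb \<xi> ^ CARD('n))) (Q * sqrt (pi ^ CARD('n)))"
      by (rule L2le_mult[OF Q jb_L2])
    moreover have "(jb \<xi> ^ (CARD('n) - 1) * G \<xi>) * (1 / jb \<xi> ^ CARD('n)) = G \<xi> / jb \<xi>" for \<xi> :: "real^'n"
    proof -
      have "jb \<xi> ^ CARD('n) = jb \<xi> * jb \<xi> ^ (CARD('n) - 1)" by (metis power_minus_mult mult.commute zero_less_card_finite)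
      then show ?thesis using jb_pos[of \<xi>] by simp
    qed
    moreover have "Q * sqrt (pi ^ CARD('n)) \<le> 4 * Q"
    proof -
      have "pi ^ CARD('n) \<le> pi ^ 2" using dim pi_ge_two by (intro power_increasing) auto
      also have "\<dots> \<le> 4 ^ 2" using pi_less_4 by (intro power_mono) auto
      finally have "sqrt (pi ^ CARD('n)) \<le> 4" by (intro real_le_lsqrt) auto
      then show ?thesis using Q0 mult_left_mono by (metis mult.commute)
    qed
    ultimately show ?thesis using L1le_mono by (metis (no_types, lifting) ext)
  qed
  let ?g8 = "\<lambda>\<xi>::real^'n. exp (- (T / 8 * (norm \<xi>)\<^sup>2))"
  let ?g16 = "\<lambda>\<xi>::real^'n. exp (- (T / 16 * (norm \<xi>)\<^sup>2))"
  have jb1: "c * (decay t \<xi> / jb \<xi>) * \<bar>G \<xi>\<bar> \<le> c * decay t \<xi> * \<bar>G \<xi>\<bar>" for \<xi>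
  proof -
    have "decay t \<xi> / jb \<xi> \<le> decay t \<xi>" using jb_ge_1[of \<xi>] jb_pos[of \<xi>] decay_bounds(1)[of t \<xi>] by (simp add: divide_le_eq)
    then show ?thesis using c by (intro mult_right_mono mult_left_mono) auto
  qed
  have low: "norm (F \<xi>) \<le> 2 * c * ?g8 \<xi> * \<bar>G \<xi>\<bar>" if x: "norm \<xi> \<le> 1" for \<xi>
  proof -
    have "norm (F \<xi>) \<le> c * decay t \<xi> * \<bar>G \<xi>\<bar>" using FG[of \<xi>] jb1[of \<xi>] by linarith
    also have "\<dots> \<le> c * (2 * ?g8 \<xi>) * \<bar>G \<xi>\<bar>"
      using low_frequency_bound[OF t x] c by (intro mult_right_mono mult_left_mono) (auto simp: T_def)
    finally show ?thesis by (simp add: mult_ac)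
  qed
  have high: "norm (F \<xi>) \<le> 8 * c * T powr (- \<beta>) * \<bar>G \<xi> / jb \<xi>\<bar>" if x: "\<not> norm \<xi> \<le> 1" and b: "0 \<le> \<beta>" "\<beta> \<le> 1" for \<xi> \<beta>
  proof -
    have "norm (F \<xi>) \<le> (c * (\<bar>G \<xi>\<bar> / jb \<xi>)) * decay t \<xi>" using FG[of \<xi>] by (simp add: mult_ac)
    also have "\<dots> \<le> (c * (\<bar>G \<xi>\<bar> / jb \<xi>)) * (8 * T powr (- \<beta>))"
      using high_frequency_bound[OF t _ b, of \<xi>] x c jb_pos[of \<xi>] by (intro mult_left_mono) (auto simp: T_def)
    finally show ?thesis using jb_pos[of \<xi>] by (simp add: mult_ac)
  qed
  have GJle: "\<bar>G \<xi> / jb \<xi>\<bar> \<le> \<bar>G \<xi>\<bar>" "norm \<xi> * \<bar>G \<xi> / jb \<xi>\<bar> \<le> \<bar>G \<xi>\<bar>" for \<xi> :: "real^'n"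
  proof -
    show "\<bar>G \<xi> / jb \<xi>\<bar> \<le> \<bar>G \<xi>\<bar>" using jb_ge_1[of \<xi>] jb_pos[of \<xi>] mult_left_mono[OF jb_ge_1[of \<xi>], of "\<bar>G \<xi>\<bar>"] by (simp add: divide_le_eq)
    show "norm \<xi> * \<bar>G \<xi> / jb \<xi>\<bar> \<le> \<bar>G \<xi>\<bar>"
      using mult_right_mono[OF norm_le_jb[of \<xi>], of "\<bar>G \<xi>\<bar>"] jb_pos[of \<xi>] by (simp add: divide_le_eq mult.commute)
  qed
  have L2case: "L2le lborel H (a1 * A1 + a2 * Q)"
    if H: "H \<in> borel_measurable borel" and a: "a1 \<ge> 0" "a2 \<ge> 0" and g: "L2le lborel g A1"
      and le: "\<And>\<xi>. norm \<xi> \<le> 1 \<Longrightarrow> norm (H \<xi>) \<le> a1 * \<bar>g \<xi>\<bar>" "\<And>\<xi>. \<not> norm \<xi> \<le> 1 \<Longrightarrow> norm (H \<xi>) \<le> a2 * \<bar>G \<xi>\<bar>"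
    for H :: "real^'n \<Rightarrow> complex" and g :: "real^'n \<Rightarrow> real" and a1 a2 A1
  proof -
    have [measurable]: "g \<in> borel_measurable borel" using g by (auto simp: L2le_def)
    have "L2le lborel (\<lambda>\<xi>. a1 * \<bar>g \<xi>\<bar> + a2 * \<bar>G \<xi>\<bar>) (a1 * A1 + a2 * Q)"
      by (intro L2le_add L2le_dom[OF g] L2le_dom[OF GQ]) (use a in \<open>auto simp: abs_mult\<close>)
    then show ?thesis
    proof (rule L2le_dom1)
      show "norm (H \<xi>) \<le> norm (a1 * \<bar>g \<xi>\<bar> + a2 * \<bar>G \<xi>\<bar>)" for \<xi>
        using le[of \<xi>] a by (cases "norm \<xi> \<le> 1") (auto intro: order_trans)
    qed (use H in simp)
  qed
  have g8L2: "L2le lborel ?g8 (32 * T powr (- (n / 4)))" and g16L2: "L2le lborel ?g16 (32 * T powr (- (n / 4)))"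
    and g8L1: "L1le lborel ?g8 (32 * T powr (- (n / 2)))"
  proof -
    have "L2le lborel ?g8 ((4 * pi / T) powr (n / 4))"
      using gaussian_L2[of "T / 8", where 'n='n] T by (simp add: n_def mult.commute)
    then show "L2le lborel ?g8 (32 * T powr (- (n / 4)))" by (rule L2le_mono) (use n T in \<open>auto intro!: powr_pi_bound\<close>)
    have "L2le lborel ?g16 ((8 * pi / T) powr (n / 4))"
      using gaussian_L2[of "T / 16", where 'n='n] T by (simp add: n_def mult.commute)
    then show "L2le lborel ?g16 (32 * T powr (- (n / 4)))" by (rule L2le_mono) (use n T in \<open>auto intro!: powr_pi_bound\<close>)
    have "L1le lborel ?g8 ((8 * pi / T) powr (n / 2))"
      using gaussian_L1[of "T / 8", where 'n='n] T by (simp add: n_def mult.commute)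
    then show "L1le lborel ?g8 (32 * T powr (- (n / 2)))" by (rule L1le_mono) (use n T in \<open>auto intro!: powr_pi_bound\<close>)
  qed
  have powr_pos: "T powr x \<ge> 0" for x by simp
  \<comment> \<open>A single generous constant, 400, absorbs the factors of all three norms; the
    largest that actually arises is 128.\<close>
  have key: "a * c * p * x + b * c * p * y \<le> 400 * c * p * (x + y)" if "a \<le> 400" "b \<le> 400" "p \<ge> 0" "x \<ge> 0" "y \<ge> 0" for a b p x y :: real
  proof -
    have "a * (c * p * x) \<le> 400 * (c * p * x)" "b * (c * p * y) \<le> 400 * (c * p * y)"
      using that c by (auto intro!: mult_right_mono)
    then show ?thesis by (simp add: algebra_simps)
  qed
  consider "j = 0" | "j = 1" | "j \<noteq> 0" "j \<noteq> 1" by blast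
  then show ?g1
  proof cases
    case 1
    have "L2le lborel F ((2 * c * P) * (32 * T powr (- (n / 4))) + (8 * c * T powr (- (n / 4))) * Q)"
    proof (rule L2case[OF Fm _ _ g8L2])
      show "norm (F \<xi>) \<le> (2 * c * P) * \<bar>?g8 \<xi>\<bar>" if "norm \<xi> \<le> 1" for \<xi>
        using order_trans[OF low[OF that] mult_left_mono[OF P[OF that], of "2 * c * ?g8 \<xi>"]] c by (simp add: mult_ac)
      show "norm (F \<xi>) \<le> (8 * c * T powr (- (n / 4))) * \<bar>G \<xi>\<bar>" if "\<not> norm \<xi> \<le> 1" for \<xi>
        using order_trans[OF high[OF that, of "n / 4"] mult_left_mono[OF GJle(1)[of \<xi>], of "8 * c * T powr (- (n / 4))"]] n c by simp
    qed (use c P0 in auto)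
    then have "L2le lborel F (400 * c * T powr (- (n / 4)) * (P + Q))"
      by (rule L2le_mono) (use key[of 64 8 "T powr (- (n / 4))" P Q] P0 Q0 in \<open>simp add: mult_ac\<close>)
    then show ?thesis using 1 by (simp add: fnorm_le_def rate_def T_def n_def)
  next
    case 2
    have "L2le lborel (\<lambda>\<xi>. complex_of_real (norm \<xi>) * F \<xi>) ((4 * c * T powr (- 1/2) * P) * (32 * T powr (- (n / 4))) + (8 * c * T powr (- (1/2 + n / 4))) * Q)"
    proof (rule L2case[OF _ _ _ g16L2])
      show "norm (complex_of_real (norm \<xi>) * F \<xi>) \<le> (4 * c * T powr (- 1/2) * P) * \<bar>?g16 \<xi>\<bar>" if "norm \<xi> \<le> 1" for \<xi>
      proof -
        have "norm (complex_of_real (norm \<xi>) * F \<xi>) \<le> norm \<xi> * (2 * c * ?g8 \<xi> * \<bar>G \<xi>\<bar>)"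
          using low[OF that] by (simp add: norm_mult mult_left_mono)
        also have "\<dots> = (2 * c * \<bar>G \<xi>\<bar>) * (norm \<xi> * ?g8 \<xi>)" by (simp add: mult_ac)
        also have "\<dots> \<le> (2 * c * P) * (2 * T powr (- 1/2) * ?g16 \<xi>)"
          by (rule mult_mono[OF mult_left_mono[OF P[OF that]] norm_gaussian_bound[OF T(2)]]) (use c P0 in auto)
        finally show ?thesis by (simp add: mult_ac)
      qed
      show "norm (complex_of_real (norm \<xi>) * F \<xi>) \<le> (8 * c * T powr (- (1/2 + n / 4))) * \<bar>G \<xi>\<bar>" if "\<not> norm \<xi> \<le> 1" for \<xi>
      proof -
        have "norm (complex_of_real (norm \<xi>) * F \<xi>) \<le> norm \<xi> * (8 * c * T powr (- (1/2 + n / 4)) * \<bar>G \<xi> / jb \<xi>\<bar>)"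
          using mult_left_mono[OF high[OF that, of "1/2 + n / 4"] norm_ge_zero[of \<xi>]] n by (simp add: norm_mult)
        also have "\<dots> = (8 * c * T powr (- (1/2 + n / 4))) * (norm \<xi> * \<bar>G \<xi> / jb \<xi>\<bar>)" by (simp only: mult_ac)
        also have "\<dots> \<le> (8 * c * T powr (- (1/2 + n / 4))) * \<bar>G \<xi>\<bar>" using GJle(2)[of \<xi>] c by (intro mult_left_mono) auto
        finally show ?thesis .
      qed
    qed (use c P0 in auto)
    moreover have "T powr (- 1/2) * T powr (- (n / 4)) = T powr (- (1/2 + n / 4))" by (simp add: powr_add[symmetric])
    then have "(4 * c * T powr (- 1/2) * P) * (32 * T powr (- (n / 4))) = 128 * c * T powr (- (1/2 + n / 4)) * P" by (simp add: mult_ac)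
    ultimately have "L2le lborel (\<lambda>\<xi>. complex_of_real (norm \<xi>) * F \<xi>) (128 * c * T powr (- (1/2 + n / 4)) * P + (8 * c * T powr (- (1/2 + n / 4))) * Q)"
      by (simp only:)
    then have "L2le lborel (\<lambda>\<xi>. complex_of_real (norm \<xi>) * F \<xi>) (400 * c * T powr (- (1/2 + n / 4)) * (P + Q))"
      by (rule L2le_mono) (use key[of 128 8 "T powr (- (1/2 + n / 4))" P Q] P0 Q0 in simp)
    then show ?thesis using 2 by (simp add: fnorm_le_def rate_def T_def n_def)
  next
    case 3
    \<comment> \<open>For the L1 norm the low frequencies contribute the full integral of the
      Gaussian, of size T^(-n/2), times P.\<close>
    have "L1le lborel (\<lambda>\<xi>. (2 * c * P) * ?g8 \<xi> + (8 * c * T powr (- (n / 2))) * \<bar>G \<xi> / jb \<xi>\<bar>) ((2 * c * P) * (32 * T powr (- (n / 2))) + (8 * c * T powr (- (n / 2))) * (4 * Q))"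
      by (intro L1le_add L1le_dom[OF g8L1] L1le_dom[OF GJ]) (use c P0 in \<open>auto simp: abs_mult\<close>)
    then have "L1le lborel F ((2 * c * P) * (32 * T powr (- (n / 2))) + (8 * c * T powr (- (n / 2))) * (4 * Q))"
    proof (rule L1le_dom1)
      show "norm (F \<xi>) \<le> norm ((2 * c * P) * ?g8 \<xi> + (8 * c * T powr (- (n / 2))) * \<bar>G \<xi> / jb \<xi>\<bar>)" for \<xi>
      proof (cases "norm \<xi> \<le> 1")
        case True
        have "norm (F \<xi>) \<le> (2 * c * P) * ?g8 \<xi>"
          using order_trans[OF low[OF True] mult_left_mono[OF P[OF True], of "2 * c * ?g8 \<xi>"]] c by (simp add: mult_ac)
        moreover have "0 \<le> (8 * c * T powr (- (n / 2))) * \<bar>G \<xi> / jb \<xi>\<bar>" using c by simp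
        ultimately show ?thesis unfolding real_norm_def by (intro order_trans[OF _ abs_ge_self] add_increasing add_increasing2) auto
      next
        case False
        have "norm (F \<xi>) \<le> (8 * c * T powr (- (n / 2))) * \<bar>G \<xi> / jb \<xi>\<bar>" using high[OF False, of "n / 2"] n by simp
        moreover have "0 \<le> (2 * c * P) * ?g8 \<xi>" using c P0 by simp
        ultimately show ?thesis unfolding real_norm_def by (intro order_trans[OF _ abs_ge_self] add_increasing add_increasing2) auto
      qed
    qed simp
    then have "L1le lborel F (400 * c * T powr (- (n / 2)) * (P + Q))"
      by (rule L1le_mono) (use key[of 64 32 "T powr (- (n / 2))" P Q] P0 Q0 in \<open>simp add: mult_ac\<close>)
    then show ?thesis using 3 by (simp add: fnorm_le_def rate_def T_def n_def)
  qed
  consider "j = 0" | "j = 1" | "j \<noteq> 0" "j \<noteq> 1" by blast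
  then show ?g2
  proof cases
    case 1
    have "L2le lborel F ((2 * c) * Q + (8 * c * T powr (- 0)) * Q)"
    proof (rule L2case[OF Fm _ _ GQ])
      show "norm (F \<xi>) \<le> (2 * c) * \<bar>G \<xi>\<bar>" if "norm \<xi> \<le> 1" for \<xi>
      proof -
        have "?g8 \<xi> \<le> 1" using T by simp
        then have "2 * c * ?g8 \<xi> * \<bar>G \<xi>\<bar> \<le> 2 * c * 1 * \<bar>G \<xi>\<bar>" using c by (intro mult_right_mono mult_left_mono) auto
        then show ?thesis using low[OF that] by simp
      qed
      show "norm (F \<xi>) \<le> (8 * c * T powr (- 0)) * \<bar>G \<xi>\<bar>" if "\<not> norm \<xi> \<le> 1" for \<xi>
        using order_trans[OF high[OF that, of 0] mult_left_mono[OF GJle(1)[of \<xi>], of "8 * c * T powr (- 0)"]] c by simp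
    qed (use c in auto)
    then have "L2le lborel F (400 * c * T powr (- 0) * Q)"
      by (rule L2le_mono) (use key[of 0 10 1 0 Q] Q0 T in simp)
    then show ?thesis using 1 by (simp add: fnorm_le_def rate_def T_def n_def)
  next
    case 2
    have "L2le lborel (\<lambda>\<xi>. complex_of_real (norm \<xi>) * F \<xi>) ((4 * c * T powr (- 1/2)) * Q + (8 * c * T powr (- (1/2))) * Q)"
    proof (rule L2case[OF _ _ _ GQ])
      show "norm (complex_of_real (norm \<xi>) * F \<xi>) \<le> (4 * c * T powr (- 1/2)) * \<bar>G \<xi>\<bar>" if "norm \<xi> \<le> 1" for \<xi>
      proof -
        have "norm (complex_of_real (norm \<xi>) * F \<xi>) \<le> norm \<xi> * (2 * c * ?g8 \<xi> * \<bar>G \<xi>\<bar>)"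
          using low[OF that] by (simp add: norm_mult mult_left_mono)
        also have "\<dots> = (2 * c * \<bar>G \<xi>\<bar>) * (norm \<xi> * ?g8 \<xi>)" by (simp add: mult_ac)
        also have "\<dots> \<le> (2 * c * \<bar>G \<xi>\<bar>) * (2 * T powr (- 1/2) * 1)"
        proof (intro mult_left_mono)
          have "2 * T powr (- 1/2) * ?g16 \<xi> \<le> 2 * T powr (- 1/2) * 1" using T by (intro mult_left_mono) auto
          then show "norm \<xi> * ?g8 \<xi> \<le> 2 * T powr (- 1/2) * 1" using norm_gaussian_bound[OF T(2), of \<xi>] by linarith
        qed (use c in auto)
        finally show ?thesis by (simp add: mult_ac)
      qed
      show "norm (complex_of_real (norm \<xi>) * F \<xi>) \<le> (8 * c * T powr (- (1/2))) * \<bar>G \<xi>\<bar>" if "\<not> norm \<xi> \<le> 1" for \<xi>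
      proof -
        have "norm (complex_of_real (norm \<xi>) * F \<xi>) \<le> norm \<xi> * (8 * c * T powr (- (1/2)) * \<bar>G \<xi> / jb \<xi>\<bar>)"
          using mult_left_mono[OF high[OF that, of "1/2"] norm_ge_zero[of \<xi>]] by (simp add: norm_mult)
        also have "\<dots> = (8 * c * T powr (- (1/2))) * (norm \<xi> * \<bar>G \<xi> / jb \<xi>\<bar>)" by (simp only: mult_ac)
        also have "\<dots> \<le> (8 * c * T powr (- (1/2))) * \<bar>G \<xi>\<bar>" using GJle(2)[of \<xi>] c by (intro mult_left_mono) auto
        finally show ?thesis .
      qed
    qed (use c in auto)
    then have "L2le lborel (\<lambda>\<xi>. complex_of_real (norm \<xi>) * F \<xi>) (400 * c * T powr (- (1/2)) * Q)"
      by (rule L2le_mono) (use key[of 0 12 "T powr (- (1/2))" 0 Q] Q0 in simp)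
    then show ?thesis using 2 by (simp add: fnorm_le_def rate_def T_def n_def)
  next
    case 3
    \<comment> \<open>Without P the low frequencies are handled by Cauchy-Schwarz against the
      Gaussian, whose L2 norm has only half of the previous decay.\<close>
    have g8G: "L1le lborel (\<lambda>\<xi>. ?g8 \<xi> * G \<xi>) (32 * T powr (- (n / 4)) * Q)" by (rule L2le_mult[OF g8L2 GQ])
    have "L1le lborel (\<lambda>\<xi>. (2 * c) * \<bar>?g8 \<xi> * G \<xi>\<bar> + (8 * c * T powr (- (n / 4))) * \<bar>G \<xi> / jb \<xi>\<bar>) ((2 * c) * (32 * T powr (- (n / 4)) * Q) + (8 * c * T powr (- (n / 4))) * (4 * Q))"
      by (intro L1le_add L1le_dom[OF g8G] L1le_dom[OF GJ]) (use c in \<open>auto simp: abs_mult\<close>)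
    then have "L1le lborel F ((2 * c) * (32 * T powr (- (n / 4)) * Q) + (8 * c * T powr (- (n / 4))) * (4 * Q))"
    proof (rule L1le_dom1)
      show "norm (F \<xi>) \<le> norm ((2 * c) * \<bar>?g8 \<xi> * G \<xi>\<bar> + (8 * c * T powr (- (n / 4))) * \<bar>G \<xi> / jb \<xi>\<bar>)" for \<xi>
      proof (cases "norm \<xi> \<le> 1")
        case True
        have "norm (F \<xi>) \<le> (2 * c) * \<bar>?g8 \<xi> * G \<xi>\<bar>" using low[OF True] by (simp add: abs_mult mult_ac)
        moreover have "0 \<le> (8 * c * T powr (- (n / 4))) * \<bar>G \<xi> / jb \<xi>\<bar>" using c by simp
        ultimately show ?thesis unfolding real_norm_def by (intro order_trans[OF _ abs_ge_self] add_increasing add_increasing2) auto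
      next
        case False
        have "norm (F \<xi>) \<le> (8 * c * T powr (- (n / 4))) * \<bar>G \<xi> / jb \<xi>\<bar>" using high[OF False, of "n / 4"] n by simp
        moreover have "0 \<le> (2 * c) * \<bar>?g8 \<xi> * G \<xi>\<bar>" using c by simp
        ultimately show ?thesis unfolding real_norm_def by (intro order_trans[OF _ abs_ge_self] add_increasing add_increasing2) auto
      qed
    qed simp
    then have "L1le lborel F (400 * c * T powr (- (n / 4)) * Q)"
      by (rule L1le_mono) (use key[of 0 96 "T powr (- (n / 4))" 0 Q] Q0 in \<open>simp add: mult_ac\<close>)
    then show ?thesis using 3 by (simp add: fnorm_le_def rate_def T_def n_def)
  qed
qed

subsection \<open>The nonlinearity\<close>

text \<open>In both dimensions q = 2/n is an integer, so the real power 1 + 2/n becomes the ordinary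
  power q + 1. The dimension enters as a real number and is tied to a vector type only where
  functions of x occur.\<close>

locale semilinear =
  fixes \<mu> :: "real \<Rightarrow> real" and q :: nat and n :: real
  assumes modulus: "modulus_of_continuity \<mu>" and qn: "real q * n = 2" and n12: "n = 1 \<or> n = 2"
    and tail: "\<exists>C\<^sub>0>0. set_integrable lborel {C\<^sub>0..} (\<lambda>s. \<mu> (1 / s) / s)"
begin

lemma q12: "q = 1 \<or> q = 2"
  using qn n12 by auto

lemma mu_nonneg: "0 \<le> s \<Longrightarrow> 0 \<le> \<mu> s"
  and mu_mono: "0 \<le> a \<Longrightarrow> a \<le> b \<Longrightarrow> \<mu> a \<le> \<mu> b"
  and mu_0: "\<mu> 0 = 0"
  and mu_continuous: "continuous_on {0..} \<mu>"
  using modulus by (auto simp: modulus_of_continuity_def mono_on_def)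

text \<open>Concavity and the value 0 at the origin make the slope of the chord from the origin
  nonincreasing; the inequality is written without division.\<close>

lemma mu_concave:
  assumes "0 < b" "0 \<le> a" "a \<le> b" shows "a * \<mu> b \<le> b * \<mu> a"
proof -
  have c: "concave_on {0..} \<mu>" using modulus by (simp add: modulus_of_continuity_def)
  have "\<mu> ((1 - a / b) *\<^sub>R 0 + (a / b) *\<^sub>R b) \<ge> (1 - a / b) * \<mu> 0 + (a / b) * \<mu> b"
    using assms by (intro concave_onD[OF c]) (auto simp: divide_le_eq)
  then have "(a / b) * \<mu> b \<le> \<mu> a" using assms by (simp add: mu_0)
  then show ?thesis using assms by (simp add: field_simps)
qed

definition h :: "real \<Rightarrow> real" where "h s = \<bar>s\<bar> ^ Suc q * \<mu> \<bar>s\<bar>"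

lemma h_continuous: "continuous_on UNIV h"
  unfolding h_def[abs_def]
  by (intro continuous_intros continuous_on_compose2[OF mu_continuous]) auto

lemma h_measurable[measurable]: "h \<in> borel_measurable borel"
  by (intro borel_measurable_continuous_onI h_continuous)

text \<open>The difference splits into an increment of the power with \<mu> frozen at b, and an
  increment of \<mu>. The former has constant q + 1 <= 3; by monotone chord slopes a (\<mu> b -
  \<mu> a) is at most (b - a) \<mu> b, which contributes 1 more.\<close>

lemma h_diff_nonneg:
  assumes ab: "0 \<le> a" "a \<le> b" shows "\<bar>h b - h a\<bar> \<le> 4 * b ^ q * \<mu> b * (b - a)"
proof (cases "b = 0")
  case True
  then show ?thesis using ab by (simp add: h_def)
next
  case False
  then have b: "b > 0" using ab by linarith
  have q1: "real (Suc q) \<le> 3" using q12 by auto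
  have mono: "h a \<le> h b" unfolding h_def using ab b by (intro mult_mono power_mono) (auto intro: mu_mono mu_nonneg)
  have pw: "b ^ Suc q - a ^ Suc q \<le> 3 * b ^ q * (b - a)"
  proof -
    have "b ^ Suc q - a ^ Suc q = (b - a) * (\<Sum>i<Suc q. b ^ i * a ^ (q - i))"
      using power_diff_sumr2[of b "Suc q" a] by (simp add: mult.commute)
    also have "\<dots> \<le> (b - a) * (\<Sum>i<Suc q. b ^ q)"
    proof (intro mult_left_mono sum_mono)
      fix i assume i: "i \<in> {..<Suc q}"
      have "b ^ i * a ^ (q - i) \<le> b ^ i * b ^ (q - i)" using ab by (intro mult_left_mono power_mono) auto
      also have "\<dots> = b ^ q" using i by (simp add: power_add[symmetric])
      finally show "b ^ i * a ^ (q - i) \<le> b ^ q" .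
    qed (use ab in auto)
    also have "\<dots> = real (Suc q) * (b ^ q * (b - a))" by simp
    also have "\<dots> \<le> 3 * (b ^ q * (b - a))" using ab by (intro mult_right_mono q1) auto
    finally show ?thesis by simp
  qed
  have "h b - h a = (b ^ Suc q - a ^ Suc q) * \<mu> b + a ^ q * (a * \<mu> b - a * \<mu> a)"
    using ab by (simp add: h_def algebra_simps)
  also have "\<dots> \<le> (3 * b ^ q * (b - a)) * \<mu> b + b ^ q * ((b - a) * \<mu> b)"
  proof (intro add_mono)
    show "(b ^ Suc q - a ^ Suc q) * \<mu> b \<le> (3 * b ^ q * (b - a)) * \<mu> b" using ab by (intro mult_right_mono pw mu_nonneg) auto
    have "a * \<mu> b - a * \<mu> a \<le> (b - a) * \<mu> a" using mu_concave[OF b ab] by (simp add: algebra_simps)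
    also have "\<dots> \<le> (b - a) * \<mu> b" using ab by (intro mult_left_mono mu_mono) auto
    finally have 1: "a * \<mu> b - a * \<mu> a \<le> (b - a) * \<mu> b" .
    have 0: "0 \<le> a * \<mu> b - a * \<mu> a" using ab mult_left_mono[OF mu_mono[OF ab] ab(1)] by simp
    show "a ^ q * (a * \<mu> b - a * \<mu> a) \<le> b ^ q * ((b - a) * \<mu> b)" using 0 1 ab by (intro mult_mono power_mono) auto
  qed
  also have "\<dots> = 4 * b ^ q * \<mu> b * (b - a)" by (simp add: algebra_simps)
  finally show ?thesis using mono by simp
qed

lemma h_diff_max: "\<bar>h x - h y\<bar> \<le> 4 * (max \<bar>x\<bar> \<bar>y\<bar>) ^ q * \<mu> (max \<bar>x\<bar> \<bar>y\<bar>) * \<bar>x - y\<bar>"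
proof -
  have ha: "h \<bar>x\<bar> = h x" for x by (simp add: h_def)
  have *: "\<bar>h x - h y\<bar> \<le> 4 * (max \<bar>x\<bar> \<bar>y\<bar>) ^ q * \<mu> (max \<bar>x\<bar> \<bar>y\<bar>) * \<bar>x - y\<bar>" if "\<bar>y\<bar> \<le> \<bar>x\<bar>" for x y
  proof -
    have "\<bar>h x - h y\<bar> \<le> 4 * \<bar>x\<bar> ^ q * \<mu> \<bar>x\<bar> * (\<bar>x\<bar> - \<bar>y\<bar>)" using h_diff_nonneg[OF _ that] by (simp add: ha)
    also have "\<dots> \<le> 4 * \<bar>x\<bar> ^ q * \<mu> \<bar>x\<bar> * \<bar>x - y\<bar>" by (intro mult_left_mono mult_nonneg_nonneg mu_nonneg) auto
    finally show ?thesis using that by (simp add: max_def)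
  qed
  show ?thesis
  proof (cases "\<bar>y\<bar> \<le> \<bar>x\<bar>")
    case False
    then show ?thesis using *[of x y] by (metis abs_minus_commute max.commute nle_le)
  qed (rule *)
qed

lemma h_lipschitz:
  assumes "\<bar>x\<bar> \<le> M" "\<bar>y\<bar> \<le> M" shows "\<bar>h x - h y\<bar> \<le> 4 * M ^ q * \<mu> M * \<bar>x - y\<bar>"
proof -
  let ?m = "max \<bar>x\<bar> \<bar>y\<bar>"
  have m: "0 \<le> ?m" "?m \<le> M" using assms by auto
  have "4 * ?m ^ q * \<mu> ?m \<le> 4 * M ^ q * \<mu> M" using m by (intro mult_mono power_mono mu_mono mu_nonneg mult_nonneg_nonneg zero_le_power) auto
  then have "4 * ?m ^ q * \<mu> ?m * \<bar>x - y\<bar> \<le> 4 * M ^ q * \<mu> M * \<bar>x - y\<bar>" by (rule mult_right_mono) simp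
  then show ?thesis using h_diff_max[of x y] by linarith
qed

text \<open>One power of the maximum is kept as |x| + |y|, to be put in L2 with x - y: this is the
  form that yields an L1 bound by Cauchy-Schwarz. The plain Lipschitz form serves the L2
  bound.\<close>

lemma h_diff_bilinear:
  assumes "\<bar>x\<bar> \<le> M" "\<bar>y\<bar> \<le> M" shows "\<bar>h x - h y\<bar> \<le> 4 * M ^ (q - 1) * \<mu> M * ((\<bar>x\<bar> + \<bar>y\<bar>) * \<bar>x - y\<bar>)"
proof -
  let ?m = "max \<bar>x\<bar> \<bar>y\<bar>"
  have m: "0 \<le> ?m" "?m \<le> M" "?m \<le> \<bar>x\<bar> + \<bar>y\<bar>" using assms by auto
  have M: "0 \<le> M" using assms by linarith
  have qs: "q = Suc (q - 1)" using q12 by auto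
  have "?m ^ q = ?m ^ (q - 1) * ?m" using qs by (metis power_Suc2)
  also have "\<dots> \<le> M ^ (q - 1) * (\<bar>x\<bar> + \<bar>y\<bar>)" using m M by (intro mult_mono power_mono) auto
  finally have le: "4 * ?m ^ q \<le> 4 * (M ^ (q - 1) * (\<bar>x\<bar> + \<bar>y\<bar>))" by simp
  have "4 * ?m ^ q * \<mu> ?m \<le> 4 * (M ^ (q - 1) * (\<bar>x\<bar> + \<bar>y\<bar>)) * \<mu> M"
    by (rule mult_mono[OF le mu_mono[OF m(1,2)]]) (use m(1) M in \<open>simp_all add: mu_nonneg\<close>)
  then have "4 * ?m ^ q * \<mu> ?m * \<bar>x - y\<bar> \<le> 4 * (M ^ (q - 1) * (\<bar>x\<bar> + \<bar>y\<bar>)) * \<mu> M * \<bar>x - y\<bar>" by (rule mult_right_mono) simp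
  then show ?thesis using h_diff_max[of x y] by (simp add: mult_ac)
qed

lemma h_bound1: assumes "\<bar>x\<bar> \<le> M" shows "\<bar>h x\<bar> \<le> M ^ q * \<mu> M * \<bar>x\<bar>"
proof -
  have "\<bar>h x\<bar> = \<bar>x\<bar> ^ q * \<mu> \<bar>x\<bar> * \<bar>x\<bar>" by (simp add: h_def abs_mult mu_nonneg mult_ac)
  also have "\<dots> \<le> M ^ q * \<mu> M * \<bar>x\<bar>"
    using assms by (intro mult_right_mono mult_mono power_mono mu_mono mu_nonneg) auto
  finally show ?thesis .
qed

lemma h_bound2: assumes "\<bar>x\<bar> \<le> M" shows "\<bar>h x\<bar> \<le> M ^ (q - 1) * \<mu> M * (\<bar>x\<bar> * \<bar>x\<bar>)"
proof -
  have qs: "q = Suc (q - 1)" using q12 by auto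
  have "\<bar>x\<bar> ^ Suc q = \<bar>x\<bar> ^ (q - 1) * (\<bar>x\<bar> * \<bar>x\<bar>)" by (subst qs) simp
  then have "\<bar>h x\<bar> = \<bar>x\<bar> ^ (q - 1) * \<mu> \<bar>x\<bar> * (\<bar>x\<bar> * \<bar>x\<bar>)" by (simp add: h_def abs_mult mu_nonneg mult_ac)
  also have "\<dots> \<le> M ^ (q - 1) * \<mu> M * (\<bar>x\<bar> * \<bar>x\<bar>)"
    using assms by (intro mult_right_mono mult_mono power_mono mu_mono mu_nonneg) auto
  finally show ?thesis .
qed

section \<open>Norm bounds for the nonlinear source\<close>

lemma h_L1:
  assumes u: "L2le N u B" and M: "\<And>x. \<bar>u x\<bar> \<le> M" shows "L1le N (\<lambda>x. h (u x)) (M ^ (q - 1) * \<mu> M * (B * B))"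
proof -
  have [measurable]: "u \<in> borel_measurable N" using u by (simp add: L2le_def)
  have M0: "0 \<le> M" using M[of undefined] by linarith
  show ?thesis
  proof (rule L1le_dom[OF L2le_mult[OF u u]])
    show "AE x in N. norm (h (u x)) \<le> M ^ (q - 1) * \<mu> M * norm (u x * u x)"
      using h_bound2[OF M] by (intro AE_I2) (simp add: abs_mult)
  qed (use M0 in \<open>auto intro!: mult_nonneg_nonneg mu_nonneg\<close>)
qed

lemma h_L2:
  assumes u: "L2le N u B" and M: "\<And>x. \<bar>u x\<bar> \<le> M" shows "L2le N (\<lambda>x. h (u x)) (M ^ q * \<mu> M * B)"
proof -
  have [measurable]: "u \<in> borel_measurable N" using u by (simp add: L2le_def)
  have M0: "0 \<le> M" using M[of undefined] by linarith
  show ?thesis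
  proof (rule L2le_dom[OF u])
    show "AE x in N. norm (h (u x)) \<le> M ^ q * \<mu> M * norm (u x)"
      using h_bound1[OF M] by (intro AE_I2) simp
  qed (use M0 in \<open>auto intro!: mult_nonneg_nonneg mu_nonneg\<close>)
qed

lemma h_diff_L2:
  assumes [measurable]: "u \<in> borel_measurable N" "v \<in> borel_measurable N"
    and d: "L2le N (\<lambda>x. u x - v x) D" and M: "\<And>x. \<bar>u x\<bar> \<le> M" "\<And>x. \<bar>v x\<bar> \<le> M"
  shows "L2le N (\<lambda>x. h (u x) - h (v x)) (4 * M ^ q * \<mu> M * D)"
proof -
  have M0: "0 \<le> M" using M(1)[of undefined] by linarith
  show ?thesis
  proof (rule L2le_dom[OF d])
    show "AE x in N. norm (h (u x) - h (v x)) \<le> 4 * M ^ q * \<mu> M * norm (u x - v x)"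
      using h_lipschitz[OF M] by (intro AE_I2) simp
  qed (use M0 in \<open>auto intro!: mult_nonneg_nonneg mu_nonneg\<close>)
qed

lemma h_diff_L1:
  assumes u: "L2le N u A" and v: "L2le N v B"
    and d: "L2le N (\<lambda>x. u x - v x) D" and M: "\<And>x. \<bar>u x\<bar> \<le> M" "\<And>x. \<bar>v x\<bar> \<le> M"
  shows "L1le N (\<lambda>x. h (u x) - h (v x)) (4 * M ^ (q - 1) * \<mu> M * ((A + B) * D))"
proof -
  have [measurable]: "u \<in> borel_measurable N" "v \<in> borel_measurable N" using u v by (auto simp: L2le_def)
  have M0: "0 \<le> M" using M(1)[of undefined] by linarith
  have s: "L2le N (\<lambda>x. \<bar>u x\<bar> + \<bar>v x\<bar>) (A + B)" using L2le_add[OF L2le_norm[OF u] L2le_norm[OF v]] by simp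
  show ?thesis
  proof (rule L1le_dom[OF L2le_mult[OF s d]])
    show "AE x in N. norm (h (u x) - h (v x)) \<le> 4 * M ^ (q - 1) * \<mu> M * norm ((\<bar>u x\<bar> + \<bar>v x\<bar>) * (u x - v x))"
      using h_diff_bilinear[OF M] by (intro AE_I2) (simp add: abs_mult)
  qed (use M0 in \<open>auto intro!: mult_nonneg_nonneg mu_nonneg\<close>)
qed

text \<open>Difference quotients replace the chain rule: translation differences of \<open>u\<close> and of
  \<open>h \<circ> u\<close> are compared pointwise and measured by Plancherel.\<close>

lemma h_gradient_coord:
  fixes F :: "real^'n::finite \<Rightarrow> complex"
  assumes F: "integrable lborel F" "L2le lborel F A" and FB: "L2le lborel (\<lambda>\<xi>. complex_of_real (norm \<xi>) * F \<xi>) B"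
    and M: "\<And>x. \<bar>Re (ift F x)\<bar> \<le> M"
  shows "L2le lborel (\<lambda>\<xi>. complex_of_real (\<xi> $ i) * ft (cx (\<lambda>x. h (Re (ift F x)))) \<xi>) (sqrt (ftc TYPE('n)) * (4 * M ^ q * \<mu> M * B))"
proof -
  define u where "u x = Re (ift F x)" for x
  define f where "f = cx (\<lambda>x. h (u x))"
  have Fm[measurable]: "F \<in> borel_measurable borel" using F by auto
  have u2: "L2le lborel u A" unfolding u_def by (rule L2le_Re[OF ift_L2[OF F]])
  have um[measurable]: "u \<in> borel_measurable borel" using u2 by (simp add: L2le_def)
  have uM: "\<bar>u x\<bar> \<le> M" for x using M by (simp add: u_def)
  have fi: "integrable lborel f" unfolding f_def by (rule cx_integrable[OF L1le_integrable[OF h_L1[OF u2 uM]]])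
  have fm[measurable]: "f \<in> borel_measurable borel" using fi by auto
  let ?L = "4 * M ^ q * \<mu> M" and ?s = "sqrt (ftc TYPE('n))"
  let ?y = "\<lambda>k. (1 / real (Suc k)) *\<^sub>R axis i 1 :: real^'n"
  let ?E = "\<lambda>k \<xi>. exp (\<i> * complex_of_real (?y k \<bullet> \<xi>)) - 1"
  have yx: "?y k \<bullet> \<xi> = \<xi> $ i / real (Suc k)" for k \<xi> by (simp add: inner_axis')
  have step: "L2le lborel (\<lambda>\<xi>. ?E k \<xi> * ft f \<xi>) (?s * (?L * ((1 / real (Suc k)) * B)))" for k
  proof -
    \<comment> \<open>Since |exp(i r) - 1| <= |r|, the bound on |\<xi>| F makes the translation
      difference of size 1/(k+1) in L2. The Lipschitz property of \<open>h\<close> preserves this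
      size.\<close>
    have EF: "L2le lborel (\<lambda>\<xi>. ?E k \<xi> * F \<xi>) ((1 / real (Suc k)) * B)"
    proof (rule L2le_dom[OF FB])
      show "AE \<xi> in lborel. norm (?E k \<xi> * F \<xi>) \<le> 1 / real (Suc k) * norm (complex_of_real (norm \<xi>) * F \<xi>)"
      proof (rule AE_I2)
        fix \<xi> :: "real^'n"
        have "norm (?E k \<xi>) \<le> \<bar>\<xi> $ i\<bar> / real (Suc k)" using iexp_minus_one_bound[of "?y k \<bullet> \<xi>"] unfolding yx by (simp only: abs_divide abs_of_nat)
        also have "\<dots> \<le> norm \<xi> / real (Suc k)" by (intro divide_right_mono component_le_norm_cart) simp
        finally have "norm (?E k \<xi>) * norm (F \<xi>) \<le> (norm \<xi> / real (Suc k)) * norm (F \<xi>)" by (rule mult_right_mono) simp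
        then show "norm (?E k \<xi> * F \<xi>) \<le> 1 / real (Suc k) * norm (complex_of_real (norm \<xi>) * F \<xi>)" by (simp only: norm_mult) simp
      qed
    qed measurable
    have pF: "integrable lborel (\<lambda>\<xi>. exp (\<i> * complex_of_real (?y k \<bullet> \<xi>)) * F \<xi>)"
      using integrable_phase[OF F(1), of "- ?y k"] by (simp add: inner_commute)
    have EFi: "integrable lborel (\<lambda>\<xi>. ?E k \<xi> * F \<xi>)"
      using Bochner_Integration.integrable_diff[OF pF F(1)] by (simp add: left_diff_distrib)
    have ud: "u (?y k + x) - u x = Re (ift (\<lambda>\<xi>. ?E k \<xi> * F \<xi>) x)" for x
    proof -
      have "ift (\<lambda>\<xi>. ?E k \<xi> * F \<xi>) x = ift (\<lambda>\<xi>. exp (\<i> * complex_of_real (?y k \<bullet> \<xi>)) * F \<xi> - F \<xi>) x" by (simp only: left_diff_distrib mult_1)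
      also have "\<dots> = ift F (?y k + x) - ift F x" by (simp only: ift_diff[OF pF F(1)] ift_shift)
      finally show ?thesis by (simp add: u_def)
    qed
    have "L2le lborel (\<lambda>x. u (?y k + x) - u x) ((1 / real (Suc k)) * B)"
      unfolding ud by (rule L2le_Re[OF ift_L2[OF EFi EF]])
    then have "L2le lborel (\<lambda>x. h (u (?y k + x)) - h (u x)) (?L * ((1 / real (Suc k)) * B))"
      by (intro h_diff_L2 uM) measurable
    then have D: "L2le lborel (\<lambda>x. f (?y k + x) - f x) (?L * ((1 / real (Suc k)) * B))"
      by (rule L2le_dom1) (auto simp: f_def cx_def of_real_diff[symmetric] simp del: of_real_diff)
    have fs: "integrable lborel (\<lambda>x. f (?y k + x))" using lborel_shift_reflect(3)[of f 1 "?y k"] fi by simp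
    have "L2le lborel (ft (\<lambda>x. f (?y k + x) - f x)) (?s * (?L * ((1 / real (Suc k)) * B)))"
      by (rule ft_L2[OF Bochner_Integration.integrable_diff[OF fs fi] D])
    moreover have "ft (\<lambda>x. f (?y k + x) - f x) = (\<lambda>\<xi>. ?E k \<xi> * ft f \<xi>)"
      by (rule ext) (simp only: ft_diff[OF fs fi] ft_shift[OF fm] left_diff_distrib mult_1)
    ultimately show ?thesis by simp
  qed
  show ?thesis unfolding u_def[symmetric] f_def[symmetric]
  \<comment> \<open>Multiplying the phase difference by (k+1)/i makes it converge to the i-th
    coordinate of \<xi>, while the bounds become independent of k.\<close>
  proof (rule L2le_Fatou[where A="\<lambda>k. ?s * (?L * B)" and f="\<lambda>k \<xi>. complex_of_real (real (Suc k)) * (?E k \<xi> / \<i>) * ft f \<xi>"])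
    fix k
    have "L2le lborel (\<lambda>\<xi>. complex_of_real (real (Suc k)) * (?E k \<xi> / \<i>) * ft f \<xi>) (real (Suc k) * (?s * (?L * ((1 / real (Suc k)) * B))))"
      by (rule L2le_dom[OF step[of k]]) (use ft_measurable[OF fi] in \<open>auto simp: norm_mult norm_divide simp del: of_nat_Suc\<close>)
    then show "L2le lborel (\<lambda>\<xi>. complex_of_real (real (Suc k)) * (?E k \<xi> / \<i>) * ft f \<xi>) (?s * (?L * B))"
      by (simp add: field_simps del: of_nat_Suc)
  next
    show "(\<lambda>\<xi>. complex_of_real (\<xi> $ i) * ft f \<xi>) \<in> borel_measurable lborel" using ft_measurable[OF fi] by simp
    have "(\<lambda>k. complex_of_real (real (Suc k)) * (?E k \<xi> / \<i>) * ft f \<xi>) \<longlonglongrightarrow> complex_of_real (\<xi> $ i) * ft f \<xi>" for \<xi>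
    proof (intro tendsto_mult_right)
      have "((\<lambda>z. exp (\<i> * complex_of_real (\<xi> $ i) * z)) has_field_derivative \<i> * complex_of_real (\<xi> $ i)) (at 0)"
        by (auto intro!: derivative_eq_intros)
      then have 1: "((\<lambda>z. (exp (\<i> * complex_of_real (\<xi> $ i) * z) - 1) / z) \<longlongrightarrow> \<i> * complex_of_real (\<xi> $ i)) (at 0)"
        by (simp add: has_field_derivative_iff)
      have "filterlim (\<lambda>k. complex_of_real (1 / real (Suc k))) (at 0) sequentially"
        by (rule filterlim_atI[OF tendsto_of_real[OF LIMSEQ_Suc[OF lim_1_over_n], where 'a=complex, simplified of_real_0]]) (simp only: of_real_eq_0_iff, simp)
      from filterlim_compose[OF 1 this]
      have "(\<lambda>k. (exp (\<i> * complex_of_real (\<xi> $ i) * complex_of_real (1 / real (Suc k))) - 1) / complex_of_real (1 / real (Suc k)) / \<i>) \<longlonglongrightarrow> \<i> * complex_of_real (\<xi> $ i) / \<i>"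
        by (intro tendsto_divide tendsto_const) auto
      moreover have "(exp (\<i> * complex_of_real (\<xi> $ i) * complex_of_real (1 / real (Suc k))) - 1) / complex_of_real (1 / real (Suc k)) / \<i> = complex_of_real (real (Suc k)) * (?E k \<xi> / \<i>)" for k
        unfolding yx by (simp add: mult_ac del: of_nat_Suc)
      moreover have "\<i> * complex_of_real (\<xi> $ i) / \<i> = complex_of_real (\<xi> $ i)" by simp
      ultimately show "(\<lambda>k. complex_of_real (real (Suc k)) * (?E k \<xi> / \<i>)) \<longlonglongrightarrow> complex_of_real (\<xi> $ i)" by (simp only:)
    qed
    then show "AE \<xi> in lborel. (\<lambda>k. complex_of_real (real (Suc k)) * (?E k \<xi> / \<i>) * ft f \<xi>) \<longlonglongrightarrow> complex_of_real (\<xi> $ i) * ft f \<xi>" by simp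
  qed auto
qed

text \<open>The weight is 1 in dimension one and \<open>jb\<close> in dimension two, so it is at
  most 1 plus the sum of the |\<xi>_i|. The constant 9 is 1 for the source itself plus 4 for each of
  at most two coordinates.\<close>

lemma h_source_weighted:
  fixes F :: "real^'n::finite \<Rightarrow> complex"
  assumes dim: "real CARD('n) = n" and F: "integrable lborel F" "L2le lborel F B"
    and FB: "L2le lborel (\<lambda>\<xi>. complex_of_real (norm \<xi>) * F \<xi>) B"
    and M: "\<And>x. \<bar>Re (ift F x)\<bar> \<le> M"
  shows "L2le lborel (\<lambda>\<xi>. jb \<xi> ^ (CARD('n) - 1) * norm (ft (cx (\<lambda>x. h (Re (ift F x)))) \<xi>)) (sqrt (ftc TYPE('n)) * (9 * M ^ q * \<mu> M * B))"
proof -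
  define u where "u x = Re (ift F x)" for x
  define f where "f = cx (\<lambda>x. h (u x))"
  have u2: "L2le lborel u B" unfolding u_def by (rule L2le_Re[OF ift_L2[OF F]])
  have uM: "\<bar>u x\<bar> \<le> M" for x using M by (simp add: u_def)
  have M0: "0 \<le> M" using uM[of 0] by linarith
  have fi: "integrable lborel f" unfolding f_def by (rule cx_integrable[OF L1le_integrable[OF h_L1[OF u2 uM]]])
  have ftm[measurable]: "ft f \<in> borel_measurable borel" by (rule ft_measurable[OF fi])
  let ?s = "sqrt (ftc TYPE('n))"
  have f2: "L2le lborel (ft f) (?s * (M ^ q * \<mu> M * B))"
    unfolding f_def by (rule ft_L2[OF fi[unfolded f_def] cx_L2le[OF h_L2[OF u2 uM]]])
  have g: "L2le lborel (\<lambda>\<xi>. complex_of_real (\<xi> $ i) * ft f \<xi>) (?s * (4 * M ^ q * \<mu> M * B))" for i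
    unfolding f_def u_def by (rule h_gradient_coord[OF F FB M])
  have S: "L2le lborel (\<lambda>\<xi>. norm (ft f \<xi>) + (\<Sum>i\<in>(UNIV::'n set). norm (complex_of_real (\<xi> $ i) * ft f \<xi>)))
      (?s * (M ^ q * \<mu> M * B) + (\<Sum>i\<in>(UNIV::'n set). ?s * (4 * M ^ q * \<mu> M * B)))"
    by (intro L2le_add L2le_sum L2le_norm f2 g)
  have "L2le lborel (\<lambda>\<xi>. jb \<xi> ^ (CARD('n) - 1) * norm (ft f \<xi>)) (?s * (M ^ q * \<mu> M * B) + (\<Sum>i\<in>(UNIV::'n set). ?s * (4 * M ^ q * \<mu> M * B)))"
  proof (rule L2le_dom1[OF S])
    fix \<xi> :: "real^'n"
    have j1: "jb \<xi> \<le> 1 + norm \<xi>" unfolding jb_def by (rule real_le_lsqrt) (auto simp: power2_sum)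
    have "jb \<xi> ^ (CARD('n) - 1) \<le> 1 + norm \<xi>" using dim n12 j1 by auto
    also have "norm \<xi> \<le> (\<Sum>i\<in>UNIV. \<bar>\<xi> $ i\<bar>)" by (rule norm_le_l1_cart)
    finally have "jb \<xi> ^ (CARD('n) - 1) * norm (ft f \<xi>) \<le> (1 + (\<Sum>i\<in>UNIV. \<bar>\<xi> $ i\<bar>)) * norm (ft f \<xi>)" by (intro mult_right_mono) auto
    also have "\<dots> = norm (ft f \<xi>) + (\<Sum>i\<in>UNIV. norm (complex_of_real (\<xi> $ i) * ft f \<xi>))"
      by (simp add: distrib_right sum_distrib_right norm_mult)
    finally show "norm (jb \<xi> ^ (CARD('n) - 1) * norm (ft f \<xi>)) \<le> norm (norm (ft f \<xi>) + (\<Sum>i\<in>(UNIV::'n set). norm (complex_of_real (\<xi> $ i) * ft f \<xi>)))"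
      using jb_pos[of \<xi>] by (simp add: abs_mult sum_nonneg)
  qed measurable
  then have "L2le lborel (\<lambda>\<xi>. jb \<xi> ^ (CARD('n) - 1) * norm (ft f \<xi>)) (?s * (9 * M ^ q * \<mu> M * B))"
  proof (rule L2le_mono)
    define X where "X = ?s * (M ^ q * \<mu> M * B)"
    have X: "0 \<le> X" unfolding X_def using L2le_nonneg[OF f2] .
    have "(\<Sum>i\<in>(UNIV::'n set). ?s * (4 * M ^ q * \<mu> M * B)) = n * (4 * X)" using dim by (simp add: X_def mult_ac)
    also have "\<dots> \<le> 2 * (4 * X)" using n12 X by (intro mult_right_mono) auto
    finally have "X + (\<Sum>i\<in>(UNIV::'n set). ?s * (4 * M ^ q * \<mu> M * B)) \<le> 9 * X" by simp
    then show "?s * (M ^ q * \<mu> M * B) + (\<Sum>i\<in>(UNIV::'n set). ?s * (4 * M ^ q * \<mu> M * B)) \<le> ?s * (9 * M ^ q * \<mu> M * B)"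
      by (simp add: X_def mult_ac)
  qed
  then show ?thesis by (simp add: f_def u_def)
qed

subsection \<open>Time integrals\<close>

definition omega :: "real \<Rightarrow> real" where "omega \<tau> = \<mu> ((1 + \<tau>) powr (- (n / 2)))"

lemma omega_bounds: assumes "\<tau> \<ge> 0" shows "0 \<le> omega \<tau>" "omega \<tau> \<le> \<mu> 1"
proof -
  show "0 \<le> omega \<tau>" unfolding omega_def by (rule mu_nonneg) simp
  have "(1 + \<tau>) powr (- (n / 2)) \<le> (1 + \<tau>) powr 0" using assms n12 by (intro powr_mono) auto
  then show "omega \<tau> \<le> \<mu> 1" unfolding omega_def using assms by (intro mu_mono) auto
qed

lemma omega_integral:
  "\<exists>\<Lambda>\<ge>0. \<forall>t\<ge>0. set_integrable lborel {0..t} (\<lambda>\<tau>. omega \<tau> / (1 + \<tau>)) \<and> (LINT \<tau>:{0..t}|lborel. omega \<tau> / (1 + \<tau>)) \<le> \<Lambda>"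
proof -
  obtain C0 where C0: "C0 > 0" "set_integrable lborel {C0..} (\<lambda>s. \<mu> (1 / s) / s)" using tail by blast
  define f where "f s = \<mu> (1 / s) / s" for s
  have fnn: "0 \<le> f s" if "s \<ge> 0" for s using that by (auto simp: f_def intro!: divide_nonneg_nonneg mu_nonneg)
  have cont: "continuous_on {1..b} f" for b
    unfolding f_def by (intro continuous_intros continuous_on_compose2[OF mu_continuous]) auto
  have int: "set_integrable lborel {1..b} f" for b by (rule borel_integrable_atLeastAtMost'[OF cont])
  \<comment> \<open>The Dini condition speaks only of the half-line from C0, while the integral in r
    begins at 1. The interval [1, C0+1] is compact; the overlap of the two pieces is harmless
    because the integrand is nonnegative.\<close>
  define I where "I = (LINT s:{1..C0+1}|lborel. f s) + (LINT s:{C0..}|lborel. f s)"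
  have ub: "(LINT s:{1..b}|lborel. f s) \<le> I" for b
  proof -
    have "(LINT s|lborel. indicator {1..b} s *\<^sub>R f s) \<le> (LINT s|lborel. indicator {1..C0+1} s *\<^sub>R f s + indicator {C0..} s *\<^sub>R f s)"
    proof (rule integral_mono)
      show "integrable lborel (\<lambda>s. indicator {1..b} s *\<^sub>R f s)" using int[of b] by (simp add: set_integrable_def)
      show "integrable lborel (\<lambda>s. indicator {1..C0+1} s *\<^sub>R f s + indicator {C0..} s *\<^sub>R f s)"
        using int[of "C0+1"] C0(2) by (simp add: set_integrable_def f_def)
      show "indicator {1..b} s *\<^sub>R f s \<le> indicator {1..C0+1} s *\<^sub>R f s + indicator {C0..} s *\<^sub>R f s" for s
        using fnn[of s] C0(1) by (auto simp: indicator_def)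
    qed
    also have "\<dots> = I" unfolding I_def set_lebesgue_integral_def
      using int[of "C0+1"] C0(2) by (intro Bochner_Integration.integral_add) (simp_all add: set_integrable_def f_def)
    finally show ?thesis by (simp add: set_lebesgue_integral_def)
  qed
  have n0: "n > 0" using n12 by auto
  have I0: "I \<ge> 0" unfolding I_def set_lebesgue_integral_def using C0(1) fnn
    by (intro add_nonneg_nonneg integral_nonneg_AE AE_I2) (auto simp: indicator_def)
  have main: "set_integrable lborel {0..t} (\<lambda>\<tau>. omega \<tau> / (1 + \<tau>)) \<and> (LINT \<tau>:{0..t}|lborel. omega \<tau> / (1 + \<tau>)) \<le> 2 / n * I" if t: "t \<ge> 0" for t
  proof -
    define g where "g \<tau> = (1 + \<tau>) powr (n / 2)" for \<tau>
    define g' where "g' \<tau> = n / 2 * (1 + \<tau>) powr (n / 2 - 1)" for \<tau>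
    have g0: "g 0 = 1" by (simp add: g_def)
    have fi: "set_integrable lborel {g 0..g t} f" using int[of "g t"] unfolding g0 .
    have der: "(g has_real_derivative g' x) (at x)" if "x \<in> {0..t}" for x
      unfolding g_def g'_def using that by (auto intro!: derivative_eq_intros)
    have cg: "continuous_on {0..t} g'" unfolding g'_def by (intro continuous_intros) auto
    have g'0: "0 \<le> g' x" if "x \<in> {0..t}" for x using n0 by (simp add: g'_def)
    \<comment> \<open>Under r = (1+\<tau>)^(n/2) the measure dr/r becomes (n/2)
      d\<tau>/(1+\<tau>).\<close>
    have fg: "f (g \<tau>) * g' \<tau> = (n / 2) * (omega \<tau> / (1 + \<tau>))" if "\<tau> \<in> {0..t}" for \<tau>
    proof -
      have p: "1 + \<tau> > 0" using that by auto
      have "1 / g \<tau> = (1 + \<tau>) powr (- (n / 2))" by (simp add: g_def powr_minus inverse_eq_divide)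
      moreover have "g' \<tau> / g \<tau> = n / 2 / (1 + \<tau>)" using p by (simp add: g_def g'_def powr_diff)
      moreover have "f (g \<tau>) * g' \<tau> = \<mu> (1 / g \<tau>) * (g' \<tau> / g \<tau>)" by (simp add: f_def)
      ultimately have "f (g \<tau>) * g' \<tau> = omega \<tau> * (n / 2 / (1 + \<tau>))" by (simp only: omega_def)
      then show ?thesis by (simp add: mult.commute)
    qed
    have S: "set_integrable lborel {0..t} (\<lambda>x. f (g x) * g' x)"
      "(LBINT x. f x * indicator {g 0..g t} x) = (LBINT x. f (g x) * g' x * indicator {0..t} x)"
      by (rule integral_substitution[OF fi der cg g'0 t], assumption+)+
    have eq: "f (g x) * g' x * indicator {0..t} x = (n / 2) * (indicator {0..t} x *\<^sub>R (omega x / (1 + x)))" for x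
      using fg[of x] by (auto simp: indicator_def)
    have I1: "integrable lborel (\<lambda>x. indicator {0..t} x *\<^sub>R (omega x / (1 + x)))"
    proof -
      have "integrable lborel (\<lambda>x. (n / 2) * (indicator {0..t} x *\<^sub>R (omega x / (1 + x))))"
        using S(1) unfolding set_integrable_def eq[symmetric] by (simp add: mult.commute)
      moreover have "2 / n * ((n / 2) * y) = y" for y using n0 by simp
      ultimately show ?thesis using integrable_mult_right[of "2 / n" lborel "\<lambda>x. (n / 2) * (indicator {0..t} x *\<^sub>R (omega x / (1 + x)))"] by (simp only:)
    qed
    have "(n / 2) * (LINT \<tau>:{0..t}|lborel. omega \<tau> / (1 + \<tau>)) = (LINT s:{1..g t}|lborel. f s)"
    proof -
      have "(LBINT x. f (g x) * g' x * indicator {0..t} x) = (n / 2) * (LINT \<tau>:{0..t}|lborel. omega \<tau> / (1 + \<tau>))"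
        unfolding eq set_lebesgue_integral_def by (rule integral_mult_right_zero)
      moreover have "(LBINT x. f x * indicator {g 0..g t} x) = (LINT s:{1..g t}|lborel. f s)"
        by (simp add: set_lebesgue_integral_def g0 mult.commute)
      ultimately show ?thesis using S(2) by simp
    qed
    then have "(n / 2) * (LINT \<tau>:{0..t}|lborel. omega \<tau> / (1 + \<tau>)) \<le> I" using ub[of "g t"] by simp
    then have "(LINT \<tau>:{0..t}|lborel. omega \<tau> / (1 + \<tau>)) \<le> 2 / n * I" using n0 by (simp add: field_simps)
    then show ?thesis using I1 by (simp add: set_integrable_def)
  qed
  show ?thesis using main I0 n0 by (intro exI[of _ "2 / n * I"]) auto
qed

text \<open>The exponent stays at or below 1/2, away from the logarithmic case 1; this is where the
  constant 2 comes from.\<close>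

lemma kernel_integral:
  fixes t \<alpha> :: real
  assumes t: "t \<ge> 0" and a: "0 \<le> \<alpha>" "\<alpha> \<le> 1/2"
  shows "set_integrable lborel {0..t} (\<lambda>\<tau>. (1 + t - \<tau>) powr (- \<alpha>))"
    and "(LINT \<tau>:{0..t}|lborel. (1 + t - \<tau>) powr (- \<alpha>)) \<le> 2 * (1 + t) powr (1 - \<alpha>)"
proof -
  have c: "continuous_on {0..t} (\<lambda>\<tau>. (1 + t - \<tau>) powr (- \<alpha>))" by (intro continuous_on_powr continuous_intros) auto
  show "set_integrable lborel {0..t} (\<lambda>\<tau>. (1 + t - \<tau>) powr (- \<alpha>))" by (rule borel_integrable_atLeastAtMost'[OF c])
  define F where "F \<tau> = - ((1 + t - \<tau>) powr (1 - \<alpha>)) / (1 - \<alpha>)" for \<tau>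
  have "(LINT \<tau>:{0..t}|lborel. (1 + t - \<tau>) powr (- \<alpha>)) = F t - F 0"
    unfolding set_lebesgue_integral_def
  proof (rule integral_FTC_atLeastAtMost[OF t _ c])
    fix x assume x: "0 \<le> x" "x \<le> t"
    then have p: "1 + t - x > 0" by simp
    have "(F has_real_derivative (1 + t - x) powr (- \<alpha>)) (at x)"
    proof -
      have "((\<lambda>\<tau>. (1 + t - \<tau>) powr (1 - \<alpha>)) has_real_derivative - ((1 - \<alpha>) * (1 + t - x) powr (- \<alpha>))) (at x)"
        using p by (auto intro!: derivative_eq_intros)
      from DERIV_cdivide[OF DERIV_minus[OF this], of "1 - \<alpha>"] show ?thesis unfolding F_def using a by simp
    qed
    then show "(F has_vector_derivative (1 + t - x) powr (- \<alpha>)) (at x within {0..t})"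
      by (simp add: has_real_derivative_iff_has_vector_derivative has_vector_derivative_at_within)
  qed
  also have "\<dots> \<le> (1 + t) powr (1 - \<alpha>) / (1 - \<alpha>)" using a by (simp add: F_def)
  also have "\<dots> \<le> (1 + t) powr (1 - \<alpha>) / (1/2)" using a by (intro divide_left_mono) auto
  finally show "(LINT \<tau>:{0..t}|lborel. (1 + t - \<tau>) powr (- \<alpha>)) \<le> 2 * (1 + t) powr (1 - \<alpha>)" by simp
qed

text \<open>One majorant for both ways of estimating the integrand: the disjunction says that at
  each time at least one of the two estimates is below \<open>w\<close>. For \<tau> <= t/2 the
  kernel with the larger exponent is comparable to its value at \<tau> = 0 and the Dini integral
  remains; for \<tau> > t/2 the factor (1+\<tau>)^(-(1+n/4)) is comparable to its value at t and the
  milder kernel is integrated.\<close>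

lemma duhamel_time_integral:
  assumes L: "\<And>t. t \<ge> 0 \<Longrightarrow> set_integrable lborel {0..t} (\<lambda>\<tau>. omega \<tau> / (1 + \<tau>)) \<and> (LINT \<tau>:{0..t}|lborel. omega \<tau> / (1 + \<tau>)) \<le> \<Lambda>"
    and t: "t \<ge> 0" and a: "0 \<le> \<alpha>" "\<alpha> \<le> 1/2" and D: "D \<ge> 0"
  shows "\<exists>w. set_integrable lborel {0..t} w \<and> (LINT \<tau>:{0..t}|lborel. w \<tau>) \<le> (2 * \<Lambda> + 8 * \<mu> 1) * D * (1 + t) powr (- (\<alpha> + n / 4))
    \<and> (\<forall>\<tau>\<in>{0..t}. D * (1 + (t - \<tau>)) powr (- (\<alpha> + n / 4)) * (omega \<tau> / (1 + \<tau>)) \<le> w \<tau>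
          \<or> D * (1 + (t - \<tau>)) powr (- \<alpha>) * (omega \<tau> * (1 + \<tau>) powr (- (1 + n / 4))) \<le> w \<tau>)"
proof -
  have n: "0 \<le> n / 4" "\<alpha> + n / 4 \<le> 1" "1 + n / 4 \<le> 2" using n12 a by auto
  \<comment> \<open>The factors 2 and 4 bound 2^(\<alpha>+n/4) and 2^(1+n/4), the cost of replacing
    t/2 by t.\<close>
  define A1 where "A1 = 2 * D * (1 + t) powr (- (\<alpha> + n / 4))"
  define A2 where "A2 = 4 * D * \<mu> 1 * (1 + t) powr (- (1 + n / 4))"
  have m1: "0 \<le> \<mu> 1" by (rule mu_nonneg) simp
  have A: "0 \<le> A1" "0 \<le> A2" using D m1 by (auto simp: A1_def A2_def)
  define w where "w \<tau> = A1 * (omega \<tau> / (1 + \<tau>)) + A2 * (1 + t - \<tau>) powr (- \<alpha>)" for \<tau>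
  have i1: "set_integrable lborel {0..t} (\<lambda>\<tau>. A1 * (omega \<tau> / (1 + \<tau>)))" using L[OF t] by (intro set_integrable_mult_right) auto
  have i2: "set_integrable lborel {0..t} (\<lambda>\<tau>. A2 * (1 + t - \<tau>) powr (- \<alpha>))" using kernel_integral(1)[OF t a] by (intro set_integrable_mult_right) auto
  have wi: "set_integrable lborel {0..t} w" unfolding w_def using i1 i2 by (rule set_integral_add(1))
  have "(LINT \<tau>:{0..t}|lborel. w \<tau>) = A1 * (LINT \<tau>:{0..t}|lborel. omega \<tau> / (1 + \<tau>)) + A2 * (LINT \<tau>:{0..t}|lborel. (1 + t - \<tau>) powr (- \<alpha>))"
    unfolding w_def by (simp only: set_integral_add(2)[OF i1 i2] set_integral_mult_right)
  also have "\<dots> \<le> A1 * \<Lambda> + A2 * (2 * (1 + t) powr (1 - \<alpha>))"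
    using L[OF t] kernel_integral(2)[OF t a] A by (intro add_mono mult_left_mono) auto
  also have "\<dots> = (2 * \<Lambda> + 8 * \<mu> 1) * D * (1 + t) powr (- (\<alpha> + n / 4))"
  proof -
    have "(1 + t) powr (- (1 + n / 4)) * (1 + t) powr (1 - \<alpha>) = (1 + t) powr (- (\<alpha> + n / 4))"
      by (simp add: powr_add[symmetric] algebra_simps)
    then have "A2 * (2 * (1 + t) powr (1 - \<alpha>)) = 8 * \<mu> 1 * D * (1 + t) powr (- (\<alpha> + n / 4))" by (simp add: A2_def mult_ac)
    then show ?thesis by (simp add: A1_def algebra_simps)
  qed
  finally have wI: "(LINT \<tau>:{0..t}|lborel. w \<tau>) \<le> (2 * \<Lambda> + 8 * \<mu> 1) * D * (1 + t) powr (- (\<alpha> + n / 4))" .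
  have half: "x powr (- \<beta>) \<le> 2 powr \<beta> * (1 + t) powr (- \<beta>)" if "x \<ge> (1 + t) / 2" "\<beta> \<ge> 0" for x \<beta>
  proof -
    have "x powr (- \<beta>) \<le> ((1 + t) / 2) powr (- \<beta>)" using that t by (intro powr_mono2') auto
    also have "\<dots> = 2 powr \<beta> * (1 + t) powr (- \<beta>)" using t by (simp add: powr_divide powr_minus field_simps)
    finally show ?thesis .
  qed
  have "D * (1 + (t - \<tau>)) powr (- (\<alpha> + n / 4)) * (omega \<tau> / (1 + \<tau>)) \<le> w \<tau>
          \<or> D * (1 + (t - \<tau>)) powr (- \<alpha>) * (omega \<tau> * (1 + \<tau>) powr (- (1 + n / 4))) \<le> w \<tau>" if tau: "\<tau> \<in> {0..t}" for \<tau>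
  proof -
    have o: "0 \<le> omega \<tau>" "omega \<tau> \<le> \<mu> 1" using omega_bounds tau by auto
    have p1: "0 \<le> A1 * (omega \<tau> / (1 + \<tau>))" "0 \<le> A2 * (1 + t - \<tau>) powr (- \<alpha>)" using A o tau by auto
    \<comment> \<open>Both summands of \<open>w\<close> are nonnegative, so each case may discard
      the one it does not use.\<close>
    show ?thesis
    proof (cases "\<tau> \<le> t / 2")
      case True
      have "(1 + (t - \<tau>)) powr (- (\<alpha> + n / 4)) \<le> 2 powr (\<alpha> + n / 4) * (1 + t) powr (- (\<alpha> + n / 4))"
        using True n a by (intro half) auto
      also have "\<dots> \<le> 2 powr 1 * (1 + t) powr (- (\<alpha> + n / 4))" using n by (intro mult_right_mono powr_mono) auto
      finally have "D * (1 + (t - \<tau>)) powr (- (\<alpha> + n / 4)) * (omega \<tau> / (1 + \<tau>)) \<le> D * (2 powr 1 * (1 + t) powr (- (\<alpha> + n / 4))) * (omega \<tau> / (1 + \<tau>))"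
        using D o tau by (intro mult_right_mono mult_left_mono) auto
      also have "\<dots> = A1 * (omega \<tau> / (1 + \<tau>))" by (simp add: A1_def)
      finally show ?thesis using p1 by (simp add: w_def)
    next
      case False
      have "(1 + \<tau>) powr (- (1 + n / 4)) \<le> 2 powr (1 + n / 4) * (1 + t) powr (- (1 + n / 4))"
        using False n by (intro half) auto
      also have "\<dots> \<le> 2 powr 2 * (1 + t) powr (- (1 + n / 4))" using n by (intro mult_right_mono powr_mono) auto
      finally have "omega \<tau> * (1 + \<tau>) powr (- (1 + n / 4)) \<le> \<mu> 1 * (2 powr 2 * (1 + t) powr (- (1 + n / 4)))"
        using o by (intro mult_mono) auto
      then have "D * (1 + (t - \<tau>)) powr (- \<alpha>) * (omega \<tau> * (1 + \<tau>) powr (- (1 + n / 4))) \<le> D * (1 + (t - \<tau>)) powr (- \<alpha>) * (\<mu> 1 * (2 powr 2 * (1 + t) powr (- (1 + n / 4))))"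
        using D by (intro mult_left_mono) auto
      also have "\<dots> = A2 * (1 + t - \<tau>) powr (- \<alpha>)" by (simp add: A2_def add_diff_eq)
      finally show ?thesis using p1 by (simp add: w_def)
    qed
  qed
  then show ?thesis using wi wI by blast
qed

end

subsection \<open>Picard iteration on the Fourier side\<close>

lemma L1le_dominated_convergence:
  fixes f :: "nat \<Rightarrow> 'a \<Rightarrow> 'b::{banach,second_countable_topology}" and h :: "'a \<Rightarrow> 'c::{banach,second_countable_topology}"
  assumes [measurable]: "\<And>k. f k \<in> borel_measurable M" and h: "L1le M h A"
    and dom: "\<And>k x. norm (f k x) \<le> norm (h x)"
    and lim: "\<And>x. (\<lambda>k. f k x) \<longlonglongrightarrow> 0" and e: "\<epsilon> > 0"
  shows "eventually (\<lambda>k. L1le M (f k) \<epsilon>) sequentially"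
proof -
  have [measurable]: "h \<in> borel_measurable M" using h by (simp add: L1le_def)
  have "(\<lambda>k. \<integral>\<^sup>+x. ennreal (norm (f k x)) \<partial>M) \<longlonglongrightarrow> (\<integral>\<^sup>+x. ennreal (norm (0::'b)) \<partial>M)"
  proof (rule nn_integral_dominated_convergence[where w="\<lambda>x. ennreal (norm (h x))"])
    show "(\<integral>\<^sup>+x. ennreal (norm (h x)) \<partial>M) < \<infinity>"
      using h by (auto simp: L1le_def intro: le_less_trans[OF _ ennreal_less_top])
    show "AE x in M. (\<lambda>k. ennreal (norm (f k x))) \<longlonglongrightarrow> ennreal (norm (0::'b))"
      by (intro AE_I2 tendsto_ennrealI tendsto_norm lim)
  qed (use dom in \<open>auto intro!: ennreal_leI\<close>)
  then have "eventually (\<lambda>k. (\<integral>\<^sup>+x. ennreal (norm (f k x)) \<partial>M) < ennreal \<epsilon>) sequentially"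
    using e by (intro order_tendstoD(2)[where y=0]) auto
  then show ?thesis by eventually_elim (use e in \<open>auto simp: L1le_def\<close>)
qed

lemma fnorm_le_dominated_convergence:
  assumes F: "\<And>k. F k \<in> borel_measurable borel" and h: "fnorm_le j H A"
    and dom: "\<And>k \<xi>. norm (F k \<xi>) \<le> norm (H \<xi>)" and lim: "\<And>\<xi>. (\<lambda>k. F k \<xi>) \<longlonglongrightarrow> 0" and e: "\<epsilon> > 0"
  shows "eventually (\<lambda>k. fnorm_le j (F k) \<epsilon>) sequentially"
proof -
  have Fm: "F k \<in> borel_measurable lborel" for k using F by simp
  consider "j = 0" | "j = 1" | "j \<noteq> 0" "j \<noteq> 1" by blast
  then show ?thesis
  proof cases
    case 1
    then have "L2le lborel H A" using h by (simp add: fnorm_le_def)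
    from L2le_dominated_convergence[OF Fm this AE_I2[OF dom] AE_I2[OF lim] e] show ?thesis using 1 by (simp add: fnorm_le_def)
  next
    case 2
    then have H: "L2le lborel (\<lambda>\<xi>. complex_of_real (norm \<xi>) * H \<xi>) A" using h by (simp add: fnorm_le_def)
    have "eventually (\<lambda>k. L2le lborel (\<lambda>\<xi>. complex_of_real (norm \<xi>) * F k \<xi>) \<epsilon>) sequentially"
    proof (rule L2le_dominated_convergence[OF _ H _ _ e])
      show "AE x in lborel. norm (complex_of_real (norm x) * F k x) \<le> norm (complex_of_real (norm x) * H x)" for k
        unfolding norm_mult by (intro AE_I2 mult_left_mono dom) simp
      show "AE x in lborel. (\<lambda>k. complex_of_real (norm x) * F k x) \<longlonglongrightarrow> 0"
        by (intro AE_I2 tendsto_mult_right_zero lim)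
    qed (use F in simp)
    then show ?thesis using 2 by (simp add: fnorm_le_def)
  next
    case 3
    then have "L1le lborel H A" using h by (simp add: fnorm_le_def)
    from L1le_dominated_convergence[OF Fm this dom lim e] show ?thesis using 3 by (simp add: fnorm_le_def)
  qed
qed

lemma L2le_telescope:
  assumes d: "\<And>k. L2le M (\<lambda>x. f (Suc k) x - f k x) (c * (1/2) ^ k)"
  shows "L2le M (\<lambda>x. f (k + j) x - f k x) (2 * c * (1/2) ^ k)"
proof -
  have c: "0 \<le> c" using L2le_nonneg[OF d[of 0]] by simp
  have "L2le M (\<lambda>x. \<Sum>i<j. f (Suc (k + i)) x - f (k + i) x) (\<Sum>i<j. c * (1/2) ^ (k + i))"
    by (intro L2le_sum d)
  moreover have "(\<Sum>i<j. f (Suc (k + i)) x - f (k + i) x) = f (k + j) x - f k x" for x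
    by (induction j) auto
  moreover have "(\<Sum>i<j. c * (1/2) ^ (k + i)) = 2 * c * (1/2) ^ k - 2 * c * (1/2) ^ (k + j)"
    by (induction j) (auto simp: algebra_simps)
  ultimately have "L2le M (\<lambda>x. f (k + j) x - f k x) (2 * c * (1/2) ^ k - 2 * c * (1/2) ^ (k + j))" by simp
  then show ?thesis by (rule L2le_mono) (use c in simp)
qed

lemma cx_L1le: "L1le M f A \<Longrightarrow> L1le M (cx f) A"
  unfolding L1le_def by auto

lemma ft_hermitian: "ft (cx f) (- \<xi>) = cnj (ft (cx f) \<xi>)"
proof -
  have "(\<lambda>x. cnj (cx f x)) = cx f" by (auto simp: cx_def fun_eq_iff)
  then show ?thesis using ft_cnj[of "cx f" "- \<xi>"] by simp
qed

lemma exp_integral: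
  fixes l t :: real
  assumes l: "l > 0" and t: "t \<ge> 0"
  shows "set_integrable lborel {0..t} (\<lambda>s. c * exp (l * s))" "0 \<le> c \<Longrightarrow> (LINT s:{0..t}|lborel. c * exp (l * s)) \<le> c * (exp (l * t) / l)"
proof -
  have c: "continuous_on {0..t} (\<lambda>s. exp (l * s))" by (intro continuous_intros)
  have i: "set_integrable lborel {0..t} (\<lambda>s. exp (l * s))" by (rule borel_integrable_atLeastAtMost'[OF c])
  then show "set_integrable lborel {0..t} (\<lambda>s. c * exp (l * s))" by (intro set_integrable_mult_right) auto
  have "(LINT s:{0..t}|lborel. exp (l * s)) = exp (l * t) / l - exp (l * 0) / l"
    unfolding set_lebesgue_integral_def
  proof (rule integral_FTC_atLeastAtMost[OF t _ c])
    fix x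
    have "((\<lambda>s. exp (l * s) / l) has_real_derivative exp (l * x)) (at x)"
      using l by (auto intro!: derivative_eq_intros)
    then show "((\<lambda>s. exp (l * s) / l) has_vector_derivative exp (l * x)) (at x within {0..t})"
      by (simp add: has_real_derivative_iff_has_vector_derivative has_vector_derivative_at_within)
  qed
  then have "(LINT s:{0..t}|lborel. exp (l * s)) \<le> exp (l * t) / l" using l by simp
  then show "(LINT s:{0..t}|lborel. c * exp (l * s)) \<le> c * (exp (l * t) / l)" if "0 \<le> c"
    using that by (simp only: set_integral_mult_right mult_left_mono)
qed

lemma K1_le_16: "t \<ge> 0 \<Longrightarrow> \<bar>K1 t \<xi>\<bar> \<le> 16"
proof -
  assume t: "t \<ge> 0"
  have "16 * (decay t \<xi> / jb \<xi>) \<le> 16 * (1 / 1)" using decay_bounds[of t \<xi>] t jb_ge_1[of \<xi>] by (intro mult_left_mono frac_le) auto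
  then show ?thesis using K1_bound[OF t, of \<xi>] by linarith
qed

text \<open>\<open>d\<close> bounds the data and \<open>R\<close> is the radius of the ball that
  holds the iterates. The linear estimate costs 400 * 16 * (d + d) = 12800 d, so 25600 d <= R lets
  the linear part fill half of the ball. The Duhamel estimate costs 64000 = 400 * 16 * 10, and the
  smallness condition confines it to the other half.\<close>

locale damped = semilinear \<mu> q n for \<mu> :: "real \<Rightarrow> real" and q :: nat and n :: real +
  fixes f0 f1 :: "real^'n::finite \<Rightarrow> complex" and d R \<Lambda> :: real
  assumes dim: "real CARD('n) = n"
    and f0_meas[measurable]: "f0 \<in> borel_measurable borel" and f1_meas[measurable]: "f1 \<in> borel_measurable borel"
    and f0_herm: "\<And>\<xi>. f0 (- \<xi>) = cnj (f0 \<xi>)" and f1_herm: "\<And>\<xi>. f1 (- \<xi>) = cnj (f1 \<xi>)"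
    and data_low: "\<And>\<xi>. norm \<xi> \<le> 1 \<Longrightarrow> jb \<xi> * norm (f0 \<xi>) + norm (f1 \<xi>) \<le> d"
    and data_L2: "L2le lborel (\<lambda>\<xi>. jb \<xi> ^ (CARD('n) - 1) * (jb \<xi> * norm (f0 \<xi>) + norm (f1 \<xi>))) d"
    and omega_int: "\<And>t. t \<ge> 0 \<Longrightarrow> set_integrable lborel {0..t} (\<lambda>\<tau>. omega \<tau> / (1 + \<tau>)) \<and> (LINT \<tau>:{0..t}|lborel. omega \<tau> / (1 + \<tau>)) \<le> \<Lambda>"
    and R: "0 \<le> R" "R \<le> 1" "25600 * d \<le> R" and small: "(2 * \<Lambda> + 8 * \<mu> 1) * (64000 * sqrt (ftc TYPE('n))) * R \<le> 1 / 2"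
begin

lemma card12: "CARD('n) = 1 \<or> CARD('n) = 2"
  using dim n12 by auto

definition wt :: "nat \<Rightarrow> real \<Rightarrow> real" where "wt j t = (1 + t) powr (- (rate n j + n / 4))"

lemma wt_nonneg: "0 \<le> wt j t"
  by (simp add: wt_def)

definition sol :: "(real^'n \<Rightarrow> complex) \<Rightarrow> real^'n \<Rightarrow> real" where "sol F x = Re (ift F x)"

text \<open>The ball in which the iteration lives. Hermitian symmetry makes inverse transforms real,
  so that the real part in \<open>sol\<close> loses nothing. Continuity in time is asked only in L2
  along sequences, which is what the source estimates consume.\<close>

definition good :: "(real \<Rightarrow> real^'n \<Rightarrow> complex) \<Rightarrow> bool" where
  "good F \<longleftrightarrow> (\<forall>t\<ge>0. F t \<in> borel_measurable borel \<and> (\<forall>\<xi>. F t (- \<xi>) = cnj (F t \<xi>)) \<and> (\<forall>j. fnorm_le j (F t) (R * wt j t)))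
     \<and> (\<forall>t\<ge>0. \<forall>X. (\<forall>k. X k \<ge> 0) \<longrightarrow> X \<longlonglongrightarrow> t \<longrightarrow> (\<forall>\<epsilon>>0. eventually (\<lambda>k. L2le lborel (\<lambda>\<xi>. F (X k) \<xi> - F t \<xi>) \<epsilon>) sequentially))"

lemma goodD:
  assumes "good F" "t \<ge> 0"
  shows "F t \<in> borel_measurable borel" "F t (- \<xi>) = cnj (F t \<xi>)" "fnorm_le j (F t) (R * wt j t)"
    "\<lbrakk>\<And>k. X k \<ge> 0; X \<longlonglongrightarrow> t; \<epsilon> > 0\<rbrakk> \<Longrightarrow> eventually (\<lambda>k. L2le lborel (\<lambda>\<xi>. F (X k) \<xi> - F t \<xi>) \<epsilon>) sequentially"
  using assms by (auto simp: good_def)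

lemma good_norms:
  assumes F: "good F" and t: "t \<ge> 0"
  shows "L1le lborel (F t) (R * (1 + t) powr (- (n / 2)))" "L2le lborel (F t) (R * (1 + t) powr (- (n / 4)))"
    "L2le lborel (\<lambda>\<xi>. complex_of_real (norm \<xi>) * F t \<xi>) (R * (1 + t) powr (- (n / 4)))" "integrable lborel (F t)"
    "\<bar>sol (F t) x\<bar> \<le> R * (1 + t) powr (- (n / 2))" "L2le lborel (sol (F t)) (R * (1 + t) powr (- (n / 4)))"
    "L2le lborel (F t) R" "\<bar>sol (F t) x\<bar> \<le> R" "L2le lborel (sol (F t)) R" "sol (F t) \<in> borel_measurable borel"
proof -
  show 1: "L1le lborel (F t) (R * (1 + t) powr (- (n / 2)))"
    using goodD(3)[OF F t, of 2] by (simp add: fnorm_le_def wt_def rate_def)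
  show 2: "L2le lborel (F t) (R * (1 + t) powr (- (n / 4)))"
    using goodD(3)[OF F t, of 0] by (simp add: fnorm_le_def wt_def rate_def)
  have "L2le lborel (\<lambda>\<xi>. complex_of_real (norm \<xi>) * F t \<xi>) (R * wt 1 t)"
    using goodD(3)[OF F t, of 1] by (simp add: fnorm_le_def)
  then show "L2le lborel (\<lambda>\<xi>. complex_of_real (norm \<xi>) * F t \<xi>) (R * (1 + t) powr (- (n / 4)))"
  proof (rule L2le_mono)
    show "R * wt 1 t \<le> R * (1 + t) powr (- (n / 4))"
      unfolding wt_def rate_def using t R by (intro mult_left_mono powr_mono) auto
  qed
  show i: "integrable lborel (F t)" by (rule L1le_integrable[OF 1])
  have m: "ift (F t) \<in> borel_measurable borel" by (rule ift_measurable[OF i])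
  then show "sol (F t) \<in> borel_measurable borel" unfolding sol_def by measurable
  show s: "\<bar>sol (F t) x\<bar> \<le> R * (1 + t) powr (- (n / 2))"
    unfolding sol_def using ift_bound[OF 1, of x] abs_Re_le_cmod order_trans by blast
  show s2: "L2le lborel (sol (F t)) (R * (1 + t) powr (- (n / 4)))"
    unfolding sol_def by (rule L2le_Re[OF ift_L2[OF i 2]])
  have w: "R * (1 + t) powr (- x) \<le> R" if "x \<ge> 0" for x
    using powr_mono[of "-x" 0 "1 + t"] that t R mult_left_mono[of "(1 + t) powr (- x)" 1 R] by simp
  show "L2le lborel (F t) R" "L2le lborel (sol (F t)) R" using L2le_mono[OF 2] L2le_mono[OF s2] w[of "n/4"] n12 by auto
  show "\<bar>sol (F t) x\<bar> \<le> R" using s w[of "n/2"] n12 by auto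
qed

text \<open>Times are clipped at 0, so that the source is continuous in time and frequency on the
  whole plane and joint Borel measurability follows.\<close>

definition src :: "(real \<Rightarrow> real^'n \<Rightarrow> complex) \<Rightarrow> real \<Rightarrow> real^'n \<Rightarrow> complex" where
  "src F s = ft (cx (\<lambda>x. h (sol (F (max 0 s)) x)))"

lemma src_source:
  assumes F: "good F"
  shows "integrable lborel (cx (\<lambda>x. h (sol (F (max 0 s)) x)))" "src F s \<in> borel_measurable borel"
  using cx_integrable[OF L1le_integrable[OF h_L1[OF good_norms(9,8)[OF F]]]] ft_measurable by (auto simp: src_def)

text \<open>The critical exponent at work: since n q = 2, the q-th power of the sup-norm rate is
  exactly 1/(1+t). The bound R <= 1 is used inside \<mu> to compare with
  \<open>omega\<close>.\<close>

lemma R_powers: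
  assumes t: "t \<ge> 0"
  shows "(R * (1 + t) powr (- (n / 2))) ^ q * \<mu> (R * (1 + t) powr (- (n / 2))) \<le> R ^ q * (omega t / (1 + t))"
    and "(R * (1 + t) powr (- (n / 2))) ^ (q - 1) * \<mu> (R * (1 + t) powr (- (n / 2))) * ((R * (1 + t) powr (- (n / 4))) * (R * (1 + t) powr (- (n / 4)))) \<le> R ^ Suc q * (omega t / (1 + t))"
proof -
  let ?T = "1 + t"
  have mu: "0 \<le> \<mu> (R * ?T powr (- (n / 2)))" "\<mu> (R * ?T powr (- (n / 2))) \<le> omega t"
    using R mult_right_mono[of R 1 "?T powr (- (n / 2))"] by (auto simp: omega_def intro!: mu_nonneg mu_mono)
  have p: "(?T powr (- (n / 2))) ^ k = ?T powr (- (n / 2 * k))" for k :: nat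
    using t by (simp add: powr_realpow[symmetric] powr_powr)
  have nq: "n / 2 * real q = 1" using qn by (simp add: mult.commute)
  have e1: "(R * ?T powr (- (n / 2))) ^ q = R ^ q * (1 / ?T)"
    unfolding power_mult_distrib p nq using t by (simp add: powr_minus inverse_eq_divide)
  show "(R * ?T powr (- (n / 2))) ^ q * \<mu> (R * ?T powr (- (n / 2))) \<le> R ^ q * (omega t / ?T)"
    unfolding e1 using mult_left_mono[OF mu(2), of "R ^ q * (1 / ?T)"] R t by simp
  have pq: "x ^ q = x * x ^ (q - 1)" for x :: real using q12 by (metis One_nat_def diff_Suc_1 power_Suc numeral_2_eq_2)
  have "(R * ?T powr (- (n / 4))) * (R * ?T powr (- (n / 4))) = R * (R * ?T powr (- (n / 2)))"
    by (simp add: powr_add[symmetric] mult_ac)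
  then have "(R * ?T powr (- (n / 2))) ^ (q - 1) * \<mu> (R * ?T powr (- (n / 2))) * ((R * ?T powr (- (n / 4))) * (R * ?T powr (- (n / 4))))
     = R * ((R * ?T powr (- (n / 2))) ^ q * \<mu> (R * ?T powr (- (n / 2))))"
    by (simp only: pq mult_ac)
  also have "\<dots> = R ^ Suc q * (1 / ?T) * \<mu> (R * ?T powr (- (n / 2)))" unfolding e1 by simp
  also have "\<dots> \<le> R ^ Suc q * (1 / ?T) * omega t" using R t by (intro mult_left_mono mu) auto
  finally show "(R * ?T powr (- (n / 2))) ^ (q - 1) * \<mu> (R * ?T powr (- (n / 2))) * ((R * ?T powr (- (n / 4))) * (R * ?T powr (- (n / 4)))) \<le> R ^ Suc q * (omega t / ?T)"
    by simp
qed

text \<open>The L1 norm of the source bounds its transform at every frequency. The factor R^(q+1) is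
  at least quadratically small.\<close>

lemma src_low:
  assumes F: "good F" and s: "s \<ge> 0" shows "norm (src F s \<xi>) \<le> R ^ Suc q * (omega s / (1 + s))"
proof -
  have "L1le lborel (cx (\<lambda>x. h (sol (F s) x))) (R ^ Suc q * (omega s / (1 + s)))"
    by (rule L1le_dom1[OF L1le_mono[OF h_L1[OF good_norms(6,5)[OF F s]] R_powers(2)[OF s]]])
       (use src_source(1)[OF F, of s] s in auto)
  then show ?thesis using ft_bound s by (auto simp: src_def)
qed

text \<open>The L2 estimate carries the extra factor (1+s)^(-n/4) from the L2 norm of the solution;
  it is what compensates for the weaker kernel at recent times.\<close>

lemma src_weighted:
  assumes F: "good F" and s: "s \<ge> 0"
  shows "L2le lborel (\<lambda>\<xi>. jb \<xi> ^ (CARD('n) - 1) * norm (src F s \<xi>)) (9 * sqrt (ftc TYPE('n)) * R ^ Suc q * (omega s * (1 + s) powr (- (1 + n / 4))))"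
proof -
  let ?M = "R * (1 + s) powr (- (n / 2))" and ?B = "R * (1 + s) powr (- (n / 4))"
  have "L2le lborel (\<lambda>\<xi>. jb \<xi> ^ (CARD('n) - 1) * norm (src F s \<xi>)) (sqrt (ftc TYPE('n)) * (9 * ?M ^ q * \<mu> ?M * ?B))"
    using h_source_weighted[OF dim good_norms(4,2,3)[OF F s], of ?M] good_norms(5)[OF F s] s by (simp add: src_def sol_def)
  then show ?thesis
  proof (rule L2le_mono)
    have "(?M ^ q * \<mu> ?M) * ?B \<le> (R ^ q * (omega s / (1 + s))) * ?B" using R by (intro mult_right_mono R_powers(1)[OF s]) auto
    also have "\<dots> = R ^ Suc q * (omega s * ((1 + s) powr (-1) * (1 + s) powr (- (n / 4))))"
    proof -
      have "(1 + s) powr (-1) = 1 / (1 + s)" using s by (simp add: powr_minus inverse_eq_divide)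
      then show ?thesis by simp
    qed
    also have "(1 + s) powr (-1) * (1 + s) powr (- (n / 4)) = (1 + s) powr (- (1 + n / 4))" unfolding powr_add[symmetric] by simp
    finally have "9 * sqrt (ftc TYPE('n)) * (?M ^ q * \<mu> ?M * ?B) \<le> 9 * sqrt (ftc TYPE('n)) * (R ^ Suc q * (omega s * (1 + s) powr (- (1 + n / 4))))"
      using sqrt_ftc_ge_1[where 'n='n] by (intro mult_left_mono) auto
    then show "sqrt (ftc TYPE('n)) * (9 * ?M ^ q * \<mu> ?M * ?B) \<le> 9 * sqrt (ftc TYPE('n)) * R ^ Suc q * (omega s * (1 + s) powr (- (1 + n / 4)))"
      by (simp add: mult_ac)
  qed
qed

lemma sol_diff_L2:
  assumes "integrable lborel F" "integrable lborel G" "L2le lborel (\<lambda>\<xi>. F \<xi> - G \<xi>) D"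
  shows "L2le lborel (\<lambda>x. sol F x - sol G x) D"
  using L2le_Re[OF ift_L2[OF Bochner_Integration.integrable_diff[OF assms(1,2)] assms(3)]]
  by (simp add: sol_def ift_diff[OF assms(1,2)])

text \<open>The constant 4 R^(q-1) \<mu>(R) of the bilinear L1 estimate times R + R. It also exceeds
  the L2 Lipschitz constant of \<open>h\<close>, so one number serves both bounds on the
  source.\<close>

definition lipc :: real where "lipc = 8 * R ^ (q - 1) * \<mu> R * R"

lemma lipc_nonneg: "0 \<le> lipc"
  using R by (auto simp: lipc_def intro!: mult_nonneg_nonneg mu_nonneg)

lemma src_diff:
  assumes F: "good F" and G: "good G" and s: "s \<ge> 0" "s' \<ge> 0" and D: "L2le lborel (\<lambda>\<xi>. F s \<xi> - G s' \<xi>) D"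
  shows "norm (src F s \<xi> - src G s' \<xi>) \<le> lipc * D"
    and "L2le lborel (\<lambda>\<xi>. src F s \<xi> - src G s' \<xi>) (sqrt (ftc TYPE('n)) * (lipc * D))"
proof -
  let ?u = "sol (F s)" and ?v = "sol (G s')"
  have m: "max 0 s = s" "max 0 s' = s'" using s by auto
  note i = src_source(1)[OF F, of s, unfolded m] src_source(1)[OF G, of s', unfolded m]
  have DL: "L2le lborel (\<lambda>x. ?u x - ?v x) D" by (rule sol_diff_L2[OF good_norms(4)[OF F s(1)] good_norms(4)[OF G s(2)] D])
  have D0: "0 \<le> D" by (rule L2le_nonneg[OF D])
  have eq: "src F s \<xi> - src G s' \<xi> = ft (cx (\<lambda>x. h (?u x) - h (?v x))) \<xi>" for \<xi>
  proof -
    have "cx (\<lambda>x. h (?u x) - h (?v x)) = (\<lambda>x. cx (\<lambda>x. h (?u x)) x - cx (\<lambda>x. h (?v x)) x)" by (auto simp: cx_def fun_eq_iff)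
    then show ?thesis by (simp only: ft_diff[OF i] src_def m)
  qed
  have "L1le lborel (\<lambda>x. h (?u x) - h (?v x)) (4 * R ^ (q - 1) * \<mu> R * ((R + R) * D))"
    by (rule h_diff_L1[OF good_norms(9)[OF F s(1)] good_norms(9)[OF G s(2)] DL good_norms(8)[OF F s(1)] good_norms(8)[OF G s(2)]])
  then have L1: "L1le lborel (cx (\<lambda>x. h (?u x) - h (?v x))) (lipc * D)"
    by (intro cx_L1le) (simp add: lipc_def mult_ac)
  then show "norm (src F s \<xi> - src G s' \<xi>) \<le> lipc * D" unfolding eq by (rule ft_bound)
  have pq: "R ^ q = R * R ^ (q - 1)" using q12 by (metis One_nat_def diff_Suc_1 power_Suc numeral_2_eq_2)
  have "L2le lborel (\<lambda>x. h (?u x) - h (?v x)) (4 * R ^ q * \<mu> R * D)"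
    by (rule h_diff_L2[OF _ _ DL good_norms(8)[OF F s(1)] good_norms(8)[OF G s(2)]]) (use good_norms(10)[OF F s(1)] good_norms(10)[OF G s(2)] in auto)
  then have "L2le lborel (\<lambda>x. h (?u x) - h (?v x)) (lipc * D)"
  proof (rule L2le_mono)
    have "4 * R ^ q * \<mu> R = lipc / 2" by (simp add: lipc_def pq)
    also have "\<dots> \<le> lipc" using lipc_nonneg by simp
    finally show "4 * R ^ q * \<mu> R * D \<le> lipc * D" using D0 by (rule mult_right_mono)
  qed
  from ft_L2[OF L1le_integrable[OF L1] cx_L2le[OF this]]
  show "L2le lborel (\<lambda>\<xi>. src F s \<xi> - src G s' \<xi>) (sqrt (ftc TYPE('n)) * (lipc * D))" by (simp add: eq)
qed

text \<open>In time the source is Lipschitz with respect to the L2 distance, uniformly in \<xi>; in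
  \<xi> it is the transform of one fixed integrable function.\<close>

lemma src_continuous:
  assumes F: "good F" shows "continuous_on UNIV (\<lambda>(s, \<xi>). src F s \<xi>)"
proof -
  have "isCont (\<lambda>(s, \<xi>). src F s \<xi>) p" for p
  proof (rule continuous_at_sequentiallyI)
    fix X assume X: "X \<longlonglongrightarrow> p"
    obtain s \<xi> where p: "p = (s, \<xi>)" by (cases p)
    let ?s = "\<lambda>k. max 0 (fst (X k))" and ?x = "\<lambda>k. snd (X k)"
    have s: "?s \<longlonglongrightarrow> max 0 s" and x: "?x \<longlonglongrightarrow> \<xi>" using tendsto_fst[OF X] tendsto_snd[OF X] by (auto simp: p intro: tendsto_max)
    have mm: "src F (max 0 s) = src F s" for s by (simp add: src_def)
    have "(\<lambda>k. src F (?s k) (?x k) - src F (max 0 s) (?x k)) \<longlonglongrightarrow> 0"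
    proof (rule LIMSEQ_I)
      fix e :: real assume e: "e > 0"
      define \<epsilon> where "\<epsilon> = e / (lipc + 1)"
      have e': "\<epsilon> > 0" "lipc * \<epsilon> < e" using e lipc_nonneg by (auto simp: \<epsilon>_def field_simps)
      have "eventually (\<lambda>k. L2le lborel (\<lambda>\<xi>. F (?s k) \<xi> - F (max 0 s) \<xi>) \<epsilon>) sequentially"
        by (rule goodD(4)[OF F _ _ s e'(1)]) auto
      then obtain N where N: "\<And>k. k \<ge> N \<Longrightarrow> L2le lborel (\<lambda>\<xi>. F (?s k) \<xi> - F (max 0 s) \<xi>) \<epsilon>" unfolding eventually_sequentially by blast
      have "norm (src F (?s k) (?x k) - src F (max 0 s) (?x k) - 0) < e" if "k \<ge> N" for k
        using src_diff(1)[OF F F _ _ N[OF that], of "?x k"] e'(2) by simp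
      then show "\<exists>N. \<forall>k\<ge>N. norm (src F (?s k) (?x k) - src F (max 0 s) (?x k) - 0) < e" by blast
    qed
    moreover have "(\<lambda>k. src F (max 0 s) (?x k)) \<longlonglongrightarrow> src F (max 0 s) \<xi>"
    proof -
      have "isCont (src F (max 0 s)) \<xi>"
        using ft_continuous[OF src_source(1)[OF F, of "max 0 s"]] by (simp add: continuous_on_eq_continuous_at src_def)
      then show ?thesis using x by (rule isCont_tendsto_compose)
    qed
    ultimately have "(\<lambda>k. (src F (?s k) (?x k) - src F (max 0 s) (?x k)) + src F (max 0 s) (?x k)) \<longlonglongrightarrow> 0 + src F (max 0 s) \<xi>" by (rule tendsto_add)
    then show "(\<lambda>k. case X k of (s, \<xi>) \<Rightarrow> src F s \<xi>) \<longlonglongrightarrow> (case p of (s, \<xi>) \<Rightarrow> src F s \<xi>)"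
      by (simp add: p mm case_prod_beta)
  qed
  then show ?thesis by (simp add: continuous_at_imp_continuous_on)
qed

lemma src_measurable: assumes F: "good F" shows "(\<lambda>(s, \<xi>). src F s \<xi>) \<in> borel_measurable (borel \<Otimes>\<^sub>M borel)"
  using borel_measurable_continuous_onI[OF src_continuous[OF F]] by (simp add: borel_prod)

lemma src_integrable:
  assumes F: "good F" shows "set_integrable lborel {0..t} (\<lambda>s. complex_of_real (K1 (t' - s) \<xi>) * src F s \<xi>)"
proof -
  have "continuous_on UNIV (\<lambda>s. src F s \<xi>)"
  proof -
    have c: "continuous_on UNIV (\<lambda>s::real. (s, \<xi>))" by (intro continuous_intros)
    show ?thesis using continuous_on_compose2[OF src_continuous[OF F] c] by simp
  qed
  moreover have "continuous_on UNIV (\<lambda>s. K1 (t' - s) \<xi>)"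
    by (rule continuous_on_compose2[OF K1_continuous]) (auto intro: continuous_intros)
  ultimately have "continuous_on {0..t} (\<lambda>s. complex_of_real (K1 (t' - s) \<xi>) * src F s \<xi>)"
    by (intro continuous_intros) (auto elim: continuous_on_subset)
  then show ?thesis by (rule borel_integrable_atLeastAtMost')
qed

section \<open>The Duhamel map\<close>

definition lin :: "real \<Rightarrow> real^'n \<Rightarrow> complex" where
  "lin t \<xi> = complex_of_real (K0 t \<xi>) * f0 \<xi> + complex_of_real (K1 t \<xi>) * f1 \<xi>"

definition duh :: "(real \<Rightarrow> real^'n \<Rightarrow> complex) \<Rightarrow> real \<Rightarrow> real^'n \<Rightarrow> complex" where
  "duh F t \<xi> = (LINT s:{0..t}|lborel. complex_of_real (K1 (t - s) \<xi>) * src F s \<xi>)"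

definition Phi :: "(real \<Rightarrow> real^'n \<Rightarrow> complex) \<Rightarrow> real \<Rightarrow> real^'n \<Rightarrow> complex" where
  "Phi F t \<xi> = lin t \<xi> + duh F t \<xi>"

lemma lin_meas[measurable]: "lin t \<in> borel_measurable borel"
  unfolding lin_def[abs_def] by measurable

lemma integrand_meas:
  assumes F: "good F" shows "(\<lambda>(s, \<xi>). complex_of_real (K1 (t - s) \<xi>) * src F s \<xi>) \<in> borel_measurable (borel \<Otimes>\<^sub>M borel)"
proof -
  note [measurable] = src_measurable[OF F]
  show ?thesis by measurable
qed

lemma duh_meas: assumes F: "good F" shows "duh F t \<in> borel_measurable borel"
proof -
  note [measurable] = integrand_meas[OF F, of t]
  have "(\<lambda>\<xi>. LINT s:{0..t}|lborel. complex_of_real (K1 (t - s) \<xi>) * src F s \<xi>) \<in> borel_measurable borel"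
    unfolding set_lebesgue_integral_def by measurable
  then show ?thesis by (simp add: duh_def[abs_def])
qed

lemma Phi_meas: "good F \<Longrightarrow> Phi F t \<in> borel_measurable borel"
  unfolding Phi_def[abs_def] using duh_meas by measurable

lemma Phi_herm: "Phi F t (- \<xi>) = cnj (Phi F t \<xi>)"
proof -
  have "duh F t (- \<xi>) = cnj (duh F t \<xi>)"
    unfolding duh_def set_lebesgue_integral_def Bochner_Integration.integral_cnj[symmetric]
    by (simp add: src_def ft_hermitian K1_even)
  then show ?thesis by (simp add: Phi_def lin_def K0_even K1_even f0_herm f1_herm)
qed

text \<open>The first datum carries a factor \<open>jb\<close> to offset the negative power of
  \<open>jb\<close> that \<open>K1\<close> has and \<open>K0\<close> lacks; both data then obey one
  multiplier bound.\<close>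

definition gdata :: "real^'n \<Rightarrow> real" where "gdata \<xi> = jb \<xi> * norm (f0 \<xi>) + norm (f1 \<xi>)"

lemma lin_le: assumes t: "t \<ge> 0" shows "norm (lin t \<xi>) \<le> 16 * (decay t \<xi> / jb \<xi>) * \<bar>gdata \<xi>\<bar>"
proof -
  have g0: "0 \<le> gdata \<xi>" using jb_pos[of \<xi>] by (simp add: gdata_def)
  have "norm (lin t \<xi>) \<le> \<bar>K0 t \<xi>\<bar> * norm (f0 \<xi>) + \<bar>K1 t \<xi>\<bar> * norm (f1 \<xi>)"
    unfolding lin_def using norm_triangle_ineq[of "complex_of_real (K0 t \<xi>) * f0 \<xi>" "complex_of_real (K1 t \<xi>) * f1 \<xi>"] by (simp add: norm_mult)
  also have "\<dots> \<le> 16 * decay t \<xi> * norm (f0 \<xi>) + 16 * (decay t \<xi> / jb \<xi>) * norm (f1 \<xi>)"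
    using K0_bound[OF t, of \<xi>] K1_bound[OF t, of \<xi>] decay_bounds(1)[of t \<xi>] by (intro add_mono mult_right_mono) auto
  also have "\<dots> = 16 * (decay t \<xi> / jb \<xi>) * gdata \<xi>" using jb_pos[of \<xi>] by (simp add: gdata_def field_simps)
  finally show ?thesis using g0 by simp
qed

lemma gdata_facts: "gdata \<in> borel_measurable borel" "norm \<xi> \<le> 1 \<Longrightarrow> \<bar>gdata \<xi>\<bar> \<le> d"
  "L2le lborel (\<lambda>\<xi>. jb \<xi> ^ (CARD('n) - 1) * gdata \<xi>) d"
  using data_low[of \<xi>] data_L2 jb_pos[of \<xi>] by (auto simp: gdata_def[abs_def] add_nonneg_nonneg abs_of_nonneg)

lemma lin_bound: assumes t: "t \<ge> 0" shows "fnorm_le j (lin t) (R / 2 * wt j t)"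
proof -
  have "fnorm_le j (lin t) (400 * 16 * (1 + t) powr (- (rate CARD('n) j + CARD('n) / 4)) * (d + d))"
    by (rule multiplier_estimate(1)[OF card12 t _ lin_meas gdata_facts(1) lin_le[OF t] gdata_facts(2,3)]) simp_all
  then show ?thesis
  proof (rule fnorm_le_mono)
    have "400 * 16 * wt j t * (d + d) = (12800 * d) * wt j t" by simp
    also have "\<dots> \<le> (R / 2) * wt j t" using R wt_nonneg by (intro mult_right_mono) auto
    finally show "400 * 16 * (1 + t) powr (- (rate CARD('n) j + CARD('n) / 4)) * (d + d) \<le> R / 2 * wt j t"
      by (simp add: wt_def dim)
  qed
qed

text \<open>At each time the integrand is estimated in whichever of the two ways the majorant
  \<open>w\<close> supports, and Minkowski integrates the result.\<close>

lemma duh_bound: assumes F: "good F" and t: "t \<ge> 0" shows "fnorm_le j (duh F t) (R / 2 * wt j t)"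
proof -
  define D where "D = 64000 * sqrt (ftc TYPE('n)) * R ^ Suc q"
  have s1: "sqrt (ftc TYPE('n)) \<ge> 1" by (rule sqrt_ftc_ge_1)
  have D: "D \<ge> 0" using R s1 by (simp add: D_def)
  have a: "0 \<le> rate n j" "rate n j \<le> 1/2" using n12 by (auto simp: rate_def)
  obtain w where w: "set_integrable lborel {0..t} w" "(LINT \<tau>:{0..t}|lborel. w \<tau>) \<le> (2 * \<Lambda> + 8 * \<mu> 1) * D * (1 + t) powr (- (rate n j + n / 4))"
    "\<And>\<tau>. \<tau> \<in> {0..t} \<Longrightarrow> D * (1 + (t - \<tau>)) powr (- (rate n j + n / 4)) * (omega \<tau> / (1 + \<tau>)) \<le> w \<tau>
          \<or> D * (1 + (t - \<tau>)) powr (- rate n j) * (omega \<tau> * (1 + \<tau>) powr (- (1 + n / 4))) \<le> w \<tau>"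
    using duhamel_time_integral[OF omega_int t a D] by blast
  have "fnorm_le j (\<lambda>\<xi>. LINT s:{0..t}|lborel. complex_of_real (K1 (t - s) \<xi>) * src F s \<xi>) (LINT \<tau>:{0..t}|lborel. w \<tau>)"
  proof (rule fnorm_le_Minkowski[OF integrand_meas[OF F] _ w(1)])
    fix \<tau> assume tau: "\<tau> \<in> {0..t}"
    then have t0: "\<tau> \<ge> 0" "t - \<tau> \<ge> 0" by auto
    let ?F = "\<lambda>\<xi>. complex_of_real (K1 (t - \<tau>) \<xi>) * src F \<tau> \<xi>" and ?G = "\<lambda>\<xi>. norm (src F \<tau> \<xi>)"
    let ?P = "R ^ Suc q * (omega \<tau> / (1 + \<tau>))" and ?Q = "9 * sqrt (ftc TYPE('n)) * R ^ Suc q * (omega \<tau> * (1 + \<tau>) powr (- (1 + n / 4)))"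
    have o: "0 \<le> omega \<tau>" using omega_bounds t0 by auto
    have Fm: "?F \<in> borel_measurable borel" using src_source(2)[OF F, of \<tau>] by measurable
    have Gm: "?G \<in> borel_measurable borel" using src_source(2)[OF F, of \<tau>] by measurable
    have le: "norm (?F \<xi>) \<le> 16 * (decay (t - \<tau>) \<xi> / jb \<xi>) * \<bar>?G \<xi>\<bar>" for \<xi>
      using mult_right_mono[OF K1_bound[OF t0(2), of \<xi>], of "?G \<xi>"] by (simp add: norm_mult)
    have P: "\<bar>?G \<xi>\<bar> \<le> ?P" for \<xi> using src_low[OF F t0(1)] by simp
    note E = multiplier_estimate[OF card12 t0(2) _ Fm Gm le P src_weighted[OF F t0(1)], of j]
    \<comment> \<open>In the L1-based estimate the extra decay of the L2 term is given up; P counts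
      1 and Q counts 9 towards the constant 10.\<close>
    have PQ: "?P + ?Q \<le> 10 * sqrt (ftc TYPE('n)) * R ^ Suc q * (omega \<tau> / (1 + \<tau>))"
    proof -
      have "(1 + \<tau>) powr (- (1 + n / 4)) \<le> (1 + \<tau>) powr (-1)" using t0 n12 by (intro powr_mono) auto
      then have "omega \<tau> * (1 + \<tau>) powr (- (1 + n / 4)) \<le> omega \<tau> * (1 / (1 + \<tau>))" using o t0 by (intro mult_left_mono) (auto simp: powr_minus inverse_eq_divide)
      then have "?Q \<le> 9 * sqrt (ftc TYPE('n)) * R ^ Suc q * (omega \<tau> / (1 + \<tau>))" using R s1 by (intro mult_left_mono) auto
      also have "\<dots> = 9 * (sqrt (ftc TYPE('n)) * ?P)" by (simp add: mult_ac)
      finally have "?Q \<le> 9 * (sqrt (ftc TYPE('n)) * ?P)" .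
      moreover have "1 * ?P \<le> sqrt (ftc TYPE('n)) * ?P" using R o t0 by (intro mult_right_mono s1) auto
      ultimately have "1 * ?P + ?Q \<le> sqrt (ftc TYPE('n)) * ?P + 9 * (sqrt (ftc TYPE('n)) * ?P)" by (rule add_mono[rotated])
      moreover have "y + 9 * y = 10 * y" for y :: real by simp
      ultimately have "?P + ?Q \<le> 10 * (sqrt (ftc TYPE('n)) * ?P)" by (simp only: mult_1)
      then show ?thesis by (simp only: mult_ac)
    qed
    from w(3)[OF tau] show "fnorm_le j ?F (w \<tau>)"
    proof
      assume le1: "D * (1 + (t - \<tau>)) powr (- (rate n j + n / 4)) * (omega \<tau> / (1 + \<tau>)) \<le> w \<tau>"
      have "fnorm_le j ?F (400 * 16 * (1 + (t - \<tau>)) powr (- (rate n j + n / 4)) * (?P + ?Q))" using E(1) by (simp add: dim)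
      then show ?thesis
      proof (rule fnorm_le_mono)
        have "400 * 16 * (1 + (t - \<tau>)) powr (- (rate n j + n / 4)) * (?P + ?Q) \<le> 400 * 16 * (1 + (t - \<tau>)) powr (- (rate n j + n / 4)) * (10 * sqrt (ftc TYPE('n)) * R ^ Suc q * (omega \<tau> / (1 + \<tau>)))"
          by (intro mult_left_mono PQ) auto
        also have "\<dots> = D * (1 + (t - \<tau>)) powr (- (rate n j + n / 4)) * (omega \<tau> / (1 + \<tau>))" by (simp add: D_def)
        finally show "400 * 16 * (1 + (t - \<tau>)) powr (- (rate n j + n / 4)) * (?P + ?Q) \<le> w \<tau>" using le1 by linarith
      qed
    next
      assume le2: "D * (1 + (t - \<tau>)) powr (- rate n j) * (omega \<tau> * (1 + \<tau>) powr (- (1 + n / 4))) \<le> w \<tau>"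
      have "fnorm_le j ?F (400 * 16 * (1 + (t - \<tau>)) powr (- rate n j) * ?Q)" using E(2) by (simp add: dim)
      then show ?thesis
      proof (rule fnorm_le_mono)
        define Y where "Y = sqrt (ftc TYPE('n)) * R ^ Suc q * ((1 + (t - \<tau>)) powr (- rate n j) * (omega \<tau> * (1 + \<tau>) powr (- (1 + n / 4))))"
        have "0 \<le> Y" unfolding Y_def using R s1 o by (intro mult_nonneg_nonneg) auto
        moreover have "400 * 16 * (1 + (t - \<tau>)) powr (- rate n j) * ?Q = 57600 * Y" by (simp add: Y_def mult_ac)
        moreover have "D * (1 + (t - \<tau>)) powr (- rate n j) * (omega \<tau> * (1 + \<tau>) powr (- (1 + n / 4))) = 64000 * Y" by (simp add: Y_def D_def mult_ac)
        ultimately show "400 * 16 * (1 + (t - \<tau>)) powr (- rate n j) * ?Q \<le> w \<tau>" using le2 by linarith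
      qed
    qed
  qed
  then have "fnorm_le j (duh F t) (LINT \<tau>:{0..t}|lborel. w \<tau>)" by (simp add: duh_def[abs_def])
  then show ?thesis
  proof (rule fnorm_le_mono)
    \<comment> \<open>Of the q + 1 powers of R, one is spent on the smallness condition; the
      remaining q are at most R because R <= 1 and q >= 1.\<close>
    have "(2 * \<Lambda> + 8 * \<mu> 1) * D = R ^ q * ((2 * \<Lambda> + 8 * \<mu> 1) * (64000 * sqrt (ftc TYPE('n))) * R)" by (simp add: D_def mult_ac)
    also have "\<dots> \<le> R ^ q * (1 / 2)" using R small by (intro mult_left_mono) auto
    also have "\<dots> \<le> R / 2"
    proof -
      have "R ^ q \<le> R ^ 1" using R q12 by (intro power_decreasing) auto
      then show ?thesis by simp
    qed
    finally have "(2 * \<Lambda> + 8 * \<mu> 1) * D * wt j t \<le> R / 2 * wt j t" by (rule mult_right_mono[OF _ wt_nonneg])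
    then show "(LINT \<tau>:{0..t}|lborel. w \<tau>) \<le> R / 2 * wt j t" using w(2) by (simp add: wt_def)
  qed
qed

lemma Phi_bound: assumes F: "good F" and t: "t \<ge> 0" shows "fnorm_le j (Phi F t) (R * wt j t)"
  using fnorm_le_add[OF lin_bound[OF t, of j] duh_bound[OF F t, of j]] by (simp add: Phi_def[abs_def])

lemma src_sup: assumes F: "good F" shows "norm (src F s \<xi>) \<le> \<mu> 1"
proof -
  have m: "src F s = src F (max 0 s)" by (simp add: src_def)
  have o: "0 \<le> omega (max 0 s)" "omega (max 0 s) \<le> \<mu> 1" using omega_bounds by auto
  have "norm (src F s \<xi>) \<le> R ^ Suc q * (omega (max 0 s) / (1 + max 0 s))" unfolding m by (rule src_low[OF F]) simp
  also have "\<dots> \<le> 1 * (\<mu> 1 / 1)" using R o by (intro mult_mono power_le_one frac_le) auto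
  finally show ?thesis by simp
qed

text \<open>A majorant independent of time on [0,T], up to the factor 16 / \<open>jb\<close>. It is
  the dominating function for continuity in time in all three norms.\<close>

definition dom :: "(real \<Rightarrow> real^'n \<Rightarrow> complex) \<Rightarrow> real \<Rightarrow> real^'n \<Rightarrow> real" where
  "dom F T \<xi> = gdata \<xi> + (LINT s:{0..T}|lborel. norm (src F s \<xi>))"

lemma src_norm_integrable: assumes F: "good F" shows "set_integrable lborel {a..b} (\<lambda>s. norm (src F s \<xi>))"
proof -
  have c: "continuous_on UNIV (\<lambda>s::real. (s, \<xi>))" by (intro continuous_intros)
  have "continuous_on UNIV (\<lambda>s. norm (src F s \<xi>))" using continuous_on_norm[OF continuous_on_compose2[OF src_continuous[OF F] c]] by simp
  then show ?thesis by (intro borel_integrable_atLeastAtMost') (auto elim: continuous_on_subset)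
qed

lemma Phi_dominated:
  assumes F: "good F" and t: "0 \<le> t" "t \<le> T"
  shows "norm (Phi F t \<xi>) \<le> 16 / jb \<xi> * dom F T \<xi>"
proof -
  have g0: "0 \<le> gdata \<xi>" using jb_pos[of \<xi>] by (simp add: gdata_def)
  have k: "16 * (decay t' \<xi> / jb \<xi>) \<le> 16 / jb \<xi>" if "t' \<ge> 0" for t'
    using decay_bounds(2)[OF that, of \<xi>] jb_pos[of \<xi>] by (simp add: divide_right_mono)
  have "norm (lin t \<xi>) \<le> 16 / jb \<xi> * gdata \<xi>"
    using lin_le[OF t(1), of \<xi>] mult_right_mono[OF k[OF t(1)] g0] g0 by simp
  moreover have "norm (duh F t \<xi>) \<le> (LINT s:{0..T}|lborel. 16 / jb \<xi> * norm (src F s \<xi>))"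
    unfolding duh_def set_lebesgue_integral_def
  proof (rule Bochner_Integration.integral_norm_bound_integral)
    show "integrable lborel (\<lambda>s. indicator {0..t} s *\<^sub>R (complex_of_real (K1 (t - s) \<xi>) * src F s \<xi>))"
      using src_integrable[OF F] by (simp add: set_integrable_def)
    have "set_integrable lborel {0..T} (\<lambda>s. 16 / jb \<xi> * norm (src F s \<xi>))"
      by (intro set_integrable_mult_right src_norm_integrable[OF F])
    then show "integrable lborel (\<lambda>s. indicator {0..T} s *\<^sub>R (16 / jb \<xi> * norm (src F s \<xi>)))" by (simp add: set_integrable_def)
    show "norm (indicator {0..t} s *\<^sub>R (complex_of_real (K1 (t - s) \<xi>) * src F s \<xi>)) \<le> indicator {0..T} s *\<^sub>R (16 / jb \<xi> * norm (src F s \<xi>))" for s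
    proof (cases "s \<in> {0..t}")
      case True
      then have ts: "t - s \<ge> 0" by auto
      have "\<bar>K1 (t - s) \<xi>\<bar> * norm (src F s \<xi>) \<le> 16 / jb \<xi> * norm (src F s \<xi>)"
        using K1_bound[OF ts, of \<xi>] k[OF ts] by (intro mult_right_mono) auto
      then show ?thesis using True t by (simp add: norm_mult)
    next
      case False
      then show ?thesis using jb_pos[of \<xi>] by (auto simp: indicator_def)
    qed
  qed
  ultimately show ?thesis
    unfolding Phi_def dom_def using norm_triangle_ineq[of "lin t \<xi>" "duh F t \<xi>"] by (simp add: distrib_left)
qed

text \<open>At time 0 \<open>decay\<close> equals 1, so the second part of
  \<open>multiplier_estimate\<close> becomes a plain finiteness statement. The scalar
  \<open>c\<close> makes room for the factor 2 of a difference of two values.\<close>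

lemma dom_fnorm:
  assumes F: "good F" and T: "T \<ge> 0"
  shows "\<exists>A. fnorm_le j (\<lambda>\<xi>. complex_of_real (c * (16 / jb \<xi> * dom F T \<xi>))) A"
proof -
  note [measurable] = src_measurable[OF F] gdata_facts(1)
  have "(\<lambda>\<xi>. LINT s:{0..T}|lborel. norm (src F s \<xi>)) \<in> borel_measurable borel"
    unfolding set_lebesgue_integral_def by measurable
  then have dm[measurable]: "dom F T \<in> borel_measurable borel" unfolding dom_def[abs_def] by measurable
  let ?I = "\<lambda>\<xi>. LINT s:{0..T}|lborel. norm (src F s \<xi>)"
  have low: "\<bar>dom F T \<xi>\<bar> \<le> d + (LINT s:{0..T}|lborel. \<mu> 1)" if "norm \<xi> \<le> 1" for \<xi>
  proof -
    have "?I \<xi> \<le> (LINT s:{0..T}|lborel. \<mu> 1)"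
      using src_sup[OF F] by (intro set_integral_mono src_norm_integrable[OF F] borel_integrable_atLeastAtMost') auto
    moreover have "0 \<le> ?I \<xi>" unfolding set_lebesgue_integral_def by (intro integral_nonneg_AE AE_I2) simp
    moreover have "0 \<le> gdata \<xi>" "gdata \<xi> \<le> d" using gdata_facts(2)[OF that] jb_pos[of \<xi>] by (auto simp: gdata_def)
    ultimately show ?thesis unfolding dom_def by linarith
  qed
  define B where "B = 9 * sqrt (ftc TYPE('n)) * R ^ Suc q * (\<mu> 1 * 1)"
  have "L2le lborel (\<lambda>\<xi>. LINT s:{0..T}|lborel. jb \<xi> ^ (CARD('n) - 1) * norm (src F s \<xi>)) (LINT s:{0..T}|lborel. B)"
  proof (rule L2le_Minkowski[OF lborel.sigma_finite_measure_axioms])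
    show "(\<lambda>(s, \<xi>). jb \<xi> ^ (CARD('n) - 1) * norm (src F s \<xi>)) \<in> borel_measurable (lborel \<Otimes>\<^sub>M lborel)" by measurable
    fix s assume s: "s \<in> {0..T}"
    then have s0: "s \<ge> 0" by simp
    show "L2le lborel (\<lambda>\<xi>. jb \<xi> ^ (CARD('n) - 1) * norm (src F s \<xi>)) B"
    proof (rule L2le_mono[OF src_weighted[OF F s0]])
      have p: "(1 + s) powr (- (1 + n / 4)) \<le> (1 + s) powr 0" using s0 n12 by (intro powr_mono) auto
      have "omega s * (1 + s) powr (- (1 + n / 4)) \<le> \<mu> 1 * 1"
        using omega_bounds[OF s0] p s0 by (intro mult_mono) auto
      then show "9 * sqrt (ftc TYPE('n)) * R ^ Suc q * (omega s * (1 + s) powr (- (1 + n / 4))) \<le> B"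
        unfolding B_def using R sqrt_ftc_ge_1[where 'n='n] by (intro mult_left_mono) auto
    qed
  qed (auto intro: borel_integrable_atLeastAtMost')
  then have "L2le lborel (\<lambda>\<xi>. jb \<xi> ^ (CARD('n) - 1) * ?I \<xi>) (LINT s:{0..T}|lborel. B)" by simp
  from L2le_add[OF gdata_facts(3) this]
  have Q: "L2le lborel (\<lambda>\<xi>. jb \<xi> ^ (CARD('n) - 1) * dom F T \<xi>) (d + (LINT s:{0..T}|lborel. B))" by (simp add: dom_def distrib_left)
  have "norm (complex_of_real (c * (16 / jb \<xi> * dom F T \<xi>))) \<le> (16 * \<bar>c\<bar>) * (decay 0 \<xi> / jb \<xi>) * \<bar>dom F T \<xi>\<bar>" for \<xi>
    unfolding norm_of_real using jb_pos[of \<xi>] by (simp add: decay_def abs_mult mult_ac)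
  moreover have "(\<lambda>\<xi>. complex_of_real (c * (16 / jb \<xi> * dom F T \<xi>))) \<in> borel_measurable borel" by measurable
  ultimately show ?thesis using multiplier_estimate(2)[OF card12 order_refl _ _ dm _ low Q] abs_ge_zero[of c] by (meson mult_nonneg_nonneg zero_le_numeral)
qed

lemma Phi_pointwise_continuous:
  assumes F: "good F" and X: "\<And>k. X k \<ge> 0" "X \<longlonglongrightarrow> t"
  shows "(\<lambda>k. Phi F (X k) \<xi>) \<longlonglongrightarrow> Phi F t \<xi>"
proof -
  obtain T where T: "\<And>k. norm (X k) \<le> T" using X(2) convergent_imp_Bseq[of X] by (auto simp: convergent_def Bseq_def)
  have XT: "X k \<le> T" for k using T[of k] by simp
  have c1: "(\<lambda>k. K1 (X k - s) \<xi>) \<longlonglongrightarrow> K1 (t - s) \<xi>" for s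
    using K1_continuous[of \<xi>] X(2) by (intro isCont_tendsto_compose[where g="\<lambda>t. K1 t \<xi>"] tendsto_intros) (auto simp: continuous_on_eq_continuous_at)
  have c0: "(\<lambda>k. K0 (X k) \<xi>) \<longlonglongrightarrow> K0 t \<xi>"
    using K0_continuous[of \<xi>] X(2) by (intro isCont_tendsto_compose[where g="\<lambda>t. K0 t \<xi>"]) (auto simp: continuous_on_eq_continuous_at)
  have l: "(\<lambda>k. lin (X k) \<xi>) \<longlonglongrightarrow> lin t \<xi>"
    unfolding lin_def using c1[of 0] c0 by (intro tendsto_intros) auto
  have "(\<lambda>k. LINT s|lborel. indicator {0..X k} s *\<^sub>R (complex_of_real (K1 (X k - s) \<xi>) * src F s \<xi>)) \<longlonglongrightarrow> (LINT s|lborel. indicator {0..t} s *\<^sub>R (complex_of_real (K1 (t - s) \<xi>) * src F s \<xi>))"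
  proof (rule integral_dominated_convergence[where w="\<lambda>s. indicator {0..T} s * (16 * norm (src F s \<xi>))"])
    note [measurable] = src_measurable[OF F]
    show "(\<lambda>s. indicator {0..t} s *\<^sub>R (complex_of_real (K1 (t - s) \<xi>) * src F s \<xi>)) \<in> borel_measurable lborel"
      "(\<lambda>s. indicator {0..X k} s *\<^sub>R (complex_of_real (K1 (X k - s) \<xi>) * src F s \<xi>)) \<in> borel_measurable lborel" for k
      using src_integrable[OF F] by (auto simp: set_integrable_def)
    have "set_integrable lborel {0..T} (\<lambda>s. 16 * norm (src F s \<xi>))" by (intro set_integrable_mult_right src_norm_integrable[OF F])
    then show "integrable lborel (\<lambda>s. indicator {0..T} s * (16 * norm (src F s \<xi>)))" by (simp add: set_integrable_def)
    show "AE s in lborel. norm (indicator {0..X k} s *\<^sub>R (complex_of_real (K1 (X k - s) \<xi>) * src F s \<xi>)) \<le> indicator {0..T} s * (16 * norm (src F s \<xi>))" for k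
    proof (rule AE_I2)
      fix s
      show "norm (indicator {0..X k} s *\<^sub>R (complex_of_real (K1 (X k - s) \<xi>) * src F s \<xi>)) \<le> indicator {0..T} s * (16 * norm (src F s \<xi>))"
      proof (cases "s \<in> {0..X k}")
        case True
        then have ts: "X k - s \<ge> 0" by auto
        have "16 * (decay (X k - s) \<xi> / jb \<xi>) \<le> 16 * (1 / 1)" using decay_bounds[OF , of "X k - s" \<xi>] ts jb_ge_1[of \<xi>] by (intro mult_left_mono frac_le) auto
        then have "\<bar>K1 (X k - s) \<xi>\<bar> * norm (src F s \<xi>) \<le> 16 * norm (src F s \<xi>)" using K1_bound[OF ts, of \<xi>] by (intro mult_right_mono) auto
        then show ?thesis using True XT[of k] by (simp add: norm_mult)
      next
        case False
        then have "indicator {0..X k} s = (0::real)" by simp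
        then show ?thesis by simp
      qed
    qed
    \<comment> \<open>At s = t the indicator of [0, X k] may oscillate, so this single time is
      removed as a null set.\<close>
    show "AE s in lborel. (\<lambda>k. indicator {0..X k} s *\<^sub>R (complex_of_real (K1 (X k - s) \<xi>) * src F s \<xi>)) \<longlonglongrightarrow> indicator {0..t} s *\<^sub>R (complex_of_real (K1 (t - s) \<xi>) * src F s \<xi>)"
    proof (rule AE_mp[OF AE_lborel_singleton[of t]], rule AE_I2, rule impI)
      fix s assume st: "s \<noteq> t"
      have "eventually (\<lambda>k. indicator {0..X k} s = (indicator {0..t} s :: real)) sequentially"
      proof (cases "s < t")
        case True
        from order_tendstoD(1)[OF X(2) True] show ?thesis by (rule eventually_mono) (use True in \<open>auto simp: indicator_def\<close>)
      next
        case False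
        then have "t < s" using st by simp
        from order_tendstoD(2)[OF X(2) this] show ?thesis by (rule eventually_mono) (use \<open>t < s\<close> in \<open>auto simp: indicator_def\<close>)
      qed
      then have "(\<lambda>k. indicator {0..X k} s :: real) \<longlonglongrightarrow> indicator {0..t} s" by (rule tendsto_eventually)
      then show "(\<lambda>k. indicator {0..X k} s *\<^sub>R (complex_of_real (K1 (X k - s) \<xi>) * src F s \<xi>)) \<longlonglongrightarrow> indicator {0..t} s *\<^sub>R (complex_of_real (K1 (t - s) \<xi>) * src F s \<xi>)"
        by (intro tendsto_scaleR tendsto_mult tendsto_of_real c1 tendsto_const)
    qed
  qed
  then have "(\<lambda>k. duh F (X k) \<xi>) \<longlonglongrightarrow> duh F t \<xi>" by (simp add: duh_def set_lebesgue_integral_def)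
  with l show ?thesis unfolding Phi_def by (rule tendsto_add)
qed

text \<open>The map improves continuity: L2 continuity of the argument yields continuity of the
  image in each of the three norms.\<close>

lemma Phi_continuous:
  assumes F: "good F" and t: "t \<ge> 0" and X: "\<And>k. X k \<ge> 0" "X \<longlonglongrightarrow> t" and e: "\<epsilon> > 0"
  shows "eventually (\<lambda>k. fnorm_le j (\<lambda>\<xi>. Phi F (X k) \<xi> - Phi F t \<xi>) \<epsilon>) sequentially"
proof -
  obtain T where T: "\<And>k. norm (X k) \<le> T" using X(2) convergent_imp_Bseq[of X] by (auto simp: convergent_def Bseq_def)
  have XT: "X k \<le> T" for k using T[of k] by simp
  have tT: "t \<le> T" using X(2) XT by (intro LIMSEQ_le_const2) auto
  have T0: "T \<ge> 0" using t tT by simp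
  obtain A where A: "fnorm_le j (\<lambda>\<xi>. complex_of_real (2 * (16 / jb \<xi> * dom F T \<xi>))) A" using dom_fnorm[OF F T0] by blast
  show ?thesis
  proof (rule fnorm_le_dominated_convergence[OF _ A _ _ e])
    show "(\<lambda>\<xi>. Phi F (X k) \<xi> - Phi F t \<xi>) \<in> borel_measurable borel" for k using Phi_meas[OF F] by measurable
    show "norm (Phi F (X k) \<xi> - Phi F t \<xi>) \<le> norm (complex_of_real (2 * (16 / jb \<xi> * dom F T \<xi>)))" for k \<xi>
    proof -
      have "norm (Phi F (X k) \<xi> - Phi F t \<xi>) \<le> 2 * (16 / jb \<xi> * dom F T \<xi>)"
        using norm_triangle_ineq4[of "Phi F (X k) \<xi>" "Phi F t \<xi>"] Phi_dominated[OF F X(1) XT, of k \<xi>] Phi_dominated[OF F t tT, of \<xi>] by linarith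
      also have "\<dots> \<le> norm (complex_of_real (2 * (16 / jb \<xi> * dom F T \<xi>)))" unfolding norm_of_real by (rule abs_ge_self)
      finally show ?thesis .
    qed
    show "(\<lambda>k. Phi F (X k) \<xi> - Phi F t \<xi>) \<longlonglongrightarrow> 0" for \<xi> by (rule LIM_zero[OF Phi_pointwise_continuous[OF F X]])
  qed
qed

lemma good_Phi: assumes F: "good F" shows "good (Phi F)"
  unfolding good_def using Phi_meas[OF F] Phi_herm Phi_bound[OF F] Phi_continuous[OF F, of _ _ _ 0]
  by (auto simp: fnorm_le_def)

lemma good_zero: "good (\<lambda>t \<xi>. 0)"
proof -
  have "fnorm_le j (\<lambda>\<xi>. 0) (R * wt j t)" for j t
    using R wt_nonneg by (auto simp: fnorm_le_def L2le_def L1le_def)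
  then show ?thesis by (auto simp: good_def L2le_zero)
qed

text \<open>The integral of exp(\<lambda> s) over [0,t] is at most exp(\<lambda> t) / \<lambda>, and
  32 is twice the bound 16 of the propagator, so the contraction factor becomes 1/2. The summand 1
  keeps the exponent positive.\<close>

definition lam :: real where "lam = 32 * (sqrt (ftc TYPE('n)) * lipc) + 1"

lemma lam_pos: "lam > 0" "32 * (sqrt (ftc TYPE('n)) * lipc) \<le> lam"
proof -
  have "0 \<le> sqrt (ftc TYPE('n)) * lipc" using lipc_nonneg sqrt_ftc_ge_1[where 'n='n] by simp
  then show "lam > 0" "32 * (sqrt (ftc TYPE('n)) * lipc) \<le> lam" unfolding lam_def by linarith+
qed

text \<open>The second conclusion is what allows a pointwise limit: an L2 bound on the difference of
  the arguments controls the difference of the images at every frequency, because the transform of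
  an L1 difference is bounded everywhere.\<close>

lemma Phi_contraction:
  assumes F: "good F" and G: "good G" and A: "A \<ge> 0" and D: "\<And>s. s \<ge> 0 \<Longrightarrow> L2le lborel (\<lambda>\<xi>. F s \<xi> - G s \<xi>) (A * exp (lam * s))" and t: "t \<ge> 0"
  shows "L2le lborel (\<lambda>\<xi>. Phi F t \<xi> - Phi G t \<xi>) (A * (1/2) * exp (lam * t))"
    and "norm (Phi F t \<xi> - Phi G t \<xi>) \<le> A * exp (lam * t)"
proof -
  let ?c = "16 * (sqrt (ftc TYPE('n)) * (lipc * A))"
  have s1: "sqrt (ftc TYPE('n)) \<ge> 1" by (rule sqrt_ftc_ge_1)
  have c0: "0 \<le> ?c" using lipc_nonneg A s1 by simp
  have eq: "Phi F t \<xi> - Phi G t \<xi> = (LINT s:{0..t}|lborel. complex_of_real (K1 (t - s) \<xi>) * (src F s \<xi> - src G s \<xi>))" for \<xi>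
    unfolding Phi_def duh_def right_diff_distrib by (subst set_integral_diff(2)[OF src_integrable[OF F] src_integrable[OF G]]) simp
  have le: "(LINT s:{0..t}|lborel. ?c * exp (lam * s)) \<le> A * (1/2) * exp (lam * t)"
  proof -
    have "(LINT s:{0..t}|lborel. ?c * exp (lam * s)) \<le> ?c * (exp (lam * t) / lam)" by (rule exp_integral(2)[OF lam_pos(1) t c0])
    also have "\<dots> = (32 * (sqrt (ftc TYPE('n)) * lipc)) * (A * exp (lam * t) / (2 * lam))" by simp
    also have "\<dots> \<le> lam * (A * exp (lam * t) / (2 * lam))" using A lam_pos by (intro mult_right_mono) auto
    finally show ?thesis using lam_pos(1) by simp
  qed
  have "L2le lborel (\<lambda>\<xi>. LINT s:{0..t}|lborel. complex_of_real (K1 (t - s) \<xi>) * (src F s \<xi> - src G s \<xi>)) (LINT s:{0..t}|lborel. ?c * exp (lam * s))"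
  proof (rule L2le_Minkowski[OF lborel.sigma_finite_measure_axioms _ _ exp_integral(1)[OF lam_pos(1) t]])
    note [measurable] = src_measurable[OF F] src_measurable[OF G]
    show "(\<lambda>(s, \<xi>). complex_of_real (K1 (t - s) \<xi>) * (src F s \<xi> - src G s \<xi>)) \<in> borel_measurable (lborel \<Otimes>\<^sub>M lborel)" by measurable
    fix s assume s: "s \<in> {0..t}"
    then have s0: "s \<ge> 0" "t - s \<ge> 0" by auto
    have "L2le lborel (\<lambda>\<xi>. complex_of_real (K1 (t - s) \<xi>) * (src F s \<xi> - src G s \<xi>)) (16 * (sqrt (ftc TYPE('n)) * (lipc * (A * exp (lam * s)))))"
    proof (rule L2le_dom[OF src_diff(2)[OF F G s0(1) s0(1) D[OF s0(1)]]])
      show "AE \<xi> in lborel. norm (complex_of_real (K1 (t - s) \<xi>) * (src F s \<xi> - src G s \<xi>)) \<le> 16 * norm (src F s \<xi> - src G s \<xi>)"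
        by (intro AE_I2) (simp add: norm_mult mult_right_mono K1_le_16[OF s0(2)])
    qed (use src_source(2)[OF F, of s] src_source(2)[OF G, of s] in auto)
    then show "L2le lborel (\<lambda>\<xi>. complex_of_real (K1 (t - s) \<xi>) * (src F s \<xi> - src G s \<xi>)) (?c * exp (lam * s))" by (simp add: mult_ac)
  qed
  then have "L2le lborel (\<lambda>\<xi>. Phi F t \<xi> - Phi G t \<xi>) (LINT s:{0..t}|lborel. ?c * exp (lam * s))" by (simp only: eq)
  then show "L2le lborel (\<lambda>\<xi>. Phi F t \<xi> - Phi G t \<xi>) (A * (1/2) * exp (lam * t))" using le by (rule L2le_mono)
  have "norm (LINT s:{0..t}|lborel. complex_of_real (K1 (t - s) \<xi>) * (src F s \<xi> - src G s \<xi>)) \<le> (LINT s:{0..t}|lborel. ?c * exp (lam * s))"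
    unfolding set_lebesgue_integral_def
  proof (rule Bochner_Integration.integral_norm_bound_integral)
    have "set_integrable lborel {0..t} (\<lambda>s. complex_of_real (K1 (t - s) \<xi>) * (src F s \<xi> - src G s \<xi>))"
      unfolding right_diff_distrib by (intro set_integral_diff(1) src_integrable F G)
    then show "integrable lborel (\<lambda>s. indicator {0..t} s *\<^sub>R (complex_of_real (K1 (t - s) \<xi>) * (src F s \<xi> - src G s \<xi>)))" by (simp add: set_integrable_def)
    show "integrable lborel (\<lambda>s. indicator {0..t} s *\<^sub>R (?c * exp (lam * s)))" using exp_integral(1)[OF lam_pos(1) t] by (simp add: set_integrable_def)
    show "norm (indicator {0..t} s *\<^sub>R (complex_of_real (K1 (t - s) \<xi>) * (src F s \<xi> - src G s \<xi>))) \<le> indicator {0..t} s *\<^sub>R (?c * exp (lam * s))" for s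
    proof (cases "s \<in> {0..t}")
      case True
      then have s0: "s \<ge> 0" "t - s \<ge> 0" by auto
      have "norm (complex_of_real (K1 (t - s) \<xi>) * (src F s \<xi> - src G s \<xi>)) \<le> 16 * (lipc * (A * exp (lam * s)))"
        unfolding norm_mult norm_of_real by (intro mult_mono K1_le_16[OF s0(2)] src_diff(1)[OF F G s0(1) s0(1) D[OF s0(1)]]) auto
      also have "\<dots> = 16 * (1 * (lipc * A)) * exp (lam * s)" by simp
      also have "\<dots> \<le> ?c * exp (lam * s)" using lipc_nonneg A by (intro mult_right_mono mult_left_mono s1) auto
      finally show ?thesis using True by simp
    qed simp
  qed
  moreover have "A * (1/2) * exp (lam * t) \<le> A * exp (lam * t)" using A by simp
  ultimately show "norm (Phi F t \<xi> - Phi G t \<xi>) \<le> A * exp (lam * t)" unfolding eq using le by linarith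
qed

fun picard :: "nat \<Rightarrow> real \<Rightarrow> real^'n \<Rightarrow> complex" where
  "picard 0 = (\<lambda>t \<xi>. 0)"
| "picard (Suc k) = Phi (picard k)"

lemma good_picard: "good (picard k)"
  by (induction k) (simp_all add: good_zero good_Phi)

lemma picard_diff:
  "t \<ge> 0 \<Longrightarrow> L2le lborel (\<lambda>\<xi>. picard (Suc k) t \<xi> - picard k t \<xi>) (R * exp (lam * t) * (1/2) ^ k)"
proof (induction k arbitrary: t)
  case 0
  have "R * 1 \<le> R * exp (lam * t)" using R 0 lam_pos(1) by (intro mult_left_mono) auto
  then show ?case using L2le_mono[OF good_norms(7)[OF good_picard[of 1] 0], of "R * exp (lam * t)"] by simp
next
  case (Suc k)
  have "L2le lborel (\<lambda>\<xi>. Phi (picard (Suc k)) t \<xi> - Phi (picard k) t \<xi>) (R * (1/2) ^ k * (1/2) * exp (lam * t))"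
    by (rule Phi_contraction(1)[OF good_picard good_picard _ _ Suc.prems]) (use R Suc.IH in \<open>simp_all add: mult_ac\<close>)
  then show ?case by (simp add: mult_ac)
qed

definition limF :: "real \<Rightarrow> real^'n \<Rightarrow> complex" where "limF t \<xi> = lim (\<lambda>k. picard k t \<xi>)"

text \<open>From the second iterate on, consecutive differences are bounded at each \<xi> by a
  geometric sequence. Convergence thus holds at every frequency, with no exceptional set depending
  on time.\<close>

lemma picard_tendsto: assumes t: "t \<ge> 0" shows "(\<lambda>k. picard k t \<xi>) \<longlonglongrightarrow> limF t \<xi>"
proof -
  have b: "norm (picard (Suc (Suc k)) t \<xi> - picard (Suc k) t \<xi>) \<le> R * exp (lam * t) * (1/2) ^ k" for k
    using Phi_contraction(2)[OF good_picard[of "Suc k"] good_picard[of k] _ _ t, of "R * (1/2) ^ k" \<xi>] picard_diff[of _ k] R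
    by (simp add: mult_ac)
  have "summable (\<lambda>k. R * exp (lam * t) * (1/2::real) ^ k)" by (intro summable_mult summable_geometric) simp
  then have "summable (\<lambda>k. picard (Suc (Suc k)) t \<xi> - picard (Suc k) t \<xi>)"
    by (rule summable_comparison_test'[where N=0]) (rule b)
  then have "convergent (\<lambda>m. \<Sum>k<m. picard (Suc (Suc k)) t \<xi> - picard (Suc k) t \<xi>)" by (simp add: summable_iff_convergent)
  then have "convergent (\<lambda>m. picard (Suc m) t \<xi> - picard (Suc 0) t \<xi>)"
    unfolding sum_lessThan_telescope[of "\<lambda>k. picard (Suc k) t \<xi>"] .
  then have "convergent (\<lambda>m. picard (Suc m) t \<xi>)" using convergent_diff_const_right_iff by blast
  then have "convergent (\<lambda>m. picard m t \<xi>)" by (subst (asm) convergent_Suc_iff)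
  then show ?thesis by (simp add: limF_def convergent_LIMSEQ_iff)
qed

lemma limF_meas: "limF t \<in> borel_measurable borel" if "t \<ge> 0" for t
  unfolding limF_def[abs_def] by (rule borel_measurable_lim_metric) (rule goodD(1)[OF good_picard that])

lemma limF_approx:
  assumes t: "t \<ge> 0" shows "L2le lborel (\<lambda>\<xi>. limF t \<xi> - picard k t \<xi>) (2 * R * exp (lam * t) * (1/2) ^ k)"
proof (rule L2le_Fatou[OF _ _ _ tendsto_const])
  show "L2le lborel (\<lambda>\<xi>. picard (k + j) t \<xi> - picard k t \<xi>) (2 * R * exp (lam * t) * (1/2) ^ k)" for j
    using L2le_telescope[of lborel "\<lambda>k. picard k t" "R * exp (lam * t)", OF picard_diff[OF t], of k j] by (simp add: mult_ac)
  show "(\<lambda>\<xi>. limF t \<xi> - picard k t \<xi>) \<in> borel_measurable lborel"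
    using limF_meas[OF t] goodD(1)[OF good_picard t] by simp
  have "(\<lambda>j. picard (k + j) t \<xi>) \<longlonglongrightarrow> limF t \<xi>" for \<xi>
    using LIMSEQ_ignore_initial_segment[OF picard_tendsto[OF t, of \<xi>], of k] by (simp add: add.commute)
  then show "AE \<xi> in lborel. (\<lambda>j. picard (k + j) t \<xi> - picard k t \<xi>) \<longlonglongrightarrow> limF t \<xi> - picard k t \<xi>"
    by (intro AE_I2 tendsto_diff tendsto_const)
qed

text \<open>Norm bounds pass by Fatou and Hermitian symmetry by continuity of conjugation. For
  continuity in time, the approximation by iterates is uniform on bounded time intervals.\<close>

lemma good_limF: "good limF"
  unfolding good_def
proof (intro conjI allI impI)
  fix t :: real assume t: "t \<ge> 0"
  show m: "limF t \<in> borel_measurable borel" by (rule limF_meas[OF t])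
  show "limF t (- \<xi>) = cnj (limF t \<xi>)" for \<xi>
  proof (rule LIMSEQ_unique[OF picard_tendsto[OF t, of "- \<xi>"]])
    show "(\<lambda>k. picard k t (- \<xi>)) \<longlonglongrightarrow> cnj (limF t \<xi>)"
      unfolding goodD(2)[OF good_picard t] by (intro tendsto_cnj picard_tendsto[OF t])
  qed
  show "fnorm_le j (limF t) (R * wt j t)" for j
    by (rule fnorm_le_Fatou[OF goodD(3)[OF good_picard t] m picard_tendsto[OF t]])
next
  fix t :: real and X :: "nat \<Rightarrow> real" and \<epsilon> :: real
  assume t: "t \<ge> 0" and X: "\<forall>k. X k \<ge> 0" "X \<longlonglongrightarrow> t" and e: "\<epsilon> > 0"
  obtain T where T: "\<And>k. norm (X k) \<le> T" using X(2) convergent_imp_Bseq[of X] by (auto simp: convergent_def Bseq_def)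
  have XT: "X k \<le> T" for k using T[of k] by simp
  have tT: "t \<le> T" using X(2) XT by (intro LIMSEQ_le_const2) auto
  have "(\<lambda>k. 2 * R * exp (lam * T) * (1/2::real) ^ k) \<longlonglongrightarrow> 2 * R * exp (lam * T) * 0"
    by (intro tendsto_mult_left LIMSEQ_realpow_zero) auto
  \<comment> \<open>The index is fixed using the weight at the right end T, which bounds all times
    visited by the sequence.\<close>
  then have "eventually (\<lambda>k. 2 * R * exp (lam * T) * (1/2::real) ^ k < \<epsilon> / 3) sequentially"
    using e by (intro order_tendstoD(2)) auto
  then obtain m where m: "2 * R * exp (lam * T) * (1/2::real) ^ m < \<epsilon> / 3" by (auto simp: eventually_sequentially)
  have ap: "L2le lborel (\<lambda>\<xi>. limF s \<xi> - picard m s \<xi>) (\<epsilon> / 3)" if "0 \<le> s" "s \<le> T" for s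
  proof (rule L2le_mono[OF limF_approx[OF that(1)]])
    have "2 * R * exp (lam * s) * (1/2::real) ^ m \<le> 2 * R * exp (lam * T) * (1/2::real) ^ m"
      using that R lam_pos(1) by (intro mult_right_mono mult_left_mono) auto
    then show "2 * R * exp (lam * s) * (1/2) ^ m \<le> \<epsilon> / 3" using m by linarith
  qed
  have "eventually (\<lambda>k. L2le lborel (\<lambda>\<xi>. picard m (X k) \<xi> - picard m t \<xi>) (\<epsilon> / 3)) sequentially"
    using X e by (intro goodD(4)[OF good_picard t]) auto
  then show "eventually (\<lambda>k. L2le lborel (\<lambda>\<xi>. limF (X k) \<xi> - limF t \<xi>) \<epsilon>) sequentially"
  proof eventually_elim
    case (elim k)
    from L2le_diff[OF L2le_add[OF ap[of "X k"] elim] ap[OF t tT]] X(1) XT show ?case by simp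
  qed
qed

text \<open>The shifted iterates converge pointwise to the limit and, by the contraction estimate
  applied to the limit itself, also to its image.\<close>

theorem Phi_fixed_point: assumes t: "t \<ge> 0" shows "Phi limF t \<xi> = limF t \<xi>"
proof (rule LIMSEQ_unique)
  show "(\<lambda>k. picard (Suc k) t \<xi>) \<longlonglongrightarrow> limF t \<xi>" by (rule LIMSEQ_Suc[OF picard_tendsto[OF t]])
  have b: "norm (Phi limF t \<xi> - Phi (picard k) t \<xi>) \<le> 2 * R * exp (lam * t) * (1/2) ^ k" for k
    using Phi_contraction(2)[OF good_limF good_picard[of k] _ _ t, of "2 * R * (1/2) ^ k" \<xi>] limF_approx[of _ k] R by (simp add: mult_ac)
  have "(\<lambda>k. 2 * R * exp (lam * t) * (1/2::real) ^ k) \<longlonglongrightarrow> 2 * R * exp (lam * t) * 0"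
    by (intro tendsto_mult_left LIMSEQ_realpow_zero) auto
  then have "(\<lambda>k. Phi limF t \<xi> - Phi (picard k) t \<xi>) \<longlonglongrightarrow> 0"
    by (intro Lim_null_comparison[OF always_eventually[rule_format, OF b]]) (simp only: mult_zero_right)
  from tendsto_diff[OF tendsto_const[of "Phi limF t \<xi>"] this]
  show "(\<lambda>k. picard (Suc k) t \<xi>) \<longlonglongrightarrow> Phi limF t \<xi>" by simp
qed

end

subsection \<open>Lebesgue measurable functions and the spaces of the statement\<close>

text \<open>The statement uses the completed measure, whereas the analysis needs Borel functions for
  joint measurability and Fubini. Passing to such representatives is the bridge between the
  two.\<close>

lemma lebesgue_borel_rep:
  fixes f :: "real^'n::finite \<Rightarrow> real"
  assumes "f \<in> borel_measurable lebesgue"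
  shows "\<exists>f'. f' \<in> borel_measurable borel \<and> (AE x in lborel. f x = f' x)"
  using completion_ex_borel_measurable_real[OF assms] by auto

lemma L2le_lebesgue_rep:
  assumes "f' \<in> borel_measurable borel" "AE x in lborel. f x = f' x"
  shows "L2le lebesgue f A \<Longrightarrow> L2le lborel f' A" "L1le lebesgue f A \<Longrightarrow> L1le lborel f' A"
proof -
  have e: "(\<integral>\<^sup>+x. ennreal ((norm (f' x))\<^sup>2) \<partial>lborel) = (\<integral>\<^sup>+x. ennreal ((norm (f x))\<^sup>2) \<partial>lebesgue)"
    "(\<integral>\<^sup>+x. ennreal (norm (f' x)) \<partial>lborel) = (\<integral>\<^sup>+x. ennreal (norm (f x)) \<partial>lebesgue)"
    unfolding nn_integral_completion by (intro nn_integral_cong_AE, use assms(2) in eventually_elim, simp)+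
  show "L2le lebesgue f A \<Longrightarrow> L2le lborel f' A" "L1le lebesgue f A \<Longrightarrow> L1le lborel f' A"
    using assms(1) e by (auto simp: L2le_def L1le_def)
qed

lemma L2le_lebesgue_of_lborel: "L2le lborel f A \<Longrightarrow> L2le lebesgue f A"
  unfolding L2le_def nn_integral_completion by (auto intro: measurable_completion)

lemma integral_lebesgue_rep:
  fixes f f' :: "real^'n::finite \<Rightarrow> real" and g :: "real^'n \<Rightarrow> 'b::{real_normed_algebra_1,banach,second_countable_topology}"
  assumes f: "f \<in> borel_measurable lebesgue" and f': "f' \<in> borel_measurable borel" "AE x in lborel. f x = f' x" and g: "g \<in> borel_measurable borel"
  shows "(\<integral>x. of_real (f x) * g x \<partial>lebesgue) = (\<integral>x. of_real (f' x) * g x \<partial>lborel)"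
proof -
  have gl: "g \<in> borel_measurable lebesgue" "f' \<in> borel_measurable lebesgue" using g f' by (auto intro: measurable_completion)
  have "(\<integral>x. of_real (f x) * g x \<partial>lebesgue) = (\<integral>x. of_real (f' x) * g x \<partial>lebesgue)"
  proof (rule integral_cong_AE)
    show "AE x in lebesgue. of_real (f x) * g x = of_real (f' x) * g x"
      unfolding AE_completion_iff using f'(2) by eventually_elim simp
  qed (use f gl in auto)
  also have "\<dots> = (\<integral>x. of_real (f' x) * g x \<partial>lborel)" by (rule integral_completion) (use g f' in auto)
  finally show ?thesis .
qed

lemma fourier_rep:
  fixes f f' :: "real^'n::finite \<Rightarrow> real"
  assumes "f \<in> borel_measurable lebesgue" "f' \<in> borel_measurable borel" "AE x in lborel. f x = f' x"
  shows "fourier f \<xi> = ft (cx f') \<xi>"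
proof -
  have "fourier f \<xi> = (\<integral>x. of_real (f x) * exp (- \<i> * complex_of_real (x \<bullet> \<xi>)) \<partial>lebesgue)"
    unfolding fourier_def by (simp only: mult.commute)
  also have "\<dots> = (\<integral>x. of_real (f' x) * exp (- \<i> * complex_of_real (x \<bullet> \<xi>)) \<partial>lborel)"
    by (rule integral_lebesgue_rep[OF assms]) measurable
  finally show ?thesis by (simp only: ft_def cx_def mult.commute)
qed

lemma fourier_borel: "f \<in> borel_measurable borel \<Longrightarrow> fourier f = ft (cx f)"
  by (rule ext, rule fourier_rep) (auto intro: measurable_completion)

lemma Lp_2_iff: "Lp 2 f \<longleftrightarrow> f \<in> borel_measurable lebesgue \<and> integrable lebesgue (\<lambda>x. (f x)\<^sup>2)"
  and Lp_norm_2: "Lp_norm 2 f = sqrt (\<integral>x. (f x)\<^sup>2 \<partial>lebesgue)"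
proof -
  have p: "\<bar>x\<bar> powr 2 = x\<^sup>2" for x :: real by (cases "x = 0") (auto simp: powr_numeral)
  show "Lp 2 f \<longleftrightarrow> f \<in> borel_measurable lebesgue \<and> integrable lebesgue (\<lambda>x. (f x)\<^sup>2)" by (simp add: Lp_def p)
  have "0 \<le> (\<integral>x. (f x)\<^sup>2 \<partial>lebesgue)" by simp
  then show "Lp_norm 2 f = sqrt (\<integral>x. (f x)\<^sup>2 \<partial>lebesgue)" by (simp add: Lp_norm_def p powr_half_sqrt)
qed

lemma Lp_norm_nonneg: "0 \<le> Lp_norm p f"
  by (simp add: Lp_norm_def)

lemma Lp_2_L2le: "Lp 2 f \<Longrightarrow> L2le lebesgue f (Lp_norm 2 f)"
  by (rule L2leI_integrable) (auto simp: Lp_2_iff Lp_norm_2)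

lemma L2le_Lp_2: assumes "L2le lebesgue f A" shows "Lp 2 f" "Lp_norm 2 f \<le> A"
  using L2le_integrable[OF assms] L2le_integral[OF assms] L2le_nonneg[OF assms] L2le_measurable[OF assms]
  by (auto simp: Lp_2_iff Lp_norm_2 real_le_lsqrt)

lemma Lp_1_L1le: "Lp 1 f \<Longrightarrow> L1le lebesgue f (Lp_norm 1 f)"
  by (rule L1leI_integrable) (auto simp: Lp_def Lp_norm_def integrable_abs_iff)

lemma weak_deriv_rep:
  fixes f g :: "real^'n::finite \<Rightarrow> real"
  assumes w: "weak_deriv is f g" and f: "f \<in> borel_measurable lebesgue" "f' \<in> borel_measurable borel" "AE x in lborel. f x = f' x"
    and g: "g \<in> borel_measurable lebesgue" "g' \<in> borel_measurable borel" "AE x in lborel. g x = g' x" and t: "test_fun \<theta>"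
  shows "(\<integral>x. f' x * iter_pd is \<theta> x \<partial>lborel) = (-1) ^ length is * (\<integral>x. g' x * \<theta> x \<partial>lborel)"
  using w t integral_lebesgue_rep[OF f test_fun_measurable[OF test_fun_iter_pd[OF t]], of "is"] integral_lebesgue_rep[OF g test_fun_measurable[OF t]]
  by (simp add: weak_deriv_def)

text \<open>Borel representatives of the two derivatives have equal pairings with every test
  function, so the fundamental lemma applies to their difference.\<close>

lemma weak_deriv_unique:
  fixes f g1 g2 :: "real^'n::finite \<Rightarrow> real"
  assumes w: "weak_deriv is f g1" "weak_deriv is f g2" and g: "L2le lebesgue g1 A" "L2le lebesgue g2 B"
  shows "AE x in lebesgue. g1 x = g2 x"
proof -
  obtain h1 h2 where h: "h1 \<in> borel_measurable borel" "AE x in lborel. g1 x = h1 x" "h2 \<in> borel_measurable borel" "AE x in lborel. g2 x = h2 x"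
    using lebesgue_borel_rep L2le_measurable[OF g(1)] L2le_measurable[OF g(2)] by metis
  have L: "L2le lborel h1 A" "L2le lborel h2 B" using L2le_lebesgue_rep(1) h g by auto
  have "AE x in lborel. h1 x - h2 x = 0"
  proof (rule fundamental_lemma_lborel[OF L2le_diff[OF L]])
    fix \<theta> :: "real^'n \<Rightarrow> real" assume t: "test_fun \<theta>"
    obtain c where c: "L2le lborel \<theta> c" using test_fun_L2[OF t] by blast
    have "(\<integral>x. h1 x * \<theta> x \<partial>lborel) = (\<integral>x. g1 x * \<theta> x \<partial>lebesgue)" "(\<integral>x. h2 x * \<theta> x \<partial>lborel) = (\<integral>x. g2 x * \<theta> x \<partial>lebesgue)"
      using integral_lebesgue_rep[OF L2le_measurable[OF g(1)] h(1,2) test_fun_measurable[OF t]]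
        integral_lebesgue_rep[OF L2le_measurable[OF g(2)] h(3,4) test_fun_measurable[OF t]] by auto
    moreover have "(-1) ^ length is * (\<integral>x. g1 x * \<theta> x \<partial>lebesgue) = (-1) ^ length is * (\<integral>x. g2 x * \<theta> x \<partial>lebesgue)"
      using w t unfolding weak_deriv_def by metis
    ultimately have "(\<integral>x. h1 x * \<theta> x \<partial>lborel) = (\<integral>x. h2 x * \<theta> x \<partial>lborel)" by simp
    then show "(\<integral>x. (h1 x - h2 x) * \<theta> x \<partial>lborel) = 0"
      unfolding left_diff_distrib
      by (subst Bochner_Integration.integral_diff) (auto intro: L1le_integrable[OF L2le_mult[OF L(1) c]] L1le_integrable[OF L2le_mult[OF L(2) c]])
  qed
  then show ?thesis unfolding AE_completion_iff using h(2,4) by eventually_elim simp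
qed

text \<open>\<open>wd\<close> is a Hilbert choice; uniqueness of weak derivatives transfers to it
  any L2 bound known for some weak derivative.\<close>

lemma wd_L2le:
  fixes f g :: "real^'n::finite \<Rightarrow> real"
  assumes w: "weak_deriv is f g" and g: "L2le lebesgue g A"
  shows "Lp 2 (wd is f)" "weak_deriv is f (wd is f)" "L2le lebesgue (wd is f) A" "Lp_norm 2 (wd is f) \<le> A" "AE x in lebesgue. wd is f x = g x"
proof -
  have "\<exists>g. Lp 2 g \<and> weak_deriv is f g" using w L2le_Lp_2(1)[OF g] by blast
  then have s: "Lp 2 (wd is f) \<and> weak_deriv is f (wd is f)" unfolding wd_def by (rule someI_ex)
  then show 1: "Lp 2 (wd is f)" "weak_deriv is f (wd is f)" by auto
  show 2: "AE x in lebesgue. wd is f x = g x" by (rule weak_deriv_unique[OF 1(2) w Lp_2_L2le[OF 1(1)] g])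
  have "AE x in lebesgue. g x = wd is f x" using 2 by eventually_elim simp
  then show 3: "L2le lebesgue (wd is f) A" by (rule L2le_cong_AE[OF g L2le_measurable[OF Lp_2_L2le[OF 1(1)]]])
  show "Lp_norm 2 (wd is f) \<le> A" by (rule L2le_Lp_2(2)[OF 3])
qed

lemma weak_deriv_Nil:
  fixes f :: "real^'n::finite \<Rightarrow> real"
  assumes f: "L2le lebesgue f A" shows "weak_deriv [] f f"
  unfolding weak_deriv_def
proof (intro allI impI)
  fix \<theta> :: "real^'n \<Rightarrow> real" assume "test_fun \<theta>"
  then obtain c where "L2le lborel \<theta> c" using test_fun_L2 by blast
  then have "integrable lebesgue (\<lambda>x. f x * \<theta> x)" using L1le_integrable[OF L2le_mult[OF f L2le_lebesgue_of_lborel]] by blast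
  then show "integrable lebesgue (\<lambda>x. f x * iter_pd [] \<theta> x) \<and> integrable lebesgue (\<lambda>x. f x * \<theta> x) \<and>
    (\<integral>x. f x * iter_pd [] \<theta> x \<partial>lebesgue) = (- 1) ^ length ([]::'n list) * (\<integral>x. f x * \<theta> x \<partial>lebesgue)" by simp
qed

lemma finite_lists_le: "finite {is::'n::finite list. length is \<le> k}"
  using finite_lists_length_le[of "UNIV :: 'n set" k] by simp

lemma wd_le_sobolev_norm: "length is \<le> k \<Longrightarrow> Lp_norm 2 (wd is f) \<le> sobolev_norm k f"
proof -
  assume k: "length is \<le> k"
  have "(Lp_norm 2 (wd is f))\<^sup>2 \<le> (\<Sum>is\<in>{is. length is \<le> k}. (Lp_norm 2 (wd is f))\<^sup>2)"
    by (rule member_le_sum) (use k finite_lists_le in auto)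
  then show ?thesis unfolding sobolev_norm_def by (rule real_le_rsqrt)
qed

lemma sobolev_norm_nonneg: "0 \<le> sobolev_norm k f"
  unfolding sobolev_norm_def by (intro real_sqrt_ge_zero sum_nonneg) simp

lemma sobolev_norm_1_le:
  fixes f :: "real^'n::finite \<Rightarrow> real"
  assumes "\<And>is. length is \<le> 1 \<Longrightarrow> Lp_norm 2 (wd is f) \<le> A"
  shows "sobolev_norm 1 f \<le> real (card {is::'n list. length is \<le> 1}) * A"
proof -
  have "sobolev_norm 1 f \<le> (\<Sum>is\<in>{is. length is \<le> 1}. Lp_norm 2 (wd is f))"
    unfolding sobolev_norm_def L2_set_def[symmetric] by (rule L2_set_le_sum) (rule Lp_norm_nonneg)
  also have "\<dots> \<le> (\<Sum>is\<in>{is::'n list. length is \<le> 1}. A)" using assms by (intro sum_mono) auto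
  finally show ?thesis by simp
qed

text \<open>The infimum defining the norm is attained: the bounds enlarged by 1/(k+1) hold off
  countably many null sets. Negative bounds are impossible because the whole space is not
  null.\<close>

lemma Linf_norm_le:
  fixes f :: "real^'n::finite \<Rightarrow> real"
  assumes "AE x in lebesgue. \<bar>f x\<bar> \<le> A"
  shows "Linf_norm f \<le> A" "0 \<le> Linf_norm f" "AE x in lebesgue. \<bar>f x\<bar> \<le> Linf_norm f"
proof -
  let ?S = "{M. AE x in lebesgue. \<bar>f x\<bar> \<le> M}"
  have nn: "0 \<le> M" if "M \<in> ?S" for M
  proof (rule ccontr)
    assume M: "\<not> 0 \<le> M"
    have "AE x in (lborel :: (real^'n) measure). False"
      using that unfolding mem_Collect_eq AE_completion_iff by eventually_elim (use M in linarith)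
    then show False by (simp add: ae_filter_eq_bot_iff)
  qed
  have ne: "?S \<noteq> {}" using assms by auto
  have bd: "bdd_below ?S" by (rule bdd_belowI[OF nn])
  show "Linf_norm f \<le> A" unfolding Linf_norm_def by (rule cInf_lower[OF _ bd]) (simp add: assms)
  show "0 \<le> Linf_norm f" unfolding Linf_norm_def by (rule cInf_greatest[OF ne nn])
  have "AE x in lebesgue. \<bar>f x\<bar> \<le> Linf_norm f + 1 / real (Suc k)" for k
  proof -
    have "Inf ?S < Linf_norm f + 1 / real (Suc k)" by (simp add: Linf_norm_def)
    then obtain M where M: "M \<in> ?S" "M < Linf_norm f + 1 / real (Suc k)" using cInf_lessD[OF ne] by blast
    from M(1) have "AE x in lebesgue. \<bar>f x\<bar> \<le> M" by simp
    then show ?thesis by eventually_elim (use M(2) in linarith)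
  qed
  then have "AE x in lebesgue. \<forall>k. \<bar>f x\<bar> \<le> Linf_norm f + 1 / real (Suc k)" unfolding AE_all_countable by blast
  then show "AE x in lebesgue. \<bar>f x\<bar> \<le> Linf_norm f"
  proof eventually_elim
    case (elim x)
    have "(\<lambda>k. Linf_norm f + 1 / real (Suc k)) \<longlonglongrightarrow> Linf_norm f + 0" by (intro tendsto_intros LIMSEQ_Suc[OF lim_1_over_n])
    from LIMSEQ_le_const[OF this] show ?case using elim by simp
  qed
qed

text \<open>Even the term for the empty list is a chosen function, equal to f only almost
  everywhere, which is why the passage goes through \<open>wd []\<close>.\<close>

lemma L2le_sobolev_norm:
  fixes f :: "real^'n::finite \<Rightarrow> real"
  assumes "Lp 2 f" shows "L2le lebesgue f (sobolev_norm k f)"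
proof -
  have L: "L2le lebesgue f (Lp_norm 2 f)" by (rule Lp_2_L2le[OF assms])
  note w = wd_L2le[OF weak_deriv_Nil[OF L] L]
  have "L2le lebesgue (wd [] f) (sobolev_norm k f)" by (rule L2le_mono[OF Lp_2_L2le[OF w(1)] wd_le_sobolev_norm]) simp
  then show ?thesis using w(5) L2le_measurable[OF L] by (rule_tac L2le_cong_AE) auto
qed

text \<open>Translates the three frequency norms into the norms of the statement. It is applied to
  the solution for the decay rates and to time differences for continuity.\<close>

lemma ift_sobolev:
  fixes F :: "real^'n::finite \<Rightarrow> complex"
  assumes F: "fnorm_le 0 F A" "fnorm_le 1 F B" "fnorm_le 2 F E"
  defines "f \<equiv> \<lambda>x. Re (ift F x)"
  shows "sobolev 1 f" "Linf f" "Lp_norm 2 f \<le> A" "Lp_norm 2 (wd [i] f) \<le> B" "Linf_norm f \<le> E" "0 \<le> Linf_norm f"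
    "sobolev_norm 1 f \<le> real (card {is::'n list. length is \<le> 1}) * max A B"
proof -
  have F': "L2le lborel F A" "L2le lborel (\<lambda>\<xi>. complex_of_real (norm \<xi>) * F \<xi>) B" "L1le lborel F E" using F by (auto simp: fnorm_le_def)
  have i: "integrable lborel F" by (rule L1le_integrable[OF F'(3)])
  have [measurable]: "F \<in> borel_measurable borel" using i by auto
  have fb: "L2le lborel f A" unfolding f_def by (rule L2le_Re[OF ift_L2[OF i F'(1)]])
  then have fl: "L2le lebesgue f A" by (rule L2le_lebesgue_of_lborel)
  note n0 = wd_L2le[OF weak_deriv_Nil[OF fl] fl]
  have d: "\<exists>g. L2le lebesgue g B \<and> weak_deriv [i] f g" for i
  proof -
    have "L2le lborel (\<lambda>\<xi>. complex_of_real (\<xi> $ i) * F \<xi>) B"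
      by (rule L2le_dom1[OF F'(2)]) (auto simp: norm_mult component_le_norm_cart intro!: mult_right_mono)
    from ift_weak_deriv[OF i F'(1) this] show ?thesis unfolding f_def using L2le_lebesgue_of_lborel by blast
  qed
  have w: "Lp_norm 2 (wd [i] f) \<le> B" "Lp 2 (wd [i] f)" "weak_deriv [i] f (wd [i] f)" for i using d[of i] wd_L2le by blast+
  then show "Lp_norm 2 (wd [i] f) \<le> B" by blast
  show "Lp_norm 2 f \<le> A" by (rule L2le_Lp_2(2)[OF fl])
  have cases: "is = [] \<or> (\<exists>i. is = [i])" if "length is \<le> 1" for "is" :: "'n list" using that by (cases "is") auto
  show "sobolev 1 f" unfolding sobolev_def
  proof (intro conjI allI impI)
    show "Lp 2 f" by (rule L2le_Lp_2(1)[OF fl])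
    fix "is" :: "'n list" assume "length is \<le> 1"
    then show "\<exists>g. Lp 2 g \<and> weak_deriv is f g" using cases[of "is"] n0(1,2) w(2,3) by blast
  qed
  show "sobolev_norm 1 f \<le> real (card {is::'n list. length is \<le> 1}) * max A B"
  proof (rule sobolev_norm_1_le)
    fix "is" :: "'n list" assume "length is \<le> 1"
    then show "Lp_norm 2 (wd is f) \<le> max A B" using cases[of "is"] n0(4) w(1) by (auto simp: le_max_iff_disj)
  qed
  have b: "AE x in lebesgue. \<bar>f x\<bar> \<le> E"
    unfolding f_def using ift_bound[OF F'(3)] abs_Re_le_cmod order_trans by (intro AE_I2) blast
  show "Linf f" unfolding Linf_def using b L2le_measurable[OF fl] by blast
  show "Linf_norm f \<le> E" "0 \<le> Linf_norm f" by (rule Linf_norm_le[OF b])+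
qed

text \<open>For k <= 2 the weight \<open>jb\<close> to the power k is at most 1 plus the sum of the
  |\<xi>_i|^k, the symbols of the identity and of the pure k-th derivatives. That is at most three
  terms, each bounded by the Sobolev norm.\<close>

lemma fourier_data_bound:
  fixes f :: "real^'n::finite \<Rightarrow> real"
  assumes f: "sobolev k f" "Lp 1 f" and k: "k \<le> 2" and c: "CARD('n) \<le> 2"
  shows "norm (fourier f \<xi>) \<le> Lp_norm 1 f" "fourier f \<in> borel_measurable borel" "fourier f (- \<xi>) = cnj (fourier f \<xi>)"
    "L2le lborel (\<lambda>\<xi>. jb \<xi> ^ k * norm (fourier f \<xi>)) (3 * sqrt (ftc TYPE('n)) * sobolev_norm k f)"
proof -
  have fm: "f \<in> borel_measurable lebesgue" using f(2) by (simp add: Lp_def)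
  obtain f' where f': "f' \<in> borel_measurable borel" "AE x in lborel. f x = f' x" using lebesgue_borel_rep[OF fm] by blast
  have L1: "L1le lborel f' (Lp_norm 1 f)" by (rule L2le_lebesgue_rep(2)[OF f' Lp_1_L1le[OF f(2)]])
  have i: "integrable lborel f'" by (rule L1le_integrable[OF L1])
  have e: "fourier f = ft (cx f')" using fourier_rep[OF fm f'] by blast
  show "norm (fourier f \<xi>) \<le> Lp_norm 1 f" unfolding e by (rule ft_bound[OF cx_L1le[OF L1]])
  show fm'[measurable]: "fourier f \<in> borel_measurable borel" unfolding e by (rule ft_measurable[OF cx_integrable[OF i]])
  show "fourier f (- \<xi>) = cnj (fourier f \<xi>)" unfolding e by (rule ft_hermitian)
  let ?S = "sqrt (ftc TYPE('n)) * sobolev_norm k f"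
  have S0: "0 \<le> ?S" using sobolev_norm_nonneg[of k f] sqrt_ftc_ge_1[where 'n='n] by simp
  have D: "L2le lborel (\<lambda>\<xi>. xi_pow is \<xi> * fourier f \<xi>) ?S" if l: "length is \<le> k" for "is"
  proof -
    obtain g where g: "Lp 2 g" "weak_deriv is f g" using f(1) l unfolding sobolev_def by blast
    note w = wd_L2le[OF g(2) Lp_2_L2le[OF g(1)]]
    have wm: "wd is f \<in> borel_measurable lebesgue" by (rule L2le_measurable[OF w(3)])
    obtain g' where g': "g' \<in> borel_measurable borel" "AE x in lborel. wd is f x = g' x" using lebesgue_borel_rep[OF wm] by blast
    have "L2le lborel g' (sobolev_norm k f)"
      by (rule L2le_lebesgue_rep(1)[OF g' L2le_mono[OF Lp_2_L2le[OF w(1)] wd_le_sobolev_norm[OF l]]])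
    from weak_deriv_ft_bound[OF i this weak_deriv_rep[OF w(2) fm f' wm g']] show ?thesis by (simp add: e)
  qed
  have xp: "norm (xi_pow (replicate k i) \<xi>) = \<bar>\<xi> $ i\<bar> ^ k" for i \<xi> by (simp add: xi_pow_def norm_power norm_mult)
  have "L2le lborel (\<lambda>\<xi>. norm (xi_pow [] \<xi> * fourier f \<xi>) + (\<Sum>i\<in>(UNIV::'n set). norm (xi_pow (replicate k i) \<xi> * fourier f \<xi>))) (?S + (\<Sum>i\<in>(UNIV::'n set). ?S))"
    by (intro L2le_add L2le_sum L2le_norm D) auto
  then have "L2le lborel (\<lambda>\<xi>. jb \<xi> ^ k * norm (fourier f \<xi>)) (?S + (\<Sum>i\<in>(UNIV::'n set). ?S))"
  proof (rule L2le_dom1)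
    fix \<xi> :: "real^'n"
    have "jb \<xi> ^ k \<le> 1 + (\<Sum>i\<in>UNIV. \<bar>\<xi> $ i\<bar> ^ k)"
    proof -
      consider "k = 0" | "k = 1" | "k = 2" using k by linarith
      then show ?thesis
      proof cases
        case 2
        have "jb \<xi> \<le> 1 + norm \<xi>" unfolding jb_def by (rule real_le_lsqrt) (auto simp: power2_sum)
        then show ?thesis using 2 norm_le_l1_cart[of \<xi>] by simp
      next
        case 3
        have "(norm \<xi>)\<^sup>2 = (\<Sum>i\<in>UNIV. \<bar>\<xi> $ i\<bar>\<^sup>2)" by (simp add: norm_vec_def L2_set_def sum_nonneg)
        then show ?thesis using 3 by (simp add: jb_sq)
      qed simp
    qed
    then have "jb \<xi> ^ k * norm (fourier f \<xi>) \<le> (1 + (\<Sum>i\<in>UNIV. \<bar>\<xi> $ i\<bar> ^ k)) * norm (fourier f \<xi>)" by (rule mult_right_mono) simp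
    also have "\<dots> = norm (xi_pow [] \<xi> * fourier f \<xi>) + (\<Sum>i\<in>(UNIV::'n set). norm (xi_pow (replicate k i) \<xi> * fourier f \<xi>))"
      by (simp add: norm_mult xp distrib_right sum_distrib_right) (simp add: xi_pow_def)
    finally show "norm (jb \<xi> ^ k * norm (fourier f \<xi>)) \<le> norm (norm (xi_pow [] \<xi> * fourier f \<xi>) + (\<Sum>i\<in>(UNIV::'n set). norm (xi_pow (replicate k i) \<xi> * fourier f \<xi>)))"
      using jb_pos[of \<xi>] by (simp add: abs_mult sum_nonneg)
  qed measurable
  then show "L2le lborel (\<lambda>\<xi>. jb \<xi> ^ k * norm (fourier f \<xi>)) (3 * sqrt (ftc TYPE('n)) * sobolev_norm k f)"
  proof (rule L2le_mono)
    have "?S + (\<Sum>i\<in>(UNIV::'n set). ?S) = (1 + real CARD('n)) * ?S" by (simp add: distrib_right)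
    also have "\<dots> \<le> 3 * ?S" using c S0 by (intro mult_right_mono) auto
    finally show "?S + (\<Sum>i\<in>(UNIV::'n set). ?S) \<le> 3 * sqrt (ftc TYPE('n)) * sobolev_norm k f" by simp
  qed
qed

context damped
begin

section \<open>The constructed solution and its properties\<close>

lemma limF_Phi: "t \<ge> 0 \<Longrightarrow> limF t = Phi limF t"
  using Phi_fixed_point by (intro ext) simp

text \<open>\<open>good\<close> records continuity only in L2; the fixed-point equation upgrades it
  to the gradient and sup norms.\<close>

lemma limF_continuous:
  assumes "t \<ge> 0" "\<And>k. X k \<ge> 0" "X \<longlonglongrightarrow> t" "\<epsilon> > 0"
  shows "eventually (\<lambda>k. fnorm_le j (\<lambda>\<xi>. limF (X k) \<xi> - limF t \<xi>) \<epsilon>) sequentially"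
  using Phi_continuous[OF good_limF assms, of j] assms(1,2) by (simp add: limF_Phi[symmetric])

definition usol :: "real \<Rightarrow> real^'n \<Rightarrow> real" where "usol t = sol (limF t)"

lemma usol_bounds:
  assumes t: "t \<ge> 0"
  shows "sobolev 1 (usol t)" "Linf (usol t)" "Lp_norm 2 (usol t) \<le> R * (1 + t) powr (- (n / 4))"
    "Lp_norm 2 (wd [i] (usol t)) \<le> R * (1 + t) powr (- (n / 4 + 1/2))" "Linf_norm (usol t) \<le> R * (1 + t) powr (- (n / 2))"
proof -
  note g = goodD(3)[OF good_limF t]
  have e: "usol t = (\<lambda>x. Re (ift (limF t) x))" by (simp add: usol_def sol_def[abs_def])
  note S = ift_sobolev[OF g[of 0] g[of 1] g[of 2], folded e]
  show "sobolev 1 (usol t)" "Linf (usol t)" by (rule S)+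
  show "Lp_norm 2 (usol t) \<le> R * (1 + t) powr (- (n / 4))" using S(3) by (simp add: wt_def rate_def)
  show "Lp_norm 2 (wd [i] (usol t)) \<le> R * (1 + t) powr (- (n / 4 + 1/2))" using S(4)[of i] by (simp add: wt_def rate_def add.commute)
  show "Linf_norm (usol t) \<le> R * (1 + t) powr (- (n / 2))" using S(5) by (simp add: wt_def rate_def)
qed

lemma usol_class: "solution_class usol"
  unfolding solution_class_def
proof (intro conjI allI impI)
  fix t :: real assume t: "t \<ge> 0"
  show "sobolev 1 (usol t)" "Linf (usol t)" using usol_bounds[OF t] by auto
  let ?c = "real (card {is::'n list. length is \<le> 1})"
  let ?N = "\<lambda>s. sobolev_norm 1 (\<lambda>x. usol s x - usol t x) + Linf_norm (\<lambda>x. usol s x - usol t x)"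
  show "(?N \<longlongrightarrow> 0) (at t within {0..})"
    unfolding tendsto_at_iff_sequentially
  proof (intro allI impI)
    fix X assume X: "\<forall>i. X i \<in> {0..} - {t}" "X \<longlonglongrightarrow> t"
    show "(?N \<circ> X) \<longlonglongrightarrow> 0"
    proof (rule LIMSEQ_I)
      fix r :: real assume r: "r > 0"
      \<comment> \<open>The Sobolev norm sums at most ?c terms and the sup norm adds one more; the
        denominator ?c + 2 makes the inequality strict.\<close>
      define \<epsilon> where "\<epsilon> = r / (?c + 2)"
      have e: "\<epsilon> > 0" "?c * \<epsilon> + \<epsilon> < r" using r by (auto simp: \<epsilon>_def field_simps add_pos_nonneg)
      have X0: "X k \<ge> 0" for k using X(1) by auto
      have "eventually (\<lambda>k. norm ((?N \<circ> X) k - 0) < r) sequentially"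
        using limF_continuous[OF t X0 X(2) e(1), of 0] limF_continuous[OF t X0 X(2) e(1), of 1] limF_continuous[OF t X0 X(2) e(1), of 2]
      proof eventually_elim
        case (elim k)
        have eq: "(\<lambda>x. Re (ift (\<lambda>\<xi>. limF (X k) \<xi> - limF t \<xi>) x)) = (\<lambda>x. usol (X k) x - usol t x)"
          unfolding usol_def sol_def by (simp add: ift_diff[OF good_norms(4)[OF good_limF X0] good_norms(4)[OF good_limF t]])
        note S = ift_sobolev[OF elim, unfolded eq]
        have "sobolev_norm 1 (\<lambda>x. usol (X k) x - usol t x) \<le> ?c * \<epsilon>" using S(7) by simp
        then show ?case using S(5,6) sobolev_norm_nonneg[of 1 "\<lambda>x. usol (X k) x - usol t x"] e(2) by simp
      qed
      then show "\<exists>N. \<forall>k\<ge>N. norm ((?N \<circ> X) k - 0) < r" by (simp add: eventually_sequentially)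
    qed
  qed
qed

lemma hnl_eq: "hnl CARD('n) \<mu> s = h s"
proof (cases "s = 0")
  case False
  have n0: "n > 0" using n12 by auto
  have "1 + 2 / real CARD('n) = real (Suc q)" using qn n0 dim by (simp add: field_simps)
  then have "\<bar>s\<bar> powr (1 + 2 / real CARD('n)) = \<bar>s\<bar> ^ Suc q" using False by (simp only: powr_realpow zero_less_abs_iff not_False_eq_True)
  then show ?thesis by (simp add: hnl_def h_def)
qed (simp add: hnl_def h_def)

text \<open>The fixed-point equation holds at every frequency; pairing it with \<theta> and moving
  the transform onto \<theta> gives the distributional identity. Hermitian symmetry is used to drop
  the real part.\<close>

lemma usol_mild:
  assumes f: "f0 = fourier \<phi>" "f1 = fourier \<psi>"
  shows "mild_solution \<mu> \<phi> \<psi> usol"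
  unfolding mild_solution_def
proof (intro allI impI)
  fix t :: real and \<theta> :: "real^'n \<Rightarrow> real" assume t: "0 \<le> t" and th: "test_fun \<theta>"
  note [measurable] = test_fun_measurable[OF th]
  note g = good_norms[OF good_limF t]
  obtain c where c: "L2le lborel (cx \<theta>) c" using test_fun_cx(2)[OF th] by blast
  note ti = test_fun_cx(1)[OF th]
  have Fm[measurable]: "limF t \<in> borel_measurable borel" by (rule goodD(1)[OF good_limF t])
  have um: "usol t \<in> borel_measurable borel" unfolding usol_def by (rule g(10))
  have "(\<integral>x. complex_of_real (usol t x) * fourier \<theta> x \<partial>lebesgue) = (\<integral>x. complex_of_real (usol t x) * ft (cx \<theta>) x \<partial>lborel)"
    unfolding fourier_borel[OF test_fun_measurable[OF th]] by (rule integral_completion) (use um ft_measurable[OF ti] in simp)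
  also have "\<dots> = (\<integral>x. ift (limF t) x * ft (cx \<theta>) x \<partial>lborel)"
    unfolding usol_def sol_def ift_real[OF Fm goodD(2)[OF good_limF t], symmetric] ..
  also have "\<dots> = (\<integral>\<xi>. limF t \<xi> * cx \<theta> \<xi> \<partial>lborel)" by (rule ift_ft_pairing[OF g(4,2) ti c])
  also have "\<dots> = (\<integral>\<xi>. complex_of_real (\<theta> \<xi>) * limF t \<xi> \<partial>lebesgue)"
    by (subst integral_completion) (simp_all add: cx_def mult.commute)
  also have "\<dots> = (\<integral>\<xi>. complex_of_real (\<theta> \<xi>) *
          (complex_of_real (K0 t \<xi>) * fourier \<phi> \<xi> + complex_of_real (K1 t \<xi>) * fourier \<psi> \<xi>
           + (LINT s:{0..t}|lborel. complex_of_real (K1 (t - s) \<xi>) * fourier (\<lambda>y. hnl CARD('n) \<mu> (usol s y)) \<xi>)) \<partial>lebesgue)"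
  proof (rule Bochner_Integration.integral_cong[OF refl])
    fix \<xi>
    have "duh limF t \<xi> = (LINT s:{0..t}|lborel. complex_of_real (K1 (t - s) \<xi>) * fourier (\<lambda>y. hnl CARD('n) \<mu> (usol s y)) \<xi>)"
      unfolding duh_def
    proof (rule set_lebesgue_integral_cong)
      show "\<forall>s. s \<in> {0..t} \<longrightarrow> complex_of_real (K1 (t - s) \<xi>) * src limF s \<xi> = complex_of_real (K1 (t - s) \<xi>) * fourier (\<lambda>y. hnl CARD('n) \<mu> (usol s y)) \<xi>"
      proof (intro allI impI)
        fix s assume "s \<in> {0..t}"
        then have s: "s \<ge> 0" by simp
        have "(\<lambda>y. h (sol (limF s) y)) \<in> borel_measurable borel" using good_norms(10)[OF good_limF s] by measurable
        from fourier_borel[OF this] show "complex_of_real (K1 (t - s) \<xi>) * src limF s \<xi> = complex_of_real (K1 (t - s) \<xi>) * fourier (\<lambda>y. hnl CARD('n) \<mu> (usol s y)) \<xi>"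
          using s by (simp add: src_def hnl_eq usol_def)
      qed
    qed simp
    then show "complex_of_real (\<theta> \<xi>) * limF t \<xi> = complex_of_real (\<theta> \<xi>) *
          (complex_of_real (K0 t \<xi>) * fourier \<phi> \<xi> + complex_of_real (K1 t \<xi>) * fourier \<psi> \<xi>
           + (LINT s:{0..t}|lborel. complex_of_real (K1 (t - s) \<xi>) * fourier (\<lambda>y. hnl CARD('n) \<mu> (usol s y)) \<xi>))"
      by (simp add: Phi_fixed_point[OF t, symmetric] Phi_def lin_def f[symmetric])
  qed
  finally show "(\<integral>x. complex_of_real (usol t x) * fourier \<theta> x \<partial>lebesgue) = \<dots>" .
qed

end

subsection \<open>Uniqueness\<close>

text \<open>Converse of Cauchy-Schwarz by density: a test function close to H is inserted for H
  itself, and the quadratic inequality for the norm of H is solved after the error tends to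
  0.\<close>

lemma L2_dual_bound:
  fixes H :: "real^'n::finite \<Rightarrow> real"
  assumes H: "L2le lborel H A" and K: "0 \<le> K" "\<And>\<theta> c. test_fun \<theta> \<Longrightarrow> L2le lborel \<theta> c \<Longrightarrow> \<bar>\<integral>x. H x * \<theta> x \<partial>lborel\<bar> \<le> K * c"
  shows "L2le lborel H K"
proof -
  define c0 where "c0 = sqrt (\<integral>x. (H x)\<^sup>2 \<partial>lborel)"
  have i0: "0 \<le> (\<integral>x. (H x)\<^sup>2 \<partial>lborel)" by simp
  have c0: "0 \<le> c0" "c0\<^sup>2 = (\<integral>x. (H x)\<^sup>2 \<partial>lborel)" unfolding c0_def by auto
  have Hc: "L2le lborel H c0"
    using L2le_measurable[OF H] L2le_integrable[OF H] c0 by (intro L2leI_integrable) auto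
  \<comment> \<open>The test function has norm at most c0 + d by the triangle inequality, whence the
    second term.\<close>
  have le: "c0\<^sup>2 \<le> c0 * d + K * (c0 + d)" if d: "d > 0" for d
  proof -
    obtain \<theta> where t: "test_fun \<theta>" "L2le lborel (\<lambda>x. H x - \<theta> x) d"
      using test_fun_dense_L2[OF H] d unfolding test_approx_def by blast
    have tc: "L2le lborel \<theta> (c0 + d)" using L2le_diff[OF Hc t(2)] by simp
    have "c0\<^sup>2 = (\<integral>x. H x * (H x - \<theta> x) + H x * \<theta> x \<partial>lborel)" unfolding c0(2) by (simp add: algebra_simps power2_eq_square)
    also have "\<dots> = (\<integral>x. H x * (H x - \<theta> x) \<partial>lborel) + (\<integral>x. H x * \<theta> x \<partial>lborel)"
      by (intro Bochner_Integration.integral_add L1le_integrable[OF L2le_mult[OF Hc t(2)]] L1le_integrable[OF L2le_mult[OF Hc tc]])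
    also have "\<dots> \<le> c0 * d + K * (c0 + d)"
      using L1le_integral[OF L2le_mult[OF Hc t(2)]] K(2)[OF t(1) tc] by simp
    finally show ?thesis .
  qed
  have "c0\<^sup>2 \<le> K * c0"
  proof (rule field_le_epsilon)
    fix e :: real assume e: "e > 0"
    have p: "c0 + K + 1 > 0" using c0 K by simp
    have "c0\<^sup>2 \<le> c0 * (e / (c0 + K + 1)) + K * (c0 + e / (c0 + K + 1))" using e p by (intro le) simp
    also have "\<dots> = K * c0 + (c0 + K) * (e / (c0 + K + 1))" by (simp only: distrib_left distrib_right add_ac)
    also have "(c0 + K) * (e / (c0 + K + 1)) \<le> (c0 + K + 1) * (e / (c0 + K + 1))" using e p by (intro mult_right_mono) auto
    also have "(c0 + K + 1) * (e / (c0 + K + 1)) = e" using p by simp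
    finally show "c0\<^sup>2 \<le> K * c0 + e" by simp
  qed
  then have "c0 \<le> K" using c0(1) K(1) by (cases "c0 = 0") (auto simp: power2_eq_square)
  then show ?thesis by (rule L2le_mono[OF Hc])
qed

text \<open>The function w is only in L2, so its transform is not given by an integral; G stands for
  it through the pairings. Truncating w to a ball gives an integrable function whose transform is
  compared with G by duality, and Plancherel returns to w. The total error is 3 \<epsilon>: one for
  the truncation, two for real and imaginary parts.\<close>

lemma ft_dual_estimate:
  fixes w :: "real^'n::finite \<Rightarrow> real" and G :: "real^'n \<Rightarrow> complex"
  assumes w: "L2le lborel w B" and G: "L2le lborel G (sqrt (ftc TYPE('n)) * A)"
    and eq: "\<And>\<theta>. test_fun \<theta> \<Longrightarrow> (\<integral>x. cx w x * ft (cx \<theta>) x \<partial>lborel) = (\<integral>\<xi>. cx \<theta> \<xi> * G \<xi> \<partial>lborel)"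
  shows "L2le lborel w A"
proof -
  let ?s = "sqrt (ftc TYPE('n))"
  have s1: "?s \<ge> 1" by (rule sqrt_ftc_ge_1)
  have step: "L2le lborel w (A + 3 * \<epsilon>)" if e: "\<epsilon> > 0" for \<epsilon>
  proof -
    obtain k :: nat where k: "L2le lborel (\<lambda>x. indicator (cball 0 (real k)) x *\<^sub>R cx w x - cx w x) \<epsilon>"
      using L2_truncation[OF cx_L2le[OF w] e] by blast
    define wk where "wk x = indicator (cball 0 (real k)) x *\<^sub>R cx w x" for x
    have wk: "integrable lborel wk" "L2le lborel wk B" "L2le lborel (\<lambda>x. wk x - cx w x) \<epsilon>"
      using L2_truncation_integrable[OF cx_L2le[OF w]] k by (auto simp: wk_def[abs_def])
    \<comment> \<open>Paired with a test function, H equals the truncation error paired with the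
      transform of that test function, hence it is small.\<close>
    define H where "H \<xi> = ft wk \<xi> - G \<xi>" for \<xi>
    have H2: "L2le lborel H (?s * B + ?s * A)" unfolding H_def by (rule L2le_diff[OF ft_L2[OF wk(1,2)] G])
    have Hb: "norm (\<integral>\<xi>. H \<xi> * cx \<theta> \<xi> \<partial>lborel) \<le> (?s * \<epsilon>) * c" if t: "test_fun \<theta>" and c: "L2le lborel \<theta> c" for \<theta> c
    proof -
      note c' = cx_L2le[OF c] and ti = test_fun_cx(1)[OF t]
      note fc = ft_L2[OF ti c']
      have "(\<integral>\<xi>. H \<xi> * cx \<theta> \<xi> \<partial>lborel) = (\<integral>\<xi>. ft wk \<xi> * cx \<theta> \<xi> \<partial>lborel) - (\<integral>\<xi>. cx \<theta> \<xi> * G \<xi> \<partial>lborel)"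
        unfolding H_def left_diff_distrib mult.commute[of "G _"]
        by (intro Bochner_Integration.integral_diff L1le_integrable[OF L2le_mult[OF ft_L2[OF wk(1,2)] c']] L1le_integrable[OF L2le_mult[OF c' G]])
      also have "\<dots> = (\<integral>x. wk x * ft (cx \<theta>) x \<partial>lborel) - (\<integral>x. cx w x * ft (cx \<theta>) x \<partial>lborel)"
        by (simp only: ft_mult_formula[OF wk(1) ti] eq[OF t])
      also have "\<dots> = (\<integral>x. (wk x - cx w x) * ft (cx \<theta>) x \<partial>lborel)"
        unfolding left_diff_distrib
        by (intro Bochner_Integration.integral_diff[symmetric] L1le_integrable[OF L2le_mult[OF wk(2) fc]] L1le_integrable[OF L2le_mult[OF cx_L2le[OF w] fc]])
      also have "norm \<dots> \<le> \<epsilon> * (?s * c)" by (rule L1le_integral[OF L2le_mult[OF wk(3) fc]])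
      finally show ?thesis by (simp add: mult_ac)
    qed
    have Hi: "integrable lborel (\<lambda>\<xi>. H \<xi> * cx \<theta> \<xi>)" if "L2le lborel \<theta> c" for \<theta> c
      by (rule L1le_integrable[OF L2le_mult[OF H2 cx_L2le[OF that]]])
    have se: "0 \<le> ?s * \<epsilon>" using s1 e by simp
    have "L2le lborel (\<lambda>\<xi>. Re (H \<xi>)) (?s * \<epsilon>)"
    proof (rule L2_dual_bound[OF L2le_Re[OF H2] se])
      fix \<theta> :: "real^'n \<Rightarrow> real" and c assume t: "test_fun \<theta>" "L2le lborel \<theta> c"
      have "(\<integral>x. Re (H x) * \<theta> x \<partial>lborel) = Re (\<integral>x. H x * cx \<theta> x \<partial>lborel)"
        by (subst integral_Re[symmetric, OF Hi[OF t(2)]]) (simp add: cx_def)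
      then show "\<bar>\<integral>x. Re (H x) * \<theta> x \<partial>lborel\<bar> \<le> ?s * \<epsilon> * c" using Hb[OF t] abs_Re_le_cmod order_trans by metis
    qed
    moreover have "L2le lborel (\<lambda>\<xi>. Im (H \<xi>)) (?s * \<epsilon>)"
    proof (rule L2_dual_bound[OF L2le_Im[OF H2] se])
      fix \<theta> :: "real^'n \<Rightarrow> real" and c assume t: "test_fun \<theta>" "L2le lborel \<theta> c"
      have "(\<integral>x. Im (H x) * \<theta> x \<partial>lborel) = Im (\<integral>x. H x * cx \<theta> x \<partial>lborel)"
        by (subst integral_Im[symmetric, OF Hi[OF t(2)]]) (simp add: cx_def)
      then show "\<bar>\<integral>x. Im (H x) * \<theta> x \<partial>lborel\<bar> \<le> ?s * \<epsilon> * c" using Hb[OF t] abs_Im_le_cmod order_trans by metis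
    qed
    ultimately have "L2le lborel H (?s * \<epsilon> + ?s * \<epsilon>)" by (rule L2le_complexI)
    from L2le_add[OF this G] have "L2le lborel (ft wk) (?s * (A + 2 * \<epsilon>))" by (simp add: H_def algebra_simps)
    then have "L2le lborel wk (A + 2 * \<epsilon>)" by (rule ft_L2_converse[OF wk(1,2)])
    from L2le_diff[OF this wk(3)] have "L2le lborel (cx w) (A + 3 * \<epsilon>)" by (simp add: algebra_simps)
    from L2le_Re[OF this] show ?thesis by (simp add: cx_def)
  qed
  have "L2le lborel w (A + 3 * 0)"
  proof (rule L2le_limit_bound)
    show "L2le lborel w (A + 3 * (1 / real (Suc k)))" for k by (rule step) simp
    show "(\<lambda>k. A + 3 * (1 / real (Suc k))) \<longlonglongrightarrow> A + 3 * 0" by (intro tendsto_intros LIMSEQ_Suc[OF lim_1_over_n])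
  qed
  then show ?thesis by simp
qed

section \<open>Competing solutions on compact time intervals\<close>

lemma solution_class_diff:
  fixes v :: "real \<Rightarrow> real^'n::finite \<Rightarrow> real"
  assumes v: "solution_class v" and st: "s \<ge> 0" "t \<ge> 0"
  defines "N \<equiv> sobolev_norm 1 (\<lambda>x. v s x - v t x) + Linf_norm (\<lambda>x. v s x - v t x)"
  shows "L2le lebesgue (\<lambda>x. v s x - v t x) N" "AE x in lebesgue. \<bar>v s x - v t x\<bar> \<le> N"
proof -
  have L: "Lp 2 (v s)" "Lp 2 (v t)" "Linf (v s)" "Linf (v t)" using v st by (auto simp: solution_class_def sobolev_def)
  have d: "Lp 2 (\<lambda>x. v s x - v t x)" by (rule L2le_Lp_2(1)[OF L2le_diff[OF Lp_2_L2le[OF L(1)] Lp_2_L2le[OF L(2)]]])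
  obtain M1 M2 where M: "AE x in lebesgue. \<bar>v s x\<bar> \<le> M1" "AE x in lebesgue. \<bar>v t x\<bar> \<le> M2" using L(3,4) by (auto simp: Linf_def)
  have "AE x in lebesgue. \<bar>v s x - v t x\<bar> \<le> M1 + M2" using M by eventually_elim linarith
  note b = Linf_norm_le[OF this]
  show "L2le lebesgue (\<lambda>x. v s x - v t x) N" by (rule L2le_mono[OF L2le_sobolev_norm[OF d, of 1]]) (use b(2) in \<open>simp add: N_def\<close>)
  show "AE x in lebesgue. \<bar>v s x - v t x\<bar> \<le> N"
    using b(3) by eventually_elim (use sobolev_norm_nonneg[of 1 "\<lambda>x. v s x - v t x"] in \<open>simp add: N_def\<close>)
qed

text \<open>Compactness of [0,T] in the form of a bisection principle: boundedness passes to the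
  union of adjacent intervals, and near each time it follows from continuity in the solution norm.
  The guard s >= 0 inside \<open>P\<close> is there because small intervals around time 0 may reach
  below it.\<close>

lemma solution_class_bounded:
  fixes v :: "real \<Rightarrow> real^'n::finite \<Rightarrow> real"
  assumes v: "solution_class v" and T: "T \<ge> 0"
  shows "\<exists>M\<ge>0. \<forall>s\<in>{0..T}. L2le lebesgue (v s) M \<and> (AE x in lebesgue. \<bar>v s x\<bar> \<le> M)"
proof -
  define P where "P a b \<longleftrightarrow> (\<exists>M. \<forall>s\<in>{a..b}. s \<ge> 0 \<longrightarrow> L2le lebesgue (v s) M \<and> (AE x in lebesgue. \<bar>v s x\<bar> \<le> M))" for a b
  have up: "L2le lebesgue (v s) M' \<and> (AE x in lebesgue. \<bar>v s x\<bar> \<le> M')" if "L2le lebesgue (v s) M \<and> (AE x in lebesgue. \<bar>v s x\<bar> \<le> M)" "M \<le> M'" for s M M'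
    using that by (auto intro: L2le_mono elim!: eventually_mono)
  have "P 0 T"
  proof (rule Bolzano[OF T])
    fix a b c assume ab: "P a b" "P b c" "a \<le> b" "b \<le> c"
    obtain M1 M2 where M1: "\<And>s. s \<in> {a..b} \<Longrightarrow> s \<ge> 0 \<Longrightarrow> L2le lebesgue (v s) M1 \<and> (AE x in lebesgue. \<bar>v s x\<bar> \<le> M1)"
      and M2: "\<And>s. s \<in> {b..c} \<Longrightarrow> s \<ge> 0 \<Longrightarrow> L2le lebesgue (v s) M2 \<and> (AE x in lebesgue. \<bar>v s x\<bar> \<le> M2)"
      using ab(1,2) unfolding P_def by blast
    have "L2le lebesgue (v s) (max M1 M2) \<and> (AE x in lebesgue. \<bar>v s x\<bar> \<le> max M1 M2)" if "s \<in> {a..c}" "s \<ge> 0" for s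
    proof (cases "s \<le> b")
      case True
      show ?thesis by (rule up[OF M1]) (use True that in auto)
    next
      case False
      show ?thesis by (rule up[OF M2]) (use False that in auto)
    qed
    then show "P a c" unfolding P_def by blast
  next
    fix t assume t: "0 \<le> t" "t \<le> T"
    have "((\<lambda>s. sobolev_norm 1 (\<lambda>x. v s x - v t x) + Linf_norm (\<lambda>x. v s x - v t x)) \<longlongrightarrow> 0) (at t within {0..})"
      using v t(1) by (simp add: solution_class_def)
    then have "eventually (\<lambda>s. sobolev_norm 1 (\<lambda>x. v s x - v t x) + Linf_norm (\<lambda>x. v s x - v t x) < 1) (at t within {0..})"
      by (rule order_tendstoD(2)) simp
    then obtain \<delta> where \<delta>: "\<delta> > 0" "\<And>s. s \<ge> 0 \<Longrightarrow> s \<noteq> t \<Longrightarrow> dist s t < \<delta> \<Longrightarrow> sobolev_norm 1 (\<lambda>x. v s x - v t x) + Linf_norm (\<lambda>x. v s x - v t x) < 1"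
      unfolding eventually_at by force
    have Lt: "Lp 2 (v t)" "Linf (v t)" using v t(1) by (auto simp: solution_class_def sobolev_def)
    obtain M1 where M1: "AE x in lebesgue. \<bar>v t x\<bar> \<le> M1" using Lt(2) by (auto simp: Linf_def)
    define M where "M = max (Lp_norm 2 (v t)) M1 + 1"
    have "L2le lebesgue (v s) M \<and> (AE x in lebesgue. \<bar>v s x\<bar> \<le> M)" if s: "s \<ge> 0" "dist s t < \<delta>" for s
    proof (cases "s = t")
      case True
      have "L2le lebesgue (v t) M" by (rule L2le_mono[OF Lp_2_L2le[OF Lt(1)]]) (simp add: M_def)
      moreover have "AE x in lebesgue. \<bar>v t x\<bar> \<le> M" using M1 by eventually_elim (simp add: M_def)
      ultimately show ?thesis using True by simp
    next
      case False
      note N = solution_class_diff[OF v s(1) t(1)] and N1 = \<delta>(2)[OF s(1) False s(2)]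
      have "L2le lebesgue (\<lambda>x. (v s x - v t x) + v t x) (1 + Lp_norm 2 (v t))"
        by (rule L2le_add[OF L2le_mono[OF N(1)] Lp_2_L2le[OF Lt(1)]]) (use N1 in simp)
      then have "L2le lebesgue (v s) (1 + Lp_norm 2 (v t))" by simp
      then have "L2le lebesgue (v s) M" by (rule L2le_mono) (simp add: M_def)
      moreover have "AE x in lebesgue. \<bar>v s x\<bar> \<le> M"
        using N(2) M1 by eventually_elim (use N1 in \<open>simp add: M_def\<close>)
      ultimately show ?thesis by blast
    qed
    then have "P a b" if "a \<le> t \<and> t \<le> b \<and> b - a < \<delta>" for a b
      unfolding P_def using that by (intro exI[of _ M]) (auto simp: dist_real_def)
    then show "\<exists>d>0. \<forall>a b. a \<le> t \<and> t \<le> b \<and> b - a < d \<longrightarrow> P a b" using \<delta>(1) by blast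
  qed
  then obtain M where M: "\<forall>s\<in>{0..T}. s \<ge> 0 \<longrightarrow> L2le lebesgue (v s) M \<and> (AE x in lebesgue. \<bar>v s x\<bar> \<le> M)" unfolding P_def by blast
  have "L2le lebesgue (v 0) M" using M T by simp
  then have "0 \<le> M" by (rule L2le_nonneg)
  moreover have "\<forall>s\<in>{0..T}. L2le lebesgue (v s) M \<and> (AE x in lebesgue. \<bar>v s x\<bar> \<le> M)" using M by simp
  ultimately show ?thesis by blast
qed

context semilinear
begin

text \<open>The regularity extracted from a solution for the uniqueness argument: Borel at each
  time, bounded at every point rather than almost everywhere, and continuous in L2. One constant
  bounds both norms.\<close>

definition l2path :: "real \<Rightarrow> real \<Rightarrow> (real \<Rightarrow> real^'n::finite \<Rightarrow> real) \<Rightarrow> bool" where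
  "l2path T M V \<longleftrightarrow> (\<forall>s\<in>{0..T}. V s \<in> borel_measurable borel \<and> (\<forall>x. \<bar>V s x\<bar> \<le> M) \<and> L2le lborel (V s) M \<and>
     (\<forall>X. (\<forall>k. X k \<in> {0..T}) \<longrightarrow> X \<longlonglongrightarrow> s \<longrightarrow> (\<forall>\<epsilon>>0. eventually (\<lambda>k. L2le lborel (\<lambda>x. V (X k) x - V s x) \<epsilon>) sequentially)))"

lemma solution_class_path:
  fixes v :: "real \<Rightarrow> real^'n::finite \<Rightarrow> real"
  assumes v: "solution_class v" and M: "M \<ge> 0" "\<And>s. s \<in> {0..T} \<Longrightarrow> L2le lebesgue (v s) M \<and> (AE x in lebesgue. \<bar>v s x\<bar> \<le> M)"
  shows "\<exists>V. l2path T M V \<and> (\<forall>s\<in>{0..T}. AE x in lborel. v s x = V s x)"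
proof -
  have "\<exists>g. g \<in> borel_measurable borel \<and> (AE x in lborel. v s x = g x)" if "s \<in> {0..T}" for s
    using lebesgue_borel_rep[OF L2le_measurable] M(2)[OF that] by blast
  then obtain g where g: "\<And>s. s \<in> {0..T} \<Longrightarrow> g s \<in> borel_measurable borel \<and> (AE x in lborel. v s x = g s x)" by metis
  \<comment> \<open>Clipping the Borel representative to [-M, M] changes it only on a null set and
    turns the essential bound into a pointwise one.\<close>
  define V where "V s x = max (- M) (min M (g s x))" for s x
  have Vm: "V s \<in> borel_measurable borel" if "s \<in> {0..T}" for s
  proof -
    have [measurable]: "g s \<in> borel_measurable borel" using g[OF that] by blast
    show ?thesis unfolding V_def[abs_def] by measurable
  qed
  have Ve: "AE x in lborel. v s x = V s x" if "s \<in> {0..T}" for s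
  proof -
    have "AE x in lborel. v s x = g s x" "AE x in lborel. \<bar>v s x\<bar> \<le> M" using g[OF that] M(2)[OF that] by (auto simp: AE_completion_iff)
    then show ?thesis by eventually_elim (auto simp: V_def)
  qed
  have "l2path T M V" unfolding l2path_def
  proof (intro ballI conjI allI impI)
    fix s assume s: "s \<in> {0..T}"
    show "V s \<in> borel_measurable borel" by (rule Vm[OF s])
    show "\<bar>V s x\<bar> \<le> M" for x using M(1) by (auto simp: V_def)
    show "L2le lborel (V s) M" using L2le_lebesgue_rep(1)[OF Vm[OF s] Ve[OF s]] M(2)[OF s] by blast
    fix X \<epsilon> assume X: "\<forall>k. X k \<in> {0..T}" "X \<longlonglongrightarrow> s" and e: "(\<epsilon>::real) > 0"
    have s0: "s \<ge> 0" using s by simp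
    let ?N = "\<lambda>r. sobolev_norm 1 (\<lambda>x. v r x - v s x) + Linf_norm (\<lambda>x. v r x - v s x)"
    have "eventually (\<lambda>r. ?N r < \<epsilon>) (at s within {0..})"
      using v s0 e by (intro order_tendstoD(2)[of ?N 0]) (auto simp: solution_class_def)
    then obtain \<delta> where \<delta>: "\<delta> > 0" "\<And>r. r \<ge> 0 \<Longrightarrow> r \<noteq> s \<Longrightarrow> dist r s < \<delta> \<Longrightarrow> ?N r < \<epsilon>" unfolding eventually_at by force
    have "eventually (\<lambda>k. dist (X k) s < \<delta>) sequentially" using X(2) \<delta>(1) by (rule tendstoD)
    then show "eventually (\<lambda>k. L2le lborel (\<lambda>x. V (X k) x - V s x) \<epsilon>) sequentially"
    proof eventually_elim
      case (elim k)
      show ?case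
      proof (cases "X k = s")
        case True
        then show ?thesis using e by (simp add: L2le_zero)
      next
        case False
        have Xk: "X k \<in> {0..T}" "X k \<ge> 0" using X(1) by auto
        have L: "L2le lebesgue (\<lambda>x. v (X k) x - v s x) \<epsilon>"
          by (rule L2le_mono[OF solution_class_diff(1)[OF v Xk(2) s0]]) (use \<delta>(2)[OF Xk(2) False elim] in simp)
        show ?thesis
        proof (rule L2le_lebesgue_rep(1)[OF _ _ L])
          show "(\<lambda>x. V (X k) x - V s x) \<in> borel_measurable borel" using Vm[OF Xk(1)] Vm[OF s] by measurable
          show "AE x in lborel. v (X k) x - v s x = V (X k) x - V s x" using Ve[OF Xk(1)] Ve[OF s] by eventually_elim simp
        qed
      qed
    qed
  qed
  then show ?thesis using Ve by blast
qed

definition psrc :: "(real \<Rightarrow> real^'n::finite \<Rightarrow> real) \<Rightarrow> real \<Rightarrow> real^'n \<Rightarrow> complex" where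
  "psrc V s = ft (cx (\<lambda>x. h (V s x)))"

lemma psrc_integrable: assumes "l2path T M V" "s \<in> {0..T}" shows "integrable lborel (cx (\<lambda>x. h (V s x)))"
proof -
  have "L2le lborel (V s) M" "\<And>x. \<bar>V s x\<bar> \<le> M" using assms by (auto simp: l2path_def)
  from h_L1[OF this] show ?thesis by (intro cx_integrable L1le_integrable)
qed

lemma psrc_diff:
  fixes V W :: "real \<Rightarrow> real^'n::finite \<Rightarrow> real"
  assumes V: "l2path T M V" and W: "l2path T M W" and s: "s \<in> {0..T}" "s' \<in> {0..T}" and D: "L2le lborel (\<lambda>x. V s x - W s' x) D"
  shows "norm (psrc V s \<xi> - psrc W s' \<xi>) \<le> 8 * M ^ (q - 1) * \<mu> M * M * D"
    and "L2le lborel (\<lambda>\<xi>. psrc V s \<xi> - psrc W s' \<xi>) (sqrt (ftc TYPE('n)) * (4 * M ^ q * \<mu> M * D))"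
proof -
  have eq: "psrc V s \<xi> - psrc W s' \<xi> = ft (cx (\<lambda>x. h (V s x) - h (W s' x))) \<xi>" for \<xi>
  proof -
    have "cx (\<lambda>x. h (V s x) - h (W s' x)) = (\<lambda>x. cx (\<lambda>x. h (V s x)) x - cx (\<lambda>x. h (W s' x)) x)" by (auto simp: cx_def fun_eq_iff)
    then show ?thesis by (simp only: ft_diff[OF psrc_integrable[OF V s(1)] psrc_integrable[OF W s(2)]] psrc_def)
  qed
  have p: "\<And>x. \<bar>V s x\<bar> \<le> M" "\<And>x. \<bar>W s' x\<bar> \<le> M" "L2le lborel (V s) M" "L2le lborel (W s') M"
    "V s \<in> borel_measurable lborel" "W s' \<in> borel_measurable lborel" using V W s by (auto simp: l2path_def)
  note L1 = h_diff_L1[OF p(3,4) D p(1,2)]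
  have "norm (psrc V s \<xi> - psrc W s' \<xi>) \<le> 4 * M ^ (q - 1) * \<mu> M * ((M + M) * D)" unfolding eq by (rule ft_bound[OF cx_L1le[OF L1]])
  then show "norm (psrc V s \<xi> - psrc W s' \<xi>) \<le> 8 * M ^ (q - 1) * \<mu> M * M * D" by (simp add: mult_ac)
  show "L2le lborel (\<lambda>\<xi>. psrc V s \<xi> - psrc W s' \<xi>) (sqrt (ftc TYPE('n)) * (4 * M ^ q * \<mu> M * D))"
    unfolding eq by (rule ft_L2[OF cx_integrable[OF L1le_integrable[OF L1]] cx_L2le[OF h_diff_L2[OF p(5,6) D p(1,2)]]])
qed

text \<open>Paths are controlled only on [0,T]; freezing time outside extends the source
  continuously to the whole line, as needed for joint measurability.\<close>

definition clamp :: "real \<Rightarrow> real \<Rightarrow> real" where "clamp T s = max 0 (min T s)"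

lemma psrc_continuous:
  fixes V :: "real \<Rightarrow> real^'n::finite \<Rightarrow> real"
  assumes V: "l2path T M V" and T: "T \<ge> 0" and M: "M \<ge> 0"
  shows "continuous_on UNIV (\<lambda>(s, \<xi>). psrc V (clamp T s) \<xi>)"
proof -
  have cl: "clamp T s \<in> {0..T}" for s using T by (auto simp: clamp_def)
  define L where "L = 8 * M ^ (q - 1) * \<mu> M * M"
  have L: "0 \<le> L" using M by (auto simp: L_def intro!: mult_nonneg_nonneg mu_nonneg)
  have "isCont (\<lambda>(s, \<xi>). psrc V (clamp T s) \<xi>) p" for p
  proof (rule continuous_at_sequentiallyI)
    fix X assume X: "X \<longlonglongrightarrow> p"
    obtain s \<xi> where p: "p = (s, \<xi>)" by (cases p)
    let ?s = "\<lambda>k. clamp T (fst (X k))" and ?x = "\<lambda>k. snd (X k)"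
    have s: "?s \<longlonglongrightarrow> clamp T s" and x: "?x \<longlonglongrightarrow> \<xi>"
      using tendsto_fst[OF X] tendsto_snd[OF X] by (auto simp: p clamp_def intro!: tendsto_max tendsto_min)
    have "(\<lambda>k. psrc V (?s k) (?x k) - psrc V (clamp T s) (?x k)) \<longlonglongrightarrow> 0"
    proof (rule LIMSEQ_I)
      fix e :: real assume e: "e > 0"
      define \<epsilon> where "\<epsilon> = e / (L + 1)"
      have e': "\<epsilon> > 0" "L * \<epsilon> < e" using e L by (auto simp: \<epsilon>_def field_simps)
      have "eventually (\<lambda>k. L2le lborel (\<lambda>x. V (?s k) x - V (clamp T s) x) \<epsilon>) sequentially"
        using V cl s e'(1) by (auto simp: l2path_def)
      then obtain N where N: "\<And>k. k \<ge> N \<Longrightarrow> L2le lborel (\<lambda>x. V (?s k) x - V (clamp T s) x) \<epsilon>" unfolding eventually_sequentially by blast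
      have "norm (psrc V (?s k) (?x k) - psrc V (clamp T s) (?x k) - 0) < e" if "k \<ge> N" for k
        using psrc_diff(1)[OF V V cl cl N[OF that], of "?x k"] e'(2) by (simp add: L_def)
      then show "\<exists>N. \<forall>k\<ge>N. norm (psrc V (?s k) (?x k) - psrc V (clamp T s) (?x k) - 0) < e" by blast
    qed
    moreover have "(\<lambda>k. psrc V (clamp T s) (?x k)) \<longlonglongrightarrow> psrc V (clamp T s) \<xi>"
    proof -
      have "isCont (psrc V (clamp T s)) \<xi>"
        using ft_continuous[OF psrc_integrable[OF V cl]] by (simp add: continuous_on_eq_continuous_at psrc_def)
      then show ?thesis using x by (rule isCont_tendsto_compose)
    qed
    ultimately have "(\<lambda>k. (psrc V (?s k) (?x k) - psrc V (clamp T s) (?x k)) + psrc V (clamp T s) (?x k)) \<longlonglongrightarrow> 0 + psrc V (clamp T s) \<xi>" by (rule tendsto_add)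
    then show "(\<lambda>k. case X k of (s, \<xi>) \<Rightarrow> psrc V (clamp T s) \<xi>) \<longlonglongrightarrow> (case p of (s, \<xi>) \<Rightarrow> psrc V (clamp T s) \<xi>)"
      by (simp add: p case_prod_beta)
  qed
  then show ?thesis by (simp add: continuous_at_imp_continuous_on)
qed

lemma l2path_nonneg: "l2path T M V \<Longrightarrow> T \<ge> 0 \<Longrightarrow> 0 \<le> M"
  by (rule L2le_nonneg[of lborel "V 0"]) (simp add: l2path_def)

lemma psrc_kernel_integrable:
  fixes V :: "real \<Rightarrow> real^'n::finite \<Rightarrow> real"
  assumes V: "l2path T M V" and t: "t \<in> {0..T}"
  shows "set_integrable lborel {0..t} (\<lambda>s. complex_of_real (K1 (t - s) \<xi>) * psrc V s \<xi>)"
proof -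
  have T: "T \<ge> 0" using t by simp
  note c = psrc_continuous[OF V T l2path_nonneg[OF V T]]
  have "continuous_on {0..t} (\<lambda>s. psrc V (clamp T s) \<xi>)"
    using continuous_on_compose2[OF c, of "{0..t}" "\<lambda>s. (s, \<xi>)"] by (simp add: continuous_on_Pair continuous_on_id continuous_on_const)
  moreover have "continuous_on {0..t} (\<lambda>s. K1 (t - s) \<xi>)"
    by (rule continuous_on_compose2[OF K1_continuous]) (auto intro!: continuous_intros)
  ultimately have "set_integrable lborel {0..t} (\<lambda>s. complex_of_real (K1 (t - s) \<xi>) * psrc V (clamp T s) \<xi>)"
    by (intro borel_integrable_atLeastAtMost' continuous_intros)
  moreover have "clamp T s = s" if "s \<in> {0..t}" for s using that t by (auto simp: clamp_def)
  ultimately show ?thesis by (subst set_integrable_cong[OF refl refl]) auto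
qed

text \<open>Minkowski for the clamped source, which agrees with the original one on the range of
  integration. The constant combines the bound 16 on the propagator, Plancherel, and the Lipschitz
  constant of \<open>h\<close> on [-M, M].\<close>

lemma duhamel_diff_L2:
  fixes V W :: "real \<Rightarrow> real^'n::finite \<Rightarrow> real"
  assumes V: "l2path T M V" and W: "l2path T M W" and t: "t \<in> {0..T}"
    and D: "\<And>s. s \<in> {0..t} \<Longrightarrow> L2le lborel (\<lambda>x. V s x - W s x) (w s)" and w: "continuous_on {0..t} w"
  shows "L2le lborel (\<lambda>\<xi>. LINT s:{0..t}|lborel. complex_of_real (K1 (t - s) \<xi>) * (psrc V s \<xi> - psrc W s \<xi>))
    (LINT s:{0..t}|lborel. 16 * (sqrt (ftc TYPE('n)) * (4 * M ^ q * \<mu> M * w s)))"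
proof -
  have T: "T \<ge> 0" using t by simp
  have cl: "clamp T s = s" if "s \<in> {0..t}" for s using that t by (auto simp: clamp_def)
  have [measurable]: "(\<lambda>(s, \<xi>). psrc V (clamp T s) \<xi>) \<in> borel_measurable (borel \<Otimes>\<^sub>M borel)"
    "(\<lambda>(s, \<xi>). psrc W (clamp T s) \<xi>) \<in> borel_measurable (borel \<Otimes>\<^sub>M borel)"
    using psrc_continuous[OF V T l2path_nonneg[OF V T]] psrc_continuous[OF W T l2path_nonneg[OF W T]]
    by (auto simp: borel_prod intro!: borel_measurable_continuous_onI)
  have "L2le lborel (\<lambda>\<xi>. LINT s:{0..t}|lborel. complex_of_real (K1 (t - s) \<xi>) * (psrc V (clamp T s) \<xi> - psrc W (clamp T s) \<xi>))
    (LINT s:{0..t}|lborel. 16 * (sqrt (ftc TYPE('n)) * (4 * M ^ q * \<mu> M * w s)))"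
  proof (rule L2le_Minkowski[OF lborel.sigma_finite_measure_axioms])
    show "(\<lambda>(s, \<xi>). complex_of_real (K1 (t - s) \<xi>) * (psrc V (clamp T s) \<xi> - psrc W (clamp T s) \<xi>)) \<in> borel_measurable (lborel \<Otimes>\<^sub>M lborel)" by measurable
    show "set_integrable lborel {0..t} (\<lambda>s. 16 * (sqrt (ftc TYPE('n)) * (4 * M ^ q * \<mu> M * w s)))"
      by (intro borel_integrable_atLeastAtMost' continuous_intros w)
    fix s assume s: "s \<in> {0..t}"
    then have s0: "s \<in> {0..T}" "t - s \<ge> 0" using t by auto
    have m: "(\<lambda>\<xi>. complex_of_real (K1 (t - s) \<xi>) * (psrc V (clamp T s) \<xi> - psrc W (clamp T s) \<xi>)) \<in> borel_measurable lborel" by measurable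
    show "L2le lborel (\<lambda>\<xi>. complex_of_real (K1 (t - s) \<xi>) * (psrc V (clamp T s) \<xi> - psrc W (clamp T s) \<xi>)) (16 * (sqrt (ftc TYPE('n)) * (4 * M ^ q * \<mu> M * w s)))"
      by (rule L2le_dom[OF psrc_diff(2)[OF V W s0(1) s0(1) D[OF s]] m])
        (auto simp: norm_mult cl[OF s] mult_right_mono K1_le_16[OF s0(2)])
  qed
  moreover have "(LINT s:{0..t}|lborel. complex_of_real (K1 (t - s) \<xi>) * (psrc V (clamp T s) \<xi> - psrc W (clamp T s) \<xi>)) =
      (LINT s:{0..t}|lborel. complex_of_real (K1 (t - s) \<xi>) * (psrc V s \<xi> - psrc W s \<xi>))" for \<xi>
    by (rule set_lebesgue_integral_cong) (auto simp: cl)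
  ultimately show ?thesis by simp
qed

text \<open>Comparison with the zero path, whose source vanishes because h(0) = 0.\<close>

lemma duhamel_L2:
  fixes V :: "real \<Rightarrow> real^'n::finite \<Rightarrow> real"
  assumes V: "l2path T M V" and t: "t \<in> {0..T}"
  shows "\<exists>B. L2le lborel (\<lambda>\<xi>. LINT s:{0..t}|lborel. complex_of_real (K1 (t - s) \<xi>) * psrc V s \<xi>) B"
proof -
  have M: "0 \<le> M" using l2path_nonneg[OF V] t by simp
  define Z where "Z s x = (0::real)" for s :: real and x :: "real^'n"
  have Z: "l2path T M Z" using M by (auto simp: l2path_def Z_def[abs_def] L2le_zero)
  have "psrc Z s \<xi> = 0" for s \<xi> by (simp add: psrc_def Z_def h_def cx_def ft_def)
  moreover have "L2le lborel (\<lambda>x. V s x - Z s x) M" if "s \<in> {0..t}" for s using V that t by (simp add: l2path_def Z_def)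
  ultimately show ?thesis using duhamel_diff_L2[OF V Z t, of "\<lambda>_. M"] by auto
qed

end

context damped
begin

text \<open>The mild identity in terms of Borel representatives, with the linear part separated: it
  depends on the data alone and cancels between two solutions.\<close>

lemma mild_solution_path:
  assumes f: "f0 = fourier \<phi>" "f1 = fourier \<psi>" and v: "solution_class v" "mild_solution \<mu> \<phi> \<psi> v"
    and V: "l2path T M V" "\<And>s. s \<in> {0..T} \<Longrightarrow> AE x in lborel. v s x = V s x" and t: "t \<in> {0..T}" and th: "test_fun \<theta>"
  defines "D \<equiv> \<lambda>\<xi>. LINT s:{0..t}|lborel. complex_of_real (K1 (t - s) \<xi>) * psrc V s \<xi>"
  shows "(\<integral>x. cx (V t) x * ft (cx \<theta>) x \<partial>lborel) = (\<integral>\<xi>. cx \<theta> \<xi> * lin t \<xi> \<partial>lborel) + (\<integral>\<xi>. cx \<theta> \<xi> * D \<xi> \<partial>lborel)"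
    and "integrable lborel (\<lambda>\<xi>. cx \<theta> \<xi> * D \<xi>)"
proof -
  note [measurable] = test_fun_measurable[OF th] ft_measurable[OF test_fun_cx(1)[OF th]]
  obtain c where c: "L2le lborel (cx \<theta>) c" using test_fun_cx(2)[OF th] by blast
  obtain B where B: "L2le lborel D B" using duhamel_L2[OF V(1) t] unfolding D_def by blast
  have t0: "t \<ge> 0" using t by simp
  have lin2: "L2le lborel (lin t) (R / 2 * wt 0 t)" using lin_bound[OF t0, of 0] by (simp add: fnorm_le_def)
  have vm: "v s \<in> borel_measurable lebesgue" if "s \<in> {0..T}" for s
    using v(1) that by (auto simp: solution_class_def sobolev_def Lp_def)
  have Vm: "V s \<in> borel_measurable borel" if "s \<in> {0..T}" for s using V(1) that by (simp add: l2path_def)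
  have src: "fourier (\<lambda>y. hnl CARD('n) \<mu> (v s y)) \<xi> = psrc V s \<xi>" if s: "s \<in> {0..T}" for s \<xi>
    unfolding psrc_def hnl_eq
  proof (rule fourier_rep)
    note [measurable] = vm[OF s] Vm[OF s]
    show "(\<lambda>y. h (v s y)) \<in> borel_measurable lebesgue" "(\<lambda>y. h (V s y)) \<in> borel_measurable borel" by measurable
    show "AE x in lborel. h (v s x) = h (V s x)" using V(2)[OF s] by eventually_elim simp
  qed
  have D: "(LINT s:{0..t}|lborel. complex_of_real (K1 (t - s) \<xi>) * fourier (\<lambda>y. hnl CARD('n) \<mu> (v s y)) \<xi>) = D \<xi>" for \<xi>
    unfolding D_def by (rule set_lebesgue_integral_cong) (use t in \<open>auto simp: src\<close>)
  have m[measurable]: "D \<in> borel_measurable borel" using L2le_measurable[OF B] by simp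
  have cm[measurable]: "cx \<theta> \<in> borel_measurable borel" using L2le_measurable[OF c] by simp
  have "(\<integral>x. cx (V t) x * ft (cx \<theta>) x \<partial>lborel) = (\<integral>x. complex_of_real (v t x) * fourier \<theta> x \<partial>lebesgue)"
    unfolding fourier_borel[OF test_fun_measurable[OF th]] cx_def[of "V t"]
    by (rule integral_lebesgue_rep[symmetric, OF vm[OF t] Vm[OF t] V(2)[OF t]]) measurable
  also have "\<dots> = (\<integral>\<xi>. complex_of_real (\<theta> \<xi>) * (complex_of_real (K0 t \<xi>) * fourier \<phi> \<xi> + complex_of_real (K1 t \<xi>) * fourier \<psi> \<xi> + D \<xi>) \<partial>lebesgue)"
    using v(2)[unfolded mild_solution_def, rule_format, OF t0 th] unfolding D .
  also have "\<dots> = (\<integral>\<xi>. cx \<theta> \<xi> * (lin t \<xi> + D \<xi>) \<partial>lebesgue)" by (simp add: lin_def f[symmetric] cx_def)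
  also have "\<dots> = (\<integral>\<xi>. cx \<theta> \<xi> * lin t \<xi> + cx \<theta> \<xi> * D \<xi> \<partial>lborel)" unfolding distrib_left by (rule integral_completion) measurable
  also have "\<dots> = (\<integral>\<xi>. cx \<theta> \<xi> * lin t \<xi> \<partial>lborel) + (\<integral>\<xi>. cx \<theta> \<xi> * D \<xi> \<partial>lborel)"
    by (intro Bochner_Integration.integral_add L1le_integrable[OF L2le_mult[OF c lin2]] L1le_integrable[OF L2le_mult[OF c B]])
  finally show "(\<integral>x. cx (V t) x * ft (cx \<theta>) x \<partial>lborel) = (\<integral>\<xi>. cx \<theta> \<xi> * lin t \<xi> \<partial>lborel) + (\<integral>\<xi>. cx \<theta> \<xi> * D \<xi> \<partial>lborel)" .
  show "integrable lborel (\<lambda>\<xi>. cx \<theta> \<xi> * D \<xi>)" by (rule L1le_integrable[OF L2le_mult[OF c B]])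
qed

text \<open>On [0,T] both solutions are bounded by some M of arbitrary size. A weight exp(l t) with
  l adapted to M makes the Duhamel difference halve the distance, and iterating from the trivial
  bound 2M forces it to 0.\<close>

theorem mild_solution_unique:
  assumes f: "f0 = fourier \<phi>" "f1 = fourier \<psi>" and u: "solution_class u" "mild_solution \<mu> \<phi> \<psi> u"
    and v: "solution_class v" "mild_solution \<mu> \<phi> \<psi> v" and T: "T \<ge> 0"
  shows "AE x in lebesgue. v T x = u T x"
proof -
  obtain M1 where M1: "M1 \<ge> 0" "\<forall>s\<in>{0..T}. L2le lebesgue (u s) M1 \<and> (AE x in lebesgue. \<bar>u s x\<bar> \<le> M1)"
    using solution_class_bounded[OF u(1) T] by blast
  obtain M2 where M2: "M2 \<ge> 0" "\<forall>s\<in>{0..T}. L2le lebesgue (v s) M2 \<and> (AE x in lebesgue. \<bar>v s x\<bar> \<le> M2)"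
    using solution_class_bounded[OF v(1) T] by blast
  define M where "M = M1 + M2"
  have M: "M \<ge> 0" "M1 \<le> M" "M2 \<le> M" using M1(1) M2(1) by (auto simp: M_def)
  have "L2le lebesgue (u s) M \<and> (AE x in lebesgue. \<bar>u s x\<bar> \<le> M)" if "s \<in> {0..T}" for s
    using bspec[OF M1(2) that] M(2) by (auto intro: L2le_mono elim!: eventually_mono)
  from solution_class_path[OF u(1) M(1) this]
  obtain U where U: "l2path T M U" "\<And>s. s \<in> {0..T} \<Longrightarrow> AE x in lborel. u s x = U s x" by blast
  have "L2le lebesgue (v s) M \<and> (AE x in lebesgue. \<bar>v s x\<bar> \<le> M)" if "s \<in> {0..T}" for s
    using bspec[OF M2(2) that] M(3) by (auto intro: L2le_mono elim!: eventually_mono)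
  from solution_class_path[OF v(1) M(1) this]
  obtain V where V: "l2path T M V" "\<And>s. s \<in> {0..T} \<Longrightarrow> AE x in lborel. v s x = V s x" by blast
  let ?s = "sqrt (ftc TYPE('n))"
  define c where "c = 4 * M ^ q * \<mu> M"
  have c: "0 \<le> c" using M(1) by (auto simp: c_def intro!: mult_nonneg_nonneg mu_nonneg)
  define l where "l = 32 * c + 1"
  have l: "l > 0" "32 * c \<le> l" using c by (auto simp: l_def)
  have s1: "?s \<ge> 1" by (rule sqrt_ftc_ge_1)
  \<comment> \<open>The Plancherel factor of the Duhamel bound is left in place:
    \<open>ft_dual_estimate\<close> removes it when passing back from frequency to space, so l need
    not contain it.\<close>
  have step: "L2le lborel (\<lambda>x. V t x - U t x) (A / 2 * exp (l * t))"
    if A: "A \<ge> 0" and D: "\<And>s. s \<in> {0..T} \<Longrightarrow> L2le lborel (\<lambda>x. V s x - U s x) (A * exp (l * s))" and t: "t \<in> {0..T}" for A t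
  proof (rule ft_dual_estimate[OF D[OF t]])
    let ?G = "\<lambda>\<xi>. LINT s:{0..t}|lborel. complex_of_real (K1 (t - s) \<xi>) * (psrc V s \<xi> - psrc U s \<xi>)"
    have t0: "t \<ge> 0" using t by simp
    have "L2le lborel ?G (LINT s:{0..t}|lborel. 16 * (?s * (4 * M ^ q * \<mu> M * (A * exp (l * s)))))"
      by (rule duhamel_diff_L2[OF V(1) U(1) t]) (use t in \<open>auto intro!: D continuous_intros\<close>)
    then have "L2le lborel ?G (LINT s:{0..t}|lborel. (16 * ?s * c * A) * exp (l * s))" by (simp add: c_def mult_ac)
    then show "L2le lborel ?G (?s * (A / 2 * exp (l * t)))"
    proof (rule L2le_mono)
      have "(LINT s:{0..t}|lborel. (16 * ?s * c * A) * exp (l * s)) \<le> (16 * ?s * c * A) * (exp (l * t) / l)"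
        using c A s1 by (intro exp_integral(2)[OF l(1) t0]) auto
      also have "\<dots> = (32 * c) * (?s * (A / 2) * exp (l * t) / l)" by simp
      also have "\<dots> \<le> l * (?s * (A / 2) * exp (l * t) / l)" using A s1 l by (intro mult_right_mono) auto
      finally show "(LINT s:{0..t}|lborel. (16 * ?s * c * A) * exp (l * s)) \<le> ?s * (A / 2 * exp (l * t))" using l(1) by simp
    qed
    fix \<theta> :: "real^'n \<Rightarrow> real" assume th: "test_fun \<theta>"
    note mV = mild_solution_path[OF f v V t th] and mU = mild_solution_path[OF f u U t th]
    note ti = test_fun_cx(1)[OF th]
    obtain c' where c': "L2le lborel \<theta> c'" using test_fun_L2[OF th] by blast
    note fc = ft_L2[OF ti cx_L2le[OF c']]
    have L: "L2le lborel (cx (V t)) M" "L2le lborel (cx (U t)) M" using V(1) U(1) t by (auto simp: l2path_def intro!: cx_L2le)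
    have "(\<integral>x. cx (\<lambda>x. V t x - U t x) x * ft (cx \<theta>) x \<partial>lborel) = (\<integral>x. cx (V t) x * ft (cx \<theta>) x - cx (U t) x * ft (cx \<theta>) x \<partial>lborel)"
      by (simp add: cx_def left_diff_distrib)
    also have "\<dots> = (\<integral>x. cx (V t) x * ft (cx \<theta>) x \<partial>lborel) - (\<integral>x. cx (U t) x * ft (cx \<theta>) x \<partial>lborel)"
      by (intro Bochner_Integration.integral_diff L1le_integrable[OF L2le_mult[OF L(1) fc]] L1le_integrable[OF L2le_mult[OF L(2) fc]])
    also have "\<dots> = (\<integral>\<xi>. cx \<theta> \<xi> * (LINT s:{0..t}|lborel. complex_of_real (K1 (t - s) \<xi>) * psrc V s \<xi>) \<partial>lborel)
        - (\<integral>\<xi>. cx \<theta> \<xi> * (LINT s:{0..t}|lborel. complex_of_real (K1 (t - s) \<xi>) * psrc U s \<xi>) \<partial>lborel)"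
      using mV(1) mU(1) by simp
    also have "\<dots> = (\<integral>\<xi>. cx \<theta> \<xi> * (LINT s:{0..t}|lborel. complex_of_real (K1 (t - s) \<xi>) * psrc V s \<xi>)
        - cx \<theta> \<xi> * (LINT s:{0..t}|lborel. complex_of_real (K1 (t - s) \<xi>) * psrc U s \<xi>) \<partial>lborel)"
      by (rule Bochner_Integration.integral_diff[symmetric, OF mV(2) mU(2)])
    also have "\<dots> = (\<integral>\<xi>. cx \<theta> \<xi> * ?G \<xi> \<partial>lborel)"
      unfolding right_diff_distrib[symmetric] set_integral_diff(2)[OF psrc_kernel_integrable[OF V(1) t] psrc_kernel_integrable[OF U(1) t], symmetric] ..
    finally show "(\<integral>x. cx (\<lambda>x. V t x - U t x) x * ft (cx \<theta>) x \<partial>lborel) = (\<integral>\<xi>. cx \<theta> \<xi> * ?G \<xi> \<partial>lborel)" .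
  qed
  have it: "L2le lborel (\<lambda>x. V t x - U t x) (2 * M * (1/2) ^ k * exp (l * t))" if "t \<in> {0..T}" for k t
    using that
  proof (induction k arbitrary: t)
    case 0
    have "L2le lborel (V t) M" "L2le lborel (U t) M" using V(1) U(1) 0 by (auto simp: l2path_def)
    from L2le_diff[OF this] show ?case
    proof (rule L2le_mono)
      have "0 \<le> l * t" using l(1) 0 by simp
      then have "2 * M * 1 \<le> 2 * M * exp (l * t)" using M(1) by (intro mult_left_mono) auto
      then show "M + M \<le> 2 * M * (1/2) ^ 0 * exp (l * t)" by simp
    qed
  next
    case (Suc k)
    have "L2le lborel (\<lambda>x. V t x - U t x) (2 * M * (1/2) ^ k / 2 * exp (l * t))"
      by (rule step[OF _ Suc.IH Suc.prems]) (use M(1) in simp)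
    then show ?case by simp
  qed
  have T': "T \<in> {0..T}" using T by simp
  have "(\<lambda>k. 2 * M * (1/2) ^ k * exp (l * T)) \<longlonglongrightarrow> 2 * M * 0 * exp (l * T)"
    by (intro tendsto_intros LIMSEQ_power_zero) auto
  then have "L2le lborel (\<lambda>x. V T x - U T x) (2 * M * 0 * exp (l * T))" by (rule L2le_limit_bound[OF it[OF T']])
  then have "L2le lborel (\<lambda>x. V T x - U T x) 0" by simp
  from L2le_zero_AE[OF this] V(2)[OF T'] U(2)[OF T'] show ?thesis
    unfolding AE_completion_iff by eventually_elim simp
qed

end

theorem theorem1:
  fixes \<mu> :: "real \<Rightarrow> real"
  assumes dim: "CARD('n) = 1 \<or> CARD('n) = 2"
    and modc: "modulus_of_continuity \<mu>"
    and regular: "\<exists>C C\<^sub>0 s\<^sub>0. C > 0 \<and> C\<^sub>0 > 0 \<and> s\<^sub>0 > 0 \<and>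
        (\<forall>k<CARD('n). \<forall>s\<in>{0<..s\<^sub>0}. ((deriv ^^ k) \<mu>) differentiable (at s)) \<and>
        (\<forall>k\<in>{1..CARD('n)}. \<forall>s\<in>{0<..s\<^sub>0}. s ^ k * \<bar>(deriv ^^ k) \<mu> s\<bar> \<le> C * \<mu> s) \<and>
        set_integrable lborel {C\<^sub>0..} (\<lambda>s. \<mu> (1 / s) / s)"
  shows "\<exists>\<epsilon>\<^sub>0>0. \<exists>C. \<forall>\<phi> \<psi> :: real^'n \<Rightarrow> real.
           data_space \<phi> \<psi> \<and> data_norm \<phi> \<psi> \<le> \<epsilon>\<^sub>0 \<longrightarrow>
           (\<exists>u. solution_class u \<and> mild_solution \<mu> \<phi> \<psi> u \<and>
              (\<forall>t\<ge>0. Linf_norm (u t) \<le> C * (1 + t) powr (- real CARD('n) / 2) * data_norm \<phi> \<psi>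
                    \<and> Lp_norm 2 (u t) \<le> C * (1 + t) powr (- real CARD('n) / 4) * data_norm \<phi> \<psi>
                    \<and> grad_L2 (u t) \<le> C * (1 + t) powr (- (real CARD('n) + 2) / 4) * data_norm \<phi> \<psi>) \<and>
              (\<forall>v. solution_class v \<and> mild_solution \<mu> \<phi> \<psi> v \<longrightarrow>
                   (\<forall>t\<ge>0. AE x in lebesgue. v t x = u t x)))"
proof -
  \<comment> \<open>The integer 2/n in each of the two dimensions.\<close>
  define q :: nat where "q = (if CARD('n) = 1 then 2 else 1)"
  interpret semilinear \<mu> q "real CARD('n)"
    by unfold_locales (use dim modc regular in \<open>auto simp: q_def\<close>)
  obtain \<Lambda> where \<Lambda>: "\<Lambda> \<ge> 0" "\<And>t. t \<ge> 0 \<Longrightarrow> set_integrable lborel {0..t} (\<lambda>\<tau>. omega \<tau> / (1 + \<tau>)) \<and> (LINT \<tau>:{0..t}|lborel. omega \<tau> / (1 + \<tau>)) \<le> \<Lambda>"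
    using omega_integral by blast
  define s where "s = sqrt (ftc TYPE('n))"
  have s: "s \<ge> 1" unfolding s_def by (rule sqrt_ftc_ge_1)
  \<comment> \<open>The factor in front of the radius in the smallness condition of
    \<open>damped\<close>.\<close>
  define K where "K = (2 * \<Lambda> + 8 * \<mu> 1) * (64000 * s)"
  have K: "K \<ge> 0" using \<Lambda>(1) s mu_nonneg[of 1] by (simp add: K_def)
  \<comment> \<open>76800 = 3 * 25600: the transformed data are bounded by 3 s times the data norm,
    and the radius must be 25600 times that bound.\<close>
  define N where "N = 76800 * s"
  have N: "N > 0" using s by (simp add: N_def)
  \<comment> \<open>With this threshold the radius is at most 1/(2K+1), which meets both
    requirements on it: to be at most 1, and at most 1/2 after multiplication by K.\<close>
  define \<epsilon> where "\<epsilon> = 1 / (N * (2 * K + 1))"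
  have "\<epsilon> > 0" using N K by (simp add: \<epsilon>_def)
  moreover have "\<exists>u. solution_class u \<and> mild_solution \<mu> \<phi> \<psi> u \<and>
              (\<forall>t\<ge>0. Linf_norm (u t) \<le> 2 * N * (1 + t) powr (- real CARD('n) / 2) * data_norm \<phi> \<psi>
                    \<and> Lp_norm 2 (u t) \<le> 2 * N * (1 + t) powr (- real CARD('n) / 4) * data_norm \<phi> \<psi>
                    \<and> grad_L2 (u t) \<le> 2 * N * (1 + t) powr (- (real CARD('n) + 2) / 4) * data_norm \<phi> \<psi>) \<and>
              (\<forall>v. solution_class v \<and> mild_solution \<mu> \<phi> \<psi> v \<longrightarrow>
                   (\<forall>t\<ge>0. AE x in lebesgue. v t x = u t x))"
    if ds: "data_space \<phi> \<psi>" and dn: "data_norm \<phi> \<psi> \<le> \<epsilon>" for \<phi> \<psi> :: "real^'n \<Rightarrow> real"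
  proof -
    let ?c = "CARD('n)" and ?D = "data_norm \<phi> \<psi>"
    have D: "?D = sobolev_norm (1 + ?c div 2) \<phi> + Lp_norm 1 \<phi> + sobolev_norm (?c div 2) \<psi> + Lp_norm 1 \<psi>" by (simp add: data_norm_def)
    note nn = sobolev_norm_nonneg[of "1 + ?c div 2" \<phi>] Lp_norm_nonneg[of 1 \<phi>] sobolev_norm_nonneg[of "?c div 2" \<psi>] Lp_norm_nonneg[of 1 \<psi>]
    have D0: "?D \<ge> 0" using nn D by linarith
    have sp: "sobolev (1 + ?c div 2) \<phi>" "Lp 1 \<phi>" "sobolev (?c div 2) \<psi>" "Lp 1 \<psi>" using ds by (auto simp: data_space_def)
    \<comment> \<open>For n equal to 1 or 2 the integer part of n/2 is n - 1, so the Sobolev orders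
      of the data are exactly the powers of \<open>jb\<close> demanded by the multiplier
      estimate.\<close>
    have c: "1 + ?c div 2 \<le> 2" "?c div 2 \<le> 2" "?c \<le> 2" "1 + ?c div 2 = Suc (?c - 1)" "?c div 2 = ?c - 1" using dim by auto
    note F = fourier_data_bound[OF sp(1,2) c(1,3)] and G = fourier_data_bound[OF sp(3,4) c(2,3)]
    have sD: "?D \<le> s * ?D" using mult_right_mono[OF s D0] by simp
    have ND: "N * ?D \<le> 1 / (2 * K + 1)"
    proof -
      have "N * ?D \<le> N * \<epsilon>" using dn N by simp
      then show ?thesis using N by (simp add: \<epsilon>_def)
    qed
    \<comment> \<open>The radius is taken proportional to the data norm, not fixed; this puts the
      data norm itself into the final decay estimates.\<close>
    interpret damped \<mu> q "real CARD('n)" "fourier \<phi>" "fourier \<psi>" "3 * s * ?D" "N * ?D" \<Lambda>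
    proof unfold_locales
      fix \<xi> :: "real^'n" assume x: "norm \<xi> \<le> 1"
      have "jb \<xi> \<le> 2" unfolding jb_def using power_mono[OF x norm_ge_zero, of 2] by (intro real_le_lsqrt) auto
      then have "jb \<xi> * norm (fourier \<phi> \<xi>) \<le> 2 * Lp_norm 1 \<phi>" by (intro mult_mono F(1)) auto
      then show "jb \<xi> * norm (fourier \<phi> \<xi>) + norm (fourier \<psi> \<xi>) \<le> 3 * s * ?D"
        using G(1)[of \<xi>] nn D sD by linarith
    next
      have "L2le lborel (\<lambda>\<xi>. jb \<xi> ^ Suc (?c - 1) * norm (fourier \<phi> \<xi>) + jb \<xi> ^ (?c - 1) * norm (fourier \<psi> \<xi>))
          (3 * s * sobolev_norm (1 + ?c div 2) \<phi> + 3 * s * sobolev_norm (?c div 2) \<psi>)"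
        using L2le_add[OF F(4) G(4)] c(4,5) by (simp only: s_def)
      moreover have "3 * s * sobolev_norm (1 + ?c div 2) \<phi> + 3 * s * sobolev_norm (?c div 2) \<psi> \<le> 3 * s * ?D"
        unfolding D distrib_left using nn s by simp
      ultimately show "L2le lborel (\<lambda>\<xi>. jb \<xi> ^ (?c - 1) * (jb \<xi> * norm (fourier \<phi> \<xi>) + norm (fourier \<psi> \<xi>))) (3 * s * ?D)"
        unfolding distrib_left power_Suc2 mult.assoc by (rule L2le_mono)
    next
      have "1 / (2 * K + 1) \<le> 1" using K by simp
      then show "N * ?D \<le> 1" using ND by linarith
      have "K * (N * ?D) \<le> K * (1 / (2 * K + 1))" by (rule mult_left_mono[OF ND K])
      also have "\<dots> \<le> 1 / 2" using K by (simp add: field_simps)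
      finally show "(2 * \<Lambda> + 8 * \<mu> 1) * (64000 * sqrt (ftc TYPE('n))) * (N * ?D) \<le> 1 / 2" by (simp add: K_def s_def)
    qed (use F(2,3) G(2,3) \<Lambda>(2) N D0 in \<open>simp_all add: N_def\<close>)
    have "Linf_norm (usol t) \<le> 2 * N * (1 + t) powr (- real ?c / 2) * ?D
        \<and> Lp_norm 2 (usol t) \<le> 2 * N * (1 + t) powr (- real ?c / 4) * ?D
        \<and> grad_L2 (usol t) \<le> 2 * N * (1 + t) powr (- (real ?c + 2) / 4) * ?D" if t: "t \<ge> 0" for t
    proof -
      \<comment> \<open>The final constant is 2N because the gradient sums at most two coordinate
        derivatives; the other two norms are relaxed to the same constant.\<close>
      have two: "x \<le> 2 * N * y * ?D" if "x \<le> N * ?D * y" "0 \<le> y" for x y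
      proof -
        have "0 \<le> N * ?D * y" using N D0 that(2) by simp
        then show ?thesis using that(1) by (simp add: mult_ac)
      qed
      have "grad_L2 (usol t) \<le> (\<Sum>i\<in>UNIV. Lp_norm 2 (wd [i] (usol t)))"
        unfolding grad_L2_def L2_set_def[symmetric] by (rule L2_set_le_sum) (rule Lp_norm_nonneg)
      also have "\<dots> \<le> (\<Sum>i\<in>(UNIV::'n set). N * ?D * (1 + t) powr (- (real ?c / 4 + 1/2)))"
        by (intro sum_mono usol_bounds(4)[OF t])
      also have "\<dots> = real ?c * (N * ?D * (1 + t) powr (- (real ?c / 4 + 1/2)))" by simp
      also have "\<dots> \<le> 2 * (N * ?D * (1 + t) powr (- (real ?c / 4 + 1/2)))"
        using c(3) N D0 by (intro mult_right_mono) auto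
      also have "- (real ?c / 4 + 1/2) = - (real ?c + 2) / 4" by simp
      finally have "grad_L2 (usol t) \<le> 2 * N * (1 + t) powr (- (real ?c + 2) / 4) * ?D" by (simp add: mult_ac)
      moreover have "Linf_norm (usol t) \<le> 2 * N * (1 + t) powr (- real ?c / 2) * ?D"
        using usol_bounds(5)[OF t] by (intro two) auto
      moreover have "Lp_norm 2 (usol t) \<le> 2 * N * (1 + t) powr (- real ?c / 4) * ?D"
        using usol_bounds(3)[OF t] by (intro two) auto
      ultimately show ?thesis by blast
    qed
    then show ?thesis
      using usol_class usol_mild[OF refl refl] mild_solution_unique[OF refl refl usol_class usol_mild[OF refl refl]] by blast
  qed
  ultimately show ?thesis by blast
qed

end
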